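(* For all nontrivial finitely generated subgroups $H,K\leq F_N$, \[ \widehat I(\eta_H,\eta_K)=\sum_{HgK\in H\backslash F_N/K}\eta_{H\cap gKg^{-1}},\] and consequently $\overline{\mathrm{rk}}(\widehat I(\eta_H,\eta_K))=\mathcal{N}(\eta_H,\eta_K)$.
   Context: $N\geq2$, $F_N$ free with free basis $A$, $X$ its Cayley graph (a tree), $\partial X=\partial F_N$. $\mathcal{C}_N$: closed subsets of $\partial X$ with at least two points, with the Vietoris (Hausdorff) topology; $\mathcal{S}\mathrm{Curr}(F_N)$: $F_N$-invariant Borel measures on $\mathcal{C}_N$ finite on compact sets. Counting current of nontrivial finitely generated $H$: $\eta_H=[\widehat H:H]\sum_{H'}\delta_{\Lambda(H')}$, sum over conjugates $H'$ of $\widehat H=\mathrm{Comm}_{F_N}(H)$, $\Lambda$ the limit set; $\eta_{\{1\}}=0$. Let $I(S_1,S_2)=S_1\cap S_2$ for $S_1,S_2\in\mathcal{C}_N$ (a closed subset of $\partial X$, possibly empty or a point). For $\mu,\nu\in\mathcal{S}\mathrm{Curr}(F_N)$, $\widehat I(\mu,\nu)$ is the Borel measure on $\mathcal{C}_N$ given by $\widehat I(\mu,\nu)(U)=(\mu\times\nu)(I^{-1}(U))$ for Borel $U\subset\mathcal{C}_N$ (this is a subset current). $\overline{\mathrm{rk}}$ is the reduced rank functional, the unique continuous $\mathbb{R}_{\geq0}$-linear functional on $\mathcal{S}\mathrm{Curr}(F_N)$ with $\overline{\mathrm{rk}}(\eta_H)=\max\{\mathrm{rank}(H)-1,0\}$;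 $\mathcal{N}$ is the unique continuous symmetric $\mathbb{R}_{\geq0}$-bilinear functional with $\mathcal{N}(\eta_H,\eta_K)=\sum_{HgK}\overline{\mathrm{rk}}(H\cap gKg^{-1})$. *)

theory Defs
  imports "HOL-Analysis.Analysis" "HOL-Probability.Probability" "HOL-Algebra.Coset" "HOL-Algebra.Generated_Groups"
begin

text \<open>A letter is (i, e): generator a_i (i < N) if e = False, its inverse if e = True.\<close>
type_synonym letter = "nat \<times> bool"
type_synonym word = "letter list"
type_synonym bpt = "nat \<Rightarrow> letter"   \<comment> \<open>infinite words = points of the boundary\<close>

definition linv :: "letter \<Rightarrow> letter" where
  "linv a = (fst a, \<not> snd a)"

fun push :: "letter \<Rightarrow> word \<Rightarrow> word" where
  "push a [] = [a]"
| "push a (b # w) = (if b = linv a then w else a # b # w)"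

definition reduce :: "word \<Rightarrow> word" where
  "reduce w = foldr push w []"

definition reduced :: "word \<Rightarrow> bool" where
  "reduced w \<longleftrightarrow> (\<forall>i. Suc i < length w \<longrightarrow> w ! (Suc i) \<noteq> linv (w ! i))"

definition FG :: "nat \<Rightarrow> word monoid" where
  "FG N = \<lparr>carrier = {w. reduced w \<and> (\<forall>a\<in>set w. fst a < N)},
           monoid.mult = (\<lambda>u v. reduce (u @ v)), one = []\<rparr>"

definition fgsub :: "nat \<Rightarrow> word set \<Rightarrow> bool" where
  "fgsub N H \<longleftrightarrow> subgroup H (FG N) \<and>
     (\<exists>S. finite S \<and> S \<subseteq> carrier (FG N) \<and> generate (FG N) S = H)"

definition frank :: "nat \<Rightarrow> word set \<Rightarrow> nat" where
  "frank N H = (LEAST n. \<exists>S. finite S \<and> S \<subseteq> carrier (FG N) \<and> card S = n \<and> generate (FG N) S = H)"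

definition rrank :: "nat \<Rightarrow> word set \<Rightarrow> real" where
  "rrank N H = max (real (frank N H) - 1) 0"

definition conjg :: "nat \<Rightarrow> word \<Rightarrow> word set \<Rightarrow> word set" where
  "conjg N g H = (g <#\<^bsub>FG N\<^esub> H) #>\<^bsub>FG N\<^esub> inv\<^bsub>FG N\<^esub> g"

definition cosets_in :: "nat \<Rightarrow> word set \<Rightarrow> word set \<Rightarrow> word set set" where
  "cosets_in N A B = rcosets\<^bsub>(FG N)\<lparr>carrier := A\<rparr>\<^esub> B"

definition comm :: "nat \<Rightarrow> word set \<Rightarrow> word set" where
  "comm N H = {g \<in> carrier (FG N).
      finite (cosets_in N H (H \<inter> conjg N g H)) \<and>
      finite (cosets_in N (conjg N g H) (H \<inter> conjg N g H))}"

definition dcosets :: "nat \<Rightarrow> word set \<Rightarrow> word set \<Rightarrow> word set set" where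
  "dcosets N H K = {H <#>\<^bsub>FG N\<^esub> (g <#\<^bsub>FG N\<^esub> K) | g. g \<in> carrier (FG N)}"

definition dcrep :: "nat \<Rightarrow> word set \<Rightarrow> word set \<Rightarrow> word set \<Rightarrow> word" where
  "dcrep N H K D = (SOME g. g \<in> carrier (FG N) \<and> D = H <#>\<^bsub>FG N\<^esub> (g <#\<^bsub>FG N\<^esub> K))"

definition bdry :: "nat \<Rightarrow> bpt set" where
  "bdry N = {\<xi>. (\<forall>i. fst (\<xi> i) < N) \<and> (\<forall>i. \<xi> (Suc i) \<noteq> linv (\<xi> i))}"

definition bdry_top :: "nat \<Rightarrow> bpt topology" where
  "bdry_top N = subtopology (product_topology (\<lambda>_. discrete_topology UNIV) UNIV) (bdry N)"

definition vietoris :: "'a topology \<Rightarrow> 'a set topology" where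
  "vietoris T = subtopology
     (topology_generated_by ({{C. C \<subseteq> U} | U. openin T U} \<union> {{C. C \<inter> U \<noteq> {}} | U. openin T U}))
     {C. closedin T C}"

definition CN :: "nat \<Rightarrow> bpt set set" where
  "CN N = {S. closedin (bdry_top N) S \<and> (\<exists>x y. x \<in> S \<and> y \<in> S \<and> x \<noteq> y)}"

definition CN_top :: "nat \<Rightarrow> bpt set topology" where
  "CN_top N = subtopology (vietoris (bdry_top N)) (CN N)"

definition CN_meas :: "nat \<Rightarrow> bpt set measure" where
  "CN_meas N = sigma (CN N) {U. openin (CN_top N) U}"

definition bact :: "word \<Rightarrow> bpt \<Rightarrow> bpt" where
  "bact w \<xi> = (let k = (GREATEST k. k \<le> length w \<and> (\<forall>i<k. \<xi> i = linv (w ! (length w - 1 - i))));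
                   m = length w - k
               in (\<lambda>i. if i < m then w ! i else \<xi> (i - m + k)))"

definition SCurr :: "nat \<Rightarrow> bpt set measure set" where
  "SCurr N = {\<mu>. space \<mu> = CN N \<and> sets \<mu> = sets (CN_meas N) \<and>
      (\<forall>g\<in>carrier (FG N). \<forall>U\<in>sets (CN_meas N).
          emeasure \<mu> ((\<lambda>S. bact g ` S) ` U) = emeasure \<mu> U) \<and>
      (\<forall>C. compactin (CN_top N) C \<longrightarrow> emeasure \<mu> C < \<infinity>)}"

definition limset :: "nat \<Rightarrow> word set \<Rightarrow> bpt set" where
  "limset N H = {\<xi> \<in> bdry N. \<forall>n. \<exists>h\<in>H. n \<le> length h \<and> (\<forall>i<n. h ! i = \<xi> i)}"

definition eta :: "nat \<Rightarrow> word set \<Rightarrow> bpt set measure" where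
  "eta N H = (if H = {[]} then null_measure (CN_meas N) else
     scale_measure (of_nat (card (cosets_in N (comm N H) H)))
       (distr (count_space {conjg N g (comm N H) | g. g \<in> carrier (FG N)}) (CN_meas N) (limset N)))"

definition Ihat :: "nat \<Rightarrow> bpt set measure \<Rightarrow> bpt set measure \<Rightarrow> bpt set measure" where
  "Ihat N \<mu> \<nu> = measure_of (CN N) (sets (CN_meas N))
     (\<lambda>U. emeasure (\<mu> \<Otimes>\<^sub>M \<nu>) ((\<lambda>p. fst p \<inter> snd p) -` U \<inter> space (\<mu> \<Otimes>\<^sub>M \<nu>)))"

definition dsum_eta :: "nat \<Rightarrow> word set \<Rightarrow> word set \<Rightarrow> bpt set measure" where
  "dsum_eta N H K = measure_of (CN N) (sets (CN_meas N))
     (\<lambda>U. \<integral>\<^sup>+ D. emeasure (eta N (H \<inter> conjg N (dcrep N H K D) K)) U \<partial>count_space (dcosets N H K))"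

definition Cc :: "nat \<Rightarrow> (bpt set \<Rightarrow> real) set" where
  "Cc N = {f. continuous_map (CN_top N) euclideanreal f \<and>
     (\<exists>C. compactin (CN_top N) C \<and> (\<forall>S\<in>CN N - C. f S = 0))}"

definition curr_top :: "nat \<Rightarrow> bpt set measure topology" where
  "curr_top N = subtopology
     (topology_generated_by {{\<mu>. (\<integral>S. f S \<partial>\<mu>) \<in> V} | f V. f \<in> Cc N \<and> open V}) (SCurr N)"

definition cadd :: "'a measure \<Rightarrow> 'a measure \<Rightarrow> 'a measure" where
  "cadd M1 M2 = measure_of (space M1) (sets M1) (\<lambda>A. emeasure M1 A + emeasure M2 A)"

definition csmult :: "real \<Rightarrow> 'a measure \<Rightarrow> 'a measure" where
  "csmult a M = scale_measure (ennreal a) M"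

definition nnlinear :: "nat \<Rightarrow> (bpt set measure \<Rightarrow> real) \<Rightarrow> bool" where
  "nnlinear N r \<longleftrightarrow> (\<forall>\<mu>\<in>SCurr N. \<forall>\<nu>\<in>SCurr N. \<forall>a\<ge>0. \<forall>b\<ge>0.
      r (cadd (csmult a \<mu>) (csmult b \<nu>)) = a * r \<mu> + b * r \<nu>)"

text \<open>functionals are normalised to 0 outside SCurr so that uniqueness makes sense\<close>
definition rkbar :: "nat \<Rightarrow> bpt set measure \<Rightarrow> real" where
  "rkbar N = (THE r. continuous_map (curr_top N) euclideanreal r \<and> nnlinear N r \<and>
      (\<forall>\<mu>. \<mu> \<notin> SCurr N \<longrightarrow> r \<mu> = 0) \<and>
      (\<forall>H. fgsub N H \<longrightarrow> r (eta N H) = rrank N H))"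

definition Nform :: "nat \<Rightarrow> bpt set measure \<Rightarrow> bpt set measure \<Rightarrow> real" where
  "Nform N = (THE n. continuous_map (prod_topology (curr_top N) (curr_top N)) euclideanreal
                        (\<lambda>p. n (fst p) (snd p)) \<and>
      (\<forall>\<mu> \<nu>. n \<mu> \<nu> = n \<nu> \<mu>) \<and>
      (\<forall>\<nu>\<in>SCurr N. nnlinear N (\<lambda>\<mu>. n \<mu> \<nu>)) \<and>
      (\<forall>\<mu> \<nu>. \<mu> \<notin> SCurr N \<or> \<nu> \<notin> SCurr N \<longrightarrow> n \<mu> \<nu> = 0) \<and>
      (\<forall>H K. fgsub N H \<and> fgsub N K \<longrightarrow>
          n (eta N H) (eta N K) = (\<Sum>\<^sub>\<infinity>D\<in>dcosets N H K. rrank N (H \<inter> conjg N (dcrep N H K D) K))))"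

end

theory Submission
  imports Defs "HOL-Library.Sublist" "HOL-Analysis.Kronecker_Approximation_Theorem"
begin

text \<open>
  The formula for the intersection. A finitely generated subgroup \<open>H\<close> acts with finitely many orbits
  on the convex hull of its limit set \<open>\<Lambda>(H)\<close>. Hence its commensurator is the stabiliser of \<open>\<Lambda>(H)\<close> and
  contains \<open>H\<close> with finite index, and \<open>\<eta>(H)\<close> counts the cosets \<open>Hw\<close> by the position of \<open>w\<^sup>- \<Lambda>(H)\<close>, where
  \<open>w\<^sup>-\<close> is the inverse of \<open>w\<close>. The diagonal orbits on pairs of cosets \<open>(Hx, Ky)\<close> are the double cosets
  \<open>HgK\<close>; the orbit of \<open>HgK\<close> is the set of cosets of \<open>J = H \<inter> gKg\<^sup>-\<close>, and \<open>\<Lambda>(H) \<inter> g\<Lambda>(K) = \<Lambda>(J)\<close> because \<open>J\<close>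
  acts with finitely many orbits on the intersection of the two hulls.

  The functionals. The rank of a group acting with finitely many orbits on a subtree is given by the
  Euler characteristic of the quotient, so the reduced rank of a current is the integral of
  \<open>deg / 2 - 1\<close> at the base vertex. The functional \<open>\<N>\<close> is minus the Euler characteristic of the fibre
  product plus the number of its components that are finite trees. Each such component is counted
  by giving the weight \<open>1 / k\<close> to its \<open>k\<close> vertices; discarding those with more than \<open>R\<close> vertices costs
  \<open>O(1 / R)\<close> locally uniformly, which yields continuity. Uniqueness is the density of the cone spanned
  by counting currents: the weights that a current gives to the finitely many local types of a fixed
  radius satisfy integral edge equations, and an integral solution is realised by gluing that many
  copies of every type to a finite labelled graph.
\<close>

section \<open>Reduced words and the free group\<close>

text \<open>Everything is read off at the base vertex \<open>[]\<close>. A coset Hw is recorded as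
  the hull of \<Lambda>(H) seen from w, and the cylinder \<open>Z n A\<close> collects the closed
  sets whose hull meets the ball of radius \<open>n\<close> exactly in \<open>A\<close>. These
  cylinders are clopen and form a basis of the topology, so that test functions, both functionals
  and the density argument reduce to finite sums over local types \<open>A\<close>.

  The obstacle to continuity lies in the reduced rank of the trivial group: its rank minus one is
  -1, but its reduced rank is 0. Every finite tree among the components therefore needs a correction
  by 1, and being a finite tree is not a local property. Convexity makes a truncation local: a
  convex set through \<open>[]\<close> with at most \<open>R\<close> vertices in the ball of radius
  \<open>R\<close> lies inside that ball, so a type of radius \<open>R\<close> decides whether the
  correction applies.

  In the density argument the types that receive a positive weight come from actual hulls. Their
  base vertex sees two directions, hence the glued graph has no leaves and the subgroup of a
  component has the whole universal cover as its hull.\<close>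

lemma linv_linv [simp]: "linv (linv a) = a"
  by (simp add: linv_def)

lemma linv_neq [simp]: "linv a \<noteq> a" "a \<noteq> linv a"
  by (auto simp: linv_def prod_eq_iff)

lemma fst_linv [simp]: "fst (linv a) = fst a"
  by (simp add: linv_def)

lemma linv_inject [simp]: "linv a = linv b \<longleftrightarrow> a = b"
  by (metis linv_linv)

lemma linv_swap: "a = linv b \<longleftrightarrow> b = linv a"
  by auto

lemma reduced_Nil [simp]: "reduced []"
  by (simp add: reduced_def)

lemma reduced_Cons: "reduced (a # w) \<longleftrightarrow> reduced w \<and> (w = [] \<or> hd w \<noteq> linv a)"
proof (cases w)
  case (Cons b v)
  have "(\<forall>i. Suc i < length (a # b # v) \<longrightarrow> (a # b # v) ! Suc i \<noteq> linv ((a # b # v) ! i)) \<longleftrightarrow>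
    b \<noteq> linv a \<and> (\<forall>i. Suc i < length (b # v) \<longrightarrow> (b # v) ! Suc i \<noteq> linv ((b # v) ! i))"
    (is "(\<forall>i. ?P i) \<longleftrightarrow> _ \<and> (\<forall>i. ?Q i)")
  proof -
    have "(\<forall>i. ?P i) \<longleftrightarrow> ?P 0 \<and> (\<forall>i. ?P (Suc i))" by (metis not0_implies_Suc)
    then show ?thesis by simp
  qed
  then show ?thesis unfolding reduced_def Cons by auto
qed (simp add: reduced_def)

lemma reduced_append:
  "reduced (u @ v) \<longleftrightarrow> reduced u \<and> reduced v \<and> (u = [] \<or> v = [] \<or> hd v \<noteq> linv (last u))"
  by (induction u) (auto simp: reduced_Cons)

definition winv :: "word \<Rightarrow> word" where
  "winv u = map linv (rev u)"

lemma winv_Nil [simp]: "winv [] = []"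
  by (simp add: winv_def)

lemma winv_Cons: "winv (a # u) = winv u @ [linv a]"
  by (simp add: winv_def)

lemma winv_append: "winv (u @ v) = winv v @ winv u"
  by (simp add: winv_def)

lemma length_winv [simp]: "length (winv u) = length u"
  by (simp add: winv_def)

lemma winv_eq_Nil [simp]: "winv u = [] \<longleftrightarrow> u = []"
  by (simp add: winv_def)

lemma last_winv: "u \<noteq> [] \<Longrightarrow> last (winv u) = linv (hd u)"
  by (cases u) (auto simp: winv_Cons)

lemma hd_winv: "u \<noteq> [] \<Longrightarrow> hd (winv u) = linv (last u)"
  by (cases u rule: rev_cases) (auto simp: winv_append winv_Cons)

lemma set_winv: "set (winv u) = linv ` set u"
  by (simp add: winv_def)

lemma winv_winv [simp]: "winv (winv u) = u"
  by (simp add: winv_def rev_map o_def)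

lemma reduced_winv [simp]: "reduced u \<Longrightarrow> reduced (winv u)"
  by (induction u) (auto simp: winv_Cons reduced_append reduced_Cons last_winv linv_swap)

lemma push_reduced: "reduced (a # w) \<Longrightarrow> push a w = a # w"
  by (cases w) (auto simp: reduced_Cons)

lemma reduced_push [simp]: "reduced w \<Longrightarrow> reduced (push a w)"
  by (cases w) (auto simp: reduced_Cons)

lemma push_push_linv [simp]: "reduced w \<Longrightarrow> push a (push (linv a) w) = w"
  by (cases w) (auto simp: reduced_Cons push_reduced)

lemma push_linv_push [simp]: "reduced w \<Longrightarrow> push (linv a) (push a w) = w"
  using push_push_linv[of w "linv a"] by simp

lemma set_push: "set (push a w) \<subseteq> insert a (set w)"
  by (cases w) auto

lemma length_push: "length (push a w) \<le> Suc (length w)"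
  by (cases w) auto

lemma reduced_foldr_push [simp]: "reduced w \<Longrightarrow> reduced (foldr push u w)"
  by (induction u) auto

lemma foldr_push_reduced: "reduced (u @ w) \<Longrightarrow> foldr push u w = u @ w"
  by (induction u) (auto simp: reduced_Cons push_reduced)

lemma set_foldr_push: "set (foldr push u w) \<subseteq> set u \<union> set w"
  by (induction u) (use set_push in fastforce)+

lemma length_foldr_push: "length (foldr push u w) \<le> length u + length w"
proof (induction u)
  case (Cons a u)
  then show ?case using length_push[of a "foldr push u w"] by simp
qed simp

lemma reduce_append: "reduced v \<Longrightarrow> reduce (u @ v) = foldr push u v"
  unfolding reduce_def using foldr_push_reduced[of v "[]"] by simp

lemma foldr_push_push: "reduced w \<Longrightarrow> foldr push (push a u) w = push a (foldr push u w)"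
  by (cases u) auto

lemma foldr_push_foldr_push:
  "reduced w \<Longrightarrow> foldr push (foldr push u v) w = foldr push u (foldr push v w)"
  by (induction u) (auto simp: foldr_push_push)

lemma foldr_push_winv: "reduced w \<Longrightarrow> foldr push (winv u) (foldr push u w) = w"
  by (induction u) (auto simp: winv_Cons)

lemma foldr_push_snoc:
  "reduced b \<Longrightarrow> foldr push b [c] = (if b \<noteq> [] \<and> last b = linv c then butlast b else b @ [c])"
proof (cases "b \<noteq> [] \<and> last b = linv c")
  case True
  then obtain d where d: "b = d @ [linv c]"
    by (metis append_butlast_last_id)
  assume "reduced b"
  then show ?thesis using d foldr_push_reduced[of d "[]"] by (auto simp: reduced_append)
next
  case False
  assume "reduced b"
  then show ?thesis using False foldr_push_reduced[of b "[c]"]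
    by (auto simp: reduced_append reduced_Cons linv_swap)
qed

text \<open>Each letter of \<open>t\<close> can cancel at most one letter of \<open>b\<close>, so a
  prefix of \<open>b\<close> survives as long as \<open>length t\<close> letters remain behind it.
  The induction moves the first letter of \<open>t\<close> over to \<open>b\<close>.\<close>

lemma take_foldr_push:
  "reduced b \<Longrightarrow> reduced t \<Longrightarrow> m + length t \<le> length b \<Longrightarrow> take m (foldr push b t) = take m b"
proof (induction t arbitrary: b)
  case Nil
  then show ?case using foldr_push_reduced[of b "[]"] by simp
next
  case (Cons c t)
  have rt: "reduced t" and ct: "foldr push [c] t = c # t"
    using Cons.prems by (auto simp: reduced_Cons push_reduced)
  have "foldr push b (c # t) = foldr push (foldr push b [c]) t"
    using foldr_push_foldr_push[OF rt, of b "[c]"] ct by simp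
  moreover have "take m (foldr push (foldr push b [c]) t) = take m (foldr push b [c])"
  proof (rule Cons.IH)
    show "reduced (foldr push b [c])"
      using Cons.prems by (intro reduced_foldr_push) (simp add: reduced_Cons)
  qed (use Cons.prems rt in \<open>auto simp: foldr_push_snoc\<close>)
  moreover have "take m (foldr push b [c]) = take m b"
    using Cons.prems by (auto simp: foldr_push_snoc take_butlast)
  ultimately show ?case by simp
qed

text \<open>In the tree, the geodesic from \<open>[]\<close> to the product is covered by the
  geodesic to \<open>u\<close> and the translate by \<open>u\<close> of the geodesic to
  \<open>v\<close>.\<close>

lemma prefix_foldr_push:
  assumes "reduced u" "reduced v" "prefix p (foldr push u v)"
  shows "prefix p u \<or> (\<exists>q. prefix q v \<and> p = foldr push u q)"
  using assms
proof (induction u arbitrary: p)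
  case (Cons a u)
  let ?w = "foldr push u v"
  have ru: "reduced u" and rw: "reduced ?w" using Cons.prems by (auto simp: reduced_Cons)
  show ?case
  proof (cases "p = []")
    case False
    show ?thesis
    proof (cases "\<exists>w'. ?w = linv a # w'")
      case True
      then obtain w' where w': "?w = linv a # w'" by blast
      then have "prefix (linv a # p) ?w" using Cons.prems by simp
      then consider "prefix (linv a # p) u" | q where "prefix q v" "linv a # p = foldr push u q"
        using Cons.IH[OF ru Cons.prems(2)] by blast
      then show ?thesis
      proof cases
        case 1
        \<comment> \<open>This case is void: \<open>u\<close> cannot begin with
          \<open>linv a\<close>, since \<open>a # u\<close> is reduced.\<close>
        then show ?thesis using Cons.prems(1) by (cases u) (auto simp: reduced_Cons)
      next
        case 2
        then have "p = foldr push (a # u) q"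
          by (metis foldr_Cons comp_apply push.simps(2))
        then show ?thesis using 2 by blast
      qed
    next
      case nc: False
      then have "push a ?w = a # ?w" by (cases ?w) auto
      then obtain p' where p': "p = a # p'" "prefix p' ?w"
        using Cons.prems False by (cases p) auto
      then consider "prefix p' u" | q where "prefix q v" "p' = foldr push u q"
        using Cons.IH[OF ru Cons.prems(2)] by blast
      then show ?thesis
      proof cases
        case 2
        have "push a p' = a # p'" using p' nc by (cases p') (auto simp: prefix_def)
        then have "p = foldr push (a # u) q" using 2 p' by simp
        then show ?thesis using 2 by blast
      qed (use p' in auto)
    qed
  qed auto
qed auto

section \<open>The group of reduced words\<close>

locale free_group =
  fixes N :: nat
begin

abbreviation G :: "word set" where "G \<equiv> carrier (FG N)"
abbreviation mul :: "word \<Rightarrow> word \<Rightarrow> word" (infixl "\<sqdot>" 70) where "u \<sqdot> v \<equiv> u \<otimes>\<^bsub>FG N\<^esub> v"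
abbreviation iv :: "word \<Rightarrow> word" where "iv u \<equiv> inv\<^bsub>FG N\<^esub> u"

lemma G_iff: "w \<in> G \<longleftrightarrow> reduced w \<and> (\<forall>a\<in>set w. fst a < N)"
  by (simp add: FG_def)

lemma G_reduced: "w \<in> G \<Longrightarrow> reduced w"
  by (simp add: G_iff)

lemma mul_eq: "v \<in> G \<Longrightarrow> u \<sqdot> v = foldr push u v"
  by (simp add: FG_def reduce_append)

lemma one_eq [simp]: "\<one>\<^bsub>FG N\<^esub> = []"
  by (simp add: FG_def)

lemma Nil_in_G [simp]: "[] \<in> G"
  by (simp add: G_iff)

lemma winv_in_G [simp]: "u \<in> G \<Longrightarrow> winv u \<in> G"
  by (auto simp: G_iff set_winv)

sublocale group "FG N"
proof (rule groupI)
  fix x y assume xy: "x \<in> G" "y \<in> G"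
  then show "x \<sqdot> y \<in> G"
    using set_foldr_push[of x y] by (auto simp: mul_eq G_iff)
next
  fix x y z assume xyz: "x \<in> G" "y \<in> G" "z \<in> G"
  then have yz: "foldr push y z \<in> G" using set_foldr_push[of y z] by (auto simp: G_iff)
  show "x \<sqdot> y \<sqdot> z = x \<sqdot> (y \<sqdot> z)"
    using xyz yz by (simp add: mul_eq foldr_push_foldr_push G_reduced)
next
  fix x assume x: "x \<in> G"
  show "\<one>\<^bsub>FG N\<^esub> \<sqdot> x = x" using x by (simp add: mul_eq)
  have "winv x \<sqdot> x = \<one>\<^bsub>FG N\<^esub>"
    using x foldr_push_winv[of "[]" x] foldr_push_reduced[of x "[]"] by (simp add: mul_eq G_reduced)
  then show "\<exists>y\<in>G. y \<sqdot> x = \<one>\<^bsub>FG N\<^esub>" using x winv_in_G by blast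
qed simp

lemma iv_eq: "u \<in> G \<Longrightarrow> iv u = winv u"
proof (rule inv_equality)
  assume x: "u \<in> G"
  show "winv u \<sqdot> u = \<one>\<^bsub>FG N\<^esub>"
    using x foldr_push_winv[of "[]" u] foldr_push_reduced[of u "[]"] by (simp add: mul_eq G_reduced)
qed auto

lemma mul_Nil [simp]: "u \<in> G \<Longrightarrow> u \<sqdot> [] = u" "u \<in> G \<Longrightarrow> [] \<sqdot> u = u"
  using r_one l_one by auto

lemma iv_Nil [simp]: "iv [] = []"
  using iv_eq by simp

lemma mul_iv [simp]: "u \<in> G \<Longrightarrow> u \<sqdot> iv u = []" "u \<in> G \<Longrightarrow> iv u \<sqdot> u = []"
  using r_inv l_inv by auto

lemma mul_iv_cancel [simp]:
  "u \<in> G \<Longrightarrow> v \<in> G \<Longrightarrow> u \<sqdot> (iv u \<sqdot> v) = v"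
  "u \<in> G \<Longrightarrow> v \<in> G \<Longrightarrow> iv u \<sqdot> (u \<sqdot> v) = v"
  "u \<in> G \<Longrightarrow> v \<in> G \<Longrightarrow> v \<sqdot> u \<sqdot> iv u = v"
  "u \<in> G \<Longrightarrow> v \<in> G \<Longrightarrow> v \<sqdot> iv u \<sqdot> u = v"
  by (simp_all add: m_assoc flip: m_assoc[of u "iv u" v] m_assoc[of "iv u" u v])

lemma length_iv [simp]: "u \<in> G \<Longrightarrow> length (iv u) = length u"
  by (simp add: iv_eq)

lemma iv_eq_Nil [simp]: "u \<in> G \<Longrightarrow> iv u = [] \<longleftrightarrow> u = []"
  by (simp add: iv_eq)

lemma length_mul: "v \<in> G \<Longrightarrow> length (u \<sqdot> v) \<le> length u + length v"
  by (simp add: mul_eq length_foldr_push)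

lemma mul_append: "u @ v \<in> G \<Longrightarrow> u \<sqdot> v = u @ v"
  by (subst mul_eq) (auto simp: G_iff reduced_append foldr_push_reduced)

lemma G_append: "u @ v \<in> G \<Longrightarrow> u \<in> G \<and> v \<in> G"
  by (auto simp: G_iff reduced_append)

lemma G_prefix: "w \<in> G \<Longrightarrow> prefix p w \<Longrightarrow> p \<in> G"
  by (metis G_append prefix_def)

lemma G_take [simp]: "w \<in> G \<Longrightarrow> take n w \<in> G"
  by (meson G_prefix take_is_prefix)

lemma letter_in_G [simp]: "[a] \<in> G \<longleftrightarrow> fst a < N"
  by (auto simp: G_iff reduced_Cons)

lemma iv_letter: "fst a < N \<Longrightarrow> iv [a] = [linv a]"
  by (simp add: iv_eq winv_def)

lemma G_Cons: "a # w \<in> G \<longleftrightarrow> fst a < N \<and> w \<in> G \<and> (w = [] \<or> hd w \<noteq> linv a)"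
  by (auto simp: G_iff reduced_Cons)

lemma G_snoc: "w @ [a] \<in> G \<longleftrightarrow> fst a < N \<and> w \<in> G \<and> (w = [] \<or> last w \<noteq> linv a)"
  by (auto simp: G_iff reduced_append reduced_Cons linv_swap)

lemma mul_letter:
  "b \<in> G \<Longrightarrow> fst c < N \<Longrightarrow> b \<sqdot> [c] = (if b \<noteq> [] \<and> last b = linv c then butlast b else b @ [c])"
  by (simp add: mul_eq foldr_push_snoc G_reduced)

lemma take_mul: "b \<in> G \<Longrightarrow> t \<in> G \<Longrightarrow> m + length t \<le> length b \<Longrightarrow> take m (b \<sqdot> t) = take m b"
  by (simp add: mul_eq take_foldr_push G_reduced)

lemma prefix_mul:
  assumes "u \<in> G" "v \<in> G" "prefix p (u \<sqdot> v)"
  shows "prefix p u \<or> (\<exists>q. prefix q v \<and> p = u \<sqdot> q)"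
  using prefix_foldr_push[of u v p] assms G_prefix
  by (metis G_reduced mul_eq)

lemma finite_ball: "finite {w \<in> G. length w \<le> n}"
proof (rule finite_subset)
  show "{w \<in> G. length w \<le> n} \<subseteq> {w. set w \<subseteq> {..<N} \<times> UNIV \<and> length w \<le> n}"
    by (auto simp: G_iff)
qed (intro finite_lists_length_le, simp)

lemma countable_G: "countable G"
  by simp

end

section \<open>The boundary and convex hulls\<close>

definition bpush :: "letter \<Rightarrow> bpt \<Rightarrow> bpt" where
  "bpush a \<xi> = (if \<xi> 0 = linv a then (\<lambda>i. \<xi> (Suc i)) else case_nat a \<xi>)"

definition pre :: "nat \<Rightarrow> bpt \<Rightarrow> word" where
  "pre n \<xi> = map \<xi> [0..<n]"

lemma length_pre [simp]: "length (pre n \<xi>) = n"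
  by (simp add: pre_def)

lemma pre_0 [simp]: "pre 0 \<xi> = []"
  by (simp add: pre_def)

lemma pre_nth [simp]: "i < n \<Longrightarrow> pre n \<xi> ! i = \<xi> i"
  by (simp add: pre_def)

lemma pre_Suc: "pre (Suc n) \<xi> = pre n \<xi> @ [\<xi> n]"
  by (simp add: pre_def)

lemma pre_Suc_Cons: "pre (Suc n) \<xi> = \<xi> 0 # pre n (\<lambda>i. \<xi> (Suc i))"
  by (simp add: pre_def map_upt_Suc del: upt_Suc)

lemma take_pre [simp]: "take m (pre n \<xi>) = pre (min m n) \<xi>"
  by (simp add: pre_def take_map min_def)

lemma pre_eq_iff: "pre n \<xi> = pre n \<zeta> \<longleftrightarrow> (\<forall>i<n. \<xi> i = \<zeta> i)"
  by (simp add: pre_def list_eq_iff_nth_eq)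

lemma take_eq_pre_iff: "take n w = pre n \<xi> \<longleftrightarrow> n \<le> length w \<and> (\<forall>i<n. w ! i = \<xi> i)"
proof
  assume e: "take n w = pre n \<xi>"
  then have "n \<le> length w" by (metis length_pre length_take min.absorb_iff2)
  then show "n \<le> length w \<and> (\<forall>i<n. w ! i = \<xi> i)" using e by (metis nth_take pre_nth)
qed (auto intro!: nth_equalityI)

lemma bact_Nil [simp]: "bact [] \<xi> = \<xi>"
proof -
  have "(GREATEST k. k \<le> length ([] :: word) \<and> (\<forall>i<k. \<xi> i = linv ([] ! (length ([] :: word) - 1 - i)))) = 0"
    by (rule Greatest_equality) auto
  then show ?thesis unfolding bact_def Let_def by simp
qed

lemma bact_eqI:
  assumes "k \<le> length w" "\<And>i. i < k \<Longrightarrow> \<xi> i = linv (w ! (length w - 1 - i))"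
    and "k = length w \<or> \<xi> k \<noteq> linv (w ! (length w - 1 - k))"
  shows "bact w \<xi> = (\<lambda>i. if i < length w - k then w ! i else \<xi> (i - (length w - k) + k))"
proof -
  have "(GREATEST k. k \<le> length w \<and> (\<forall>i<k. \<xi> i = linv (w ! (length w - 1 - i)))) = k"
  proof (rule Greatest_equality)
    fix j assume j: "j \<le> length w \<and> (\<forall>i<j. \<xi> i = linv (w ! (length w - 1 - i)))"
    show "j \<le> k"
    proof (rule ccontr)
      assume "\<not> j \<le> k"
      then have "k < j" by simp
      then show False using j assms(3) by auto
    qed
  qed (use assms in auto)
  then show ?thesis unfolding bact_def Let_def by (simp only:)
qed

text \<open>\<open>bact\<close> performs the maximal cancellation in one go. Peeling off the first
  letter turns it into iterated \<open>bpush\<close>, and the laws of an action then follow in the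
  same way as for \<open>push\<close>.\<close>

lemma bact_Cons:
  assumes "reduced (a # w)"
  shows "bact (a # w) \<xi> = bpush a (bact w \<xi>)"
proof -
  let ?n = "length w"
  \<comment> \<open>The cancellation length is the first position at which cancellation fails; the
    clause \<open>k = ?n\<close> makes the minimum exist when all of \<open>w\<close>
    cancels.\<close>
  define Q where "Q k \<longleftrightarrow> k = ?n \<or> \<xi> k \<noteq> linv (w ! (?n - 1 - k))" for k
  define k where "k = (LEAST k. Q k)"
  have "Q ?n" by (simp add: Q_def)
  then have k1: "Q k" "k \<le> ?n" unfolding k_def by (auto intro: LeastI Least_le)
  have k2: "\<xi> i = linv (w ! (?n - 1 - i))" if "i < k" for i
    using not_less_Least[of i Q] that k1 unfolding k_def[symmetric] by (auto simp: Q_def)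
  have bw: "bact w \<xi> = (\<lambda>i. if i < ?n - k then w ! i else \<xi> (i - (?n - k) + k))"
    using k1 k2 by (intro bact_eqI) (auto simp: Q_def)
  have k3: "\<xi> i = linv ((a # w) ! (length (a # w) - 1 - i))" if "i < k" for i
    using k2[OF that] that k1 by (simp add: nth_Cons' )
  show ?thesis
  proof (cases "k < ?n")
    case True
    have ba: "bact (a # w) \<xi> = (\<lambda>i. if i < length (a # w) - k then (a # w) ! i else \<xi> (i - (length (a # w) - k) + k))"
      using True k1 k3 by (intro bact_eqI) (auto simp: Q_def nth_Cons')
    have "bact w \<xi> 0 = hd w" using bw True by (cases w) auto
    moreover have "hd w \<noteq> linv a" using assms True by (auto simp: reduced_Cons)
    ultimately have "bpush a (bact w \<xi>) = case_nat a (bact w \<xi>)" by (simp add: bpush_def)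
    then show ?thesis unfolding ba bw using True
      by (auto simp: fun_eq_iff Suc_diff_le less_imp_le split: nat.split)
  next
    case False
    then have kn: "k = ?n" using k1 by simp
    have bw': "bact w \<xi> = (\<lambda>i. \<xi> (i + ?n))" using bw kn by simp
    show ?thesis
    proof (cases "\<xi> ?n = linv a")
      case True
      have "bact (a # w) \<xi> = (\<lambda>i. if i < length (a # w) - Suc ?n then (a # w) ! i else \<xi> (i - (length (a # w) - Suc ?n) + Suc ?n))"
        using True k3 kn by (intro bact_eqI) (auto simp: less_Suc_eq)
      then show ?thesis using True by (simp add: bw' bpush_def)
    next
      case f: False
      have "bact (a # w) \<xi> = (\<lambda>i. if i < length (a # w) - ?n then (a # w) ! i else \<xi> (i - (length (a # w) - ?n) + ?n))"
        using f k3 kn by (intro bact_eqI) auto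
      then show ?thesis using f by (auto simp: bw' bpush_def fun_eq_iff split: nat.split)
    qed
  qed
qed

lemma bact_eq: "reduced w \<Longrightarrow> bact w \<xi> = foldr bpush w \<xi>"
  by (induction w) (auto simp: bact_Cons reduced_Cons)

context free_group
begin

lemma bdry_iff_pre: "\<xi> \<in> bdry N \<longleftrightarrow> (\<forall>n. pre n \<xi> \<in> G)"
proof
  assume x: "\<xi> \<in> bdry N"
  show "\<forall>n. pre n \<xi> \<in> G"
  proof
    fix n show "pre n \<xi> \<in> G"
    proof (induction n)
      case (Suc n)
      have "n = 0 \<or> last (pre n \<xi>) \<noteq> linv (\<xi> n)"
      proof (cases n)
        case (Suc m)
        then show ?thesis using x by (auto simp: pre_Suc bdry_def linv_swap)
      qed simp
      then show ?case using Suc x by (auto simp: pre_Suc G_snoc bdry_def)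
    qed simp
  qed
next
  assume p: "\<forall>n. pre n \<xi> \<in> G"
  have "fst (\<xi> i) < N" for i using p[rule_format, of "Suc i"] by (simp add: pre_Suc G_snoc)
  moreover have "\<xi> (Suc i) \<noteq> linv (\<xi> i)" for i
    using G_snoc[of "pre (Suc i) \<xi>" "\<xi> (Suc i)"] p[rule_format, of "Suc (Suc i)"]
    unfolding pre_Suc by auto
  ultimately show "\<xi> \<in> bdry N" by (simp add: bdry_def)
qed

lemma pre_in_G [simp]: "\<xi> \<in> bdry N \<Longrightarrow> pre n \<xi> \<in> G"
  by (simp add: bdry_iff_pre)

lemma bdry_shift1: "\<xi> \<in> bdry N \<Longrightarrow> (\<lambda>i. \<xi> (Suc i)) \<in> bdry N"
  by (simp add: bdry_def)

lemma bpush_bdry: "\<xi> \<in> bdry N \<Longrightarrow> fst a < N \<Longrightarrow> bpush a \<xi> \<in> bdry N"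
  by (auto simp: bpush_def bdry_def split: nat.split)

lemma bpush_linv_bpush: "\<xi> \<in> bdry N \<Longrightarrow> bpush (linv a) (bpush a \<xi>) = \<xi>"
  by (auto simp: bpush_def bdry_def fun_eq_iff split: nat.split) (metis linv_linv)+

lemma bpush_bpush_linv: "\<xi> \<in> bdry N \<Longrightarrow> bpush a (bpush (linv a) \<xi>) = \<xi>"
  using bpush_linv_bpush[of \<xi> "linv a"] by simp

lemma foldr_bpush_bdry: "\<xi> \<in> bdry N \<Longrightarrow> \<forall>a\<in>set w. fst a < N \<Longrightarrow> foldr bpush w \<xi> \<in> bdry N"
  by (induction w) (auto simp: bpush_bdry)

lemma foldr_bpush_push:
  assumes "\<xi> \<in> bdry N" "\<forall>a\<in>set w. fst a < N"
  shows "foldr bpush (push a w) \<xi> = bpush a (foldr bpush w \<xi>)"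
  using assms by (cases w) (auto simp: bpush_bpush_linv foldr_bpush_bdry)

lemma foldr_bpush_foldr_push:
  assumes "\<xi> \<in> bdry N" "\<forall>a\<in>set w. fst a < N" "\<forall>a\<in>set u. fst a < N"
  shows "foldr bpush (foldr push u w) \<xi> = foldr bpush u (foldr bpush w \<xi>)"
  using assms(3)
proof (induction u)
  case (Cons a u)
  then have "\<forall>b\<in>set (foldr push u w). fst b < N" using set_foldr_push[of u w] assms by auto
  then show ?case using Cons assms by (simp add: foldr_bpush_push)
qed simp

lemma bact_bdry [simp]: "g \<in> G \<Longrightarrow> \<xi> \<in> bdry N \<Longrightarrow> bact g \<xi> \<in> bdry N"
  by (simp add: bact_eq G_reduced foldr_bpush_bdry G_iff)

lemma bact_mul: "g \<in> G \<Longrightarrow> h \<in> G \<Longrightarrow> \<xi> \<in> bdry N \<Longrightarrow> bact (g \<sqdot> h) \<xi> = bact g (bact h \<xi>)"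
  using m_closed[of g h]
  by (simp add: bact_eq G_reduced mul_eq foldr_bpush_foldr_push G_iff)

lemma bact_iv [simp]:
  "g \<in> G \<Longrightarrow> \<xi> \<in> bdry N \<Longrightarrow> bact g (bact (iv g) \<xi>) = \<xi>"
  "g \<in> G \<Longrightarrow> \<xi> \<in> bdry N \<Longrightarrow> bact (iv g) (bact g \<xi>) = \<xi>"
  by (simp_all flip: bact_mul)

lemma image_bact_mul: "g \<in> G \<Longrightarrow> h \<in> G \<Longrightarrow> S \<subseteq> bdry N \<Longrightarrow> bact (g \<sqdot> h) ` S = bact g ` bact h ` S"
  by (force simp: bact_mul image_iff)

lemma image_bact_iv [simp]:
  assumes "g \<in> G" "S \<subseteq> bdry N"
  shows "bact g ` bact (iv g) ` S = S" "bact (iv g) ` bact g ` S = S"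
  using assms image_bact_mul[of g "iv g" S] image_bact_mul[of "iv g" g S] by auto

lemma image_bact_bdry: "g \<in> G \<Longrightarrow> S \<subseteq> bdry N \<Longrightarrow> bact g ` S \<subseteq> bdry N"
  by auto

lemma inj_on_bact: "g \<in> G \<Longrightarrow> inj_on (bact g) (bdry N)"
  by (metis bact_iv(2) inj_onI)

text \<open>The word \<open>v\<close> is a vertex of the Cayley tree, and \<open>dir v \<xi>\<close> is the first edge of the ray
  from \<open>v\<close> to \<open>\<xi>\<close>. A vertex lies in the convex hull of a set of boundary points if and only if
  it sees two of them in different directions.\<close>

definition dir :: "word \<Rightarrow> bpt \<Rightarrow> letter" where
  "dir v \<xi> = bact (iv v) \<xi> 0"

lemma dir_act: "g \<in> G \<Longrightarrow> v \<in> G \<Longrightarrow> \<xi> \<in> bdry N \<Longrightarrow> dir v (bact g \<xi>) = dir (iv g \<sqdot> v) \<xi>"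
  by (simp add: dir_def inv_mult_group bact_mul)

lemma bact_iv_Cons:
  assumes "a # w \<in> G" "\<xi> \<in> bdry N"
  shows "bact (iv (a # w)) \<xi> = bact (iv w) (bpush (linv a) \<xi>)"
proof -
  have "iv (a # w) = winv w @ [linv a]" using assms by (simp add: iv_eq winv_Cons)
  moreover have "reduced (winv w @ [linv a])"
    using reduced_winv[of "a # w"] assms by (simp add: G_reduced winv_Cons)
  ultimately show ?thesis using assms
    by (simp add: bact_eq iv_eq G_Cons G_reduced)
qed

text \<open>From a vertex off the ray to \<xi>, the way to \<xi> first goes back towards
  \<open>[]\<close>, that is, through the inverse of the last letter.\<close>

lemma dir_not_prefix:
  "w \<in> G \<Longrightarrow> \<xi> \<in> bdry N \<Longrightarrow> pre (length w) \<xi> \<noteq> w \<Longrightarrow> dir w \<xi> = linv (last w)"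
proof (induction w arbitrary: \<xi>)
  case (Cons a w)
  have w: "w \<in> G" "fst a < N" "w = [] \<or> hd w \<noteq> linv a" using Cons.prems by (auto simp: G_Cons)
  define \<zeta> where "\<zeta> = bpush (linv a) \<xi>"
  have z: "\<zeta> \<in> bdry N" using Cons.prems w by (simp add: \<zeta>_def bpush_bdry)
  have d: "dir (a # w) \<xi> = dir w \<zeta>"
    unfolding dir_def using bact_iv_Cons[OF Cons.prems(1,2)] by (simp add: \<zeta>_def)
  show ?case
  proof (cases "\<xi> 0 = a")
    case True
    then have "\<zeta> = (\<lambda>i. \<xi> (Suc i))" by (simp add: \<zeta>_def bpush_def)
    then have "pre (length w) \<zeta> \<noteq> w" using Cons.prems True by (simp add: pre_Suc_Cons)
    then show ?thesis using Cons.IH[OF w(1) z] d by auto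
  next
    case False
    then have z0: "\<zeta> 0 = linv a" by (simp add: \<zeta>_def bpush_def)
    show ?thesis
    proof (cases "w = []")
      case True
      then show ?thesis using d z0 by (simp add: dir_def)
    next
      case f: False
      then have "pre (length w) \<zeta> \<noteq> w" using z0 w by (cases w) (auto simp: pre_Suc_Cons)
      then show ?thesis using Cons.IH[OF w(1) z] d f by auto
    qed
  qed
qed simp

lemma bact_iv_pre: "\<xi> \<in> bdry N \<Longrightarrow> bact (iv (pre n \<xi>)) \<xi> = (\<lambda>i. \<xi> (i + n))"
proof (induction n arbitrary: \<xi>)
  case (Suc n)
  have "pre (Suc n) \<xi> \<in> G" using Suc.prems by simp
  then have "bact (iv (pre (Suc n) \<xi>)) \<xi> = bact (iv (pre n (\<lambda>i. \<xi> (Suc i)))) (bpush (linv (\<xi> 0)) \<xi>)"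
    using bact_iv_Cons Suc.prems by (simp add: pre_Suc_Cons)
  also have "bpush (linv (\<xi> 0)) \<xi> = (\<lambda>i. \<xi> (Suc i))" by (simp add: bpush_def)
  finally show ?case using Suc.IH[OF bdry_shift1[OF Suc.prems]] by simp
qed simp

lemma dir_prefix: "\<xi> \<in> bdry N \<Longrightarrow> pre (length w) \<xi> = w \<Longrightarrow> dir w \<xi> = \<xi> (length w)"
  unfolding dir_def by (metis add_0 bact_iv_pre)

lemma dir_Nil [simp]: "dir [] \<xi> = \<xi> 0"
  by (simp add: dir_def)

lemma prefix_not_back:
  assumes "\<xi> \<in> bdry N" "pre (length w) \<xi> = w" "w \<noteq> []"
  shows "dir w \<xi> \<noteq> linv (last w)"
proof -
  obtain m where m: "length w = Suc m" using assms by (cases w) auto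
  have "last w = \<xi> m" using assms(2) m by (metis last_snoc pre_Suc)
  then show ?thesis using assms m dir_prefix[OF assms(1,2)] by (simp add: bdry_def)
qed

lemma dir_cong:
  assumes "v \<in> G" "\<xi> \<in> bdry N" "\<zeta> \<in> bdry N" "length v < n" "pre n \<xi> = pre n \<zeta>"
  shows "dir v \<xi> = dir v \<zeta>"
proof -
  have e: "pre (length v) \<xi> = pre (length v) \<zeta>" "\<xi> (length v) = \<zeta> (length v)"
    using assms by (auto simp: pre_eq_iff)
  show ?thesis
    using assms e dir_prefix dir_not_prefix by (cases "pre (length v) \<xi> = v") auto
qed

section \<open>Convex hulls in the Cayley tree\<close>

definition thull :: "bpt set \<Rightarrow> word set" where
  "thull S = {v \<in> G. \<exists>\<xi>\<in>S. \<exists>\<zeta>\<in>S. dir v \<xi> \<noteq> dir v \<zeta>}"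

lemma hull_sub: "thull S \<subseteq> G"
  by (auto simp: thull_def)

lemma hull_in_G: "v \<in> thull S \<Longrightarrow> v \<in> G"
  by (simp add: thull_def)

lemma hull_mono: "S \<subseteq> S' \<Longrightarrow> thull S \<subseteq> thull S'"
  by (auto simp: thull_def)

lemma hull_act: "g \<in> G \<Longrightarrow> S \<subseteq> bdry N \<Longrightarrow> v \<in> G \<Longrightarrow> v \<in> thull (bact g ` S) \<longleftrightarrow> iv g \<sqdot> v \<in> thull S"
  by (auto simp: thull_def dir_act subset_iff)

lemma hull_act_eq:
  assumes "g \<in> G" "S \<subseteq> bdry N"
  shows "thull (bact g ` S) = (\<lambda>v. g \<sqdot> v) ` thull S"
proof (intro equalityI subsetI)
  fix v assume v: "v \<in> thull (bact g ` S)"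
  then have "v \<in> G" by (rule hull_in_G)
  then show "v \<in> (\<lambda>v. g \<sqdot> v) ` thull S"
    using v assms hull_act[of g S v] by (intro image_eqI[of _ _ "iv g \<sqdot> v"]) auto
next
  fix v assume "v \<in> (\<lambda>v. g \<sqdot> v) ` thull S"
  then obtain u where u: "u \<in> thull S" "v = g \<sqdot> u" by blast
  then show "v \<in> thull (bact g ` S)"
    using assms hull_act[of g S v] hull_in_G[OF u(1)] by simp
qed

text \<open>If no ray from \<open>[]\<close> to a point of \<open>S\<close> passed through
  \<open>v\<close>, all of \<open>S\<close> would be seen from \<open>v\<close> through the same
  edge, the one leading back to \<open>[]\<close>.\<close>

lemma hull_prefix:
  assumes "v \<in> thull S" "S \<subseteq> bdry N"
  shows "\<exists>\<xi>\<in>S. pre (length v) \<xi> = v"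
proof -
  obtain \<xi> \<zeta> where x: "\<xi> \<in> S" "\<zeta> \<in> S" "dir v \<xi> \<noteq> dir v \<zeta>" "v \<in> G"
    using assms by (auto simp: thull_def)
  then have "pre (length v) \<xi> = v \<or> pre (length v) \<zeta> = v"
    using dir_not_prefix[of v \<xi>] dir_not_prefix[of v \<zeta>] assms by (metis subsetD)
  then show ?thesis using x by blast
qed

lemma hull_diverge:
  assumes "v \<in> thull S" "S \<subseteq> bdry N" "length v < n"
  shows "\<exists>\<xi>\<in>S. \<exists>\<zeta>\<in>S. pre n \<xi> \<noteq> pre n \<zeta>"
proof -
  obtain \<xi> \<zeta> where x: "\<xi> \<in> S" "\<zeta> \<in> S" "dir v \<xi> \<noteq> dir v \<zeta>" "v \<in> G"
    using assms by (auto simp: thull_def)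
  then show ?thesis using dir_cong[of v \<xi> \<zeta> n] assms by blast
qed

text \<open>The vertex \<open>w\<close> lies on the ray to \<xi> but not on the ray to \<zeta>, so
  it sees the first point ahead and the second one behind.\<close>

lemma hullI:
  assumes "S \<subseteq> bdry N" "\<xi> \<in> S" "\<zeta> \<in> S" "pre (length w) \<xi> = w" "pre (length w) \<zeta> \<noteq> w"
  shows "w \<in> thull S"
proof -
  have b: "\<xi> \<in> bdry N" "\<zeta> \<in> bdry N" using assms by auto
  have w: "w \<in> G" "w \<noteq> []" using assms b by (metis pre_in_G, auto)
  then have "dir w \<zeta> = linv (last w)" "dir w \<xi> \<noteq> linv (last w)"
    using assms b dir_not_prefix prefix_not_back by auto
  then show ?thesis using assms w unfolding thull_def by force
qed

lemma hull_nonempty: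
  assumes "S \<subseteq> bdry N" "\<xi> \<in> S" "\<zeta> \<in> S" "\<xi> \<noteq> \<zeta>"
  shows "\<exists>m. \<forall>n\<ge>m. pre n \<xi> \<in> thull S"
proof -
  obtain m where m: "\<xi> m \<noteq> \<zeta> m" using assms by auto
  have "pre n \<xi> \<in> thull S" if "n \<ge> Suc m" for n
    using assms m that by (intro hullI[of S \<xi> \<zeta>]) (auto simp: pre_eq_iff Suc_le_eq)
  then show ?thesis by blast
qed

text \<open>The vertices \<open>u \<sqdot> p\<close>, for \<open>p\<close> a prefix of \<open>iv u \<sqdot> w\<close>, form the geodesic from \<open>u\<close> to \<open>w\<close>.\<close>

definition tconvex :: "word set \<Rightarrow> bool" where
  "tconvex M \<longleftrightarrow> M \<subseteq> G \<and> (\<forall>u\<in>M. \<forall>w\<in>M. \<forall>p. prefix p (iv u \<sqdot> w) \<longrightarrow> u \<sqdot> p \<in> M)"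

lemma tconvex_prefix: "tconvex M \<Longrightarrow> [] \<in> M \<Longrightarrow> w \<in> M \<Longrightarrow> prefix p w \<Longrightarrow> p \<in> M"
  unfolding tconvex_def by (metis G_prefix mul_Nil(2) iv_Nil subsetD)

lemma tconvex_Int: "tconvex M \<Longrightarrow> tconvex M' \<Longrightarrow> tconvex (M \<inter> M')"
  unfolding tconvex_def by auto

text \<open>By equivariance one endpoint may be moved to \<open>[]\<close>. A nonempty prefix then
  lies on a ray through the other endpoint, while \<open>[]\<close> sees a further point of the set
  through a different first letter; this is the situation of \<open>hullI\<close>.\<close>

lemma tconvex_hull:
  assumes S: "S \<subseteq> bdry N"
  shows "tconvex (thull S)"
  unfolding tconvex_def
proof (intro conjI ballI allI impI)
  fix u w p assume u: "u \<in> thull S" and w: "w \<in> thull S" and p: "prefix p (iv u \<sqdot> w)"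
  have G: "u \<in> G" "w \<in> G" using u w hull_in_G by auto
  define S' where "S' = bact (iv u) ` S"
  have S': "S' \<subseteq> bdry N" using S G by (auto simp: S'_def)
  have uS: "S = bact u ` S'" using S G by (simp add: S'_def)
  have one: "[] \<in> thull S'" using hull_act[of "iv u" S "[]"] u G S by (simp add: S'_def)
  have v: "iv u \<sqdot> w \<in> thull S'" using hull_act[of "iv u" S "iv u \<sqdot> w"] w G S by (simp add: S'_def)
  have pG: "p \<in> G" using p G_prefix G by blast
  have "p \<in> thull S'"
  proof (cases "p = []")
    case False
    obtain \<xi> where x: "\<xi> \<in> S'" "pre (length (iv u \<sqdot> w)) \<xi> = iv u \<sqdot> w" using hull_prefix[OF v S'] by blast
    obtain k where "p = take k (iv u \<sqdot> w)" "k \<le> length (iv u \<sqdot> w)"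
      using p by (metis append_eq_conv_conj le_add1 length_append prefixE)
    then have xp: "pre (length p) \<xi> = p" using x(2)
      by (metis length_pre min_absorb1 take_pre)
    obtain \<alpha> \<beta> where ab: "\<alpha> \<in> S'" "\<beta> \<in> S'" "\<alpha> 0 \<noteq> \<beta> 0" using one by (auto simp: thull_def)
    then obtain \<zeta> where z: "\<zeta> \<in> S'" "\<zeta> 0 \<noteq> \<xi> 0" by metis
    have "0 < length p" using False by simp
    then have "pre (length p) \<zeta> \<noteq> pre (length p) \<xi>" using z unfolding pre_eq_iff by blast
    then show ?thesis using hullI[OF S' x(1) z(1) xp] xp by simp
  qed (use one in simp)
  then show "u \<sqdot> p \<in> thull S" using hull_act[of u S' "u \<sqdot> p"] G pG S' uS by simp
qed (rule hull_sub)

lemma hull_letter: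
  assumes "[] \<in> thull S" "S \<subseteq> bdry N"
  shows "[a] \<in> thull S \<longleftrightarrow> (\<exists>\<xi>\<in>S. \<xi> 0 = a)"
proof
  assume "[a] \<in> thull S"
  then show "\<exists>\<xi>\<in>S. \<xi> 0 = a" using hull_prefix[of "[a]" S] assms by (auto simp: pre_def)
next
  assume "\<exists>\<xi>\<in>S. \<xi> 0 = a"
  then obtain \<xi> where x: "\<xi> \<in> S" "\<xi> 0 = a" by blast
  obtain \<alpha> \<beta> where ab: "\<alpha> \<in> S" "\<beta> \<in> S" "\<alpha> 0 \<noteq> \<beta> 0" using assms by (auto simp: thull_def)
  then obtain \<zeta> where z: "\<zeta> \<in> S" "\<zeta> 0 \<noteq> a" by metis
  show "[a] \<in> thull S" using x z assms by (intro hullI[of S \<xi> \<zeta>]) (auto simp: pre_def)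
qed

section \<open>Compactness of the boundary\<close>

lemma Koenig_words:
  assumes w: "\<And>n. w n \<in> G" "\<And>n::nat. n \<le> length (w n)"
  shows "\<exists>\<xi>\<in>bdry N. \<forall>m. \<exists>n\<ge>m. take m (w n) = pre m \<xi>"
proof -
  define P where "P m p \<longleftrightarrow> length p = m \<and> infinite {n. take m (w n) = p}" for m and p :: word
  define Q where "Q m p p' \<longleftrightarrow> (\<exists>a. p' = p @ [a])" for m :: nat and p p' :: word
  have "\<exists>f. \<forall>n. P n (f n) \<and> Q n (f n) (f (Suc n))"
  proof (rule dependent_nat_choice)
    show "\<exists>x. P 0 x" by (rule exI[of _ "[]"]) (simp add: P_def)
  next
    fix p n assume p: "P n p"
    let ?L = "{..<N} \<times> (UNIV :: bool set)"
    \<comment> \<open>The indices up to \<open>n\<close> are set aside because only later words are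
      sure to have a letter at position \<open>n\<close>. Since there are finitely many letters, one
      extension of \<open>p\<close> again occurs infinitely often.\<close>
    have "{k. take n (w k) = p} \<subseteq> {..n} \<union> (\<Union>a\<in>?L. {k. take (Suc n) (w k) = p @ [a]})"
    proof
      fix k assume k: "k \<in> {k. take n (w k) = p}"
      show "k \<in> {..n} \<union> (\<Union>a\<in>?L. {k. take (Suc n) (w k) = p @ [a]})"
      proof (cases "k \<le> n")
        case False
        then have l: "n < length (w k)" using w(2)[of k] by simp
        then have "take (Suc n) (w k) = p @ [w k ! n]" using k by (simp add: take_Suc_conv_app_nth)
        moreover have "w k ! n \<in> ?L" using w(1)[of k] l by (auto simp: G_iff mem_Times_iff)
        ultimately show ?thesis by auto
      qed simp
    qed
    then have "infinite (\<Union>a\<in>?L. {k. take (Suc n) (w k) = p @ [a]})"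
      using p unfolding P_def by (metis finite_Un finite_atMost finite_subset)
    then obtain a where "infinite {k. take (Suc n) (w k) = p @ [a]}" by auto
    then have "P (Suc n) (p @ [a]) \<and> Q n p (p @ [a])" using p unfolding P_def Q_def by simp
    then show "\<exists>y. P (Suc n) y \<and> Q n p y" by blast
  qed
  then obtain f where f: "\<And>n. P n (f n)" "\<And>n. \<exists>a. f (Suc n) = f n @ [a]" unfolding Q_def by blast
  define \<xi> where "\<xi> i = last (f (Suc i))" for i
  have fp: "f n = pre n \<xi>" for n
  proof (induction n)
    case 0 then show ?case using f(1)[of 0] by (simp add: P_def)
  next
    case (Suc n) then show ?case using f(2)[of n] by (auto simp: pre_Suc \<xi>_def)
  qed
  have *: "\<exists>n\<ge>m. take m (w n) = pre m \<xi>" for m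
    using f(1)[of m] fp[of m] unfolding P_def infinite_nat_iff_unbounded_le by auto
  have "pre m \<xi> \<in> G" for m using *[of m] w(1) by (metis G_take)
  then have "\<xi> \<in> bdry N" by (simp add: bdry_iff_pre)
  then show ?thesis using * by blast
qed

lemma Koenig_bdry:
  assumes "\<And>n. \<zeta> n \<in> bdry N"
  shows "\<exists>\<xi>\<in>bdry N. \<forall>m. \<exists>n\<ge>m. pre m (\<zeta> n) = pre m \<xi>"
proof -
  obtain \<xi> where "\<xi> \<in> bdry N" "\<forall>m. \<exists>n\<ge>m. take m (pre n (\<zeta> n)) = pre m \<xi>"
    using Koenig_words[of "\<lambda>n. pre n (\<zeta> n)"] assms by auto
  then show ?thesis by (metis min_absorb1 take_pre)
qed

end

section \<open>The topology on closed subsets of the boundary\<close>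

definition Tr :: "nat \<Rightarrow> bpt set \<Rightarrow> word set" where
  "Tr n S = pre n ` S"

lemma Tr_D: "w \<in> Tr n S \<Longrightarrow> \<exists>\<xi>\<in>S. pre n \<xi> = w"
  unfolding Tr_def by blast

lemma Tr_I: "\<xi> \<in> S \<Longrightarrow> pre n \<xi> \<in> Tr n S"
  unfolding Tr_def by blast

lemma Tr_take: "m \<le> n \<Longrightarrow> Tr m S = take m ` Tr n S"
  by (simp add: Tr_def image_image min_def)

lemma Tr_le: "Tr n S = Tr n S' \<Longrightarrow> m \<le> n \<Longrightarrow> Tr m S = Tr m S'"
  by (simp add: Tr_take)

context free_group
begin

abbreviation B :: "nat \<Rightarrow> word set" where "B n \<equiv> {w \<in> G. length w \<le> n}"

lemma Tr_sub: "S \<subseteq> bdry N \<Longrightarrow> Tr n S \<subseteq> B n"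
  by (auto simp: Tr_def)

lemma topspace_bdry [simp]: "topspace (bdry_top N) = bdry N"
  by (simp add: bdry_top_def)

lemma openin_bdry:
  "openin (bdry_top N) U \<longleftrightarrow> U \<subseteq> bdry N \<and> (\<forall>\<xi>\<in>U. \<exists>n. \<forall>\<zeta>\<in>bdry N. pre n \<zeta> = pre n \<xi> \<longrightarrow> \<zeta> \<in> U)"
    (is "_ \<longleftrightarrow> ?R")
proof
  assume "openin (bdry_top N) U"
  then obtain T where T: "openin (product_topology (\<lambda>_. discrete_topology UNIV) UNIV) T" "U = T \<inter> bdry N"
    unfolding bdry_top_def openin_subtopology by blast
  have "\<exists>n. \<forall>\<zeta>\<in>bdry N. pre n \<zeta> = pre n \<xi> \<longrightarrow> \<zeta> \<in> U" if x: "\<xi> \<in> U" for \<xi>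
  proof -
    have "\<xi> \<in> T" using x T by simp
    then obtain V where V: "finite {i. V i \<noteq> (UNIV :: letter set)}" "\<xi> \<in> Pi\<^sub>E UNIV V" "Pi\<^sub>E UNIV V \<subseteq> T"
      using T(1) unfolding openin_product_topology_alt by auto
    define n where "n = Suc (Max (insert 0 {i. V i \<noteq> UNIV}))"
    have n: "i < n" if "V i \<noteq> UNIV" for i
      unfolding n_def less_Suc_eq_le using V(1) that by (intro Max_ge) auto
    have "\<zeta> \<in> U" if z: "\<zeta> \<in> bdry N" "pre n \<zeta> = pre n \<xi>" for \<zeta>
    proof -
      have "\<zeta> i \<in> V i" for i
      proof (cases "V i = UNIV")
        case False
        then have "\<zeta> i = \<xi> i" using n z(2) by (auto simp: pre_eq_iff)
        then show ?thesis using V(2) by (auto simp: PiE_def)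
      qed simp
      then have "\<zeta> \<in> T" using V(3) by (auto simp: PiE_def)
      then show ?thesis using z T by simp
    qed
    then show ?thesis by blast
  qed
  then show ?R using T(2) by blast
next
  assume R: ?R
  then obtain n where n: "\<And>\<xi> \<zeta>. \<xi> \<in> U \<Longrightarrow> \<zeta> \<in> bdry N \<Longrightarrow> pre (n \<xi>) \<zeta> = pre (n \<xi>) \<xi> \<Longrightarrow> \<zeta> \<in> U" by metis
  define T where "T = (\<Union>\<xi>\<in>U. {\<zeta>. pre (n \<xi>) \<zeta> = pre (n \<xi>) \<xi>})"
  have "openin (product_topology (\<lambda>_. discrete_topology (UNIV :: letter set)) UNIV) T"
    unfolding openin_product_topology_alt
  proof
    fix \<zeta> assume "\<zeta> \<in> T"
    then obtain \<xi> where x: "\<xi> \<in> U" "pre (n \<xi>) \<zeta> = pre (n \<xi>) \<xi>" by (auto simp: T_def)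
    define V where "V i = (if i < n \<xi> then {\<zeta> i} else UNIV)" for i
    have "{i. V i \<noteq> UNIV} \<subseteq> {..<n \<xi>}" by (auto simp: V_def)
    then have "finite {i. V i \<noteq> UNIV}" by (rule finite_subset) simp
    moreover have "Pi\<^sub>E UNIV V \<subseteq> T"
    proof
      fix \<theta> assume c: "\<theta> \<in> Pi\<^sub>E UNIV V"
      have "\<theta> i = \<zeta> i" if "i < n \<xi>" for i
        using PiE_mem[OF c, of i] that by (simp add: V_def)
      then have "pre (n \<xi>) \<theta> = pre (n \<xi>) \<xi>" using x(2) by (simp add: pre_eq_iff)
      then show "\<theta> \<in> T" using x(1) by (auto simp: T_def)
    qed
    moreover have "\<zeta> \<in> Pi\<^sub>E UNIV V" by (auto simp: V_def)
    ultimately show "\<exists>U. finite {i \<in> UNIV. U i \<noteq> topspace (discrete_topology UNIV)} \<and>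
      (\<forall>i\<in>UNIV. openin (discrete_topology UNIV) (U i)) \<and> \<zeta> \<in> Pi\<^sub>E UNIV U \<and> Pi\<^sub>E UNIV U \<subseteq> T"
      by (intro exI[of _ V]) auto
  qed
  moreover have "U = T \<inter> bdry N" using R n by (auto simp: T_def)
  ultimately show "openin (bdry_top N) U" unfolding bdry_top_def openin_subtopology by blast
qed

lemma closedin_bdry:
  "closedin (bdry_top N) S \<longleftrightarrow> S \<subseteq> bdry N \<and> (\<forall>\<xi>\<in>bdry N. (\<forall>n. pre n \<xi> \<in> Tr n S) \<longrightarrow> \<xi> \<in> S)"
proof -
  have "(\<forall>\<xi>\<in>bdry N - S. \<exists>n. \<forall>\<zeta>\<in>bdry N. pre n \<zeta> = pre n \<xi> \<longrightarrow> \<zeta> \<in> bdry N - S) \<longleftrightarrow>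
    (\<forall>\<xi>\<in>bdry N. (\<forall>n. \<exists>\<zeta>\<in>S. pre n \<zeta> = pre n \<xi>) \<longrightarrow> \<xi> \<in> S)" if "S \<subseteq> bdry N"
    using that by blast
  then show ?thesis
    unfolding closedin_def openin_bdry Tr_def by (auto simp: image_iff eq_commute)
qed

definition cyl :: "word \<Rightarrow> bpt set" where
  "cyl w = {\<xi> \<in> bdry N. pre (length w) \<xi> = w}"

lemma openin_cyl: "openin (bdry_top N) (cyl w)"
  unfolding openin_bdry cyl_def by (auto intro!: exI[of _ "length w"])

lemma CN_iff: "S \<in> CN N \<longleftrightarrow> closedin (bdry_top N) S \<and> (\<exists>x\<in>S. \<exists>y\<in>S. x \<noteq> y)"
  by (auto simp: CN_def)

lemma CN_sub: "S \<in> CN N \<Longrightarrow> S \<subseteq> bdry N"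
  by (simp add: CN_iff closedin_bdry)

lemma CN_closed: "S \<in> CN N \<Longrightarrow> \<xi> \<in> bdry N \<Longrightarrow> (\<And>n. pre n \<xi> \<in> Tr n S) \<Longrightarrow> \<xi> \<in> S"
  by (simp add: CN_iff closedin_bdry)

text \<open>A compactness argument: otherwise there are points outside \<open>U\<close> that agree
  with points of \<open>C\<close> to any given level. A limit of them lies in the closed set
  \<open>C\<close>, hence in \<open>U\<close>, and openness of \<open>U\<close> puts some of the
  points into \<open>U\<close> as well.\<close>

lemma closed_in_open_Tr:
  assumes C: "closedin (bdry_top N) C" and U: "openin (bdry_top N) U" and "C \<subseteq> U"
  shows "\<exists>m. \<forall>S'. S' \<subseteq> bdry N \<and> Tr m S' = Tr m C \<longrightarrow> S' \<subseteq> U"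
proof (rule ccontr)
  assume "\<not> ?thesis"
  then have "\<forall>m. \<exists>\<zeta>. \<zeta> \<in> bdry N \<and> \<zeta> \<notin> U \<and> pre m \<zeta> \<in> Tr m C"
    unfolding Tr_def by (metis image_eqI subset_iff)
  then obtain \<zeta> where z: "\<And>m. \<zeta> m \<in> bdry N" "\<And>m. \<zeta> m \<notin> U" "\<And>m. pre m (\<zeta> m) \<in> Tr m C"
    by metis
  obtain \<xi> where x: "\<xi> \<in> bdry N" "\<And>m. \<exists>n\<ge>m. pre m (\<zeta> n) = pre m \<xi>"
    using Koenig_bdry[of \<zeta>] z(1) by blast
  have "pre m \<xi> \<in> Tr m C" for m
  proof -
    obtain n where n: "n \<ge> m" "pre m (\<zeta> n) = pre m \<xi>" using x(2) by blast
    have "take m (pre n (\<zeta> n)) \<in> Tr m C" using z(3)[of n] unfolding Tr_take[OF n(1)] by (rule imageI)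
    then show ?thesis using n by (simp add: min_def)
  qed
  then have "\<xi> \<in> U" using C x(1) \<open>C \<subseteq> U\<close> by (auto simp: closedin_bdry)
  then obtain m where m: "\<And>\<zeta>. \<zeta> \<in> bdry N \<Longrightarrow> pre m \<zeta> = pre m \<xi> \<Longrightarrow> \<zeta> \<in> U"
    using U unfolding openin_bdry by blast
  obtain n where "pre m (\<zeta> n) = pre m \<xi>" using x(2) by blast
  then show False using m z(1,2) by blast
qed

lemma generated_Tr:
  assumes "generate_topology_on ({{C. C \<subseteq> U} | U. openin (bdry_top N) U} \<union> {{C. C \<inter> U \<noteq> {}} | U. openin (bdry_top N) U}) W"
  shows "S \<in> W \<Longrightarrow> S \<in> CN N \<Longrightarrow> \<exists>m. \<forall>S'\<in>CN N. Tr m S' = Tr m S \<longrightarrow> S' \<in> W"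
  using assms
proof (induction arbitrary: S rule: generate_topology_on.induct)
  case (Int a b)
  obtain m1 where m1: "\<forall>S'\<in>CN N. Tr m1 S' = Tr m1 S \<longrightarrow> S' \<in> a" using Int by blast
  obtain m2 where m2: "\<forall>S'\<in>CN N. Tr m2 S' = Tr m2 S \<longrightarrow> S' \<in> b" using Int by blast
  have "\<forall>S'\<in>CN N. Tr (max m1 m2) S' = Tr (max m1 m2) S \<longrightarrow> S' \<in> a \<inter> b"
    using m1 m2 Tr_le[of "max m1 m2" _ S] by (metis IntI max.cobounded1 max.cobounded2)
  then show ?case by blast
next
  case (UN k)
  then obtain A where A: "A \<in> k" "S \<in> A" by blast
  then obtain m where "\<forall>S'\<in>CN N. Tr m S' = Tr m S \<longrightarrow> S' \<in> A" using UN by blast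
  then show ?case using A by blast
next
  case (Basis s)
  then consider U where "openin (bdry_top N) U" "s = {C. C \<subseteq> U}"
    | U where "openin (bdry_top N) U" "s = {C. C \<inter> U \<noteq> {}}" by blast
  then show ?case
  proof cases
    case 1
    then have "S \<subseteq> U" "closedin (bdry_top N) S" using Basis by (auto simp: CN_iff)
    then obtain m where "\<forall>S'. S' \<subseteq> bdry N \<and> Tr m S' = Tr m S \<longrightarrow> S' \<subseteq> U"
      using closed_in_open_Tr[of S U] 1 by blast
    then show ?thesis using 1 CN_sub by (intro exI[of _ m]) simp
  next
    case 2
    then obtain \<xi> where x: "\<xi> \<in> S" "\<xi> \<in> U" using Basis by auto
    then obtain m where m: "\<And>\<zeta>. \<zeta> \<in> bdry N \<Longrightarrow> pre m \<zeta> = pre m \<xi> \<Longrightarrow> \<zeta> \<in> U"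
      using 2(1) unfolding openin_bdry by blast
    have "S' \<in> s" if "S' \<in> CN N" "Tr m S' = Tr m S" for S'
    proof -
      have "pre m \<xi> \<in> Tr m S'" using x that by (auto simp: Tr_def)
      then obtain \<zeta> where "\<zeta> \<in> S'" "pre m \<zeta> = pre m \<xi>" unfolding Tr_def by (metis imageE)
      then show ?thesis using m that CN_sub 2 by blast
    qed
    then show ?thesis by blast
  qed
qed auto

lemma openin_CN_generated:
  "openin (CN_top N) U \<longleftrightarrow> (\<exists>W. openin (topology_generated_by ({{C. C \<subseteq> U} | U. openin (bdry_top N) U} \<union> {{C. C \<inter> U \<noteq> {}} | U. openin (bdry_top N) U})) W \<and> U = W \<inter> CN N)"
proof -
  have "{C. closedin (bdry_top N) C} \<inter> CN N = CN N" by (auto simp: CN_iff)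
  then show ?thesis
    unfolding CN_top_def vietoris_def subtopology_subtopology by (simp add: openin_subtopology)
qed

text \<open>Having a given trace means to be contained in the union of the finitely many cylinders
  over its words and to meet each of them, which is a finite intersection of subbasic Vietoris
  sets.\<close>

lemma openin_Tr_eq:
  assumes S: "S \<in> CN N"
  shows "openin (CN_top N) {S' \<in> CN N. Tr m S' = Tr m S}"
proof -
  let ?T = "topology_generated_by ({{C. C \<subseteq> U} | U. openin (bdry_top N) U} \<union> {{C. C \<inter> U \<noteq> {}} | U. openin (bdry_top N) U})"
  let ?A = "Tr m S"
  let ?U = "\<Union>w\<in>?A. cyl w"
  let ?W = "{C. C \<subseteq> ?U} \<inter> (\<Inter>w\<in>?A. {C. C \<inter> cyl w \<noteq> {}})"
  have fin: "finite ?A" using Tr_sub[OF CN_sub[OF S]] finite_ball finite_subset by blast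
  have ne: "?A \<noteq> {}" using S by (auto simp: Tr_def CN_iff)
  have "openin (bdry_top N) ?U" using openin_cyl by blast
  then have "openin ?T {C. C \<subseteq> ?U}" by (intro topology_generated_by_Basis) blast
  moreover have "openin ?T {C. C \<inter> cyl w \<noteq> {}}" for w
    using openin_cyl by (intro topology_generated_by_Basis) blast
  then have "openin ?T (\<Inter>w\<in>?A. {C. C \<inter> cyl w \<noteq> {}})"
    using fin ne by (intro openin_Inter) auto
  ultimately have "openin ?T ?W" by (rule openin_Int)
  moreover have "{S' \<in> CN N. Tr m S' = ?A} = ?W \<inter> CN N"
  proof -
    have len: "length w = m" if "w \<in> ?A" for w using that by (auto simp: Tr_def)
    have "(Tr m S' = ?A) \<longleftrightarrow> S' \<in> ?W" if S': "S' \<in> CN N" for S'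
    proof -
      have "Tr m S' \<subseteq> ?A \<longleftrightarrow> S' \<subseteq> ?U"
      proof
        assume "Tr m S' \<subseteq> ?A"
        then have "pre m \<xi> \<in> ?A \<and> \<xi> \<in> cyl (pre m \<xi>)" if "\<xi> \<in> S'" for \<xi>
          using CN_sub[OF S'] that by (auto simp: cyl_def Tr_def)
        then show "S' \<subseteq> ?U" by blast
      next
        assume "S' \<subseteq> ?U"
        then have "pre m \<xi> \<in> ?A" if "\<xi> \<in> S'" for \<xi>
          using that len unfolding cyl_def by fastforce
        then show "Tr m S' \<subseteq> ?A" unfolding Tr_def[of m S'] by blast
      qed
      moreover have "?A \<subseteq> Tr m S' \<longleftrightarrow> (\<forall>w\<in>?A. S' \<inter> cyl w \<noteq> {})"
      proof -
        have "w \<in> Tr m S' \<longleftrightarrow> S' \<inter> cyl w \<noteq> {}" if wA: "w \<in> ?A" for w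
        proof
          assume "w \<in> Tr m S'"
          then obtain \<xi> where "\<xi> \<in> S'" "pre m \<xi> = w" by (auto simp: Tr_def)
          then show "S' \<inter> cyl w \<noteq> {}" using CN_sub[OF S'] len[OF wA] by (auto simp: cyl_def)
        next
          assume "S' \<inter> cyl w \<noteq> {}"
          then obtain \<xi> where "\<xi> \<in> S'" "pre m \<xi> = w" using len[OF wA] by (auto simp: cyl_def)
          then show "w \<in> Tr m S'" by (auto simp: Tr_def)
        qed
        then show ?thesis by blast
      qed
      ultimately show ?thesis by auto
    qed
    then show ?thesis by blast
  qed
  ultimately show ?thesis unfolding openin_CN_generated by blast
qed

lemma openin_CN_Tr:
  "openin (CN_top N) U \<longleftrightarrow> U \<subseteq> CN N \<and> (\<forall>S\<in>U. \<exists>m. \<forall>S'\<in>CN N. Tr m S' = Tr m S \<longrightarrow> S' \<in> U)" (is "_ \<longleftrightarrow> ?R")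
proof
  assume "openin (CN_top N) U"
  then obtain W where W: "U = W \<inter> CN N" and
    g: "generate_topology_on ({{C. C \<subseteq> U} | U. openin (bdry_top N) U} \<union> {{C. C \<inter> U \<noteq> {}} | U. openin (bdry_top N) U}) W"
    unfolding openin_CN_generated openin_topology_generated_by_iff by blast
  have "\<exists>m. \<forall>S'\<in>CN N. Tr m S' = Tr m S \<longrightarrow> S' \<in> U" if "S \<in> U" for S
    using generated_Tr[OF g, of S] that unfolding W by blast
  then show ?R using W by blast
next
  assume R: ?R
  then obtain m where m: "\<And>S S'. S \<in> U \<Longrightarrow> S' \<in> CN N \<Longrightarrow> Tr (m S) S' = Tr (m S) S \<Longrightarrow> S' \<in> U" by metis
  have "U = (\<Union>S\<in>U. {S' \<in> CN N. Tr (m S) S' = Tr (m S) S})"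
  proof (intro equalityI subsetI)
    fix S assume "S \<in> U"
    then show "S \<in> (\<Union>S\<in>U. {S' \<in> CN N. Tr (m S) S' = Tr (m S) S})" using R by (intro UN_I[of S]) auto
  qed (use m in blast)
  moreover have "openin (CN_top N) (\<Union>S\<in>U. {S' \<in> CN N. Tr (m S) S' = Tr (m S) S})"
  proof (rule openin_Union, safe)
    fix S assume "S \<in> U"
    then show "openin (CN_top N) {S' \<in> CN N. Tr (m S) S' = Tr (m S) S}" using R by (intro openin_Tr_eq) blast
  qed
  ultimately show "openin (CN_top N) U" by simp
qed

lemma topspace_CN [simp]: "topspace (CN_top N) = CN N"
proof -
  have "openin (CN_top N) (CN N)" unfolding openin_CN_Tr by auto
  moreover have "openin (CN_top N) U \<Longrightarrow> U \<subseteq> CN N" for U unfolding openin_CN_Tr by auto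
  ultimately show ?thesis using openin_subset[of "CN_top N" "CN N"] openin_topspace[of "CN_top N"] by blast
qed

section \<open>Local types: the part of the hull in a ball\<close>

definition tp :: "nat \<Rightarrow> bpt set \<Rightarrow> word set" where
  "tp n S = thull S \<inter> B n"

lemma tp_sub: "tp n S \<subseteq> B n"
  by (simp add: tp_def)

lemma tp_Int: "m \<le> n \<Longrightarrow> tp m S = tp n S \<inter> B m"
  by (auto simp: tp_def)

lemma tp_le: "tp n S = tp n S' \<Longrightarrow> m \<le> n \<Longrightarrow> tp m S = tp m S'"
  by (simp add: tp_Int[of m n])

text \<open>A vertex of length at most \<open>n\<close> determines its directions from the first
  \<open>n + 1\<close> letters of a boundary point, which accounts for the shift of the
  level.\<close>

lemma tp_Tr:
  assumes "S \<subseteq> bdry N" "S' \<subseteq> bdry N" "Tr (Suc n) S = Tr (Suc n) S'"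
  shows "tp n S = tp n S'"
proof -
  have *: "v \<in> thull S2" if s: "S1 \<subseteq> bdry N" "S2 \<subseteq> bdry N" "Tr (Suc n) S1 = Tr (Suc n) S2"
    "v \<in> thull S1" "length v \<le> n" for S1 S2 v
  proof -
    obtain \<xi> \<zeta> where x: "\<xi> \<in> S1" "\<zeta> \<in> S1" "dir v \<xi> \<noteq> dir v \<zeta>" "v \<in> G"
      using s by (auto simp: thull_def)
    obtain \<xi>' \<zeta>' where x': "\<xi>' \<in> S2" "\<zeta>' \<in> S2" "pre (Suc n) \<xi>' = pre (Suc n) \<xi>" "pre (Suc n) \<zeta>' = pre (Suc n) \<zeta>"
      using Tr_D[of "pre (Suc n) \<xi>" "Suc n" S2] Tr_D[of "pre (Suc n) \<zeta>" "Suc n" S2]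
        Tr_I[OF x(1), of "Suc n"] Tr_I[OF x(2), of "Suc n"] s(3) by blast
    have "dir v \<xi>' = dir v \<xi>" "dir v \<zeta>' = dir v \<zeta>"
      using x x' s by (auto intro!: dir_cong[of v _ _ "Suc n"])
    then have "dir v \<xi>' \<noteq> dir v \<zeta>'" using x(3) by simp
    then show ?thesis using x(4) x'(1,2) unfolding thull_def by blast
  qed
  show ?thesis using *[of S S'] *[of S' S] assms unfolding tp_def by blast
qed

text \<open>A hull vertex of length below \<open>n\<close> forces two points of \<open>S\<close> to
  diverge before level \<open>n\<close>. Every word of the trace is then passed by one ray and
  missed by another one, so it is a hull vertex and visible in the type. Without such a vertex both
  types may be empty although the traces differ.\<close>

lemma Tr_tp:
  assumes S: "S \<subseteq> bdry N" "S' \<subseteq> bdry N" and tp: "tp n S = tp n S'" and v: "v \<in> thull S" "length v < n"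
  shows "Tr n S = Tr n S'"
proof -
  have *: "Tr n S1 \<subseteq> Tr n S2" if s: "S1 \<subseteq> bdry N" "S2 \<subseteq> bdry N" "tp n S1 = tp n S2" "v \<in> thull S1" for S1 S2
  proof
    fix w assume "w \<in> Tr n S1"
    then obtain \<xi> where x: "\<xi> \<in> S1" "w = pre n \<xi>" by (auto simp: Tr_def)
    obtain \<alpha> \<beta> where "\<alpha> \<in> S1" "\<beta> \<in> S1" "pre n \<alpha> \<noteq> pre n \<beta>" using hull_diverge[OF s(4,1) v(2)] by blast
    then obtain \<zeta> where z: "\<zeta> \<in> S1" "pre n \<zeta> \<noteq> w" by metis
    have "w \<in> thull S1" using hullI[OF s(1) x(1) z(1)] x z by simp
    then have "w \<in> tp n S1" using x hull_in_G[of w S1] by (simp add: tp_def)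
    then have "w \<in> thull S2" using s(3) by (auto simp: tp_def)
    then obtain \<theta> where "\<theta> \<in> S2" "pre (length w) \<theta> = w" using hull_prefix[of w S2] s(2) by blast
    then show "w \<in> Tr n S2" using x(2) unfolding Tr_def by (metis imageI length_pre)
  qed
  have "v \<in> tp n S" using v hull_in_G[of v S] by (simp add: tp_def)
  then have "v \<in> tp n S'" using tp by simp
  then have "v \<in> thull S'" by (simp add: tp_def)
  then show ?thesis using *[of S S'] *[of S' S] S tp v(1) by blast
qed

lemma CN_hull_ne:
  assumes "S \<in> CN N"
  shows "\<exists>v. v \<in> thull S"
proof -
  obtain x y where "x \<in> S" "y \<in> S" "x \<noteq> y" using assms unfolding CN_iff by blast
  then obtain m where "\<forall>n\<ge>m. pre n x \<in> thull S" using hull_nonempty[OF CN_sub[OF assms]] by blast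
  then show ?thesis by blast
qed

lemma hull_two:
  assumes "v \<in> thull S"
  shows "\<exists>x\<in>S. \<exists>y\<in>S. x \<noteq> y"
proof -
  obtain \<xi> \<zeta> where "\<xi> \<in> S" "\<zeta> \<in> S" "dir v \<xi> \<noteq> dir v \<zeta>" using assms by (auto simp: thull_def)
  moreover from this have "\<xi> \<noteq> \<zeta>" by metis
  ultimately show ?thesis by blast
qed

lemma openin_CN_tp:
  "openin (CN_top N) U \<longleftrightarrow> U \<subseteq> CN N \<and> (\<forall>S\<in>U. \<exists>m. \<forall>S'\<in>CN N. tp m S' = tp m S \<longrightarrow> S' \<in> U)" (is "_ \<longleftrightarrow> ?R")
proof
  assume o: "openin (CN_top N) U"
  have "\<exists>m. \<forall>S'\<in>CN N. tp m S' = tp m S \<longrightarrow> S' \<in> U" if S: "S \<in> U" for S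
  proof -
    have SC: "S \<in> CN N" using o S unfolding openin_CN_Tr by blast
    obtain m where m: "\<forall>S'\<in>CN N. Tr m S' = Tr m S \<longrightarrow> S' \<in> U" using o S unfolding openin_CN_Tr by blast
    obtain v where v: "v \<in> thull S" using CN_hull_ne SC by blast
    define n where "n = max m (Suc (length v))"
    have "S' \<in> U" if S': "S' \<in> CN N" "tp n S' = tp n S" for S'
    proof -
      have "Tr n S = Tr n S'"
        using Tr_tp[of S S' n v] S' CN_sub[OF SC] CN_sub[OF S'(1)] v by (simp add: n_def)
      then have "Tr m S' = Tr m S" using Tr_le[of n S' S m] by (simp add: n_def)
      then show ?thesis using m S' by blast
    qed
    then show ?thesis by blast
  qed
  then show ?R using o unfolding openin_CN_Tr by blast
next
  assume R: ?R
  have "\<exists>m. \<forall>S'\<in>CN N. Tr m S' = Tr m S \<longrightarrow> S' \<in> U" if S: "S \<in> U" for S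
  proof -
    have SC: "S \<in> CN N" using R S by auto
    obtain m where m: "\<forall>S'\<in>CN N. tp m S' = tp m S \<longrightarrow> S' \<in> U" using R S by blast
    have "S' \<in> U" if "S' \<in> CN N" "Tr (Suc m) S' = Tr (Suc m) S" for S'
      using m tp_Tr[of S' S m] CN_sub[OF SC] CN_sub[OF that(1)] that by blast
    then show ?thesis by blast
  qed
  then show "openin (CN_top N) U" using R unfolding openin_CN_Tr by blast
qed

section \<open>The compact set of closed sets whose hull contains the base vertex\<close>

definition Cv :: "word \<Rightarrow> bpt set set" where
  "Cv v = {S \<in> CN N. v \<in> thull S}"

lemma openin_Cv: "openin (CN_top N) (Cv v)"
  unfolding openin_CN_tp
proof (intro conjI ballI)
  fix S assume S: "S \<in> Cv v"
  then have "v \<in> tp (length v) S" using hull_in_G[of v S] by (simp add: Cv_def tp_def)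
  then have "S' \<in> Cv v" if "S' \<in> CN N" "tp (length v) S' = tp (length v) S" for S'
    using that by (metis (no_types, lifting) Cv_def IntD1 mem_Collect_eq tp_def)
  then show "\<exists>m. \<forall>S'\<in>CN N. tp m S' = tp m S \<longrightarrow> S' \<in> Cv v" by blast
qed (auto simp: Cv_def)

lemma compactin_sub_Cv:
  assumes "compactin (CN_top N) C"
  shows "\<exists>F. finite F \<and> F \<subseteq> G \<and> C \<subseteq> (\<Union>v\<in>F. Cv v)"
proof -
  have "C \<subseteq> (\<Union>v\<in>G. Cv v)"
  proof
    fix S assume "S \<in> C"
    then have S: "S \<in> CN N" using compactin_subset_topspace[OF assms] by auto
    then obtain v where "v \<in> thull S" using CN_hull_ne by blast
    then show "S \<in> (\<Union>v\<in>G. Cv v)" using S hull_in_G by (auto simp: Cv_def)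
  qed
  then obtain \<F> where "finite \<F>" "\<F> \<subseteq> Cv ` G" "C \<subseteq> \<Union>\<F>"
    using compactinD[OF assms, of "Cv ` G"] openin_Cv by auto
  then obtain F where "F \<subseteq> G" "finite F" "\<F> = Cv ` F" using finite_subset_image[of \<F> Cv G] by blast
  then show ?thesis using \<open>C \<subseteq> \<Union>\<F>\<close> by blast
qed

text \<open>An inverse limit of finite levels with surjective restriction maps. Every word of
  \<open>A n\<close> extends to every deeper level, and Koenig's lemma turns these extensions into a
  ray of \<open>S\<close>, so no word gets lost in the limit.\<close>

lemma limit_of_traces:
  assumes A: "\<And>n. \<exists>S. S \<subseteq> bdry N \<and> Tr n S = A n" and c: "\<And>n. take n ` A (Suc n) = A n"
  defines "S \<equiv> {\<xi> \<in> bdry N. \<forall>n. pre n \<xi> \<in> A n}"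
  shows "closedin (bdry_top N) S" "Tr n S = A n"
proof -
  have ck: "take n ` A (n + k) = A n" for n k
  proof (induction k)
    case 0
    obtain S where "Tr n S = A n" using A by blast
    then show ?case using Tr_take[of n n S] by simp
  next
    case (Suc k)
    have "take n ` A (n + Suc k) = take n ` take (n + k) ` A (Suc (n + k))"
      by (simp add: image_image min_def)
    then show ?case using c[of "n + k"] Suc by simp
  qed
  have TrS: "Tr n S = A n" for n
  proof (intro equalityI subsetI)
    fix w assume w: "w \<in> A n"
    have "\<exists>\<zeta>. \<zeta> \<in> bdry N \<and> pre (n + k) \<zeta> \<in> A (n + k) \<and> pre n \<zeta> = w" for k
    proof -
      have "w \<in> take n ` A (n + k)" using w ck[of n k] by simp
      then obtain u where u: "u \<in> A (n + k)" "w = take n u" by (rule imageE)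
      obtain S where S: "S \<subseteq> bdry N" "Tr (n + k) S = A (n + k)" using A by blast
      then obtain \<zeta> where z: "\<zeta> \<in> S" "pre (n + k) \<zeta> = u" using u(1) Tr_D[of u "n + k" S] by blast
      then have "pre n \<zeta> = w" unfolding u(2) z(2)[symmetric] by (simp add: min_def)
      moreover have "\<zeta> \<in> bdry N" using S z by blast
      moreover have "pre (n + k) \<zeta> \<in> A (n + k)" using u(1) z(2) by simp
      ultimately show ?thesis by blast
    qed
    then obtain \<zeta> where z: "\<And>k. \<zeta> k \<in> bdry N" "\<And>k. pre (n + k) (\<zeta> k) \<in> A (n + k)" "\<And>k. pre n (\<zeta> k) = w"
      by metis
    obtain \<xi> where x: "\<xi> \<in> bdry N" "\<And>m. \<exists>k\<ge>m. pre m (\<zeta> k) = pre m \<xi>"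
      using Koenig_bdry[of \<zeta>] z(1) by blast
    have "pre m \<xi> \<in> A m" for m
    proof -
      obtain k where k: "k \<ge> m" "pre m (\<zeta> k) = pre m \<xi>" using x(2) by blast
      have "take m (pre (n + k) (\<zeta> k)) \<in> take m ` A (n + k)" using z(2) by (rule imageI)
      moreover have "take m ` A (n + k) = A m" using ck[of m "n + k - m"] k by simp
      ultimately show ?thesis using k by (simp add: min_def)
    qed
    then have "\<xi> \<in> S" using x(1) by (simp add: S_def)
    moreover have "pre n \<xi> = w" using x(2)[of n] z(3) by metis
    ultimately show "w \<in> Tr n S" using Tr_I[of \<xi> S n] by simp
  next
    fix w assume "w \<in> Tr n S"
    then show "w \<in> A n" using Tr_D[of w n S] by (auto simp: S_def)
  qed
  show "Tr n S = A n" by (rule TrS)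
  show "closedin (bdry_top N) S" unfolding closedin_bdry TrS by (auto simp: S_def)
qed

text \<open>Koenig's lemma on the level of traces. If a trace class has no finite subcover, one of
  its finitely many refinements to the next level has none either. The limit of such a branch is a
  set of the family, and the cover element containing it contains a whole trace class.\<close>

lemma compactin_C0: "compactin (CN_top N) (Cv [])"
  unfolding compactin_def
proof (intro conjI allI impI)
  fix \<U> assume U: "(\<forall>U\<in>\<U>. openin (CN_top N) U) \<and> Cv [] \<subseteq> \<Union>\<U>"
  define bad where "bad n A \<longleftrightarrow> \<not> (\<exists>\<F>. finite \<F> \<and> \<F> \<subseteq> \<U> \<and> {S \<in> Cv []. Tr n S = A} \<subseteq> \<Union>\<F>)" for n A
  show "\<exists>\<F>. finite \<F> \<and> \<F> \<subseteq> \<U> \<and> Cv [] \<subseteq> \<Union>\<F>"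
  proof (rule ccontr)
    assume no: "\<not> ?thesis"
    have "\<exists>A. \<forall>n. bad n (A n) \<and> take n ` A (Suc n) = A n"
    proof (rule dependent_nat_choice)
      have "{S \<in> Cv []. Tr 0 S = {[]}} = Cv []" by (auto simp: Cv_def Tr_def CN_iff)
      then show "\<exists>A. bad 0 A" using no by (intro exI[of _ "{[]}"]) (simp add: bad_def)
    next
      fix A n assume b: "bad n A"
      show "\<exists>A'. bad (Suc n) A' \<and> take n ` A' = A"
      proof (rule ccontr)
        let ?I = "{A' \<in> Pow (B (Suc n)). take n ` A' = A}"
        assume "\<not> ?thesis"
        then have nb: "\<not> bad (Suc n) A'" if "take n ` A' = A" for A'
          using that by blast
        have "\<exists>\<F>. finite \<F> \<and> \<F> \<subseteq> \<U> \<and> {S \<in> Cv []. Tr (Suc n) S = A'} \<subseteq> \<Union>\<F>" if "take n ` A' = A" for A'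
          using nb[OF that] unfolding bad_def by (rule notnotD)
        then have "\<forall>A'\<in>?I. \<exists>\<F>. finite \<F> \<and> \<F> \<subseteq> \<U> \<and> {S \<in> Cv []. Tr (Suc n) S = A'} \<subseteq> \<Union>\<F>" by simp
        from bchoice[OF this] obtain \<F> where
          F: "\<forall>A'\<in>?I. finite (\<F> A') \<and> \<F> A' \<subseteq> \<U> \<and> {S \<in> Cv []. Tr (Suc n) S = A'} \<subseteq> \<Union>(\<F> A')" ..
        have "finite ?I" using finite_ball by simp
        then have "finite (\<Union>A'\<in>?I. \<F> A')" "(\<Union>A'\<in>?I. \<F> A') \<subseteq> \<U>" using F by auto
        moreover have "{S \<in> Cv []. Tr n S = A} \<subseteq> \<Union>(\<Union>A'\<in>?I. \<F> A')"
        proof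
          fix S assume S: "S \<in> {S \<in> Cv []. Tr n S = A}"
          then have "Tr (Suc n) S \<subseteq> B (Suc n)" using Tr_sub[of S "Suc n"] CN_sub by (simp add: Cv_def)
          moreover have "take n ` Tr (Suc n) S = A" using S Tr_take[of n "Suc n" S] by simp
          ultimately have I: "Tr (Suc n) S \<in> ?I" by simp
          then have "S \<in> \<Union>(\<F> (Tr (Suc n) S))" using bspec[OF F I] S by blast
          then show "S \<in> \<Union>(\<Union>A'\<in>?I. \<F> A')" using I by blast
        qed
        ultimately show False using b unfolding bad_def by blast
      qed
    qed
    then obtain A where A: "\<And>n. bad n (A n)" "\<And>n. take n ` A (Suc n) = A n" by blast
    have ne: "\<exists>S. S \<in> Cv [] \<and> Tr n S = A n" for n
    proof (rule ccontr)
      assume "\<nexists>S. S \<in> Cv [] \<and> Tr n S = A n"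
      then have "{S \<in> Cv []. Tr n S = A n} \<subseteq> \<Union>{}" by blast
      then show False using A(1)[of n] unfolding bad_def by blast
    qed
    have ne': "\<exists>S. S \<subseteq> bdry N \<and> Tr n S = A n" for n
      using ne[of n] CN_sub unfolding Cv_def by blast
    define S where "S = {\<xi> \<in> bdry N. \<forall>n. pre n \<xi> \<in> A n}"
    have S: "closedin (bdry_top N) S" "\<And>n. Tr n S = A n"
      using limit_of_traces[of A, OF ne' A(2)] by (auto simp: S_def)
    \<comment> \<open>Whether \<open>[]\<close> is a hull vertex is already visible in the trace of
      level one. Hence the limit keeps the base vertex in its hull, and in particular it still has
      two points.\<close>
    obtain S1 where S1: "S1 \<in> Cv []" "Tr (Suc 0) S1 = A (Suc 0)" using ne by blast
    have "tp 0 S = tp 0 S1" using tp_Tr[of S S1 0] S S1 CN_sub by (auto simp: Cv_def S_def)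
    moreover have "[] \<in> tp 0 S1" using S1 by (auto simp: tp_def Cv_def)
    ultimately have "[] \<in> tp 0 S" by simp
    then have h: "[] \<in> thull S" by (simp add: tp_def)
    have "S \<in> CN N" unfolding CN_iff using S(1) hull_two[OF h] by blast
    then have SC: "S \<in> Cv []" using h by (simp add: Cv_def)
    then obtain U where V: "U \<in> \<U>" "S \<in> U" using U by blast
    then obtain m where "\<forall>S'\<in>CN N. Tr m S' = Tr m S \<longrightarrow> S' \<in> U" using U unfolding openin_CN_Tr by blast
    then have "{S \<in> Cv []. Tr m S = A m} \<subseteq> \<Union>{U}" unfolding S(2) by (simp add: Cv_def subset_iff)
    moreover have "finite {U}" "{U} \<subseteq> \<U>" using V by auto
    ultimately show False using A(1)[of m] unfolding bad_def by blast
  qed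
qed (auto simp: Cv_def)

end

section \<open>Limit sets of subgroups\<close>

text \<open>Acting by one letter costs at most one position of the agreement between a word and a
  boundary point.\<close>

lemma take_push_bpush:
  assumes "take n a = pre n \<xi>"
  shows "take (n - 1) (push x a) = pre (n - 1) (bpush x \<xi>)"
proof (cases n)
  case (Suc k)
  then obtain b where b: "a = \<xi> 0 # b" "take k b = pre k (\<lambda>i. \<xi> (Suc i))"
    using assms by (cases a) (auto simp: pre_Suc_Cons)
  show ?thesis
  proof (cases "\<xi> 0 = linv x")
    case True
    then show ?thesis using b Suc by (simp add: bpush_def)
  next
    case False
    have "take k (x # a) = pre k (case_nat x \<xi>)"
    proof (cases k)
      case (Suc j)
      have "take j a = take j (take n a)" using \<open>n = Suc k\<close> Suc by simp
      also have "\<dots> = pre j \<xi>" using assms \<open>n = Suc k\<close> Suc by (simp add: min_def)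
      finally show ?thesis using Suc by (simp add: pre_Suc_Cons)
    qed simp
    then show ?thesis using False b Suc by (simp add: bpush_def)
  qed
qed simp

lemma take_foldr_push_bpush:
  "take n a = pre n \<xi> \<Longrightarrow> take (n - length g) (foldr push g a) = pre (n - length g) (foldr bpush g \<xi>)"
proof (induction g)
  case (Cons x g)
  have "take (n - length g - 1) (push x (foldr push g a)) = pre (n - length g - 1) (bpush x (foldr bpush g \<xi>))"
    using take_push_bpush[OF Cons.IH[OF Cons.prems]] .
  then show ?case by simp
qed simp

lemma finite_image_factor:
  assumes "finite (f ` M)" "\<And>x y. x \<in> M \<Longrightarrow> y \<in> M \<Longrightarrow> f x = f y \<Longrightarrow> g x = g y"
  shows "finite (g ` M)"
proof -
  have "g x = g (inv_into M f (f x))" if "x \<in> M" for x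
    using that by (intro assms(2)) (auto simp: inv_into_into f_inv_into_f)
  then have "g ` M \<subseteq> (\<lambda>p. g (inv_into M f p)) ` f ` M" by blast
  then show ?thesis using assms(1) finite_subset by blast
qed

context free_group
begin

abbreviation L :: "word set \<Rightarrow> bpt set" where "L A \<equiv> limset N A"

lemma limset_iff: "\<xi> \<in> L A \<longleftrightarrow> \<xi> \<in> bdry N \<and> (\<forall>n. \<exists>a\<in>A. take n a = pre n \<xi>)"
  by (simp add: limset_def take_eq_pre_iff)

lemma limset_sub: "L A \<subseteq> bdry N"
  by (auto simp: limset_iff)

lemma limset_mono: "A \<subseteq> A' \<Longrightarrow> L A \<subseteq> L A'"
  unfolding limset_iff subset_iff by blast

lemma take_mul_bact:
  assumes "g \<in> G" "a \<in> G" "take (n + length g) a = pre (n + length g) \<xi>"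
  shows "take n (g \<sqdot> a) = pre n (bact g \<xi>)"
  using take_foldr_push_bpush[OF assms(3), of g] assms by (simp add: mul_eq bact_eq G_reduced)

text \<open>Multiplying on the right by elements of bounded length changes long words only near their end.\<close>

lemma limset_right:
  assumes "A \<subseteq> G" "finite F" "F \<subseteq> G" and AB: "\<And>a. a \<in> A \<Longrightarrow> \<exists>b\<in>A'. \<exists>t\<in>F. b \<in> G \<and> a = b \<sqdot> t"
  shows "L A \<subseteq> L A'"
proof
  fix \<xi> assume x: "\<xi> \<in> L A"
  define C where "C = Max (insert 0 (length ` F))"
  have C: "length t \<le> C" if "t \<in> F" for t unfolding C_def using assms that by (intro Max_ge) auto
  have "\<exists>b\<in>A'. take n b = pre n \<xi>" for n
  proof -
    obtain a where a: "a \<in> A" "take (n + C) a = pre (n + C) \<xi>" using x by (auto simp: limset_iff)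
    obtain b t where b: "b \<in> A'" "t \<in> F" "b \<in> G" "a = b \<sqdot> t" using AB[OF a(1)] by blast
    have tG: "t \<in> G" "a \<in> G" using b assms a by auto
    have "b = a \<sqdot> iv t" using b tG by simp
    moreover have "n + C \<le> length a" using a(2) by (simp add: take_eq_pre_iff)
    then have "n + length (iv t) \<le> length a" using C[OF b(2)] tG by simp
    ultimately have "take n b = take n a" using take_mul[of a "iv t" n] tG by simp
    also have "\<dots> = take n (take (n + C) a)" by simp
    also have "\<dots> = pre n \<xi>" unfolding a(2) by simp
    finally show ?thesis using b by blast
  qed
  then show "\<xi> \<in> L A'" using x by (simp add: limset_iff)
qed

lemma limset_left1:
  assumes "g \<in> G" "A \<subseteq> G" "\<xi> \<in> L A"
  shows "bact g \<xi> \<in> L ((\<lambda>a. g \<sqdot> a) ` A)"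
  unfolding limset_iff
proof (intro conjI allI)
  fix n
  obtain a where a: "a \<in> A" "take (n + length g) a = pre (n + length g) \<xi>"
    using assms(3) by (auto simp: limset_iff)
  then show "\<exists>b\<in>(\<lambda>a. g \<sqdot> a) ` A. take n b = pre n (bact g \<xi>)"
    using take_mul_bact[of g a n \<xi>] assms by blast
qed (use assms in \<open>simp add: limset_iff\<close>)

lemma limset_left:
  assumes "g \<in> G" "A \<subseteq> G"
  shows "L ((\<lambda>a. g \<sqdot> a) ` A) = bact g ` L A"
proof
  show "bact g ` L A \<subseteq> L ((\<lambda>a. g \<sqdot> a) ` A)" using limset_left1[OF assms] by blast
next
  show "L ((\<lambda>a. g \<sqdot> a) ` A) \<subseteq> bact g ` L A"
  proof
    fix \<xi> assume x: "\<xi> \<in> L ((\<lambda>a. g \<sqdot> a) ` A)"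
    have "(\<lambda>a. iv g \<sqdot> a) ` (\<lambda>a. g \<sqdot> a) ` A = (\<lambda>a. a) ` A"
      unfolding image_image using assms by (intro image_cong) auto
    then have "bact (iv g) \<xi> \<in> L A"
      using limset_left1[of "iv g" "(\<lambda>a. g \<sqdot> a) ` A" \<xi>] x assms by (auto simp: subset_iff)
    moreover have "\<xi> = bact g (bact (iv g) \<xi>)" using x assms limset_sub by (auto simp: limset_iff)
    ultimately show "\<xi> \<in> bact g ` L A" by blast
  qed
qed

lemma limset_finite: "finite A \<Longrightarrow> L A = {}"
proof -
  assume f: "finite A"
  have "\<xi> \<notin> L A" for \<xi>
  proof
    assume x: "\<xi> \<in> L A"
    define C where "C = Suc (Max (insert 0 (length ` A)))"
    obtain a where a: "a \<in> A" "take C a = pre C \<xi>" using x by (auto simp: limset_iff)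
    have "length a < C" unfolding C_def less_Suc_eq_le using f a by (intro Max_ge) auto
    then show False using a(2) by (simp add: take_eq_pre_iff)
  qed
  then show ?thesis by blast
qed

lemma closedin_limset: "closedin (bdry_top N) (L A)"
  unfolding closedin_bdry
proof (intro conjI ballI impI limset_sub)
  fix \<xi> assume x: "\<xi> \<in> bdry N" "\<forall>n. pre n \<xi> \<in> Tr n (L A)"
  have "\<exists>a\<in>A. take n a = pre n \<xi>" for n
  proof -
    obtain \<zeta> where "\<zeta> \<in> L A" "pre n \<zeta> = pre n \<xi>" using x(2) Tr_D by blast
    then show ?thesis unfolding limset_iff by metis
  qed
  then show "\<xi> \<in> L A" using x(1) by (simp add: limset_iff)
qed

lemma sub_mul: "subgroup H (FG N) \<Longrightarrow> a \<in> H \<Longrightarrow> b \<in> H \<Longrightarrow> a \<sqdot> b \<in> H"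
  by (rule subgroup.m_closed)

lemma sub_iv: "subgroup H (FG N) \<Longrightarrow> a \<in> H \<Longrightarrow> iv a \<in> H"
  by (rule subgroup.m_inv_closed)

lemma sub_G: "subgroup H (FG N) \<Longrightarrow> a \<in> H \<Longrightarrow> a \<in> G"
  by (rule subgroup.mem_carrier)

lemma sub_Nil: "subgroup H (FG N) \<Longrightarrow> [] \<in> H"
  using subgroup.one_closed[of H "FG N"] by simp

lemma sub_image: "subgroup H (FG N) \<Longrightarrow> h \<in> H \<Longrightarrow> (\<lambda>a. h \<sqdot> a) ` H = H"
proof -
  assume H: "subgroup H (FG N)" and h: "h \<in> H"
  have "x \<in> (\<lambda>a. h \<sqdot> a) ` H" if "x \<in> H" for x
    using that h sub_mul[OF H] sub_iv[OF H] sub_G[OF H] by (intro image_eqI[of _ _ "iv h \<sqdot> x"]) auto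
  then show ?thesis using h sub_mul[OF H] by blast
qed

lemma limset_invariant: "subgroup H (FG N) \<Longrightarrow> h \<in> H \<Longrightarrow> bact h ` L H = L H"
  using limset_left[of h H] sub_image[of H h] sub_G subgroup.subset by metis

text \<open>The point of the last condition is that \<open>k\<close> can be repeated without any
  cancellation.\<close>

lemma cyclic_reduction:
  "h \<in> G \<Longrightarrow> h \<noteq> [] \<Longrightarrow> \<exists>c k. h = c @ k @ winv c \<and> k \<noteq> [] \<and> hd k \<noteq> linv (last k)"
proof (induction "length h" arbitrary: h rule: less_induct)
  case less
  show ?case
  proof (cases "hd h = linv (last h)")
    case True
    obtain a h' where h: "h = a # h'" using less.prems by (cases h) auto
    then have "h' \<noteq> []" using True by auto
    then obtain m b where m: "h' = m @ [b]" by (metis append_butlast_last_id)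
    have b: "b = linv a" using True h m by (simp add: linv_swap)
    have "m \<noteq> []" using less.prems h m b by (auto simp: G_Cons)
    moreover have "m \<in> G" using less.prems(1) h m G_append[of "[a] @ m" "[b]"] G_append[of "[a]" m] by simp
    ultimately obtain c k where "m = c @ k @ winv c" "k \<noteq> []" "hd k \<noteq> linv (last k)"
      using less.hyps[of m] h m by auto
    then show ?thesis using h m b by (intro exI[of _ "a # c"] exI[of _ k]) (simp add: winv_Cons)
  next
    case False
    then show ?thesis using less.prems by (intro exI[of _ "[]"] exI[of _ h]) simp
  qed
qed

text \<open>The powers of the given element have the form \<open>c @ P @ winv c\<close> with
  \<open>P\<close> a power of \<open>k\<close>, and their lengths are unbounded. A limit of them has
  the first letter of \<open>k\<close> behind \<open>c\<close>.\<close>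

lemma limset_power:
  assumes H: "subgroup H (FG N)" and h: "c @ k @ winv c \<in> H" "k \<noteq> []" "hd k \<noteq> linv (last k)"
  shows "\<exists>\<xi>\<in>L H. \<xi> (length c) = hd k"
proof -
  have r: "reduced (c @ k @ winv c)" using h(1) sub_G[OF H] G_reduced by blast
  \<comment> \<open>The first and last letters of \<open>P\<close> are part of the induction because
    they decide that nothing cancels between \<open>c\<close>, \<open>P\<close>, \<open>k\<close>
    and \<open>winv c\<close>.\<close>
  have "\<exists>P. P \<noteq> [] \<and> hd P = hd k \<and> last P = last k \<and> n \<le> length P \<and> c @ P @ winv c \<in> H" for n
  proof (induction n)
    case 0
    then show ?case using h by blast
  next
    case (Suc n)
    then obtain P where P: "P \<noteq> []" "hd P = hd k" "last P = last k" "n \<le> length P" "c @ P @ winv c \<in> H" by blast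
    have rP: "reduced (c @ P @ winv c)" using P sub_G[OF H] G_reduced by blast
    have r2: "reduced (c @ P @ k @ winv c)" using rP r P h
      by (auto simp: reduced_append)
    have r3: "reduced (k @ winv c)" using r by (auto simp: reduced_append)
    have "(c @ P @ winv c) \<sqdot> (c @ k @ winv c) = foldr push (c @ P) (foldr push (winv c) (foldr push c (k @ winv c)))"
      using h(1) sub_G[OF H] r foldr_push_reduced[of c "k @ winv c"] by (simp add: mul_eq)
    also have "\<dots> = foldr push (c @ P) (k @ winv c)" using foldr_push_winv[OF r3] by simp
    also have "\<dots> = c @ (P @ k) @ winv c" using foldr_push_reduced[of "c @ P" "k @ winv c"] r2 by simp
    finally have "c @ (P @ k) @ winv c \<in> H" using sub_mul[OF H P(5) h(1)] by simp
    moreover have "Suc n \<le> length (P @ k)" using P(4) h(2) by (cases k) auto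
    ultimately show ?case using P h by (intro exI[of _ "P @ k"]) auto
  qed
  then obtain P where P: "\<And>n. P n \<noteq> []" "\<And>n. hd (P n) = hd k" "\<And>n. n \<le> length (P n)" "\<And>n. c @ P n @ winv c \<in> H"
    by metis
  have "n \<le> length (c @ P n @ winv c)" for n using P(3)[of n] by simp
  moreover have "c @ P n @ winv c \<in> G" for n using P(4) sub_G[OF H] by blast
  ultimately obtain \<xi> where x: "\<xi> \<in> bdry N" "\<forall>m. \<exists>n\<ge>m. take m (c @ P n @ winv c) = pre m \<xi>"
    using Koenig_words[of "\<lambda>n. c @ P n @ winv c"] by blast
  have "\<xi> \<in> L H" using x P(4) unfolding limset_iff by blast
  moreover obtain n where "take (Suc (length c)) (c @ P n @ winv c) = pre (Suc (length c)) \<xi>"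
    using x(2) by blast
  then have "(c @ P n @ winv c) ! length c = \<xi> (length c)" by (metis lessI take_eq_pre_iff)
  then have "\<xi> (length c) = hd k" using P(1,2)[of n] by (simp add: nth_append hd_conv_nth)
  ultimately show ?thesis by blast
qed

text \<open>A nontrivial element and its inverse have different attracting points: behind the common
  prefix \<open>c\<close> they continue with \<open>hd k\<close> and with
  \<open>linv (last k)\<close>, which differ since \<open>k\<close> is cyclically reduced.\<close>

lemma limset_in_CN:
  assumes H: "subgroup H (FG N)" and "H \<noteq> {[]}"
  shows "L H \<in> CN N"
proof -
  obtain h where h: "h \<in> H" "h \<noteq> []" using assms sub_Nil[OF H] by blast
  obtain c k where ck: "h = c @ k @ winv c" "k \<noteq> []" "hd k \<noteq> linv (last k)"
    using cyclic_reduction[of h] h sub_G[OF H] by blast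
  obtain \<xi> where x: "\<xi> \<in> L H" "\<xi> (length c) = hd k" using limset_power[OF H, of c k] h ck by blast
  have "iv h = c @ winv k @ winv c" using h sub_G[OF H] by (simp add: iv_eq ck(1) winv_append)
  then have "c @ winv k @ winv c \<in> H" using sub_iv[OF H h(1)] by simp
  moreover have "hd (winv k) = linv (last k)" "last (winv k) = linv (hd k)"
    using ck by (simp_all add: hd_winv last_winv)
  ultimately obtain \<zeta> where z: "\<zeta> \<in> L H" "\<zeta> (length c) = linv (last k)"
    using limset_power[OF H, of c "winv k"] ck by auto
  have "\<xi> \<noteq> \<zeta>" using x z ck by auto
  then show ?thesis using x z closedin_limset unfolding CN_iff by blast
qed

section \<open>Cosets, finitely many orbits and finite generation\<close>

abbreviation rc :: "word set \<Rightarrow> word \<Rightarrow> word set" where "rc H v \<equiv> H #>\<^bsub>FG N\<^esub> v"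

lemma rc_eq_iff:
  assumes H: "subgroup H (FG N)" and u: "u \<in> G" "v \<in> G"
  shows "rc H u = rc H v \<longleftrightarrow> u \<sqdot> iv v \<in> H"
proof
  assume e: "rc H u = rc H v"
  have "u \<in> rc H u" using rcos_self[OF u(1) H] .
  then have "u \<in> rc H v" using e by simp
  then obtain h where "h \<in> H" "u = h \<sqdot> v" unfolding r_coset_def by blast
  then show "u \<sqdot> iv v \<in> H" using u sub_G[OF H] by simp
next
  assume m: "u \<sqdot> iv v \<in> H"
  have "u = u \<sqdot> iv v \<sqdot> v" using u by simp
  then have "u \<in> rc H v" using m unfolding r_coset_def by blast
  then show "rc H u = rc H v" using repr_independence[OF _ u(2) H] by simp
qed

lemma rc_mul_left: "subgroup H (FG N) \<Longrightarrow> h \<in> H \<Longrightarrow> v \<in> G \<Longrightarrow> rc H (h \<sqdot> v) = rc H v"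
  by (subst rc_eq_iff) (auto simp: sub_G m_assoc)

lemma rc_mul_right:
  assumes "subgroup H (FG N)" "u \<in> G" "v \<in> G" "a \<in> G" "rc H u = rc H v"
  shows "rc H (u \<sqdot> a) = rc H (v \<sqdot> a)"
  using assms by (simp add: rc_eq_iff inv_mult_group m_assoc)

text \<open>For a set invariant under left multiplication by \<open>H\<close>, the right cosets are
  the \<open>H\<close>-orbits, so this says that there are finitely many orbits.\<close>

definition cofin :: "word set \<Rightarrow> word set \<Rightarrow> bool" where
  "cofin H M \<longleftrightarrow> finite (rc H ` M)"

lemma cofin_subset: "cofin H M \<Longrightarrow> M' \<subseteq> M \<Longrightarrow> cofin H M'"
  unfolding cofin_def by (meson finite_subset image_mono)

text \<open>Every element of \<open>M\<close> is an element of \<open>H\<close> times one of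
  finitely many representatives, and right factors of bounded length do not affect limits.\<close>

lemma cofin_limset_sub:
  assumes H: "subgroup H (FG N)" and M: "M \<subseteq> G" "cofin H M"
  shows "L M \<subseteq> L H"
proof -
  obtain F where F: "finite F" "F \<subseteq> M" "rc H ` M = rc H ` F"
    using finite_subset_image[of "rc H ` M" "rc H" M] M(2) unfolding cofin_def by blast
  show ?thesis
  proof (rule limset_right[of M F])
    fix a assume a: "a \<in> M"
    then have "rc H a \<in> rc H ` F" using F(3) by blast
    then obtain t where t: "t \<in> F" "rc H a = rc H t" by blast
    have G: "a \<in> G" "t \<in> G" using a t F M by blast+
    have "a \<sqdot> iv t \<in> H" using rc_eq_iff[OF H G] t by blast
    moreover have "a = a \<sqdot> iv t \<sqdot> t" using G by simp
    ultimately show "\<exists>b\<in>H. \<exists>t\<in>F. b \<in> G \<and> a = b \<sqdot> t" using t sub_G[OF H] by blast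
  qed (use F M in auto)
qed

lemma cofin_limset:
  assumes H: "subgroup H (FG N)" and M: "M \<subseteq> G" "cofin H M"
    and x: "\<xi> \<in> bdry N" "\<And>n. \<exists>m\<ge>n. pre m \<xi> \<in> M"
  shows "\<xi> \<in> L H"
proof -
  have "\<xi> \<in> L M" unfolding limset_iff
  proof (intro conjI allI x(1))
    fix n
    obtain m where m: "m \<ge> n" "pre m \<xi> \<in> M" using x(2) by blast
    then have "take n (pre m \<xi>) = pre n \<xi>" by (simp add: min_def)
    then show "\<exists>a\<in>M. take n a = pre n \<xi>" using m by blast
  qed
  then show ?thesis using cofin_limset_sub[OF H M] by blast
qed

text \<open>Finiteness of the core graph. A prefix of \<open>h1 \<sqdot> h2\<close> is a prefix of
  \<open>h1\<close> or \<open>h1\<close> times a prefix of \<open>h2\<close>, and \<open>h1\<close>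
  is absorbed by the coset; so no cosets appear beyond those of the prefixes of the generators and
  their inverses.\<close>

lemma generate_prefix_cosets:
  assumes S: "finite S" "S \<subseteq> G" and H: "generate (FG N) S = H"
  shows "finite {rc H p | p h. h \<in> H \<and> prefix p h}"
proof -
  have sH: "subgroup H (FG N)" using generate_is_subgroup[OF S(2)] H by simp
  let ?T = "insert [] (S \<union> m_inv (FG N) ` S)"
  let ?Q = "rc H ` (\<Union>s\<in>?T. {p. prefix p s})"
  have "finite {p. prefix p s}" for s :: word
    by (rule finite_subset[of _ "set (prefixes s)"]) auto
  then have Q: "finite ?Q" using S by blast
  have "\<forall>p. prefix p h \<longrightarrow> rc H p \<in> ?Q" if "h \<in> generate (FG N) S" for h
    using that
  proof (induction rule: generate.induct)
    case one
    then show ?case by auto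
  next
    case (incl h)
    then show ?case by blast
  next
    case (inv h)
    then show ?case by blast
  next
    case (eng h1 h2)
    have h: "h1 \<in> H" "h2 \<in> H" "h1 \<in> G" "h2 \<in> G" using eng H sub_G[OF sH] by auto
    show ?case
    proof (intro allI impI)
      fix p assume "prefix p (h1 \<sqdot> h2)"
      then consider "prefix p h1" | q where "prefix q h2" "p = h1 \<sqdot> q" using prefix_mul h by blast
      then show "rc H p \<in> ?Q"
      proof cases
        case 2
        then have "rc H p = rc H q" using rc_mul_left[OF sH h(1)] G_prefix h by auto
        then show ?thesis using eng 2 by simp
      qed (use eng in blast)
    qed
  qed
  then have "{rc H p | p h. h \<in> H \<and> prefix p h} \<subseteq> ?Q" using H by blast
  then show ?thesis using Q finite_subset by blast
qed

text \<open>Approximate two boundary points seen from \<open>v\<close> in different directions by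
  elements \<open>h\<close> and \<open>h'\<close> of \<open>H\<close>. The geodesic from
  \<open>h\<close> to \<open>h'\<close> passes through \<open>v\<close>; translating it by
  \<open>iv h\<close> makes \<open>iv h \<sqdot> v\<close> a prefix of the element
  \<open>iv h \<sqdot> h'\<close> of \<open>H\<close>.\<close>

lemma hull_prefix_coset:
  assumes H: "subgroup H (FG N)" and v: "v \<in> thull (L H)"
  shows "\<exists>p h. h \<in> H \<and> prefix p h \<and> rc H v = rc H p"
proof -
  have vG: "v \<in> G" using v hull_in_G by blast
  obtain \<xi> \<zeta> where x: "\<xi> \<in> L H" "\<zeta> \<in> L H" "dir v \<xi> \<noteq> dir v \<zeta>" using v by (auto simp: thull_def)
  have *: "\<exists>h\<in>H. \<exists>u. iv v \<sqdot> h = dir v \<xi> # u" if x: "\<xi> \<in> L H" for \<xi>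
  proof -
    obtain h where h: "h \<in> H" "take (1 + length (iv v)) h = pre (1 + length (iv v)) \<xi>"
      using x unfolding limset_iff by blast
    have "take 1 (iv v \<sqdot> h) = pre 1 (bact (iv v) \<xi>)"
      using take_mul_bact[of "iv v" h 1 \<xi>] h sub_G[OF H] vG by simp
    then have "take 1 (iv v \<sqdot> h) = [dir v \<xi>]" by (simp add: pre_def dir_def)
    then show ?thesis using h by (cases "iv v \<sqdot> h") auto
  qed
  obtain h u where h: "h \<in> H" "iv v \<sqdot> h = dir v \<xi> # u" using *[OF x(1)] by blast
  obtain h' u' where h': "h' \<in> H" "iv v \<sqdot> h' = dir v \<zeta> # u'" using *[OF x(2)] by blast
  have G: "h \<in> G" "h' \<in> G" "iv v \<sqdot> h \<in> G" "iv v \<sqdot> h' \<in> G" using h(1) h'(1) sub_G[OF H] vG m_closed inv_closed by blast+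
  have uG: "dir v \<xi> # u \<in> G" "dir v \<zeta> # u' \<in> G" using G(3,4) unfolding h(2) h'(2) .
  \<comment> \<open>Nothing cancels at \<open>v\<close>, because the two words leave it in different
    directions.\<close>
  have "reduced (winv (dir v \<xi> # u) @ (dir v \<zeta> # u'))"
    unfolding reduced_append using uG x(3) by (auto simp: G_reduced last_winv)
  then have "winv (dir v \<xi> # u) \<sqdot> (dir v \<zeta> # u') = winv (dir v \<xi> # u) @ (dir v \<zeta> # u')"
    using uG foldr_push_reduced by (simp add: mul_eq)
  then have "iv (iv v \<sqdot> h) \<sqdot> (iv v \<sqdot> h') = iv (iv v \<sqdot> h) @ (iv v \<sqdot> h')"
    using h h' G by (simp add: iv_eq)
  moreover have "iv (iv v \<sqdot> h) \<sqdot> (iv v \<sqdot> h') = iv h \<sqdot> h'"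
    using G vG by (simp add: inv_mult_group m_assoc)
  moreover have "iv (iv v \<sqdot> h) = iv h \<sqdot> v" using G vG by (simp add: inv_mult_group)
  ultimately have "prefix (iv h \<sqdot> v) (iv h \<sqdot> h')" by (metis prefixI)
  moreover have "iv h \<sqdot> h' \<in> H" using h h' sub_mul[OF H] sub_iv[OF H] by blast
  moreover have "rc H v = rc H (iv h \<sqdot> v)" using rc_mul_left[OF H sub_iv[OF H h(1)] vG] by simp
  ultimately show ?thesis by blast
qed

text \<open>Convex cocompactness. It is the working form of finite generation
  (\<open>fgsub_cocpt\<close>, \<open>cocpt_fgsub\<close>), and its stability under intersection of
  nontrivial subgroups contains Howson's theorem.\<close>

definition cocpt :: "word set \<Rightarrow> bool" where
  "cocpt H \<longleftrightarrow> subgroup H (FG N) \<and> cofin H (thull (L H))"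

lemma fgsub_cocpt:
  assumes "fgsub N H"
  shows "cocpt H"
proof -
  have H: "subgroup H (FG N)" using assms by (simp add: fgsub_def)
  have f: "finite {rc H p | p h. h \<in> H \<and> prefix p h}"
    using assms generate_prefix_cosets unfolding fgsub_def by blast
  have "rc H ` thull (L H) \<subseteq> {rc H p | p h. h \<in> H \<and> prefix p h}"
    using hull_prefix_coset[OF H] by blast
  then show ?thesis using H f finite_subset unfolding cocpt_def cofin_def by blast
qed

section \<open>Conjugates and intersections\<close>

lemma conjg_eq: "g \<in> G \<Longrightarrow> conjg N g H = (\<lambda>h. g \<sqdot> h \<sqdot> iv g) ` H"
  unfolding conjg_def l_coset_def r_coset_def by auto

lemma subgroup_conjg:
  assumes "subgroup H (FG N)" "g \<in> G"
  shows "subgroup (conjg N g H) (FG N)"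
proof (rule subgroupI)
  show "conjg N g H \<subseteq> G" using assms sub_G by (auto simp: conjg_eq)
  show "conjg N g H \<noteq> {}" using assms sub_Nil[OF assms(1)] by (auto simp: conjg_eq)
next
  fix a assume "a \<in> conjg N g H"
  then obtain h where h: "h \<in> H" "a = g \<sqdot> h \<sqdot> iv g" using assms by (auto simp: conjg_eq)
  have hG: "h \<in> G" using h sub_G[OF assms(1)] by blast
  have "iv a = g \<sqdot> iv h \<sqdot> iv g" using h hG assms by (simp add: inv_mult_group m_assoc)
  then show "iv a \<in> conjg N g H" using h sub_iv[OF assms(1)] assms by (auto simp: conjg_eq)
next
  fix a b assume "a \<in> conjg N g H" "b \<in> conjg N g H"
  then obtain h k where h: "h \<in> H" "a = g \<sqdot> h \<sqdot> iv g" "k \<in> H" "b = g \<sqdot> k \<sqdot> iv g"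
    using assms by (auto simp: conjg_eq)
  have hG: "h \<in> G" "k \<in> G" using h sub_G[OF assms(1)] by blast+
  have "a \<sqdot> b = g \<sqdot> (h \<sqdot> k) \<sqdot> iv g" using h hG assms by (simp add: m_assoc)
  then show "a \<sqdot> b \<in> conjg N g H" using h sub_mul[OF assms(1)] assms by (auto simp: conjg_eq)
qed

lemma mem_conjg: "g \<in> G \<Longrightarrow> H \<subseteq> G \<Longrightarrow> x \<in> conjg N g H \<longleftrightarrow> x \<in> G \<and> iv g \<sqdot> x \<sqdot> g \<in> H"
proof
  assume g: "g \<in> G" "H \<subseteq> G" and "x \<in> conjg N g H"
  then obtain h where h: "h \<in> H" "x = g \<sqdot> h \<sqdot> iv g" by (auto simp: conjg_eq)
  then have "h \<in> G" using g by blast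
  then show "x \<in> G \<and> iv g \<sqdot> x \<sqdot> g \<in> H" using h g by (simp add: m_assoc)
next
  assume g: "g \<in> G" "H \<subseteq> G" and x: "x \<in> G \<and> iv g \<sqdot> x \<sqdot> g \<in> H"
  then have "x = g \<sqdot> (iv g \<sqdot> x \<sqdot> g) \<sqdot> iv g" by (simp add: m_assoc)
  then show "x \<in> conjg N g H" using x g by (auto simp: conjg_eq)
qed

text \<open>The right factor \<open>iv g\<close> has bounded length, so only the left translation by
  \<open>g\<close> is seen in the limit.\<close>

lemma limset_conjg:
  assumes "H \<subseteq> G" "g \<in> G"
  shows "L (conjg N g H) = bact g ` L H"
proof -
  let ?gH = "(\<lambda>a. g \<sqdot> a) ` H"
  have c: "conjg N g H \<subseteq> G" using assms by (auto simp: conjg_eq)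
  have "L (conjg N g H) \<subseteq> L ?gH"
  proof (rule limset_right[of _ "{iv g}"])
    fix a assume "a \<in> conjg N g H"
    then obtain h where "h \<in> H" "a = g \<sqdot> h \<sqdot> iv g" using assms by (auto simp: conjg_eq)
    then show "\<exists>b\<in>?gH. \<exists>t\<in>{iv g}. b \<in> G \<and> a = b \<sqdot> t" using assms by auto
  qed (use assms c in auto)
  moreover have "L ?gH \<subseteq> L (conjg N g H)"
  proof (rule limset_right[of _ "{g}"])
    fix a assume "a \<in> ?gH"
    then obtain h where h: "h \<in> H" "a = g \<sqdot> h" by blast
    then have hG: "h \<in> G" using assms by blast
    then have "a = (g \<sqdot> h \<sqdot> iv g) \<sqdot> g" "g \<sqdot> h \<sqdot> iv g \<in> G" using h assms by simp_all
    then show "\<exists>b\<in>conjg N g H. \<exists>t\<in>{g}. b \<in> G \<and> a = b \<sqdot> t" using h assms unfolding conjg_eq[OF assms(2)] by blast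
  qed (use assms in auto)
  ultimately show ?thesis using limset_left[OF assms(2,1)] by simp
qed

lemma rc_conjg:
  assumes H: "H \<subseteq> G" and g: "g \<in> G" and v: "v \<in> G"
  shows "rc (conjg N g H) (g \<sqdot> v) = (\<lambda>x. g \<sqdot> x) ` rc H v"
proof -
  have "rc (conjg N g H) (g \<sqdot> v) = (\<lambda>h. g \<sqdot> h \<sqdot> iv g \<sqdot> (g \<sqdot> v)) ` H"
    unfolding r_coset_def conjg_eq[OF g] by auto
  also have "\<dots> = (\<lambda>h. g \<sqdot> (h \<sqdot> v)) ` H"
    using g v H by (intro image_cong) (auto simp: m_assoc subset_iff)
  finally show ?thesis unfolding r_coset_def by auto
qed

lemma conjg_cofin:
  assumes H: "subgroup H (FG N)" and g: "g \<in> G" and M: "M \<subseteq> G" "cofin H M"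
  shows "cofin (conjg N g H) ((\<lambda>v. g \<sqdot> v) ` M)"
proof -
  have "rc (conjg N g H) ` ((\<lambda>v. g \<sqdot> v) ` M) \<subseteq> (\<lambda>c. (\<lambda>x. g \<sqdot> x) ` c) ` rc H ` M"
    using rc_conjg[OF subgroup.subset[OF H] g] M(1) by blast
  then show ?thesis using M(2) unfolding cofin_def by (meson finite_imageI finite_subset)
qed

lemma hull_limset_conjg:
  assumes "H \<subseteq> G" "g \<in> G"
  shows "thull (L (conjg N g H)) = (\<lambda>v. g \<sqdot> v) ` thull (L H)"
  using hull_act_eq[OF assms(2) limset_sub] limset_conjg[OF assms] by simp

lemma cocpt_conjg: "cocpt H \<Longrightarrow> g \<in> G \<Longrightarrow> cocpt (conjg N g H)"
  unfolding cocpt_def using subgroup_conjg conjg_cofin hull_limset_conjg hull_sub subgroup.subset by metis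

lemma conjg_nontriv:
  assumes "g \<in> G" "H \<subseteq> G" "H \<noteq> {[]}"
  shows "conjg N g H \<noteq> {[]}"
proof
  assume c: "conjg N g H = {[]}"
  have "h = []" if "h \<in> H" for h
  proof -
    have "g \<sqdot> h \<sqdot> iv g = []" using c that unfolding conjg_eq[OF assms(1)] by blast
    then have "iv g \<sqdot> (g \<sqdot> h \<sqdot> iv g) \<sqdot> g = []" using assms by simp
    then show ?thesis using assms that by (simp add: m_assoc subset_iff)
  qed
  moreover have "H \<noteq> {}" using c by (auto simp: conjg_eq[OF assms(1)])
  ultimately show False using assms(3) by blast
qed

text \<open>A coset of the intersection is determined by the pair of the corresponding cosets of
  \<open>H\<close> and \<open>K\<close>.\<close>

lemma cofin_Int:
  assumes "subgroup H (FG N)" "subgroup K (FG N)" "M \<subseteq> G" "cofin H M" "cofin K M"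
  shows "cofin (H \<inter> K) M"
proof -
  have J: "subgroup (H \<inter> K) (FG N)" using assms subgroups_Inter_pair by blast
  have *: "rc (H \<inter> K) u = rc (H \<inter> K) v" if "u \<in> M" "v \<in> M" "rc H u = rc H v" "rc K u = rc K v" for u v
  proof -
    have uv: "u \<in> G" "v \<in> G" using that assms by auto
    have "u \<sqdot> iv v \<in> H" "u \<sqdot> iv v \<in> K"
      using that rc_eq_iff[OF assms(1) uv] rc_eq_iff[OF assms(2) uv] by simp_all
    then show ?thesis using rc_eq_iff[OF J uv] by simp
  qed
  have fin: "finite ((\<lambda>v. (rc H v, rc K v)) ` M)"
    by (rule finite_subset[of _ "rc H ` M \<times> rc K ` M"]) (use assms in \<open>auto simp: cofin_def\<close>)
  show ?thesis unfolding cofin_def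
  proof (rule finite_image_factor[OF fin])
    fix u v assume "u \<in> M" "v \<in> M" "(rc H u, rc K u) = (rc H v, rc K v)"
    then show "rc (H \<inter> K) u = rc (H \<inter> K) v" by (intro *) auto
  qed
qed

text \<open>A ray to a common limit point eventually runs in both hulls, because each limit set has
  a second point. The intersection of the hulls consists of finitely many orbits of
  \<open>H \<inter> K\<close>, so the endpoint of the ray is a limit point of
  \<open>H \<inter> K\<close>.\<close>

lemma cocpt_Int:
  assumes "cocpt H" "cocpt K" "H \<noteq> {[]}" "K \<noteq> {[]}"
  shows "cofin (H \<inter> K) (thull (L H) \<inter> thull (L K))" "L (H \<inter> K) = L H \<inter> L K" "cocpt (H \<inter> K)"
proof -
  have H: "subgroup H (FG N)" and K: "subgroup K (FG N)" using assms by (auto simp: cocpt_def)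
  have J: "subgroup (H \<inter> K) (FG N)" using H K subgroups_Inter_pair by blast
  let ?M = "thull (L H) \<inter> thull (L K)"
  have MG: "?M \<subseteq> G" using hull_sub by blast
  show c: "cofin (H \<inter> K) ?M"
    using cofin_Int[OF H K MG] assms(1,2) cofin_subset unfolding cocpt_def by blast
  show LJ: "L (H \<inter> K) = L H \<inter> L K"
  proof
    show "L (H \<inter> K) \<subseteq> L H \<inter> L K" using limset_mono by blast
    show "L H \<inter> L K \<subseteq> L (H \<inter> K)"
    proof
      fix \<xi> assume x: "\<xi> \<in> L H \<inter> L K"
      have ev: "\<exists>m. \<forall>n\<ge>m. pre n \<xi> \<in> thull (L A)" if A: "subgroup A (FG N)" "A \<noteq> {[]}" "\<xi> \<in> L A" for A
      proof -
        obtain a b where "a \<in> L A" "b \<in> L A" "a \<noteq> b" using limset_in_CN[OF A(1,2)] by (auto simp: CN_iff)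
        then obtain \<zeta> where "\<zeta> \<in> L A" "\<xi> \<noteq> \<zeta>" by metis
        then show ?thesis using hull_nonempty[OF limset_sub A(3)] by blast
      qed
      obtain m1 where m1: "\<forall>n\<ge>m1. pre n \<xi> \<in> thull (L H)" using ev[OF H] x assms by blast
      obtain m2 where m2: "\<forall>n\<ge>m2. pre n \<xi> \<in> thull (L K)" using ev[OF K] x assms by blast
      have "\<exists>m\<ge>n. pre m \<xi> \<in> ?M" for n
        using m1 m2 by (intro exI[of _ "max n (max m1 m2)"]) auto
      then show "\<xi> \<in> L (H \<inter> K)" using cofin_limset[OF J MG c] x limset_sub by blast
    qed
  qed
  have "thull (L (H \<inter> K)) \<subseteq> ?M" unfolding LJ using hull_mono by blast
  then show "cocpt (H \<inter> K)" using c cofin_subset J unfolding cocpt_def by blast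
qed

end

section \<open>Counting currents as orbit counts\<close>

lemma emeasure_count_fibers:
  assumes k: "\<And>b. b \<in> f ` A \<Longrightarrow> card {a \<in> A. f a = b} = k" "k > 0"
  shows "emeasure (count_space A) A = of_nat k * emeasure (count_space (f ` A)) (f ` A)"
proof (cases "finite (f ` A)")
  case True
  have ff: "finite {a \<in> A. f a = b}" if "b \<in> f ` A" for b
    using k(1)[OF that] k(2) card_ge_0_finite by metis
  have "A = (\<Union>b\<in>f ` A. {a \<in> A. f a = b})" by blast
  then have fA: "finite A" using True ff by (metis (no_types, lifting) finite_UN_I)
  have "card A = (\<Sum>b\<in>f ` A. \<Sum>a\<in>{a \<in> A. f a = b}. 1)"
    using sum.image_gen[OF fA, of "\<lambda>_. 1::nat" f] by simp
  also have "\<dots> = (\<Sum>b\<in>f ` A. k)" using k(1) by (intro sum.cong) auto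
  finally have "card A = k * card (f ` A)" by simp
  then show ?thesis using fA by (simp add: emeasure_count_space of_nat_mult)
next
  case False
  then have "infinite A" by blast
  then show ?thesis using False k(2) by (simp add: emeasure_count_space ennreal_mult_top)
qed

lemma emeasure_count_space_self: "Y \<subseteq> X \<Longrightarrow> emeasure (count_space X) Y = emeasure (count_space Y) Y"
  by (simp add: emeasure_count_space)

context free_group
begin

lemma space_CN_meas [simp]: "space (CN_meas N) = CN N"
  by (simp add: CN_meas_def space_measure_of_conv)

lemma opens_Pow: "{U. openin (CN_top N) U} \<subseteq> Pow (CN N)"
  using openin_subset[of "CN_top N"] by auto

lemma sets_CN_meas: "sets (CN_meas N) = sigma_sets (CN N) {U. openin (CN_top N) U}"
  unfolding CN_meas_def using opens_Pow by (rule sets_measure_of)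

lemma sets_open: "openin (CN_top N) U \<Longrightarrow> U \<in> sets (CN_meas N)"
  unfolding sets_CN_meas by (intro sigma_sets.Basic) simp

lemma sets_CN_sub: "U \<in> sets (CN_meas N) \<Longrightarrow> U \<subseteq> CN N"
  using sets.sets_into_space by fastforce

section \<open>The action on closed sets and invariant measures\<close>

lemma bact_cont:
  assumes "g \<in> G" "pre (n + length g) \<xi> = pre (n + length g) \<zeta>"
  shows "pre n (bact g \<xi>) = pre n (bact g \<zeta>)"
proof -
  have "take (n + length g - length g) (foldr push g (pre (n + length g) \<xi>)) = pre (n + length g - length g) (foldr bpush g \<xi>)"
    by (rule take_foldr_push_bpush) simp
  moreover have "take (n + length g - length g) (foldr push g (pre (n + length g) \<xi>)) = pre (n + length g - length g) (foldr bpush g \<zeta>)"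
    by (rule take_foldr_push_bpush) (simp add: assms(2))
  ultimately show ?thesis using assms(1) by (simp add: bact_eq G_reduced)
qed

lemma Tr_act:
  assumes "g \<in> G" "Tr (n + length g) S = Tr (n + length g) S'"
  shows "Tr n (bact g ` S) = Tr n (bact g ` S')"
proof -
  have *: "Tr n (bact g ` S1) \<subseteq> Tr n (bact g ` S2)" if s: "Tr (n + length g) S1 = Tr (n + length g) S2" for S1 S2
  proof
    fix w assume "w \<in> Tr n (bact g ` S1)"
    then obtain \<xi> where x: "\<xi> \<in> S1" "pre n (bact g \<xi>) = w" using Tr_D by blast
    have "pre (n + length g) \<xi> \<in> Tr (n + length g) S2" using Tr_I[OF x(1), of "n + length g"] s by simp
    then obtain \<zeta> where z: "\<zeta> \<in> S2" "pre (n + length g) \<zeta> = pre (n + length g) \<xi>" using Tr_D by blast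
    then have "pre n (bact g \<zeta>) = w" using bact_cont[OF assms(1) z(2)] x(2) by simp
    then show "w \<in> Tr n (bact g ` S2)" using z(1) Tr_I[of "bact g \<zeta>" "bact g ` S2" n] by blast
  qed
  show ?thesis using *[OF assms(2)] *[OF assms(2)[symmetric]] by blast
qed

lemma act_CN:
  assumes g: "g \<in> G" and S: "S \<in> CN N"
  shows "bact g ` S \<in> CN N"
proof -
  have sb: "S \<subseteq> bdry N" using CN_sub[OF S] .
  have "closedin (bdry_top N) (bact g ` S)" unfolding closedin_bdry
  proof (intro conjI ballI impI image_bact_bdry[OF g sb])
    fix \<xi> assume x: "\<xi> \<in> bdry N" "\<forall>n. pre n \<xi> \<in> Tr n (bact g ` S)"
    have "pre n (bact (iv g) \<xi>) \<in> Tr n S" for n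
    proof -
      obtain \<zeta> where z: "\<zeta> \<in> S" "pre (n + length (iv g)) (bact g \<zeta>) = pre (n + length (iv g)) \<xi>"
        using x(2) Tr_D[of _ "n + length (iv g)" "bact g ` S"] by blast
      have "pre n (bact (iv g) (bact g \<zeta>)) = pre n (bact (iv g) \<xi>)"
        using bact_cont[OF inv_closed[OF g] z(2)] .
      then have "pre n \<zeta> = pre n (bact (iv g) \<xi>)" using z sb g by (simp add: subset_iff)
      then show ?thesis using Tr_I[OF z(1), of n] by simp
    qed
    then have "bact (iv g) \<xi> \<in> S" using CN_closed[OF S] g x(1) by simp
    moreover have "bact g (bact (iv g) \<xi>) = \<xi>" using g x by simp
    ultimately show "\<xi> \<in> bact g ` S" by (metis imageI)
  qed
  moreover obtain x y where xy: "x \<in> S" "y \<in> S" "x \<noteq> y" using S by (auto simp: CN_iff)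
  then have "bact g x \<noteq> bact g y" using inj_onD[OF inj_on_bact[OF g]] sb by blast
  ultimately show ?thesis using xy unfolding CN_iff by blast
qed

abbreviation act :: "word \<Rightarrow> bpt set \<Rightarrow> bpt set" where "act g S \<equiv> bact g ` S"

lemma act_iv_CN:
  "g \<in> G \<Longrightarrow> S \<in> CN N \<Longrightarrow> act g (act (iv g) S) = S"
  "g \<in> G \<Longrightarrow> S \<in> CN N \<Longrightarrow> act (iv g) (act g S) = S"
  by (simp_all add: image_bact_iv CN_sub)

lemma act_image_mem:
  assumes "g \<in> G" "U \<subseteq> CN N" "S \<in> CN N"
  shows "S \<in> act g ` U \<longleftrightarrow> act (iv g) S \<in> U"
proof
  assume "S \<in> act g ` U"
  then obtain S' where S': "S' \<in> U" "S = act g S'" by blast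
  then show "act (iv g) S \<in> U" using act_iv_CN(2)[OF assms(1), of S'] assms(2) by auto
next
  assume a: "act (iv g) S \<in> U"
  show "S \<in> act g ` U" using act_iv_CN(1)[OF assms(1,3)] imageI[OF a, of "act g"] by simp
qed

lemma act_image_CN: "g \<in> G \<Longrightarrow> U \<subseteq> CN N \<Longrightarrow> act g ` U \<subseteq> CN N"
  using act_CN by blast

lemma openin_act:
  assumes g: "g \<in> G" and U: "openin (CN_top N) U"
  shows "openin (CN_top N) (act g ` U)"
  unfolding openin_CN_Tr
proof (intro conjI ballI)
  have UC: "U \<subseteq> CN N" using U openin_subset by fastforce
  then show "act g ` U \<subseteq> CN N" using act_image_CN g by blast
  fix S assume S: "S \<in> act g ` U"
  then have SC: "S \<in> CN N" using act_image_CN[OF g UC] by blast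
  have "act (iv g) S \<in> U" using act_image_mem[OF g UC SC] S by blast
  then obtain m where m: "\<forall>S'\<in>CN N. Tr m S' = Tr m (act (iv g) S) \<longrightarrow> S' \<in> U"
    using U unfolding openin_CN_Tr by blast
  have "S' \<in> act g ` U" if S': "S' \<in> CN N" "Tr (m + length (iv g)) S' = Tr (m + length (iv g)) S" for S'
  proof -
    have "Tr m (act (iv g) S') = Tr m (act (iv g) S)" using Tr_act[OF inv_closed[OF g] S'(2)] .
    then have "act (iv g) S' \<in> U" using m act_CN[OF inv_closed[OF g] S'(1)] by blast
    then show ?thesis using act_image_mem[OF g UC S'(1)] by blast
  qed
  then show "\<exists>m. \<forall>S'\<in>CN N. Tr m S' = Tr m S \<longrightarrow> S' \<in> act g ` U" by blast
qed

lemma sets_act: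
  assumes g: "g \<in> G" and U: "U \<in> sets (CN_meas N)"
  shows "act g ` U \<in> sets (CN_meas N)"
proof -
  have vim: "act (iv g) -` V \<inter> CN N = act g ` V" if "V \<subseteq> CN N" for V
  proof (intro equalityI subsetI)
    fix S assume "S \<in> act (iv g) -` V \<inter> CN N"
    then show "S \<in> act g ` V" using act_image_mem[OF g that] by blast
  next
    fix S assume "S \<in> act g ` V"
    then show "S \<in> act (iv g) -` V \<inter> CN N"
      using act_image_mem[OF g that] act_image_CN[OF g that] by blast
  qed
  have "act (iv g) \<in> measurable (CN_meas N) (sigma (CN N) {U. openin (CN_top N) U})"
  proof (rule measurable_measure_of[OF opens_Pow])
    show "act (iv g) \<in> space (CN_meas N) \<rightarrow> CN N" using act_CN[OF inv_closed[OF g]] by auto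
    fix V assume "V \<in> {U. openin (CN_top N) U}"
    then have V: "openin (CN_top N) V" by simp
    then have "V \<subseteq> CN N" using openin_subset by fastforce
    then show "act (iv g) -` V \<inter> space (CN_meas N) \<in> sets (CN_meas N)"
      using vim[of V] sets_open[OF openin_act[OF g V]] by simp
  qed
  then have "act (iv g) -` U \<inter> space (CN_meas N) \<in> sets (CN_meas N)"
    using U unfolding CN_meas_def[symmetric] by (rule measurable_sets)
  then show ?thesis using vim[OF sets_CN_sub[OF U]] by simp
qed

lemma act_Cv:
  assumes g: "g \<in> G" and v: "v \<in> G"
  shows "act g ` Cv v = Cv (g \<sqdot> v)"
proof -
  have sub: "Cv v \<subseteq> CN N" by (auto simp: Cv_def)
  have "S \<in> act g ` Cv v \<longleftrightarrow> S \<in> Cv (g \<sqdot> v)" if S: "S \<in> CN N" for S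
  proof -
    have "S \<in> act g ` Cv v \<longleftrightarrow> v \<in> thull (act (iv g) S)"
      using act_image_mem[OF g sub S] act_CN[OF inv_closed[OF g] S] by (simp add: Cv_def)
    then show ?thesis using hull_act[OF inv_closed[OF g] CN_sub[OF S] v] g S by (simp add: Cv_def)
  qed
  moreover have "act g ` Cv v \<subseteq> CN N" "Cv (g \<sqdot> v) \<subseteq> CN N"
    using act_image_CN[OF g sub] by (auto simp: Cv_def)
  ultimately show ?thesis by blast
qed

lemma sets_Cv: "Cv v \<in> sets (CN_meas N)"
  by (rule sets_open[OF openin_Cv])

text \<open>A compact set is covered by finitely many translates of \<open>Cv []\<close>, so by
  invariance local finiteness needs checking at the base vertex alone.\<close>

lemma SCurrI:
  assumes "space \<mu> = CN N" "sets \<mu> = sets (CN_meas N)"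
    and inv: "\<And>g U. g \<in> G \<Longrightarrow> U \<in> sets (CN_meas N) \<Longrightarrow> emeasure \<mu> (act g ` U) = emeasure \<mu> U"
    and fin: "emeasure \<mu> (Cv []) < \<infinity>"
  shows "\<mu> \<in> SCurr N"
  unfolding SCurr_def
proof (intro CollectI conjI ballI allI impI)
  fix C assume "compactin (CN_top N) C"
  from compactin_sub_Cv[OF this] obtain F where F: "finite F" "F \<subseteq> G" "C \<subseteq> (\<Union>v\<in>F. Cv v)" by auto
  have "emeasure \<mu> C \<le> emeasure \<mu> (\<Union>v\<in>F. Cv v)"
    using F sets_Cv assms(2) by (intro emeasure_mono) auto
  also have "\<dots> \<le> (\<Sum>v\<in>F. emeasure \<mu> (Cv v))"
    using F sets_Cv assms(2) by (intro emeasure_subadditive_finite) auto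
  also have "\<dots> = (\<Sum>v\<in>F. emeasure \<mu> (Cv []))"
  proof (rule sum.cong)
    fix v assume "v \<in> F"
    then have "v \<in> G" using F by blast
    then show "emeasure \<mu> (Cv v) = emeasure \<mu> (Cv [])" using inv[of v "Cv []"] act_Cv[of v "[]"] sets_Cv by simp
  qed simp
  also have "\<dots> < \<infinity>" using fin by (simp add: ennreal_mult_less_top of_nat_less_top)
  finally show "emeasure \<mu> C < \<infinity>" .
qed (use assms in auto)

lemma SCurr_fin: "\<mu> \<in> SCurr N \<Longrightarrow> emeasure \<mu> (Cv []) < \<infinity>"
  using compactin_C0 by (simp add: SCurr_def)

lemma SCurr_sets: "\<mu> \<in> SCurr N \<Longrightarrow> sets \<mu> = sets (CN_meas N)"
  by (simp add: SCurr_def)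

lemma SCurr_space: "\<mu> \<in> SCurr N \<Longrightarrow> space \<mu> = CN N"
  by (simp add: SCurr_def)

lemma SCurr_inv: "\<mu> \<in> SCurr N \<Longrightarrow> g \<in> G \<Longrightarrow> U \<in> sets (CN_meas N) \<Longrightarrow> emeasure \<mu> (act g ` U) = emeasure \<mu> U"
  by (simp add: SCurr_def)

lemma cosets_in_eq: "cosets_in N A H = rc H ` A"
  unfolding cosets_in_def RCOSETS_def r_coset_def by auto

section \<open>Stabilisers of limit sets and commensurators\<close>

definition stab :: "bpt set \<Rightarrow> word set" where
  "stab S = {g \<in> G. act g S = S}"

lemma stab_iv_mul:
  assumes "S \<subseteq> bdry N" "g \<in> G" "w \<in> G"
  shows "act g S = act w S \<longleftrightarrow> iv w \<sqdot> g \<in> stab S"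
proof -
  have "act (iv w \<sqdot> g) S = act (iv w) (act g S)" using assms image_bact_mul by simp
  then have "iv w \<sqdot> g \<in> stab S \<longleftrightarrow> act (iv w) (act g S) = S" using assms by (simp add: stab_def)
  also have "\<dots> \<longleftrightarrow> act g S = act w S"
  proof
    assume e: "act (iv w) (act g S) = S"
    have "act w (act (iv w) (act g S)) = act g S"
      using image_bact_iv(1)[OF assms(3) image_bact_bdry[OF assms(2,1)]] .
    then show "act g S = act w S" using e by simp
  next
    assume "act g S = act w S"
    then show "act (iv w) (act g S) = S" using image_bact_iv(2)[OF assms(3,1)] by simp
  qed
  finally show ?thesis by simp
qed

lemma sub_stab: "subgroup H (FG N) \<Longrightarrow> H \<subseteq> stab (L H)"
  using limset_invariant sub_G by (auto simp: stab_def)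

text \<open>The stabiliser maps a fixed hull vertex \<open>v\<close> to hull vertices, which meet
  finitely many cosets, and right multiplication by \<open>v\<close> is injective on cosets.\<close>

lemma cofin_stab:
  assumes "cocpt H" "H \<noteq> {[]}"
  shows "cofin H (stab (L H))"
proof -
  have H: "subgroup H (FG N)" using assms by (simp add: cocpt_def)
  obtain v where v: "v \<in> thull (L H)" using CN_hull_ne[OF limset_in_CN[OF H assms(2)]] by blast
  have vG: "v \<in> G" using v hull_in_G by blast
  have "(\<lambda>g. rc H (g \<sqdot> v)) ` stab (L H) \<subseteq> rc H ` thull (L H)"
  proof
    fix c assume "c \<in> (\<lambda>g. rc H (g \<sqdot> v)) ` stab (L H)"
    then obtain g where g: "g \<in> G" "act g (L H) = L H" "c = rc H (g \<sqdot> v)" by (auto simp: stab_def)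
    have "g \<sqdot> v \<in> thull (act g (L H))" using hull_act[OF g(1) limset_sub[of H], of "g \<sqdot> v"] g(1) v vG by simp
    then show "c \<in> rc H ` thull (L H)" using g by simp
  qed
  then have fin: "finite ((\<lambda>g. rc H (g \<sqdot> v)) ` stab (L H))"
    using assms finite_subset unfolding cocpt_def cofin_def by blast
  show ?thesis unfolding cofin_def
  proof (rule finite_image_factor[OF fin])
    fix x y assume "x \<in> stab (L H)" "y \<in> stab (L H)" and e: "rc H (x \<sqdot> v) = rc H (y \<sqdot> v)"
    then have G: "x \<in> G" "y \<in> G" by (auto simp: stab_def)
    have "x \<sqdot> v \<sqdot> iv (y \<sqdot> v) \<in> H" using e rc_eq_iff[OF H, of "x \<sqdot> v" "y \<sqdot> v"] G vG by simp
    then show "rc H x = rc H y" using rc_eq_iff[OF H G] G vG by (simp add: inv_mult_group m_assoc)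
  qed
qed

text \<open>Passing to a subgroup of finite index does not change the limit set, so a commensurating
  \<open>g\<close> fixes \<open>L H\<close>. Conversely, if \<open>g\<close> fixes
  \<open>L H\<close>, then \<open>H\<close> and its conjugate both have finite index in the common
  stabiliser, and so does their intersection.\<close>

lemma comm_eq_stab:
  assumes c: "cocpt H" and nt: "H \<noteq> {[]}"
  shows "comm N H = stab (L H)"
proof -
  have H: "subgroup H (FG N)" using c by (simp add: cocpt_def)
  have HG: "H \<subseteq> G" using H subgroup.subset by blast
  have "g \<in> comm N H \<longleftrightarrow> g \<in> stab (L H)" if g: "g \<in> G" for g
  proof -
    let ?H' = "conjg N g H"
    let ?J = "H \<inter> ?H'"
    have H': "subgroup ?H' (FG N)" "cocpt ?H'" "?H' \<noteq> {[]}" "?H' \<subseteq> G" "L ?H' = act g (L H)"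
      using subgroup_conjg[OF H g] cocpt_conjg[OF c g] conjg_nontriv[OF g HG nt] limset_conjg[OF HG g]
        subgroup.subset[OF subgroup_conjg[OF H g]] by simp_all
    have J: "subgroup ?J (FG N)" using H H' subgroups_Inter_pair by blast
    have "g \<in> comm N H \<longleftrightarrow> cofin ?J H \<and> cofin ?J ?H'"
      using g unfolding comm_def cosets_in_eq cofin_def by simp
    also have "\<dots> \<longleftrightarrow> g \<in> stab (L H)"
    proof
      assume f: "cofin ?J H \<and> cofin ?J ?H'"
      have "L H \<subseteq> L ?J" "L ?H' \<subseteq> L ?J" using f cofin_limset_sub[OF J] HG H'(4) by blast+
      moreover have "L ?J \<subseteq> L H" "L ?J \<subseteq> L ?H'" using limset_mono by blast+
      ultimately have "L ?H' = L H" by blast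
      then show "g \<in> stab (L H)" using g H'(5) by (simp add: stab_def)
    next
      assume "g \<in> stab (L H)"
      then have e: "L ?H' = L H" using H'(5) by (simp add: stab_def)
      have sG: "stab (L H) \<subseteq> G" by (auto simp: stab_def)
      have "cofin ?J (stab (L H))"
        using cofin_Int[OF H H'(1) sG] cofin_stab[OF c nt] cofin_stab[OF H'(2,3)] e by simp
      moreover have "H \<subseteq> stab (L H)" "?H' \<subseteq> stab (L H)" using sub_stab[OF H] sub_stab[OF H'(1)] e by auto
      ultimately show "cofin ?J H \<and> cofin ?J ?H'" using cofin_subset by blast
    qed
    finally show ?thesis .
  qed
  then show ?thesis by (auto simp: comm_def stab_def)
qed

lemma limset_stab:
  assumes c: "cocpt H" and nt: "H \<noteq> {[]}"
  shows "L (stab (L H)) = L H"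
proof
  have H: "subgroup H (FG N)" using c by (simp add: cocpt_def)
  show "L (stab (L H)) \<subseteq> L H"
    using cofin_limset_sub[OF H _ cofin_stab[OF c nt]] by (auto simp: stab_def)
  show "L H \<subseteq> L (stab (L H))" using limset_mono[OF sub_stab[OF H]] .
qed

text \<open>The choice of \<open>w\<close> in the coset is immaterial, as \<open>H\<close> preserves
  its limit set; see \<open>pt_rc\<close>. The inverse is there because the cosets are right
  cosets.\<close>

definition pt :: "word set \<Rightarrow> word set \<Rightarrow> bpt set" where
  "pt H c = act (iv (SOME w. w \<in> c)) (L H)"

lemma pt_rc:
  assumes H: "subgroup H (FG N)" and w: "w \<in> G"
  shows "pt H (rc H w) = act (iv w) (L H)"
proof -
  have "(SOME w'. w' \<in> rc H w) \<in> rc H w" using rcos_self[OF w H] by (rule someI)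
  then obtain h where h: "h \<in> H" "(SOME w'. w' \<in> rc H w) = h \<sqdot> w" unfolding r_coset_def by blast
  have hG: "h \<in> G" using sub_G[OF H h(1)] .
  have "act (iv (h \<sqdot> w)) (L H) = act (iv w) (act (iv h) (L H))"
    using image_bact_mul[OF inv_closed[OF w] inv_closed[OF hG] limset_sub] hG w by (simp add: inv_mult_group)
  then show ?thesis unfolding pt_def h(2) using limset_invariant[OF H sub_iv[OF H h(1)]] by simp
qed

lemma pt_CN:
  assumes H: "subgroup H (FG N)" "H \<noteq> {[]}" and c: "c \<in> rc H ` G"
  shows "pt H c \<in> CN N"
proof -
  obtain w where w: "w \<in> G" "c = rc H w" using c by blast
  then show ?thesis using pt_rc[OF H(1) w(1)] act_CN[OF inv_closed[OF w(1)] limset_in_CN[OF H]] by simp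
qed

lemma pt_hull:
  assumes H: "subgroup H (FG N)" and w: "w \<in> G" and v: "v \<in> G"
  shows "v \<in> thull (pt H (rc H w)) \<longleftrightarrow> w \<sqdot> v \<in> thull (L H)"
  using pt_rc[OF H w] hull_act[OF inv_closed[OF w] limset_sub v] w by simp

lemma space_eta [simp]: "space (eta N H) = CN N"
  by (simp add: eta_def space_scale_measure)

lemma sets_eta [simp]: "sets (eta N H) = sets (CN_meas N)"
  by (simp add: eta_def)

text \<open>Taking limit sets is injective on the conjugates of the stabiliser, and every translate
  of \<open>L H\<close> is the value of \<open>pt H\<close> at exactly as many cosets as the index
  of \<open>H\<close> in its commensurator. The index factor thus turns into a plain count of cosets
  of \<open>H\<close>. For the trivial group all values of \<open>pt H\<close> are empty and both
  sides vanish.\<close>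

lemma eta_emeasure:
  assumes c: "cocpt H" and U: "U \<in> sets (CN_meas N)"
  shows "emeasure (eta N H) U = emeasure (count_space (rc H ` G)) {c \<in> rc H ` G. pt H c \<in> U}"
proof (cases "H = {[]}")
  case True
  have H: "subgroup H (FG N)" using c by (simp add: cocpt_def)
  have "pt H c \<notin> U" if "c \<in> rc H ` G" for c
    using that pt_rc[OF H] limset_finite[of H] True sets_CN_sub[OF U] by (auto simp: CN_iff)
  then have e: "{c \<in> rc H ` G. pt H c \<in> U} = {}" by blast
  show ?thesis unfolding e using True by (simp add: eta_def)
next
  case False
  have H: "subgroup H (FG N)" using c by (simp add: cocpt_def)
  let ?S = "stab (L H)"
  let ?C = "{conjg N g ?S | g. g \<in> G}"
  let ?A = "{c \<in> rc H ` G. pt H c \<in> U}"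
  let ?k = "card (rc H ` ?S)"
  have sG: "?S \<subseteq> G" by (auto simp: stab_def)
  have Lc: "L (conjg N g ?S) = act g (L H)" if "g \<in> G" for g
    using limset_conjg[OF sG that] limset_stab[OF c False] by simp
  have meas: "limset N \<in> measurable (count_space ?C) (CN_meas N)"
    using Lc act_CN limset_in_CN[OF H False] by auto
  have "emeasure (eta N H) U = of_nat ?k * emeasure (count_space ?C) {c \<in> ?C. L c \<in> U}"
  proof -
    have "limset N -` U \<inter> ?C = {c \<in> ?C. L c \<in> U}" by blast
    then show ?thesis
      using False meas U comm_eq_stab[OF c False]
      by (simp add: eta_def cosets_in_eq emeasure_distr)
  qed
  also have "emeasure (count_space ?C) {c \<in> ?C. L c \<in> U} = emeasure (count_space (pt H ` ?A)) (pt H ` ?A)"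
  proof -
    have inj: "inj_on (limset N) {c \<in> ?C. L c \<in> U}"
    proof (rule inj_onI)
      fix x y assume x: "x \<in> {c \<in> ?C. L c \<in> U}" and y: "y \<in> {c \<in> ?C. L c \<in> U}" and e: "L x = L y"
      obtain g where g: "g \<in> G" "x = conjg N g ?S" using x by blast
      obtain w where w: "w \<in> G" "y = conjg N w ?S" using y by blast
      have "act g (L H) = act w (L H)" using e g w Lc by simp
      then have s: "iv w \<sqdot> g \<in> ?S" using stab_iv_mul[OF limset_sub g(1) w(1)] by simp
      have sS: "subgroup ?S (FG N)"
      proof (rule subgroupI[OF sG])
        show "?S \<noteq> {}" using sub_stab[OF H] sub_Nil[OF H] by blast
      next
        fix a assume a: "a \<in> ?S"
        then have aG: "a \<in> G" and "act [] (L H) = act a (L H)" by (auto simp: stab_def)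
        then show "iv a \<in> ?S" using stab_iv_mul[OF limset_sub[of H], of "[]" a] by simp
      next
        fix a b assume a: "a \<in> ?S" "b \<in> ?S"
        then show "a \<sqdot> b \<in> ?S" using image_bact_mul[of a b "L H"] limset_sub by (auto simp: stab_def)
      qed
      have "z \<in> conjg N g ?S \<longleftrightarrow> z \<in> conjg N w ?S" if z: "z \<in> G" for z
      proof -
        let ?s = "iv w \<sqdot> g"
        have sG': "?s \<in> G" using g w by simp
        have e1: "iv w \<sqdot> z \<sqdot> w = ?s \<sqdot> (iv g \<sqdot> z \<sqdot> g) \<sqdot> iv ?s" using g w z by (simp add: inv_mult_group m_assoc)
        have e2: "iv g \<sqdot> z \<sqdot> g = iv ?s \<sqdot> (iv w \<sqdot> z \<sqdot> w) \<sqdot> ?s" using g w z by (simp add: inv_mult_group m_assoc)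
        have "iv g \<sqdot> z \<sqdot> g \<in> ?S \<longleftrightarrow> iv w \<sqdot> z \<sqdot> w \<in> ?S"
        proof
          assume a: "iv g \<sqdot> z \<sqdot> g \<in> ?S"
          show "iv w \<sqdot> z \<sqdot> w \<in> ?S" unfolding e1 by (rule sub_mul[OF sS sub_mul[OF sS s a] sub_iv[OF sS s]])
        next
          assume a: "iv w \<sqdot> z \<sqdot> w \<in> ?S"
          show "iv g \<sqdot> z \<sqdot> g \<in> ?S" unfolding e2 by (rule sub_mul[OF sS sub_mul[OF sS sub_iv[OF sS s] a] s])
        qed
        then show ?thesis using mem_conjg[OF g(1) sG] mem_conjg[OF w(1) sG] z by simp
      qed
      moreover have "conjg N g ?S \<subseteq> G" "conjg N w ?S \<subseteq> G"
        using mem_conjg[OF g(1) sG] mem_conjg[OF w(1) sG] by blast+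
      ultimately show "x = y" unfolding g(2) w(2) by blast
    qed
    have im: "limset N ` {c \<in> ?C. L c \<in> U} = pt H ` ?A"
    proof (intro equalityI subsetI)
      fix S assume "S \<in> limset N ` {c \<in> ?C. L c \<in> U}"
      then obtain g where g: "g \<in> G" "S = act g (L H)" "S \<in> U" using Lc by auto
      have "pt H (rc H (iv g)) = S" using pt_rc[OF H inv_closed[OF g(1)]] g by simp
      then show "S \<in> pt H ` ?A" using g by (intro image_eqI[of _ _ "rc H (iv g)"]) auto
    next
      fix S assume "S \<in> pt H ` ?A"
      then obtain w where w: "w \<in> G" "S = pt H (rc H w)" "S \<in> U" by auto
      then have "S = L (conjg N (iv w) ?S)" using Lc[OF inv_closed[OF w(1)]] pt_rc[OF H w(1)] by simp
      then show "S \<in> limset N ` {c \<in> ?C. L c \<in> U}"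
        using w by (intro image_eqI[of _ _ "conjg N (iv w) ?S"]) auto
    qed
    have "emeasure (count_space ?C) {c \<in> ?C. L c \<in> U} = emeasure (count_space {c \<in> ?C. L c \<in> U}) {c \<in> ?C. L c \<in> U}"
      by (rule emeasure_count_space_self) blast
    also have "\<dots> = emeasure (count_space (limset N ` {c \<in> ?C. L c \<in> U})) (limset N ` {c \<in> ?C. L c \<in> U})"
      using inj by (simp add: emeasure_count_space finite_image_iff card_image)
    finally show ?thesis unfolding im .
  qed
  also have "of_nat ?k * emeasure (count_space (pt H ` ?A)) (pt H ` ?A) = emeasure (count_space ?A) ?A"
  proof (rule emeasure_count_fibers[symmetric])
    have "rc H ` ?S \<noteq> {}" using sub_stab[OF H] sub_Nil[OF H] by blast
    then show "?k > 0" using cofin_stab[OF c False] by (simp add: cofin_def card_gt_0_iff)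
    fix S assume "S \<in> pt H ` ?A"
    then obtain w where w: "w \<in> G" "S = pt H (rc H w)" "S \<in> U" by auto
    have Sw: "S = act (iv w) (L H)" using w pt_rc[OF H] by simp
    \<comment> \<open>The fibre consists of the cosets of \<open>H\<close> inside the coset of the
      stabiliser through \<open>w\<close>, and these are as many as the cosets inside the stabiliser
      itself.\<close>
    have "{c \<in> ?A. pt H c = S} = (\<lambda>s. rc H (s \<sqdot> w)) ` ?S"
    proof (intro equalityI subsetI)
      fix c assume "c \<in> {c \<in> ?A. pt H c = S}"
      then obtain u where u: "u \<in> G" "c = rc H u" "pt H (rc H u) = S" by auto
      then have "act (iv w) (L H) = act (iv u) (L H)" using Sw pt_rc[OF H u(1)] by simp
      then have "u \<sqdot> iv w \<in> ?S" using stab_iv_mul[OF limset_sub, of "iv w" "iv u"] u w by simp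
      moreover have "c = rc H (u \<sqdot> iv w \<sqdot> w)" using u w by simp
      ultimately show "c \<in> (\<lambda>s. rc H (s \<sqdot> w)) ` ?S" by blast
    next
      fix c assume "c \<in> (\<lambda>s. rc H (s \<sqdot> w)) ` ?S"
      then obtain s where s: "s \<in> ?S" "c = rc H (s \<sqdot> w)" by blast
      have sG': "s \<in> G" using s sG by blast
      have e: "(s \<sqdot> w) \<sqdot> iv w = s" using w sG' by simp
      have "act (iv w) (L H) = act (iv (s \<sqdot> w)) (L H)"
        using stab_iv_mul[OF limset_sub, of "iv w" "iv (s \<sqdot> w)"] s sG' w e by simp
      then have "pt H c = S" using pt_rc[OF H, of "s \<sqdot> w"] sG' w Sw s by simp
      then show "c \<in> {c \<in> ?A. pt H c = S}" using w s sG' by auto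
    qed
    moreover have "card ((\<lambda>s. rc H (s \<sqdot> w)) ` ?S) = ?k"
    proof -
      have "bij_betw (\<lambda>c. c #>\<^bsub>FG N\<^esub> w) (rc H ` ?S) ((\<lambda>s. rc H (s \<sqdot> w)) ` ?S)"
        unfolding bij_betw_def
      proof
        have e: "rc H s #>\<^bsub>FG N\<^esub> w = rc H (s \<sqdot> w)" if "s \<in> ?S" for s
          using coset_mult_assoc[OF subgroup.subset[OF H], of s w] that sG w by blast
        then show "(\<lambda>c. c #>\<^bsub>FG N\<^esub> w) ` rc H ` ?S = (\<lambda>s. rc H (s \<sqdot> w)) ` ?S"
          unfolding image_image by (intro image_cong) auto
        show "inj_on (\<lambda>c. c #>\<^bsub>FG N\<^esub> w) (rc H ` ?S)"
        proof (rule inj_onI)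
          fix x y assume "x \<in> rc H ` ?S" "y \<in> rc H ` ?S" and xy: "x #>\<^bsub>FG N\<^esub> w = y #>\<^bsub>FG N\<^esub> w"
          then obtain s t where s: "s \<in> ?S" "x = rc H s" and t: "t \<in> ?S" "y = rc H t" by blast
          have G: "s \<in> G" "t \<in> G" using s t sG by auto
          have "rc H (s \<sqdot> w) = rc H (t \<sqdot> w)" using xy e s t by simp
          then have "rc H (s \<sqdot> w \<sqdot> iv w) = rc H (t \<sqdot> w \<sqdot> iv w)"
            using rc_mul_right[OF H, of "s \<sqdot> w" "t \<sqdot> w" "iv w"] G w by simp
          then show "x = y" using G w s t by simp
        qed
      qed
      then show ?thesis using bij_betw_same_card by metis
    qed
    ultimately show "card {c \<in> ?A. pt H c = S} = ?k" by simp
  qed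
  also have "\<dots> = emeasure (count_space (rc H ` G)) ?A"
    by (rule emeasure_count_space_self[symmetric]) blast
  finally show ?thesis .
qed

lemma eta_emeasure_fin:
  assumes c: "cocpt H" and U: "U \<in> sets (CN_meas N)" "U \<subseteq> Cv []"
  shows "emeasure (eta N H) U = of_nat (card {c \<in> rc H ` thull (L H). pt H c \<in> U})"
    "finite {c \<in> rc H ` thull (L H). pt H c \<in> U}"
proof -
  have H: "subgroup H (FG N)" using c by (simp add: cocpt_def)
  have e: "{c \<in> rc H ` G. pt H c \<in> U} = {c \<in> rc H ` thull (L H). pt H c \<in> U}"
  proof (intro equalityI subsetI)
    fix c assume "c \<in> {c \<in> rc H ` G. pt H c \<in> U}"
    then obtain w where w: "w \<in> G" "c = rc H w" "pt H c \<in> U" by blast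
    then have "[] \<in> thull (pt H (rc H w))" using U(2) by (auto simp: Cv_def)
    then have "w \<in> thull (L H)" using pt_hull[OF H w(1), of "[]"] w by simp
    then show "c \<in> {c \<in> rc H ` thull (L H). pt H c \<in> U}" using w by blast
  next
    fix c assume "c \<in> {c \<in> rc H ` thull (L H). pt H c \<in> U}"
    then show "c \<in> {c \<in> rc H ` G. pt H c \<in> U}" using hull_sub by blast
  qed
  have "finite (rc H ` thull (L H))" using c by (simp add: cocpt_def cofin_def)
  then show f: "finite {c \<in> rc H ` thull (L H). pt H c \<in> U}" by simp
  have "{c \<in> rc H ` thull (L H). pt H c \<in> U} \<subseteq> rc H ` G" using e by blast
  then show "emeasure (eta N H) U = of_nat (card {c \<in> rc H ` thull (L H). pt H c \<in> U})"
    unfolding eta_emeasure[OF c U(1)] e using f by (simp add: emeasure_count_space)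
qed

text \<open>Translating a closed set corresponds to right multiplication on cosets, which permutes
  them.\<close>

lemma eta_SCurr:
  assumes c: "cocpt H"
  shows "eta N H \<in> SCurr N"
proof (rule SCurrI)
  show "emeasure (eta N H) (Cv []) < \<infinity>"
    using eta_emeasure_fin(1)[OF c sets_Cv order_refl] by (simp add: of_nat_less_top)
next
  fix g U assume g: "g \<in> G" and U: "U \<in> sets (CN_meas N)"
  have H: "subgroup H (FG N)" using c by (simp add: cocpt_def)
  let ?A = "{c \<in> rc H ` G. pt H c \<in> act g ` U}"
  let ?B = "{c \<in> rc H ` G. pt H c \<in> U}"
  have e: "rc H w #>\<^bsub>FG N\<^esub> u = rc H (w \<sqdot> u)" if "w \<in> G" "u \<in> G" for w u
    using coset_mult_assoc[OF subgroup.subset[OF H] that] .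
  have p: "pt H (rc H w) \<in> act g ` U \<longleftrightarrow> pt H (rc H (w \<sqdot> g)) \<in> U" if w: "w \<in> G" for w
  proof -
    have UC: "U \<subseteq> CN N" using sets_CN_sub[OF U] .
    have a: "act (iv g) (act (iv w) (L H)) = act (iv (w \<sqdot> g)) (L H)"
      using image_bact_mul[of "iv g" "iv w" "L H"] g w limset_sub by (simp add: inv_mult_group)
    have pw: "pt H (rc H w) = act (iv w) (L H)" "pt H (rc H (w \<sqdot> g)) = act (iv g) (act (iv w) (L H))"
      using pt_rc[OF H] w g a by simp_all
    show ?thesis
    proof (cases "act (iv w) (L H) \<in> CN N")
      case True
      then show ?thesis using act_image_mem[OF g UC True] pw by simp
    next
      case False
      then have "act (iv w) (L H) \<notin> act g ` U" using act_image_CN[OF g UC] by blast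
      moreover have "act (iv g) (act (iv w) (L H)) \<notin> CN N"
      proof
        assume "act (iv g) (act (iv w) (L H)) \<in> CN N"
        then have "act g (act (iv g) (act (iv w) (L H))) \<in> CN N" using act_CN[OF g] by blast
        then show False using False image_bact_iv(1)[OF g image_bact_bdry[OF inv_closed[OF w] limset_sub]] by simp
      qed
      ultimately show ?thesis using pw UC by auto
    qed
  qed
  have "bij_betw (\<lambda>c. c #>\<^bsub>FG N\<^esub> g) ?A ?B"
  proof (rule bij_betw_byWitness[where f' = "\<lambda>c. c #>\<^bsub>FG N\<^esub> iv g"])
    show "\<forall>a\<in>?A. a #>\<^bsub>FG N\<^esub> g #>\<^bsub>FG N\<^esub> iv g = a" using e g by auto
    show "\<forall>a\<in>?B. a #>\<^bsub>FG N\<^esub> iv g #>\<^bsub>FG N\<^esub> g = a" using e g by auto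
    show "(\<lambda>c. c #>\<^bsub>FG N\<^esub> g) ` ?A \<subseteq> ?B"
    proof
      fix c assume "c \<in> (\<lambda>c. c #>\<^bsub>FG N\<^esub> g) ` ?A"
      then obtain w where "w \<in> G" "c = rc H (w \<sqdot> g)" "pt H (rc H w) \<in> act g ` U" using e g by auto
      then show "c \<in> ?B" using p g by auto
    qed
    show "(\<lambda>c. c #>\<^bsub>FG N\<^esub> iv g) ` ?B \<subseteq> ?A"
    proof
      fix c assume "c \<in> (\<lambda>c. c #>\<^bsub>FG N\<^esub> iv g) ` ?B"
      then obtain w where w: "w \<in> G" "c = rc H (w \<sqdot> iv g)" "pt H (rc H w) \<in> U" using e g by auto
      then show "c \<in> ?A" using p[of "w \<sqdot> iv g"] g by auto
    qed
  qed
  from bij_betw_finite[OF this] bij_betw_same_card[OF this]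
  have "finite ?A \<longleftrightarrow> finite ?B" "card ?A = card ?B" .
  moreover have "?A \<subseteq> rc H ` G" "?B \<subseteq> rc H ` G" by blast+
  ultimately show "emeasure (eta N H) (act g ` U) = emeasure (eta N H) U"
    using eta_emeasure[OF c U] eta_emeasure[OF c sets_act[OF g U]] by (simp add: emeasure_count_space)
qed auto

end

section \<open>The intersection of two counting currents\<close>

context free_group
begin

section \<open>Measurability of the intersection map\<close>

definition meets :: "word \<Rightarrow> bpt set set" where
  "meets w = {S \<in> CN N. w \<in> Tr (length w) S}"

lemma sets_meets: "meets w \<in> sets (CN_meas N)"
proof (rule sets_open)
  have "S' \<in> meets w" if "S \<in> meets w" "S' \<in> CN N" "Tr (length w) S' = Tr (length w) S" for S S'
    using that by (simp add: meets_def)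
  then show "openin (CN_top N) (meets w)" unfolding openin_CN_Tr meets_def by blast
qed

text \<open>A common word of the two traces need not come from a common point. By compactness it
  does when, at every deeper level, some extension is met by both sets. This makes the trace of the
  intersection a countable combination of measurable conditions on the pair.\<close>

lemma Tr_Int_iff:
  assumes S: "S1 \<in> CN N" "S2 \<in> CN N" and w: "length w = n"
  shows "w \<in> Tr n (S1 \<inter> S2) \<longleftrightarrow> (\<forall>k. \<exists>u\<in>{u \<in> B (n + k). length u = n + k \<and> take n u = w}. S1 \<in> meets u \<and> S2 \<in> meets u)"
    (is "_ \<longleftrightarrow> ?R")
proof
  assume "w \<in> Tr n (S1 \<inter> S2)"
  then obtain \<xi> where x: "\<xi> \<in> S1 \<inter> S2" "pre n \<xi> = w" using Tr_D by blast
  show ?R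
  proof
    fix k
    have "pre (n + k) \<xi> \<in> Tr (n + k) S1" "pre (n + k) \<xi> \<in> Tr (n + k) S2" using x(1) Tr_I by blast+
    moreover have "take n (pre (n + k) \<xi>) = w" using x(2) by simp
    moreover have "pre (n + k) \<xi> \<in> B (n + k)" using x(1) CN_sub[OF S(1)] by auto
    ultimately show "\<exists>u\<in>{u \<in> B (n + k). length u = n + k \<and> take n u = w}. S1 \<in> meets u \<and> S2 \<in> meets u"
      using S by (intro bexI[of _ "pre (n + k) \<xi>"]) (simp_all add: meets_def)
  qed
next
  assume R: ?R
  have "\<forall>k. \<exists>\<zeta>. \<zeta> \<in> S1 \<and> pre n \<zeta> = w \<and> pre (n + k) \<zeta> \<in> Tr (n + k) S2"
  proof
    fix k
    obtain u where u: "length u = n + k" "take n u = w" "S1 \<in> meets u" "S2 \<in> meets u" using R by blast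
    then obtain \<zeta> where z: "\<zeta> \<in> S1" "pre (n + k) \<zeta> = u" using Tr_D[of u "n + k" S1] by (auto simp: meets_def)
    then have "pre n \<zeta> = w" using u(2) by (metis le_add1 min_absorb1 take_pre)
    then show "\<exists>\<zeta>. \<zeta> \<in> S1 \<and> pre n \<zeta> = w \<and> pre (n + k) \<zeta> \<in> Tr (n + k) S2" using z u by (auto simp: meets_def)
  qed
  then obtain \<zeta> where z: "\<And>k. \<zeta> k \<in> S1" "\<And>k. pre n (\<zeta> k) = w" "\<And>k. pre (n + k) (\<zeta> k) \<in> Tr (n + k) S2"
    by metis
  have "\<And>k. \<zeta> k \<in> bdry N" using z(1) CN_sub[OF S(1)] by blast
  then obtain \<xi> where x: "\<xi> \<in> bdry N" "\<And>m. \<exists>k\<ge>m. pre m (\<zeta> k) = pre m \<xi>" using Koenig_bdry[of \<zeta>] by blast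
  have "pre m \<xi> \<in> Tr m S1 \<and> pre m \<xi> \<in> Tr m S2" for m
  proof -
    obtain k where k: "k \<ge> m" "pre m (\<zeta> k) = pre m \<xi>" using x(2) by blast
    have "pre m (\<zeta> k) \<in> Tr m S1" using z(1) Tr_I by blast
    moreover have "take m (pre (n + k) (\<zeta> k)) \<in> Tr m S2"
      using imageI[OF z(3)[of k], of "take m"] Tr_take[of m "n + k" S2] k by simp
    ultimately show ?thesis using k by (simp add: min_def)
  qed
  then have "\<xi> \<in> S1 \<inter> S2" using CN_closed[OF S(1) x(1)] CN_closed[OF S(2) x(1)] by blast
  moreover have "pre n \<xi> = w" using x(2)[of n] z(2) by metis
  ultimately show "w \<in> Tr n (S1 \<inter> S2)" using Tr_I[of \<xi> "S1 \<inter> S2" n] by simp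
qed

abbreviation CNsq :: "(bpt set \<times> bpt set) measure" where
  "CNsq \<equiv> CN_meas N \<Otimes>\<^sub>M CN_meas N"

lemma space_CNsq: "space CNsq = CN N \<times> CN N"
  by (simp add: space_pair_measure)

lemma sets_Tr_Int_mem:
  assumes "length w = n"
  shows "{p \<in> CN N \<times> CN N. w \<in> Tr n (fst p \<inter> snd p)} \<in> sets CNsq"
proof -
  let ?I = "\<lambda>k. {u \<in> B (n + k). length u = n + k \<and> take n u = w}"
  have "{p \<in> CN N \<times> CN N. w \<in> Tr n (fst p \<inter> snd p)} = (\<Inter>k. \<Union>u\<in>?I k. meets u \<times> meets u)"
  proof (intro equalityI subsetI)
    fix p assume "p \<in> {p \<in> CN N \<times> CN N. w \<in> Tr n (fst p \<inter> snd p)}"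
    then obtain S1 S2 where p: "p = (S1, S2)" "S1 \<in> CN N" "S2 \<in> CN N" "w \<in> Tr n (S1 \<inter> S2)" by auto
    show "p \<in> (\<Inter>k. \<Union>u\<in>?I k. meets u \<times> meets u)"
      using p(1,4) unfolding Tr_Int_iff[OF p(2,3) assms] by blast
  next
    fix p assume pI: "p \<in> (\<Inter>k. \<Union>u\<in>?I k. meets u \<times> meets u)"
    obtain S1 S2 where p: "p = (S1, S2)" by (cases p)
    have R: "\<forall>k. \<exists>u\<in>?I k. S1 \<in> meets u \<and> S2 \<in> meets u" using pI p by blast
    then obtain u where "S1 \<in> meets u" "S2 \<in> meets u" by blast
    then have C: "S1 \<in> CN N" "S2 \<in> CN N" by (auto simp: meets_def)
    show "p \<in> {p \<in> CN N \<times> CN N. w \<in> Tr n (fst p \<inter> snd p)}"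
      using Tr_Int_iff[OF C assms] R C p by simp
  qed
  moreover have "(\<Inter>k. \<Union>u\<in>?I k. meets u \<times> meets u) \<in> sets CNsq"
  proof -
    have "(\<Union>u\<in>?I k. meets u \<times> meets u) \<in> sets CNsq" for k
    proof -
      have "finite (?I k)" using finite_ball[of "n + k"] by (rule rev_finite_subset) blast
      then show ?thesis using sets_meets by (intro sets.finite_UN) auto
    qed
    then show ?thesis by (intro sets.countable_INT) auto
  qed
  ultimately show ?thesis by simp
qed

lemma Tr_len: "w \<in> Tr n S \<Longrightarrow> length w = n"
  by (auto simp: Tr_def)

lemma sets_Tr_Int_eq: "{p \<in> CN N \<times> CN N. Tr n (fst p \<inter> snd p) = A} \<in> sets CNsq"
proof (cases "A \<subseteq> {w \<in> B n. length w = n}")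
  case True
  let ?E = "\<lambda>w. {p \<in> CN N \<times> CN N. w \<in> Tr n (fst p \<inter> snd p)}"
  let ?W = "{w \<in> B n. length w = n}"
  have fin: "finite ?W" using finite_ball[of n] by (rule rev_finite_subset) blast
  have sub: "Tr n (fst p \<inter> snd p) \<subseteq> ?W" if "p \<in> CN N \<times> CN N" for p
    using Tr_sub[of "fst p \<inter> snd p" n] CN_sub[of "fst p"] that Tr_len by fastforce
  have "{p \<in> CN N \<times> CN N. Tr n (fst p \<inter> snd p) = A} =
    {p \<in> space CNsq. \<forall>w\<in>?W. p \<in> (if w \<in> A then ?E w else space CNsq - ?E w)}"
  proof -
    have "Tr n (fst p \<inter> snd p) = A \<longleftrightarrow> (\<forall>w\<in>?W. p \<in> (if w \<in> A then ?E w else space CNsq - ?E w))"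
      if p: "p \<in> CN N \<times> CN N" for p
      using sub[OF p] True p unfolding space_CNsq by auto
    then show ?thesis unfolding space_CNsq by blast
  qed
  moreover have "{p \<in> space CNsq. \<forall>w\<in>?W. p \<in> (if w \<in> A then ?E w else space CNsq - ?E w)} \<in> sets CNsq"
  proof (rule sets.sets_Collect_finite_All[OF _ fin])
    fix w assume w: "w \<in> ?W"
    have E: "?E w \<in> sets CNsq" using sets_Tr_Int_mem[of w n] w by simp
    define V where "V = (if w \<in> A then ?E w else space CNsq - ?E w)"
    have "V \<in> sets CNsq" unfolding V_def using E by auto
    moreover from this have "{p \<in> space CNsq. p \<in> V} = V" using sets.sets_into_space by blast
    ultimately show "{p \<in> space CNsq. p \<in> (if w \<in> A then ?E w else space CNsq - ?E w)} \<in> sets CNsq"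
      unfolding V_def[symmetric] by (simp only:)
  qed
  ultimately show ?thesis by (simp only:)
next
  case False
  have "Tr n (fst p \<inter> snd p) \<subseteq> {w \<in> B n. length w = n}" if "p \<in> CN N \<times> CN N" for p
    using Tr_sub[of "fst p \<inter> snd p" n] CN_sub[of "fst p"] that Tr_len by fastforce
  then have "{p \<in> CN N \<times> CN N. Tr n (fst p \<inter> snd p) = A} = {}" using False by blast
  then show ?thesis by (metis sets.empty_sets)
qed

lemma closedin_Int_CN: "S1 \<in> CN N \<Longrightarrow> S2 \<in> CN N \<Longrightarrow> closedin (bdry_top N) (S1 \<inter> S2)"
  by (auto simp: CN_iff)

text \<open>The intersection need not depend continuously on the pair, so the preimage is decomposed
  by traces instead. A trace is \<open>good\<close> if it has two words, so that the intersection
  has two points, and if it forces membership in \<open>U\<close>.\<close>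

lemma sets_Int_open:
  assumes U: "openin (CN_top N) U"
  shows "{p \<in> CN N \<times> CN N. fst p \<inter> snd p \<in> U} \<in> sets CNsq"
proof -
  define good where "good = (\<lambda>(m, A). (\<exists>x\<in>A. \<exists>y\<in>A. x \<noteq> y) \<and> (\<forall>S'\<in>CN N. Tr m S' = A \<longrightarrow> S' \<in> U))"
  let ?E = "\<lambda>m A. {p \<in> CN N \<times> CN N. Tr m (fst p \<inter> snd p) = A}"
  have UC: "U \<subseteq> CN N" using U openin_subset by fastforce
  have "{p \<in> CN N \<times> CN N. fst p \<inter> snd p \<in> U} = (\<Union>m. \<Union>A\<in>{A \<in> Pow (B m). good (m, A)}. ?E m A)"
  proof (intro equalityI subsetI)
    fix p assume p: "p \<in> {p \<in> CN N \<times> CN N. fst p \<inter> snd p \<in> U}"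
    let ?S = "fst p \<inter> snd p"
    have S: "?S \<in> U" "?S \<in> CN N" using p UC by auto
    obtain m where m: "\<forall>S'\<in>CN N. Tr m S' = Tr m ?S \<longrightarrow> S' \<in> U" using U S(1) unfolding openin_CN_Tr by blast
    obtain x y where xy0: "x \<in> ?S" "y \<in> ?S" "x \<noteq> y" using S(2) unfolding CN_iff by blast
    then obtain i where "x i \<noteq> y i" by (meson ext)
    note xy = xy0(1,2) this
    define n where "n = max m (Suc i)"
    have "i < n" by (simp add: n_def)
    then have "pre n x \<noteq> pre n y" using xy(3) unfolding pre_eq_iff by blast
    moreover have "pre n x \<in> Tr n ?S" "pre n y \<in> Tr n ?S" using Tr_I xy by blast+
    moreover have "S' \<in> U" if "S' \<in> CN N" "Tr n S' = Tr n ?S" for S'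
      using m that Tr_le[OF that(2), of m] by (simp add: n_def)
    ultimately have "good (n, Tr n ?S)" unfolding good_def by blast
    moreover have "Tr n ?S \<in> Pow (B n)" using Tr_sub[OF CN_sub[OF S(2)], of n] by blast
    ultimately show "p \<in> (\<Union>m. \<Union>A\<in>{A \<in> Pow (B m). good (m, A)}. ?E m A)" using p by blast
  next
    fix p assume "p \<in> (\<Union>m. \<Union>A\<in>{A \<in> Pow (B m). good (m, A)}. ?E m A)"
    then obtain m where p: "p \<in> CN N \<times> CN N" "good (m, Tr m (fst p \<inter> snd p))" by blast
    let ?S = "fst p \<inter> snd p"
    obtain u v where "u \<in> Tr m ?S" "v \<in> Tr m ?S" "u \<noteq> v" using p(2) by (auto simp: good_def)
    then have "\<exists>x\<in>?S. \<exists>y\<in>?S. x \<noteq> y" using Tr_D by metis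
    then have "?S \<in> CN N" using closedin_Int_CN[of "fst p" "snd p"] p(1) unfolding CN_iff[of ?S] by auto
    then show "p \<in> {p \<in> CN N \<times> CN N. fst p \<inter> snd p \<in> U}" using p by (auto simp: good_def)
  qed
  moreover have "(\<Union>m. \<Union>A\<in>{A \<in> Pow (B m). good (m, A)}. ?E m A) \<in> sets CNsq"
  proof (rule sets.countable_UN'')
    fix m
    have "finite {A \<in> Pow (B m). good (m, A)}" using finite_ball by simp
    then show "(\<Union>A\<in>{A \<in> Pow (B m). good (m, A)}. ?E m A) \<in> sets CNsq"
      using sets_Tr_Int_eq by (intro sets.finite_UN) auto
  qed simp
  ultimately show ?thesis by simp
qed

lemma sets_Int:
  assumes U: "U \<in> sets (CN_meas N)"
  shows "{p \<in> CN N \<times> CN N. fst p \<inter> snd p \<in> U} \<in> sets CNsq"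
  using U unfolding sets_CN_meas
proof (induction rule: sigma_sets.induct)
  case (Basic a)
  then show ?case using sets_Int_open by simp
next
  case Empty
  then show ?case by simp
next
  case (Compl a)
  \<comment> \<open>A pair whose intersection has fewer than two points lies in the preimage of
    neither \<open>a\<close> nor its complement, so the difference is taken within the preimage of
    \<open>CN N\<close>.\<close>
  have "openin (CN_top N) (CN N)" using openin_topspace[of "CN_top N"] by simp
  from sets.Diff[OF sets_Int_open[OF this] Compl.IH]
  show ?case by (rule back_subst[of "\<lambda>X. X \<in> sets CNsq"]) blast
next
  case (Union a)
  have "{p \<in> CN N \<times> CN N. fst p \<inter> snd p \<in> \<Union> (range a)} = (\<Union>i. {p \<in> CN N \<times> CN N. fst p \<inter> snd p \<in> a i})" by blast
  then show ?case using Union by (simp add: sets.countable_UN)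
qed

lemma SCurr_sigma_finite:
  assumes m: "\<mu> \<in> SCurr N"
  shows "sigma_finite_measure \<mu>"
proof
  show "\<exists>A. countable A \<and> A \<subseteq> sets \<mu> \<and> \<Union> A = space \<mu> \<and> (\<forall>a\<in>A. emeasure \<mu> a \<noteq> \<infinity>)"
  proof (intro exI[of _ "Cv ` G"] conjI ballI)
    show "countable (Cv ` G)" using countable_G by blast
    show "Cv ` G \<subseteq> sets \<mu>" using sets_Cv SCurr_sets[OF m] by auto
    show "\<Union> (Cv ` G) = space \<mu>"
    proof
      show "\<Union> (Cv ` G) \<subseteq> space \<mu>" using SCurr_space[OF m] by (auto simp: Cv_def)
      show "space \<mu> \<subseteq> \<Union> (Cv ` G)"
      proof
        fix S assume "S \<in> space \<mu>"
        then have S: "S \<in> CN N" using SCurr_space[OF m] by simp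
        then obtain v where "v \<in> thull S" using CN_hull_ne by blast
        then show "S \<in> \<Union> (Cv ` G)" using S hull_in_G by (auto simp: Cv_def)
      qed
    qed
    fix a assume "a \<in> Cv ` G"
    then obtain v where v: "v \<in> G" "a = Cv v" by blast
    have "emeasure \<mu> (Cv v) = emeasure \<mu> (Cv [])"
      using SCurr_inv[OF m v(1) sets_Cv[of "[]"]] act_Cv[OF v(1), of "[]"] v by simp
    then show "emeasure \<mu> a \<noteq> \<infinity>" using SCurr_fin[OF m] v by simp
  qed
qed

lemma pt_measurable:
  assumes "subgroup H (FG N)" "H \<noteq> {[]}"
  shows "pt H \<in> measurable (count_space (rc H ` G)) (CN_meas N)"
  using pt_CN[OF assms] by simp

lemma eta_distr:
  assumes c: "cocpt H" "H \<noteq> {[]}"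
  shows "eta N H = distr (count_space (rc H ` G)) (CN_meas N) (pt H)"
proof (rule measure_eqI)
  have H: "subgroup H (FG N)" using c by (simp add: cocpt_def)
  fix U assume "U \<in> sets (eta N H)"
  then have U: "U \<in> sets (CN_meas N)" by simp
  have "pt H -` U \<inter> rc H ` G = {c \<in> rc H ` G. pt H c \<in> U}" by blast
  then show "emeasure (eta N H) U = emeasure (distr (count_space (rc H ` G)) (CN_meas N) (pt H)) U"
    using eta_emeasure[OF c(1) U] emeasure_distr[OF pt_measurable[OF H c(2)] U] by simp
qed simp

lemma countable_rc: "countable (rc H ` G)"
  using countable_G by blast

text \<open>Both factors are images of counting measures on countable sets of cosets; iterated
  integration then turns the product measure into a count of pairs of cosets.\<close>

lemma eta_pair_emeasure:
  assumes H: "cocpt H" "H \<noteq> {[]}" and K: "cocpt K" "K \<noteq> {[]}" and U: "U \<in> sets (CN_meas N)"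
  shows "emeasure (eta N H \<Otimes>\<^sub>M eta N K) {p \<in> CN N \<times> CN N. fst p \<inter> snd p \<in> U} =
    emeasure (count_space (rc H ` G \<times> rc K ` G)) {p \<in> rc H ` G \<times> rc K ` G. pt H (fst p) \<inter> pt K (snd p) \<in> U}"
    (is "emeasure _ ?X = emeasure _ ?Y")
proof -
  have sH: "subgroup H (FG N)" and sK: "subgroup K (FG N)" using H K by (auto simp: cocpt_def)
  let ?RH = "rc H ` G" and ?RK = "rc K ` G"
  interpret K: sigma_finite_measure "eta N K" using SCurr_sigma_finite[OF eta_SCurr[OF K(1)]] .
  interpret cK: sigma_finite_measure "count_space ?RK"
    using sigma_finite_measure_count_space_countable[OF countable_rc] .
  have X: "?X \<in> sets (eta N H \<Otimes>\<^sub>M eta N K)" using sets_Int[OF U] by simp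
  have Xm: "(\<lambda>(x, y). indicator ?X (x, y) :: ennreal) \<in> borel_measurable (eta N H \<Otimes>\<^sub>M eta N K)"
    using borel_measurable_indicator[OF X] by (simp only: case_prod_eta)
  have "emeasure (eta N H \<Otimes>\<^sub>M eta N K) ?X = (\<integral>\<^sup>+ x. \<integral>\<^sup>+ y. indicator ?X (x, y) \<partial>eta N K \<partial>eta N H)"
    using K.emeasure_pair_measure[OF X] .
  also have "\<dots> = (\<integral>\<^sup>+ c. (\<integral>\<^sup>+ y. indicator ?X (pt H c, y) \<partial>eta N K) \<partial>count_space ?RH)"
  proof -
    have "(\<lambda>x. \<integral>\<^sup>+ y. indicator ?X (x, y) \<partial>eta N K) \<in> borel_measurable (eta N H)"
      using K.borel_measurable_nn_integral[OF Xm] .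
    then have "(\<lambda>x. \<integral>\<^sup>+ y. indicator ?X (x, y) \<partial>eta N K) \<in> borel_measurable (CN_meas N)"
      by (simp cong: measurable_cong_sets)
    then show ?thesis
      unfolding eta_distr[OF H] by (intro nn_integral_distr[OF pt_measurable[OF sH H(2)]]) simp
  qed
  also have "\<dots> = (\<integral>\<^sup>+ c. (\<integral>\<^sup>+ d. indicator ?X (pt H c, pt K d) \<partial>count_space ?RK) \<partial>count_space ?RH)"
  proof (rule nn_integral_cong)
    fix c assume "c \<in> space (count_space ?RH)"
    then have c: "pt H c \<in> space (eta N H)" using pt_CN[OF sH H(2)] by simp
    have "Pair (pt H c) -` ?X \<in> sets (eta N K)" using sets_Pair1[OF X] .
    moreover have "(\<lambda>y. indicator ?X (pt H c, y) :: ennreal) = indicator (Pair (pt H c) -` ?X)"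
      by (auto simp: indicator_def)
    ultimately have "(\<lambda>y. indicator ?X (pt H c, y) :: ennreal) \<in> borel_measurable (CN_meas N)" by simp
    then show "(\<integral>\<^sup>+ y. indicator ?X (pt H c, y) \<partial>eta N K) = (\<integral>\<^sup>+ d. indicator ?X (pt H c, pt K d) \<partial>count_space ?RK)"
      unfolding eta_distr[OF K] by (intro nn_integral_distr[OF pt_measurable[OF sK K(2)]]) simp
  qed
  also have "\<dots> = (\<integral>\<^sup>+ c. (\<integral>\<^sup>+ d. indicator ?Y (c, d) \<partial>count_space ?RK) \<partial>count_space ?RH)"
    using pt_CN[OF sH H(2)] pt_CN[OF sK K(2)]
    by (intro nn_integral_cong) (auto simp: indicator_def)
  also have "\<dots> = emeasure (count_space ?RH \<Otimes>\<^sub>M count_space ?RK) ?Y"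
  proof (rule cK.emeasure_pair_measure[symmetric])
    show "?Y \<in> sets (count_space ?RH \<Otimes>\<^sub>M count_space ?RK)"
      unfolding pair_measure_countable[OF countable_rc countable_rc] sets_count_space by blast
  qed
  finally show ?thesis unfolding pair_measure_countable[OF countable_rc countable_rc] .
qed

section \<open>Double cosets and diagonal orbits\<close>

definition dc :: "word set \<Rightarrow> word set \<Rightarrow> word \<Rightarrow> word set" where
  "dc H K g = H <#>\<^bsub>FG N\<^esub> (g <#\<^bsub>FG N\<^esub> K)"

lemma mem_dc: "x \<in> dc H K g \<longleftrightarrow> (\<exists>h\<in>H. \<exists>k\<in>K. x = h \<sqdot> (g \<sqdot> k))"
  by (auto simp: dc_def set_mult_def l_coset_def)

lemma dc_self: "subgroup H (FG N) \<Longrightarrow> subgroup K (FG N) \<Longrightarrow> g \<in> G \<Longrightarrow> g \<in> dc H K g"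
  unfolding mem_dc by (rule bexI[of _ "[]"], rule bexI[of _ "[]"]) (auto intro: sub_Nil)

lemma dc_eqI:
  assumes H: "subgroup H (FG N)" and K: "subgroup K (FG N)" and g: "g \<in> G" and x: "x \<in> dc H K g"
  shows "dc H K x = dc H K g"
proof -
  obtain h k where hk: "h \<in> H" "k \<in> K" "x = h \<sqdot> (g \<sqdot> k)" using x unfolding mem_dc by blast
  have G: "h \<in> G" "k \<in> G" using hk sub_G[OF H] sub_G[OF K] by blast+
  show ?thesis
  proof (intro equalityI subsetI)
    fix z assume "z \<in> dc H K x"
    then obtain h' k' where z: "h' \<in> H" "k' \<in> K" "z = h' \<sqdot> (x \<sqdot> k')" unfolding mem_dc by blast
    have G': "h' \<in> G" "k' \<in> G" using z sub_G[OF H] sub_G[OF K] by blast+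
    have "z = (h' \<sqdot> h) \<sqdot> (g \<sqdot> (k \<sqdot> k'))" using z hk G G' g by (simp add: m_assoc)
    then show "z \<in> dc H K g" unfolding mem_dc using sub_mul[OF H z(1) hk(1)] sub_mul[OF K hk(2) z(2)] by blast
  next
    fix z assume "z \<in> dc H K g"
    then obtain h' k' where z: "h' \<in> H" "k' \<in> K" "z = h' \<sqdot> (g \<sqdot> k')" unfolding mem_dc by blast
    have G': "h' \<in> G" "k' \<in> G" using z sub_G[OF H] sub_G[OF K] by blast+
    have "z = (h' \<sqdot> iv h) \<sqdot> (x \<sqdot> (iv k \<sqdot> k'))" using z hk G G' g by (simp add: m_assoc)
    then show "z \<in> dc H K x" unfolding mem_dc
      using sub_mul[OF H z(1) sub_iv[OF H hk(1)]] sub_mul[OF K sub_iv[OF K hk(2)] z(2)] by blast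
  qed
qed

lemma dcosets_eq: "dcosets N H K = dc H K ` G"
  by (auto simp: dcosets_def dc_def)

lemma dcrep:
  assumes "D \<in> dcosets N H K"
  shows "dcrep N H K D \<in> G" "D = dc H K (dcrep N H K D)"
proof -
  have "\<exists>g. g \<in> G \<and> D = H <#>\<^bsub>FG N\<^esub> (g <#\<^bsub>FG N\<^esub> K)" using assms by (auto simp: dcosets_def)
  from someI_ex[OF this] show "dcrep N H K D \<in> G" "D = dc H K (dcrep N H K D)"
    unfolding dcrep_def dc_def by blast+
qed

text \<open>The pairs of cosets in the diagonal orbit belonging to the double coset of \<open>g\<close>.\<close>

definition psi :: "word set \<Rightarrow> word set \<Rightarrow> word \<Rightarrow> word \<Rightarrow> word set \<times> word set" where
  "psi H K g w = (rc H w, rc K (iv g \<sqdot> w))"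

lemma psi_eq_iff:
  assumes H: "subgroup H (FG N)" and K: "subgroup K (FG N)" and g: "g \<in> G" and w: "w \<in> G" "w' \<in> G"
  shows "psi H K g w = psi H K g w' \<longleftrightarrow> rc (H \<inter> conjg N g K) w = rc (H \<inter> conjg N g K) w'"
proof -
  have J: "subgroup (H \<inter> conjg N g K) (FG N)" using subgroups_Inter_pair[OF H subgroup_conjg[OF K g]] .
  have "w \<sqdot> iv w' \<in> conjg N g K \<longleftrightarrow> iv g \<sqdot> w \<sqdot> iv (iv g \<sqdot> w') \<in> K"
    using mem_conjg[OF g subgroup.subset[OF K]] g w by (simp add: inv_mult_group m_assoc)
  then show ?thesis unfolding psi_def using rc_eq_iff[OF H w] rc_eq_iff[OF J w] rc_eq_iff[OF K, of "iv g \<sqdot> w" "iv g \<sqdot> w'"] g w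
    by simp
qed

text \<open>The pair of cosets of \<open>x\<close> and \<open>y\<close> belongs to the double coset
  of \<open>x \<sqdot> iv y\<close>.\<close>

lemma psi_cover:
  assumes H: "subgroup H (FG N)" and K: "subgroup K (FG N)" and x: "x \<in> G" "y \<in> G"
  shows "\<exists>D\<in>dcosets N H K. \<exists>w\<in>G. psi H K (dcrep N H K D) w = (rc H x, rc K y)"
proof -
  let ?D = "dc H K (x \<sqdot> iv y)"
  have D: "?D \<in> dcosets N H K" unfolding dcosets_eq using x by blast
  let ?g = "dcrep N H K ?D"
  have g: "?g \<in> G" "?D = dc H K ?g" using dcrep[OF D] by blast+
  have "x \<sqdot> iv y \<in> dc H K ?g" using dc_self[OF H K, of "x \<sqdot> iv y"] x g(2) by simp
  then obtain h k where hk: "h \<in> H" "k \<in> K" "x \<sqdot> iv y = h \<sqdot> (?g \<sqdot> k)" unfolding mem_dc by blast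
  have G: "h \<in> G" "k \<in> G" using hk sub_G[OF H] sub_G[OF K] by blast+
  have "iv ?g \<sqdot> (iv h \<sqdot> x) = k \<sqdot> y"
  proof -
    have "x = x \<sqdot> iv y \<sqdot> y" using x by simp
    also have "\<dots> = h \<sqdot> (?g \<sqdot> k) \<sqdot> y" using hk(3) by simp
    finally have "iv ?g \<sqdot> (iv h \<sqdot> x) = iv ?g \<sqdot> (iv h \<sqdot> (h \<sqdot> (?g \<sqdot> k) \<sqdot> y))" by simp
    then show ?thesis using G g(1) x by (simp add: m_assoc)
  qed
  then have "psi H K ?g (iv h \<sqdot> x) = (rc H x, rc K y)" unfolding psi_def
    using rc_mul_left[OF H sub_iv[OF H hk(1)] x(1)] rc_mul_left[OF K hk(2) x(2)] by simp
  then show ?thesis using D G x by (intro bexI[of _ ?D] bexI[of _ "iv h \<sqdot> x"]) auto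
qed

lemma psi_disjoint:
  assumes H: "subgroup H (FG N)" and K: "subgroup K (FG N)" and D: "D \<in> dcosets N H K" "D' \<in> dcosets N H K"
    and w: "w \<in> G" "w' \<in> G" and e: "psi H K (dcrep N H K D) w = psi H K (dcrep N H K D') w'"
  shows "D = D'"
proof -
  let ?g = "dcrep N H K D" and ?g' = "dcrep N H K D'"
  have g: "?g \<in> G" "D = dc H K ?g" "?g' \<in> G" "D' = dc H K ?g'" using dcrep D by blast+
  have h: "w' \<sqdot> iv w \<in> H" using e rc_eq_iff[OF H w(2,1)] by (simp add: psi_def)
  have k: "(iv ?g \<sqdot> w) \<sqdot> iv (iv ?g' \<sqdot> w') \<in> K"
    using e rc_eq_iff[OF K, of "iv ?g \<sqdot> w" "iv ?g' \<sqdot> w'"] g w by (simp add: psi_def)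
  have "?g' = (w' \<sqdot> iv w) \<sqdot> (?g \<sqdot> ((iv ?g \<sqdot> w) \<sqdot> iv (iv ?g' \<sqdot> w')))"
    using g(1,3) w by (simp add: inv_mult_group m_assoc)
  then have "?g' \<in> dc H K ?g" unfolding mem_dc using h k by blast
  then show ?thesis using dc_eqI[OF H K g(1)] g by simp
qed

lemma act_Int: "g \<in> G \<Longrightarrow> S \<subseteq> bdry N \<Longrightarrow> S' \<subseteq> bdry N \<Longrightarrow> act g (S \<inter> S') = act g S \<inter> act g S'"
  using inj_on_image_Int[OF inj_on_bact] .

lemma psi_pt:
  assumes H: "cocpt H" "H \<noteq> {[]}" and K: "cocpt K" "K \<noteq> {[]}" and g: "g \<in> G" and w: "w \<in> G"
  shows "pt H (fst (psi H K g w)) \<inter> pt K (snd (psi H K g w)) = pt (H \<inter> conjg N g K) (rc (H \<inter> conjg N g K) w)"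
proof -
  have sH: "subgroup H (FG N)" and sK: "subgroup K (FG N)" using H K by (auto simp: cocpt_def)
  have KG: "K \<subseteq> G" using subgroup.subset[OF sK] .
  let ?K = "conjg N g K"
  have J: "subgroup (H \<inter> ?K) (FG N)" using subgroups_Inter_pair[OF sH subgroup_conjg[OF sK g]] .
  have LJ: "L (H \<inter> ?K) = L H \<inter> act g (L K)"
    using cocpt_Int(2)[OF H(1) cocpt_conjg[OF K(1) g] H(2) conjg_nontriv[OF g KG K(2)]] limset_conjg[OF KG g] by simp
  have "act (iv (iv g \<sqdot> w)) (L K) = act (iv w) (act g (L K))"
    using image_bact_mul[of "iv w" g "L K"] limset_sub g w by (simp add: inv_mult_group)
  then have "pt H (rc H w) \<inter> pt K (rc K (iv g \<sqdot> w)) = act (iv w) (L H) \<inter> act (iv w) (act g (L K))"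
    using pt_rc[OF sH w] pt_rc[OF sK, of "iv g \<sqdot> w"] g w by simp
  also have "\<dots> = act (iv w) (L (H \<inter> ?K))"
    unfolding LJ using act_Int[of "iv w" "L H" "act g (L K)"] w limset_sub image_bact_bdry[OF g limset_sub] by simp
  finally show ?thesis using pt_rc[OF J w] by (simp add: psi_def)
qed

lemma cocpt_J:
  assumes H: "cocpt H" "H \<noteq> {[]}" and K: "cocpt K" "K \<noteq> {[]}" and g: "g \<in> G"
  shows "cocpt (H \<inter> conjg N g K)"
proof -
  have sK: "subgroup K (FG N)" using K by (auto simp: cocpt_def)
  show ?thesis
    using cocpt_Int(3)[OF H(1) cocpt_conjg[OF K(1) g] H(2) conjg_nontriv[OF g subgroup.subset[OF sK] K(2)]] .
qed

lemma pair_count_decomp: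
  assumes H: "cocpt H" "H \<noteq> {[]}" and K: "cocpt K" "K \<noteq> {[]}" and U: "U \<in> sets (CN_meas N)"
  shows "emeasure (count_space (rc H ` G \<times> rc K ` G)) {p \<in> rc H ` G \<times> rc K ` G. pt H (fst p) \<inter> pt K (snd p) \<in> U}
    = (\<integral>\<^sup>+ D. emeasure (eta N (H \<inter> conjg N (dcrep N H K D) K)) U \<partial>count_space (dcosets N H K))"
proof -
  have sH: "subgroup H (FG N)" and sK: "subgroup K (FG N)" using H K by (auto simp: cocpt_def)
  let ?Y = "{p \<in> rc H ` G \<times> rc K ` G. pt H (fst p) \<inter> pt K (snd p) \<in> U}"
  let ?M = "count_space (rc H ` G \<times> rc K ` G)"
  let ?g = "dcrep N H K"
  define J where "J D = H \<inter> conjg N (?g D) K" for D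
  define X where "X D = {psi H K (?g D) w | w. w \<in> G \<and> pt (J D) (rc (J D) w) \<in> U}" for D
  have gG: "?g D \<in> G" if "D \<in> dcosets N H K" for D using dcrep(1)[OF that] .
  have inR: "psi H K g w \<in> rc H ` G \<times> rc K ` G" if "g \<in> G" "w \<in> G" for g w
    using that by (simp add: psi_def)
  have XR: "X D \<subseteq> rc H ` G \<times> rc K ` G" if "D \<in> dcosets N H K" for D
  proof
    fix p assume "p \<in> X D"
    then obtain w where "w \<in> G" "p = psi H K (?g D) w" unfolding X_def by blast
    then show "p \<in> rc H ` G \<times> rc K ` G" using inR[OF gG[OF that]] by simp
  qed
  have YX: "?Y = \<Union> (X ` dcosets N H K)"
  proof (intro equalityI subsetI)
    fix p assume p: "p \<in> ?Y"
    then obtain x y where xy: "x \<in> G" "y \<in> G" "p = (rc H x, rc K y)" by auto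
    obtain D w where D: "D \<in> dcosets N H K" "w \<in> G" "psi H K (?g D) w = p"
      using psi_cover[OF sH sK xy(1,2)] xy(3) by blast
    have "pt (J D) (rc (J D) w) \<in> U" using psi_pt[OF H K gG[OF D(1)] D(2)] D(3) p by (simp add: J_def)
    then have "p \<in> X D" using D unfolding X_def by blast
    then show "p \<in> \<Union> (X ` dcosets N H K)" using D(1) by blast
  next
    fix p assume "p \<in> \<Union> (X ` dcosets N H K)"
    then obtain D w where D: "D \<in> dcosets N H K" "w \<in> G" "p = psi H K (?g D) w" "pt (J D) (rc (J D) w) \<in> U"
      by (auto simp: X_def)
    then show "p \<in> ?Y" using psi_pt[OF H K gG[OF D(1)] D(2)] inR[OF gG[OF D(1)] D(2)] by (simp add: J_def)
  qed
  have "emeasure ?M (\<Union> (X ` dcosets N H K)) = (\<integral>\<^sup>+ D. emeasure ?M (X D) \<partial>count_space (dcosets N H K))"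
  proof (rule emeasure_UN_countable)
    show "countable (dcosets N H K)" unfolding dcosets_eq using countable_G by blast
    show "disjoint_family_on X (dcosets N H K)" unfolding disjoint_family_on_def
    proof (intro ballI impI)
      fix D D' assume D: "D \<in> dcosets N H K" "D' \<in> dcosets N H K" "D \<noteq> D'"
      show "X D \<inter> X D' = {}"
      proof (rule ccontr)
        assume "X D \<inter> X D' \<noteq> {}"
        then obtain w w' where "w \<in> G" "w' \<in> G" "psi H K (?g D) w = psi H K (?g D') w'" unfolding X_def by blast
        then show False using psi_disjoint[OF sH sK D(1,2)] D(3) by blast
      qed
    qed
  qed (use XR in auto)
  also have "\<dots> = (\<integral>\<^sup>+ D. emeasure (eta N (J D)) U \<partial>count_space (dcosets N H K))"
  proof (rule nn_integral_cong)
    fix D assume "D \<in> space (count_space (dcosets N H K))"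
    then have D: "D \<in> dcosets N H K" by simp
    let ?J = "J D"
    have c: "cocpt ?J" using cocpt_J[OF H K gG[OF D]] by (simp add: J_def)
    let ?A = "{c \<in> rc ?J ` G. pt ?J c \<in> U}"
    let ?W = "{w \<in> G. pt ?J (rc ?J w) \<in> U}"
    have A: "?A = rc ?J ` ?W" by blast
    have X: "X D = psi H K (?g D) ` ?W" by (auto simp: X_def)
    have iff: "psi H K (?g D) w = psi H K (?g D) w' \<longleftrightarrow> rc ?J w = rc ?J w'" if "w \<in> ?W" "w' \<in> ?W" for w w'
      using psi_eq_iff[OF sH sK gG[OF D]] that by (simp add: J_def)
    \<comment> \<open>By \<open>psi_eq_iff\<close> the map \<open>psi\<close> factors through the
      cosets of \<open>?J\<close>; \<open>f\<close> is the induced bijection, evaluated at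
      representatives chosen inside \<open>?W\<close>.\<close>
    define f where "f c = psi H K (?g D) (inv_into ?W (rc ?J) c)" for c
    have f: "f (rc ?J w) = psi H K (?g D) w" if w: "w \<in> ?W" for w
    proof -
      have "inv_into ?W (rc ?J) (rc ?J w) \<in> ?W" "rc ?J (inv_into ?W (rc ?J) (rc ?J w)) = rc ?J w"
        using inv_into_into[OF imageI[OF w], of "rc ?J"] f_inv_into_f[OF imageI[OF w], of "rc ?J"] by blast+
      then show ?thesis unfolding f_def using iff w by blast
    qed
    have "bij_betw f ?A (X D)" unfolding A X bij_betw_def
    proof
      show "inj_on f (rc ?J ` ?W)"
      proof (rule inj_onI)
        fix a b assume "a \<in> rc ?J ` ?W" "b \<in> rc ?J ` ?W" and ab: "f a = f b"
        then obtain w w' where w: "w \<in> ?W" "a = rc ?J w" "w' \<in> ?W" "b = rc ?J w'" by blast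
        then show "a = b" using ab f[OF w(1)] f[OF w(3)] iff[OF w(1,3)] by simp
      qed
      show "f ` rc ?J ` ?W = psi H K (?g D) ` ?W" unfolding image_image using f by (rule image_cong[OF refl])
    qed
    from bij_betw_finite[OF this] bij_betw_same_card[OF this]
    have "finite ?A \<longleftrightarrow> finite (X D)" "card ?A = card (X D)" .
    moreover have "?A \<subseteq> rc ?J ` G" by blast
    ultimately show "emeasure ?M (X D) = emeasure (eta N ?J) U"
      using eta_emeasure[OF c U] XR[OF D] by (simp add: emeasure_count_space)
  qed
  finally show ?thesis unfolding YX J_def .
qed

theorem Ihat_eq_dsum:
  assumes H: "cocpt H" "H \<noteq> {[]}" and K: "cocpt K" "K \<noteq> {[]}"
  shows "Ihat N (eta N H) (eta N K) = dsum_eta N H K"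
  unfolding Ihat_def dsum_eta_def
proof (rule measure_of_eq)
  show "sets (CN_meas N) \<subseteq> Pow (CN N)" using sets_CN_sub by blast
  fix U assume "U \<in> sigma_sets (CN N) (sets (CN_meas N))"
  then have U: "U \<in> sets (CN_meas N)" using sets.sigma_sets_eq[of "CN_meas N"] by simp
  have "(\<lambda>p. fst p \<inter> snd p) -` U \<inter> space (eta N H \<Otimes>\<^sub>M eta N K) = {p \<in> CN N \<times> CN N. fst p \<inter> snd p \<in> U}"
    by (auto simp: space_pair_measure)
  then show "emeasure (eta N H \<Otimes>\<^sub>M eta N K) ((\<lambda>p. fst p \<inter> snd p) -` U \<inter> space (eta N H \<Otimes>\<^sub>M eta N K)) =
    (\<integral>\<^sup>+ D. emeasure (eta N (H \<inter> conjg N (dcrep N H K D) K)) U \<partial>count_space (dcosets N H K))"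
    using eta_pair_emeasure[OF H K U] pair_count_decomp[OF H K U] by simp
qed

lemma space_dsum [simp]: "space (dsum_eta N H K) = CN N"
  unfolding dsum_eta_def by (rule space_measure_of) (use sets_CN_sub in blast)

lemma sets_dsum [simp]: "sets (dsum_eta N H K) = sets (CN_meas N)"
proof -
  have "sets (dsum_eta N H K) = sigma_sets (CN N) (sets (CN_meas N))"
    unfolding dsum_eta_def by (rule sets_measure_of) (use sets_CN_sub in blast)
  then show ?thesis using sets.sigma_sets_eq[of "CN_meas N"] by simp
qed

lemma emeasure_dsum:
  assumes U: "U \<in> sets (CN_meas N)"
  shows "emeasure (dsum_eta N H K) U =
    (\<integral>\<^sup>+ D. emeasure (eta N (H \<inter> conjg N (dcrep N H K D) K)) U \<partial>count_space (dcosets N H K))"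
proof (rule emeasure_measure_of[OF dsum_eta_def])
  show "sets (CN_meas N) \<subseteq> Pow (CN N)" using sets_CN_sub by blast
  show "U \<in> sets (dsum_eta N H K)" using U by simp
  show "positive (sets (dsum_eta N H K))
     (\<lambda>U. \<integral>\<^sup>+ D. emeasure (eta N (H \<inter> conjg N (dcrep N H K D) K)) U \<partial>count_space (dcosets N H K))"
    by (simp add: positive_def)
  show "countably_additive (sets (dsum_eta N H K))
     (\<lambda>U. \<integral>\<^sup>+ D. emeasure (eta N (H \<inter> conjg N (dcrep N H K D) K)) U \<partial>count_space (dcosets N H K))"
  proof (rule countably_additiveI)
    fix A :: "nat \<Rightarrow> bpt set set" assume A: "range A \<subseteq> sets (dsum_eta N H K)" "disjoint_family A"
    have "(\<Sum>i. \<integral>\<^sup>+ D. emeasure (eta N (H \<inter> conjg N (dcrep N H K D) K)) (A i) \<partial>count_space (dcosets N H K)) =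
      (\<integral>\<^sup>+ D. (\<Sum>i. emeasure (eta N (H \<inter> conjg N (dcrep N H K D) K)) (A i)) \<partial>count_space (dcosets N H K))"
      by (rule nn_integral_suminf[symmetric]) simp
    also have "\<dots> = (\<integral>\<^sup>+ D. emeasure (eta N (H \<inter> conjg N (dcrep N H K D) K)) (\<Union>i. A i) \<partial>count_space (dcosets N H K))"
      using A by (intro nn_integral_cong suminf_emeasure) auto
    finally show "(\<Sum>i. \<integral>\<^sup>+ D. emeasure (eta N (H \<inter> conjg N (dcrep N H K D) K)) (A i) \<partial>count_space (dcosets N H K)) =
      (\<integral>\<^sup>+ D. emeasure (eta N (H \<inter> conjg N (dcrep N H K D) K)) (\<Union>i. A i) \<partial>count_space (dcosets N H K))" .
  qed
qed

text \<open>Finiteness at the base vertex: if \<open>[]\<close> lies in the hull of an intersection,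
  it lies in both hulls, and only finitely many pairs of cosets place it there.\<close>

lemma dsum_SCurr:
  assumes H: "cocpt H" "H \<noteq> {[]}" and K: "cocpt K" "K \<noteq> {[]}"
  shows "dsum_eta N H K \<in> SCurr N"
proof (rule SCurrI)
  have sH: "subgroup H (FG N)" and sK: "subgroup K (FG N)" using H K by (auto simp: cocpt_def)
  let ?Y = "{p \<in> rc H ` G \<times> rc K ` G. pt H (fst p) \<inter> pt K (snd p) \<in> Cv []}"
  have "?Y \<subseteq> rc H ` thull (L H) \<times> rc K ` thull (L K)"
  proof
    fix p assume p: "p \<in> ?Y"
    then obtain x y where xy: "x \<in> G" "y \<in> G" "p = (rc H x, rc K y)" by auto
    have "[] \<in> thull (pt H (rc H x) \<inter> pt K (rc K y))" using p xy by (simp add: Cv_def)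
    then have "[] \<in> thull (pt H (rc H x))" "[] \<in> thull (pt K (rc K y))"
      using hull_mono[of "pt H (rc H x) \<inter> pt K (rc K y)"] by blast+
    then show "p \<in> rc H ` thull (L H) \<times> rc K ` thull (L K)"
      using pt_hull[OF sH xy(1), of "[]"] pt_hull[OF sK xy(2), of "[]"] xy by simp
  qed
  moreover have "finite (rc H ` thull (L H) \<times> rc K ` thull (L K))" using H K by (simp add: cocpt_def cofin_def)
  ultimately have "finite ?Y" by (rule finite_subset)
  then have "emeasure (count_space (rc H ` G \<times> rc K ` G)) ?Y < \<infinity>"
    by (subst emeasure_count_space) (auto simp: of_nat_less_top)
  then show "emeasure (dsum_eta N H K) (Cv []) < \<infinity>"
    using emeasure_dsum[OF sets_Cv] pair_count_decomp[OF H K sets_Cv] by simp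
next
  fix g U assume g: "g \<in> G" and U: "U \<in> sets (CN_meas N)"
  show "emeasure (dsum_eta N H K) (act g ` U) = emeasure (dsum_eta N H K) U"
    unfolding emeasure_dsum[OF U] emeasure_dsum[OF sets_act[OF g U]]
    using SCurr_inv[OF eta_SCurr[OF cocpt_J[OF H K]] g U] dcrep(1)
    by (intro nn_integral_cong) simp
qed auto

end

section \<open>The rank of a group acting cofinitely on a subtree\<close>

context free_group
begin

definition code :: "letter \<Rightarrow> nat" where
  "code a = 2 * fst a + of_bool (snd a)"

lemma code_inj: "code a = code b \<Longrightarrow> a = b"
proof -
  assume e: "code a = code b"
  have "snd a = snd b" using arg_cong[OF e, of odd] unfolding code_def by (cases "snd a"; cases "snd b") auto
  then show ?thesis using e unfolding code_def by (simp add: prod_eq_iff)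
qed

lemma code_less: "fst a < N \<Longrightarrow> code a < 2 * N"
  by (cases "snd a") (auto simp: code_def)

text \<open>A numerical short-lex order: representatives of cosets with minimal key form a prefix-closed
  (Schreier) transversal.\<close>

definition key :: "word \<Rightarrow> nat" where
  "key w = foldl (\<lambda>k a. (2 * N + 1) * k + code a + 1) 0 w"

lemma key_Nil [simp]: "key [] = 0"
  by (simp add: key_def)

lemma key_snoc: "key (w @ [a]) = (2 * N + 1) * key w + code a + 1"
  by (simp add: key_def)

lemma key_mono_snoc: "key u < key w \<Longrightarrow> key (u @ [a]) < key (w @ [a])"
  using mult_strict_left_mono[of "key u" "key w" "2 * N + 1"] unfolding key_snoc by linarith

lemma nat_digit_less:
  fixes b k c k' c' :: nat
  assumes "b * k + c = b * k' + c'" "c < b"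
  shows "\<not> k < k'"
proof
  assume "k < k'"
  then have "b * (k + 1) \<le> b * k'" by (intro mult_le_mono2) simp
  then show False using assms by (simp add: distrib_left)
qed

lemma key_butlast: "key (butlast w) \<le> key w"
  by (cases w rule: rev_cases) (auto simp: key_snoc)

text \<open>The digits \<open>code a + 1\<close> are nonzero and smaller than the base
  \<open>2 * N + 1\<close>, so a word can be recovered from its key, including its length.\<close>

lemma key_inj: "u \<in> G \<Longrightarrow> w \<in> G \<Longrightarrow> key u = key w \<Longrightarrow> u = w"
proof (induction u arbitrary: w rule: rev_induct)
  case Nil
  then show ?case by (cases w rule: rev_cases) (auto simp: key_snoc)
next
  case (snoc a u)
  then obtain b v where w: "w = v @ [b]" by (cases w rule: rev_cases) (auto simp: key_snoc)
  have G: "u \<in> G" "v \<in> G" "fst a < N" "fst b < N" using snoc.prems w by (auto simp: G_snoc)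
  have e: "(2 * N + 1) * key u + (code a + 1) = (2 * N + 1) * key v + (code b + 1)"
    using snoc.prems(3) w by (simp add: key_snoc)
  have l: "code a + 1 < 2 * N + 1" "code b + 1 < 2 * N + 1" using code_less G by auto
  have "key u = key v" using nat_digit_less[OF e l(1)] nat_digit_less[OF e[symmetric] l(2)] by simp
  moreover have "code a = code b" using e calculation by simp
  ultimately show ?case using snoc.IH[OF G(1,2)] code_inj w by auto
qed

definition dg :: "word set \<Rightarrow> word \<Rightarrow> nat" where
  "dg M v = card {a. fst a < N \<and> v \<sqdot> [a] \<in> M}"

lemma finite_letters: "finite {a :: letter. fst a < N \<and> P a}"
  by (rule finite_subset[of _ "{..<N} \<times> UNIV"]) auto

section \<open>Maximal trees in quotient graphs\<close>

context
  fixes J M :: "word set"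
  assumes J: "subgroup J (FG N)" and cM: "tconvex M" and oneM: "[] \<in> M"
    and JM: "\<And>h v. h \<in> J \<Longrightarrow> v \<in> M \<Longrightarrow> h \<sqdot> v \<in> M" and fin: "cofin J M"
begin

lemma MG: "v \<in> M \<Longrightarrow> v \<in> G"
  using cM unfolding tconvex_def by blast

lemma JsubM: "h \<in> J \<Longrightarrow> h \<in> M"
  using JM[OF _ oneM] sub_G[OF J] by fastforce

lemma rc_in_M: "v \<in> M \<Longrightarrow> u \<in> G \<Longrightarrow> rc J u = rc J v \<Longrightarrow> u \<in> M"
proof -
  assume v: "v \<in> M" and u: "u \<in> G" "rc J u = rc J v"
  have "u \<sqdot> iv v \<in> J" using rc_eq_iff[OF J u(1) MG[OF v]] u by simp
  from JM[OF this v] show ?thesis using u MG[OF v] by simp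
qed

text \<open>The representatives of minimal key. Being closed under prefixes, they form a lift to
  \<open>M\<close> of a maximal tree of the quotient graph.\<close>

definition tv :: "word set" where
  "tv = {t \<in> M. \<forall>u\<in>M. rc J u = rc J t \<longrightarrow> key t \<le> key u}"

lemma tvM: "t \<in> tv \<Longrightarrow> t \<in> M"
  by (simp add: tv_def)

lemma tvG: "t \<in> tv \<Longrightarrow> t \<in> G"
  using tvM MG by blast

lemma tv_unique: "t \<in> tv \<Longrightarrow> t' \<in> tv \<Longrightarrow> rc J t = rc J t' \<Longrightarrow> t = t'"
  using key_inj[of t t'] tvG unfolding tv_def by (metis (mono_tags, lifting) le_antisym mem_Collect_eq)

lemma tv_ex: "w \<in> M \<Longrightarrow> \<exists>t\<in>tv. rc J t = rc J w"
proof -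
  assume w: "w \<in> M"
  define P where "P u \<longleftrightarrow> u \<in> M \<and> rc J u = rc J w" for u
  have "P w" using w by (simp add: P_def)
  then obtain t where "P t" "\<forall>u. P u \<longrightarrow> key t \<le> key u" using ex_has_least_nat[of P w key] by blast
  then show ?thesis unfolding P_def tv_def by (intro bexI[of _ t]) auto
qed

definition tau :: "word \<Rightarrow> word" where
  "tau w = (THE t. t \<in> tv \<and> rc J t = rc J w)"

lemma tau: "w \<in> M \<Longrightarrow> tau w \<in> tv \<and> rc J (tau w) = rc J w"
proof -
  assume w: "w \<in> M"
  have "\<exists>!t. t \<in> tv \<and> rc J t = rc J w" using tv_ex[OF w] tv_unique by metis
  from theI'[OF this] show ?thesis unfolding tau_def .
qed

lemma tau_tv: "t \<in> tv \<Longrightarrow> tau t = t"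
  using tau[OF tvM] tv_unique by blast

lemma tau_cong: "rc J u = rc J v \<Longrightarrow> tau u = tau v"
  by (simp add: tau_def)

text \<open>A representative \<open>u\<close> smaller than \<open>t\<close> would yield the
  representative \<open>u \<sqdot> [a]\<close>, smaller than \<open>t @ [a]\<close>: appending a
  letter preserves the order of keys, and a cancellation only lowers the key further.\<close>

lemma tv_prefix: "t @ [a] \<in> tv \<Longrightarrow> t \<in> tv"
proof -
  assume ta: "t @ [a] \<in> tv"
  have M: "t @ [a] \<in> M" "t \<in> M" using tvM[OF ta] tconvex_prefix[OF cM oneM, of "t @ [a]" t] by auto
  have a: "fst a < N" using MG[OF M(1)] by (simp add: G_snoc)
  have "key t \<le> key u" if u: "u \<in> M" "rc J u = rc J t" for u
  proof (rule ccontr)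
    assume "\<not> key t \<le> key u"
    then have k: "key u < key t" by simp
    have uG: "u \<in> G" using MG[OF u(1)] .
    have e: "t \<sqdot> [a] = t @ [a]" using mul_append MG[OF M(1)] by simp
    have rc: "rc J (u \<sqdot> [a]) = rc J (t @ [a])"
      using rc_mul_right[OF J uG MG[OF M(2)], of "[a]"] a u(2) e by simp
    have "u \<sqdot> [a] \<in> M" using rc_in_M[OF M(1) _ rc] uG a by simp
    then have "key (t @ [a]) \<le> key (u \<sqdot> [a])" using ta rc unfolding tv_def by blast
    moreover have "key (u \<sqdot> [a]) < key (t @ [a])"
    proof (cases "u \<noteq> [] \<and> last u = linv a")
      case True
      then have "key (u \<sqdot> [a]) \<le> key u" using mul_letter[OF uG a] key_butlast by simp
      also have "key u < key t" by (rule k)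
      also have "key t \<le> key (t @ [a])" using key_butlast[of "t @ [a]"] by simp
      finally show ?thesis .
    next
      case False
      then show ?thesis using mul_letter[OF uG a] key_mono_snoc[OF k] by auto
    qed
    ultimately show False by simp
  qed
  then show "t \<in> tv" using M by (simp add: tv_def)
qed

lemma one_tv: "[] \<in> tv"
  using oneM by (simp add: tv_def)

lemma tau_J: "h \<in> J \<Longrightarrow> tau h = []"
proof -
  assume h: "h \<in> J"
  have "rc J h = rc J []" using rc_eq_iff[OF J sub_G[OF J h], of "[]"] h sub_G[OF J h] by simp
  then show ?thesis using tau_cong tau_tv[OF one_tv] by metis
qed

lemma bij_tv: "bij_betw (rc J) tv (rc J ` M)"
  unfolding bij_betw_def
proof
  show "inj_on (rc J) tv" using tv_unique by (rule inj_onI)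
  show "rc J ` tv = rc J ` M"
  proof
    show "rc J ` tv \<subseteq> rc J ` M" using tvM by blast
    show "rc J ` M \<subseteq> rc J ` tv"
    proof
      fix c assume "c \<in> rc J ` M"
      then obtain w where "w \<in> M" "c = rc J w" by blast
      then obtain t where "t \<in> tv" "rc J t = c" using tv_ex[of w] by auto
      then show "c \<in> rc J ` tv" by blast
    qed
  qed
qed

lemma finite_tv: "finite tv"
  using bij_betw_finite[OF bij_tv] fin by (simp add: cofin_def)

text \<open>Oriented edges of the quotient graph, given by initial vertex and label. Reversal is
  \<open>rv\<close>; \<open>edp\<close> keeps the positively labelled orientation of every edge, and
  \<open>edt\<close> the edges of the maximal tree among these.\<close>

definition ed :: "(word \<times> letter) set" where
  "ed = {(t, a). t \<in> tv \<and> fst a < N \<and> t \<sqdot> [a] \<in> M}"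

definition rv :: "word \<times> letter \<Rightarrow> word \<times> letter" where
  "rv = (\<lambda>(t, a). (tau (t \<sqdot> [a]), linv a))"

definition edp :: "(word \<times> letter) set" where
  "edp = {(t, a) \<in> ed. \<not> snd a}"

definition edt :: "(word \<times> letter) set" where
  "edt = {(t, a) \<in> edp. t \<sqdot> [a] \<in> tv}"

lemma finite_ed: "finite ed"
proof (rule finite_subset)
  show "ed \<subseteq> tv \<times> {a. fst a < N}" by (auto simp: ed_def)
  show "finite (tv \<times> {a :: letter. fst a < N})" using finite_tv finite_letters[of "\<lambda>_. True"] by simp
qed

lemma edp_sub: "edp \<subseteq> ed"
  by (auto simp: edp_def)

lemma edt_sub: "edt \<subseteq> edp"
  by (auto simp: edt_def)

lemma mul_letter_linv: "t \<in> G \<Longrightarrow> fst a < N \<Longrightarrow> t \<sqdot> [a] \<sqdot> [linv a] = t"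
  using iv_letter[of a] mul_iv_cancel(3)[of "[a]" t] by simp

lemma rv_ed:
  assumes "(t, a) \<in> ed"
  shows "rv (t, a) \<in> ed" "rv (rv (t, a)) = (t, a)"
proof -
  have t: "t \<in> tv" "fst a < N" "t \<sqdot> [a] \<in> M" using assms by (auto simp: ed_def)
  have tG: "t \<in> G" using tvG t by blast
  let ?s = "tau (t \<sqdot> [a])"
  have s: "?s \<in> tv" "rc J ?s = rc J (t \<sqdot> [a])" using tau[OF t(3)] by auto
  have sG: "?s \<in> G" using tvG s by blast
  have rc: "rc J (?s \<sqdot> [linv a]) = rc J t"
    using rc_mul_right[OF J sG _ _ s(2), of "[linv a]"] tG t(2) mul_letter_linv[OF tG t(2)] by simp
  have sM: "?s \<sqdot> [linv a] \<in> M" using rc_in_M[OF tvM[OF t(1)] _ rc] sG t(2) by simp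
  show "rv (t, a) \<in> ed" using s sM t by (simp add: rv_def ed_def)
  have "tau (?s \<sqdot> [linv a]) = t" using tau_cong[OF rc] tau_tv[OF t(1)] by simp
  then show "rv (rv (t, a)) = (t, a)" by (simp add: rv_def)
qed

lemma card_ed: "card ed = 2 * card edp"
proof -
  have "ed = edp \<union> rv ` edp"
  proof (intro equalityI subsetI)
    fix e assume e: "e \<in> ed"
    obtain t a where ta: "e = (t, a)" by (cases e)
    show "e \<in> edp \<union> rv ` edp"
    proof (cases "snd a")
      case True
      have "rv (t, a) \<in> edp" using rv_ed(1)[of t a] e ta True by (auto simp: edp_def rv_def linv_def)
      then show ?thesis using rv_ed(2)[of t a] e ta by (metis UnI2 imageI)
    qed (use e ta in \<open>simp add: edp_def\<close>)
  next
    fix e assume "e \<in> edp \<union> rv ` edp"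
    then show "e \<in> ed" using rv_ed(1) edp_sub by (auto simp: edp_def)
  qed
  moreover have "edp \<inter> rv ` edp = {}" by (auto simp: edp_def rv_def linv_def)
  moreover have "finite edp" using finite_subset[OF edp_sub finite_ed] .
  moreover have "inj_on rv edp"
  proof (rule inj_onI)
    fix x y assume "x \<in> edp" "y \<in> edp" "rv x = rv y"
    then show "x = y" using rv_ed(2)[of "fst x" "snd x"] rv_ed(2)[of "fst y" "snd y"] subsetD[OF edp_sub, of x] subsetD[OF edp_sub, of y] by simp
  qed
  ultimately show ?thesis by (simp add: card_Un_disjoint card_image)
qed

lemma card_ed_dg: "card ed = (\<Sum>t\<in>tv. dg M t)"
proof -
  have "ed = (SIGMA t:tv. {a. fst a < N \<and> t \<sqdot> [a] \<in> M})" by (auto simp: ed_def)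
  then show ?thesis using finite_tv finite_letters by (simp add: dg_def card_SigmaI)
qed

text \<open>The edge that joins a tree vertex to its parent, in its positive orientation.\<close>

definition te :: "word \<Rightarrow> word \<times> letter" where
  "te s = (if snd (last s) then (s, linv (last s)) else (butlast s, last s))"

lemma te_snoc: "te (p @ [b]) = (if snd b then (p @ [b], linv b) else (p, b))"
  by (simp add: te_def)

lemma card_edt: "card edt = card tv - 1"
proof -
  have "bij_betw te (tv - {[]}) edt"
    unfolding bij_betw_def
  proof
    show "inj_on te (tv - {[]})"
    proof (rule inj_onI)
      fix x y assume x: "x \<in> tv - {[]}" and y: "y \<in> tv - {[]}" and e: "te x = te y"
      obtain p a where p: "x = p @ [a]" using x by (cases x rule: rev_cases) auto
      obtain q b where q: "y = q @ [b]" using y by (cases y rule: rev_cases) auto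
      have r: "reduced (p @ [a])" "reduced (q @ [b])" using x y p q tvG G_reduced by blast+
      show "x = y" using e r unfolding p q te_snoc
        by (auto split: if_splits simp: reduced_append reduced_Cons)
    qed
    show "te ` (tv - {[]}) = edt"
    proof (intro equalityI subsetI)
      fix e assume "e \<in> te ` (tv - {[]})"
      then obtain s where s: "s \<in> tv" "s \<noteq> []" "e = te s" by blast
      obtain p a where p: "s = p @ [a]" using s by (cases s rule: rev_cases) auto
      have pT: "p \<in> tv" using tv_prefix s p by blast
      have sG: "p @ [a] \<in> G" "p \<in> G" "fst a < N" using tvG[OF s(1)] p by (auto simp: G_snoc)
      have e1: "p \<sqdot> [a] = p @ [a]" using mul_append sG by simp
      have e2: "(p @ [a]) \<sqdot> [linv a] = p" using mul_letter_linv[OF sG(2,3)] e1 by simp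
      show "e \<in> edt"
        using s p pT sG e1 e2 tvM by (auto simp: te_snoc edt_def edp_def ed_def linv_def)
    next
      fix e assume e: "e \<in> edt"
      obtain t a where ta: "e = (t, a)" by (cases e)
      have t: "t \<in> tv" "fst a < N" "\<not> snd a" "t \<sqdot> [a] \<in> tv" using e ta by (auto simp: edt_def edp_def ed_def)
      show "e \<in> te ` (tv - {[]})"
      proof (cases "t \<noteq> [] \<and> last t = linv a")
        case True
        then obtain q where q: "t = q @ [linv a]" by (metis append_butlast_last_id)
        have "te t = e" using q ta t(3) by (simp add: te_snoc linv_def) (simp add: prod_eq_iff)
        then show ?thesis using t True by blast
      next
        case False
        then have "t \<sqdot> [a] = t @ [a]" using mul_letter[OF tvG[OF t(1)] t(2)] by auto
        then have "t @ [a] \<in> tv - {[]}" "te (t @ [a]) = e" using t ta by (auto simp: te_snoc)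
        then show ?thesis by (metis imageI)
      qed
    qed
  qed
  then show ?thesis using bij_betw_same_card[of te] one_tv finite_tv by (metis card_Diff_singleton)
qed

section \<open>Schreier generators\<close>

definition nt :: "(word \<times> letter) set" where
  "nt = edp - edt"

definition gn :: "word \<times> letter \<Rightarrow> word" where
  "gn = (\<lambda>(t, a). t \<sqdot> [a] \<sqdot> iv (tau (t \<sqdot> [a])))"

lemma finite_nt: "finite nt"
  using finite_subset[OF edp_sub finite_ed] by (simp add: nt_def)

lemma card_tv_pos: "card tv > 0"
  using one_tv finite_tv by (auto simp: card_gt_0_iff)

text \<open>Both sides are the number of edges minus the number of vertices: the tree has one edge
  less than vertices, and the degrees count every edge twice.\<close>

lemma card_nt: "real (card nt) - 1 = (\<Sum>t\<in>tv. real (dg M t) / 2 - 1)"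
proof -
  have fe: "finite edp" using finite_subset[OF edp_sub finite_ed] .
  have "card nt = card edp - card edt" unfolding nt_def using edt_sub fe by (simp add: card_Diff_subset finite_subset)
  moreover have "card edt \<le> card edp" using card_mono[OF fe edt_sub] .
  ultimately have "real (card nt) = real (card edp) - real (card edt)" by simp
  also have "real (card edt) = real (card tv) - 1" using card_edt card_tv_pos by simp
  finally have "real (card nt) - 1 = real (card ed) / 2 - real (card tv)" using card_ed by simp
  also have "real (card ed) / 2 = (\<Sum>t\<in>tv. real (dg M t) / 2)" by (simp add: card_ed_dg sum_divide_distrib)
  finally show ?thesis by (simp add: sum_subtractf)
qed

lemma gn_J:
  assumes "(t, a) \<in> ed"
  shows "gn (t, a) \<in> J"
proof -
  have t: "t \<in> tv" "fst a < N" "t \<sqdot> [a] \<in> M" using assms by (auto simp: ed_def)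
  have "tau (t \<sqdot> [a]) \<in> G" "rc J (tau (t \<sqdot> [a])) = rc J (t \<sqdot> [a])" using tau[OF t(3)] tvG by auto
  then show ?thesis using rc_eq_iff[OF J, of "t \<sqdot> [a]" "tau (t \<sqdot> [a])"] MG[OF t(3)] by (simp add: gn_def)
qed

text \<open>Reading a word \<open>w\<close> of \<open>M\<close> letter by letter writes
  \<open>w \<sqdot> iv (tau w)\<close> as a product of edge elements \<open>gn\<close>, and
  \<open>tau\<close> is trivial on \<open>J\<close>. Edges of the tree contribute trivial
  elements.\<close>

lemma generate_nt: "generate (FG N) (gn ` nt) = J"
proof
  have sub: "gn ` nt \<subseteq> J" using gn_J edp_sub by (auto simp: nt_def subset_iff)
  then show "generate (FG N) (gn ` nt) \<subseteq> J" using generate_subgroup_incl[OF _ J] by blast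
  let ?K = "generate (FG N) (gn ` nt)"
  have K: "subgroup ?K (FG N)" using generate_is_subgroup sub sub_G[OF J] by blast
  have pos: "gn (t, a) \<in> ?K" if ta: "(t, a) \<in> edp" for t a
  proof (cases "(t, a) \<in> edt")
    case True
    then have t: "t \<sqdot> [a] \<in> tv" by (simp add: edt_def)
    then have "gn (t, a) = []" using tau_tv[OF t] tvG[OF t] by (simp add: gn_def)
    then show ?thesis using sub_Nil[OF K] by simp
  next
    case False
    then show ?thesis using ta by (intro generate.incl) (auto simp: nt_def)
  qed
  \<comment> \<open>Reversing an edge inverts its element, which settles the negatively labelled
    edges.\<close>
  have edK: "gn (t, a) \<in> ?K" if ta: "(t, a) \<in> ed" for t a
  proof (cases "snd a")
    case False
    then show ?thesis using pos ta by (simp add: edp_def)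
  next
    case True
    let ?s = "tau (t \<sqdot> [a])"
    have t: "t \<in> tv" "fst a < N" "t \<sqdot> [a] \<in> M" using ta by (auto simp: ed_def)
    have G: "t \<in> G" "?s \<in> G" using tvG t tau[OF t(3)] by auto
    have r: "(?s, linv a) \<in> edp" using rv_ed(1)[OF ta] True by (auto simp: edp_def rv_def linv_def)
    have "tau (?s \<sqdot> [linv a]) = t" using rv_ed(2)[OF ta] by (simp add: rv_def)
    then have "gn (?s, linv a) = ?s \<sqdot> [linv a] \<sqdot> iv t" by (simp add: gn_def)
    then have "iv (gn (?s, linv a)) = t \<sqdot> [a] \<sqdot> iv ?s"
      using G t(2) iv_letter[of "linv a"] by (simp add: inv_mult_group m_assoc)
    then have "gn (t, a) = iv (gn (?s, linv a))" by (simp add: gn_def)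
    then show ?thesis using sub_iv[OF K pos[OF r]] by simp
  qed
  have "w \<sqdot> iv (tau w) \<in> ?K" if "w \<in> M" for w
    using that
  proof (induction w rule: rev_induct)
    case Nil
    then show ?case using tau_tv[OF one_tv] sub_Nil[OF K] by simp
  next
    case (snoc a p)
    have p: "p \<in> M" using tconvex_prefix[OF cM oneM snoc.prems, of p] by simp
    have G: "p \<in> G" "p @ [a] \<in> G" "fst a < N" "tau p \<in> tv" "tau p \<in> G" "tau (p @ [a]) \<in> G"
      using MG[OF p] MG[OF snoc.prems] tau[OF p] tau[OF snoc.prems] tvG by (auto simp: G_snoc)
    have pa: "p \<sqdot> [a] = p @ [a]" using mul_append G by simp
    have rc: "rc J (tau p \<sqdot> [a]) = rc J (p @ [a])"
      using rc_mul_right[OF J G(5,1), of "[a]"] tau[OF p] G(3) pa by simp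
    have M: "tau p \<sqdot> [a] \<in> M" using rc_in_M[OF snoc.prems _ rc] G by simp
    have "gn (tau p, a) = tau p \<sqdot> [a] \<sqdot> iv (tau (p @ [a]))" using tau_cong[OF rc] by (simp add: gn_def)
    moreover have "gn (tau p, a) \<in> ?K" using edK[of "tau p" a] G M by (simp add: ed_def)
    ultimately have "(p \<sqdot> iv (tau p)) \<sqdot> (tau p \<sqdot> [a] \<sqdot> iv (tau (p @ [a]))) \<in> ?K"
      using sub_mul[OF K snoc.IH[OF p]] by simp
    moreover have "(p \<sqdot> iv (tau p)) \<sqdot> (tau p \<sqdot> [a] \<sqdot> iv (tau (p @ [a]))) = p \<sqdot> [a] \<sqdot> iv (tau (p @ [a]))"
      using G by (simp add: m_assoc)
    ultimately show ?case using pa by simp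
  qed
  then show "J \<subseteq> ?K" using JsubM tau_J sub_G[OF J] by (metis inv_one mul_Nil(1) one_eq subsetI)
qed

text \<open>For every set \<open>X\<close> of edges outside the spanning tree, \<open>kap X []\<close> is the parity of the number of
  crossings of \<open>X\<close>, a homomorphism to the group of order two. As these homomorphisms are distinct,
  any generating set has at least as many elements as there are edges outside the tree.\<close>

definition chi :: "(word \<times> letter) set \<Rightarrow> word \<Rightarrow> letter \<Rightarrow> bool" where
  "chi X t a \<longleftrightarrow> (t, a) \<in> X \<or> rv (t, a) \<in> X"

primrec kap :: "(word \<times> letter) set \<Rightarrow> word \<Rightarrow> word \<Rightarrow> bool" where
  "kap X p [] = False"
| "kap X p (a # w) = (chi X (tau p) a \<noteq> kap X (p @ [a]) w)"

lemma kap_snoc: "kap X p (w @ [a]) = (kap X p w \<noteq> chi X (tau (p @ w)) a)"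
  by (induction w arbitrary: p) auto

text \<open>If the new letter cancels, the edge just crossed is crossed back, and two crossings do
  not change the parity.\<close>

lemma kap_step:
  assumes w: "w \<in> M" "fst a < N" "w \<sqdot> [a] \<in> M"
  shows "kap X [] (w \<sqdot> [a]) = (kap X [] w \<noteq> chi X (tau w) a)"
proof (cases "w \<noteq> [] \<and> last w = linv a")
  case False
  then have "w \<sqdot> [a] = w @ [a]" using mul_letter[OF MG[OF w(1)] w(2)] by auto
  then show ?thesis by (simp add: kap_snoc)
next
  case True
  then obtain q where q: "w = q @ [linv a]" by (metis append_butlast_last_id)
  have qM: "q \<in> M" using tconvex_prefix[OF cM oneM w(1), of q] q by simp
  have G: "q \<in> G" "w \<in> G" using MG qM w by auto
  have e1: "q \<sqdot> [linv a] = w" using mul_append[of q "[linv a]"] G q by simp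
  have e2: "w \<sqdot> [a] = q" using mul_letter[OF G(2) w(2)] True q by simp
  have t: "tau q \<in> tv" "rc J (tau q) = rc J q" "tau q \<in> G" using tau[OF qM] tvG by auto
  have rc: "rc J (tau q \<sqdot> [linv a]) = rc J w"
    using rc_mul_right[OF J t(3) G(1) _ t(2), of "[linv a]"] w(2) e1 by simp
  have ed: "(tau q, linv a) \<in> ed" using t(1) w(2) rc_in_M[OF w(1) _ rc] t(3) by (simp add: ed_def)
  have r: "rv (tau q, linv a) = (tau w, a)" using tau_cong[OF rc] by (simp add: rv_def)
  have "rv (tau w, a) = (tau q, linv a)" using rv_ed(2)[OF ed] r by simp
  then have "chi X (tau q) (linv a) = chi X (tau w) a" using r by (auto simp: chi_def)
  moreover have "kap X [] w = (kap X [] q \<noteq> chi X (tau q) (linv a))" using kap_snoc[of X "[]" q "linv a"] q by simp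
  ultimately show ?thesis using e2 by auto
qed

text \<open>Translation by \<open>h\<close> does not change \<open>tau\<close>, so the part of the
  path behind \<open>h\<close> crosses the same edges as the path to \<open>w\<close>.\<close>

lemma kap_hom:
  assumes h: "h \<in> J"
  shows "w \<in> M \<Longrightarrow> kap X [] (h \<sqdot> w) = (kap X [] h \<noteq> kap X [] w)"
proof (induction w rule: rev_induct)
  case Nil
  then show ?case using sub_G[OF J h] by simp
next
  case (snoc a p)
  have p: "p \<in> M" using tconvex_prefix[OF cM oneM snoc.prems, of p] by simp
  have G: "p \<in> G" "p @ [a] \<in> G" "fst a < N" "h \<in> G"
    using MG[OF p] MG[OF snoc.prems] sub_G[OF J h] by (auto simp: G_snoc)
  have pa: "p \<sqdot> [a] = p @ [a]" using mul_append G by simp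
  have e: "h \<sqdot> (p @ [a]) = h \<sqdot> p \<sqdot> [a]" using G pa by (simp add: m_assoc)
  have "kap X [] (h \<sqdot> p \<sqdot> [a]) = (kap X [] (h \<sqdot> p) \<noteq> chi X (tau (h \<sqdot> p)) a)"
    using kap_step[OF JM[OF h p] G(3)] JM[OF h snoc.prems] e by simp
  moreover have "tau (h \<sqdot> p) = tau p" using tau_cong[OF rc_mul_left[OF J h G(1)]] .
  moreover have "kap X [] (p @ [a]) = (kap X [] p \<noteq> chi X (tau p) a)" using kap_snoc[of X "[]" p a] by simp
  ultimately show ?case using snoc.IH[OF p] e by auto
qed

lemma kap_tv:
  assumes X: "X \<subseteq> nt"
  shows "t \<in> tv \<Longrightarrow> kap X [] t = False"
proof (induction t rule: rev_induct)
  case (snoc a p)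
  have p: "p \<in> tv" using tv_prefix snoc.prems by blast
  have G: "p \<in> G" "p @ [a] \<in> G" "fst a < N" using tvG[OF p] tvG[OF snoc.prems] by (auto simp: G_snoc)
  have pa: "p \<sqdot> [a] = p @ [a]" using mul_append G by simp
  have e2: "(p @ [a]) \<sqdot> [linv a] = p" using mul_letter_linv[OF G(1,3)] pa by simp
  have "(p, a) \<notin> nt" using pa snoc.prems by (auto simp: nt_def edt_def)
  moreover have "rv (p, a) \<notin> nt" using pa tau_tv[OF snoc.prems] e2 p by (auto simp: nt_def edt_def rv_def)
  ultimately have "\<not> chi X p a" using X by (auto simp: chi_def)
  then show ?case using snoc.IH[OF p] tau_tv[OF p] kap_snoc[of X "[]" p a] by simp
qed simp

text \<open>The loop of a Schreier generator stays in the maximal tree except for one passage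
  through its own edge.\<close>

lemma kap_gn:
  assumes X: "X \<subseteq> nt" and x: "x \<in> nt"
  shows "kap X [] (gn x) \<longleftrightarrow> x \<in> X"
proof -
  obtain t a where ta: "x = (t, a)" by (cases x)
  have ed: "(t, a) \<in> ed" "\<not> snd a" using x ta edp_sub by (auto simp: nt_def edp_def)
  have t: "t \<in> tv" "fst a < N" "t \<sqdot> [a] \<in> M" using ed by (auto simp: ed_def)
  let ?s = "tau (t \<sqdot> [a])"
  have s: "?s \<in> tv" "?s \<in> G" using tau[OF t(3)] tvG by auto
  have "gn (t, a) \<sqdot> ?s = t \<sqdot> [a]" using s MG[OF t(3)] by (simp add: gn_def)
  then have "kap X [] (t \<sqdot> [a]) = (kap X [] (gn (t, a)) \<noteq> kap X [] ?s)"
    using kap_hom[OF gn_J[OF ed(1)] tvM[OF s(1)], of X] by simp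
  then have "kap X [] (gn (t, a)) = kap X [] (t \<sqdot> [a])" using kap_tv[OF X s(1)] by simp
  also have "\<dots> = chi X t a" using kap_step[OF tvM[OF t(1)] t(2,3)] kap_tv[OF X t(1)] tau_tv[OF t(1)] by simp
  also have "\<dots> \<longleftrightarrow> (t, a) \<in> X"
  proof -
    have "snd (snd (rv (t, a)))" using ed(2) by (simp add: rv_def linv_def)
    then have "rv (t, a) \<notin> X" using X by (auto simp: nt_def edp_def)
    then show ?thesis by (simp add: chi_def)
  qed
  finally show ?thesis using ta by simp
qed

lemma generators_ge:
  assumes S: "finite S" "S \<subseteq> G" "generate (FG N) S = J"
  shows "card nt \<le> card S"
proof -
  have SJ: "S \<subseteq> J" using generate.incl[of _ S "FG N"] S(3) by blast
  have inj: "inj_on (\<lambda>X. {s \<in> S. kap X [] s}) (Pow nt)"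
  proof (rule inj_onI)
    fix X Y assume X: "X \<in> Pow nt" and Y: "Y \<in> Pow nt" and e: "{s \<in> S. kap X [] s} = {s \<in> S. kap Y [] s}"
    have "kap X [] h = kap Y [] h" if "h \<in> generate (FG N) S" for h
      using that
    proof (induction rule: generate.induct)
      case (incl h)
      then show ?case using e by blast
    next
      case (inv h)
      have h: "h \<in> J" "h \<in> G" "iv h \<in> J" using inv SJ sub_G[OF J] sub_iv[OF J] by blast+
      have "kap Z [] (iv h) = kap Z [] h" for Z
        using kap_hom[OF h(1) JsubM[OF h(3)], of Z] h(2) by simp
      moreover have "kap X [] h = kap Y [] h" using inv e by blast
      ultimately show ?case by simp
    next
      case (eng h1 h2)
      have h: "h1 \<in> J" "h2 \<in> M" using eng S(3) JsubM by auto
      show ?case using kap_hom[OF h, of X] kap_hom[OF h, of Y] eng by simp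
    qed simp
    then have "kap X [] (gn x) = kap Y [] (gn x)" if "x \<in> nt" for x
      using gn_J[of "fst x" "snd x"] that edp_sub S(3) by (auto simp: nt_def)
    then show "X = Y" using kap_gn X Y by blast
  qed
  have "card (Pow nt) \<le> card (Pow S)"
    by (rule card_inj_on_le[OF inj]) (use S in auto)
  then have "2 ^ card nt \<le> (2 :: nat) ^ card S" using finite_nt S(1) by (simp add: card_Pow)
  then show ?thesis by simp
qed

lemma frank_eq_nt: "frank N J = card nt" "fgsub N J"
proof -
  let ?P = "\<lambda>n. \<exists>S. finite S \<and> S \<subseteq> G \<and> card S = n \<and> generate (FG N) S = J"
  have ex: "finite (gn ` nt)" "gn ` nt \<subseteq> G" using finite_nt gn_J edp_sub sub_G[OF J] by (auto simp: nt_def subset_iff)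
  have "?P (card (gn ` nt))" using ex generate_nt by blast
  then have "?P (card nt)"
    using generators_ge[OF ex generate_nt] card_image_le[OF finite_nt, of gn] by (metis le_antisym)
  moreover have "card nt \<le> n" if "?P n" for n using that generators_ge by blast
  ultimately show "frank N J = card nt" unfolding frank_def by (rule Least_equality)
  show "fgsub N J" using J ex generate_nt unfolding fgsub_def by blast
qed

lemma frank_based:
  assumes f: "\<And>v. v \<in> M \<Longrightarrow> f (rc J v) = real (dg M v) / 2 - 1"
  shows "real (frank N J) - 1 = sum f (rc J ` M)"
proof -
  have "sum f (rc J ` M) = (\<Sum>t\<in>tv. f (rc J t))" using sum.reindex_bij_betw[OF bij_tv, of f] by simp
  also have "\<dots> = (\<Sum>t\<in>tv. real (dg M t) / 2 - 1)" using f tvM by (intro sum.cong) auto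
  finally show ?thesis using card_nt frank_eq_nt(1) by simp
qed

end

section \<open>Change of the base vertex\<close>

lemma generate_conjg:
  assumes S: "S \<subseteq> G" and g: "g \<in> G"
  shows "generate (FG N) ((\<lambda>x. g \<sqdot> x \<sqdot> iv g) ` S) = conjg N g (generate (FG N) S)"
proof -
  have "(\<lambda>x. g \<sqdot> x \<sqdot> iv g) \<in> hom (FG N) (FG N)"
    unfolding hom_def using g by (auto simp: m_assoc)
  then interpret h: group_hom "FG N" "FG N" "\<lambda>x. g \<sqdot> x \<sqdot> iv g"
    by (unfold_locales) auto
  show ?thesis using h.generate_img[OF S] conjg_eq[OF g] by simp
qed

lemma conjg_conjg_iv:
  assumes "g \<in> G" "H \<subseteq> G"
  shows "conjg N (iv g) (conjg N g H) = H"
proof -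
  have "conjg N (iv g) (conjg N g H) = (\<lambda>h. iv g \<sqdot> (g \<sqdot> h \<sqdot> iv g) \<sqdot> iv (iv g)) ` H"
    using assms by (simp add: conjg_eq image_image)
  also have "\<dots> = (\<lambda>h. h) ` H" using assms by (intro image_cong) (auto simp: m_assoc subset_iff)
  finally show ?thesis by simp
qed

lemma frank_conjg:
  assumes H: "H \<subseteq> G" and g: "g \<in> G"
  shows "frank N (conjg N g H) = frank N H"
proof -
  have *: "\<exists>S. finite S \<and> S \<subseteq> G \<and> card S = n \<and> generate (FG N) S = conjg N g H"
    if g: "g \<in> G" and S: "\<exists>S. finite S \<and> S \<subseteq> G \<and> card S = n \<and> generate (FG N) S = H" for g n H
  proof -
    obtain S where S: "finite S" "S \<subseteq> G" "card S = n" "generate (FG N) S = H" using S by blast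
    have inj: "inj_on (\<lambda>x. g \<sqdot> x \<sqdot> iv g) S"
    proof (rule inj_onI)
      fix x y assume xy: "x \<in> S" "y \<in> S" "g \<sqdot> x \<sqdot> iv g = g \<sqdot> y \<sqdot> iv g"
      have G: "x \<in> G" "y \<in> G" using xy S by auto
      have "iv g \<sqdot> (g \<sqdot> x \<sqdot> iv g) \<sqdot> g = iv g \<sqdot> (g \<sqdot> y \<sqdot> iv g) \<sqdot> g" using xy by simp
      then show "x = y" using G g by (simp add: m_assoc)
    qed
    show ?thesis
      using S g inj generate_conjg[OF S(2) g]
      by (intro exI[of _ "(\<lambda>x. g \<sqdot> x \<sqdot> iv g) ` S"]) (auto simp: card_image)
  qed
  have "(\<exists>S. finite S \<and> S \<subseteq> G \<and> card S = n \<and> generate (FG N) S = conjg N g H) \<longleftrightarrow>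
    (\<exists>S. finite S \<and> S \<subseteq> G \<and> card S = n \<and> generate (FG N) S = H)" for n
    using *[OF g, of n H] *[OF inv_closed[OF g], of n "conjg N g H"] conjg_conjg_iv[OF g H] by auto
  then show ?thesis unfolding frank_def by presburger
qed

lemma tconvex_translate:
  assumes M: "tconvex M" and g: "g \<in> G"
  shows "tconvex ((\<lambda>v. g \<sqdot> v) ` M)"
  unfolding tconvex_def
proof (intro conjI ballI allI impI)
  have MG: "v \<in> G" if "v \<in> M" for v using M that unfolding tconvex_def by blast
  then show "(\<lambda>v. g \<sqdot> v) ` M \<subseteq> G" using g by auto
  fix u w p assume "u \<in> (\<lambda>v. g \<sqdot> v) ` M" "w \<in> (\<lambda>v. g \<sqdot> v) ` M" and p: "prefix p (iv u \<sqdot> w)"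
  then obtain u' w' where u: "u' \<in> M" "u = g \<sqdot> u'" "w' \<in> M" "w = g \<sqdot> w'" by blast
  have e: "iv u \<sqdot> w = iv u' \<sqdot> w'" using u MG g by (simp add: inv_mult_group m_assoc)
  then have "u' \<sqdot> p \<in> M" using M u p unfolding tconvex_def by simp
  moreover have "p \<in> G" using p e G_prefix[of "iv u' \<sqdot> w'" p] u MG by simp
  then have "u \<sqdot> p = g \<sqdot> (u' \<sqdot> p)" using u MG g by (simp add: m_assoc)
  ultimately show "u \<sqdot> p \<in> (\<lambda>v. g \<sqdot> v) ` M" by blast
qed

text \<open>Conjugation by a vertex \<open>m\<close> of \<open>M\<close> moves the base vertex into
  the subtree and preserves the rank, the cosets and the degrees. The weights enter through a
  function \<open>f\<close> on cosets because degrees are constant on orbits, and because the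
  applications compute the weight from the local type of a coset.\<close>

theorem frank_formula:
  assumes J: "subgroup J (FG N)" and cM: "tconvex M" and ne: "M \<noteq> {}"
    and JM: "\<And>h v. h \<in> J \<Longrightarrow> v \<in> M \<Longrightarrow> h \<sqdot> v \<in> M" and fin: "cofin J M"
  shows "fgsub N J"
    and "(\<And>v. v \<in> M \<Longrightarrow> f (rc J v) = real (dg M v) / 2 - 1) \<Longrightarrow> real (frank N J) - 1 = sum f (rc J ` M)"
proof -
  have MG: "M \<subseteq> G" using cM by (simp add: tconvex_def)
  obtain m where m: "m \<in> M" using ne by blast
  have mG: "m \<in> G" using m MG by blast
  have JG: "J \<subseteq> G" using subgroup.subset[OF J] .
  let ?g = "iv m"
  let ?J = "conjg N ?g J" and ?M = "(\<lambda>v. ?g \<sqdot> v) ` M"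
  have gG: "?g \<in> G" using mG by simp
  have J': "subgroup ?J (FG N)" using subgroup_conjg[OF J gG] .
  have cM': "tconvex ?M" using tconvex_translate[OF cM gG] .
  have one: "[] \<in> ?M" using m mG by (intro image_eqI[of _ _ m]) auto
  have JM': "h \<sqdot> v \<in> ?M" if h: "h \<in> ?J" "v \<in> ?M" for h v
  proof -
    obtain h' where h': "h' \<in> J" "h = ?g \<sqdot> h' \<sqdot> iv ?g" using h conjg_eq[OF gG] by blast
    obtain v' where v': "v' \<in> M" "v = ?g \<sqdot> v'" using h by blast
    have "h \<sqdot> v = ?g \<sqdot> (h' \<sqdot> v')" using h' v' mG JG MG by (simp add: m_assoc subset_iff)
    then show ?thesis using JM[OF h'(1) v'(1)] by blast
  qed
  have fin': "cofin ?J ?M" using conjg_cofin[OF J gG MG fin] .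
  have fg: "fgsub N ?J" using frank_eq_nt(2)[OF J' cM' one JM' fin'] .
  then obtain S where S: "finite S" "S \<subseteq> G" "generate (FG N) S = ?J" unfolding fgsub_def by blast
  have "generate (FG N) ((\<lambda>x. m \<sqdot> x \<sqdot> iv m) ` S) = J"
    using generate_conjg[OF S(2) mG] S(3) conjg_conjg_iv[OF gG JG] mG by simp
  then show "fgsub N J" using J S mG unfolding fgsub_def
    by (intro conjI exI[of _ "(\<lambda>x. m \<sqdot> x \<sqdot> iv m) ` S"]) auto
  assume f: "\<And>v. v \<in> M \<Longrightarrow> f (rc J v) = real (dg M v) / 2 - 1"
  define f' where "f' c = f ((\<lambda>x. m \<sqdot> x) ` c)" for c
  have bk: "(\<lambda>x. m \<sqdot> x) ` ((\<lambda>x. ?g \<sqdot> x) ` c) = c" if "c \<subseteq> G" for c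
  proof -
    have "(\<lambda>x. m \<sqdot> x) ` ((\<lambda>x. ?g \<sqdot> x) ` c) = (\<lambda>x. x) ` c"
      unfolding image_image using that mG by (intro image_cong) (auto simp: subset_iff)
    then show ?thesis by simp
  qed
  have rcG: "rc J v \<subseteq> G" if "v \<in> M" for v using r_coset_subset_G[OF JG] that MG by blast
  have f'v: "f' (rc ?J (?g \<sqdot> v)) = f (rc J v)" if v: "v \<in> M" for v
    unfolding f'_def using rc_conjg[OF JG gG, of v] bk[OF rcG[OF v]] v MG by (simp add: subset_iff)
  have dg': "dg ?M (?g \<sqdot> v) = dg M v" if v: "v \<in> M" for v
  proof -
    have "?g \<sqdot> v \<sqdot> [a] \<in> ?M \<longleftrightarrow> v \<sqdot> [a] \<in> M" if a: "fst a < N" for a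
    proof
      assume "?g \<sqdot> v \<sqdot> [a] \<in> ?M"
      then obtain u where u: "u \<in> M" "?g \<sqdot> v \<sqdot> [a] = ?g \<sqdot> u" by blast
      have "m \<sqdot> (?g \<sqdot> v \<sqdot> [a]) = m \<sqdot> (?g \<sqdot> u)" using u by simp
      then have "v \<sqdot> [a] = u" using mG MG v u a by (simp add: m_assoc subset_iff)
      then show "v \<sqdot> [a] \<in> M" using u by simp
    next
      assume "v \<sqdot> [a] \<in> M"
      moreover have "?g \<sqdot> v \<sqdot> [a] = ?g \<sqdot> (v \<sqdot> [a])" using mG MG v a by (simp add: m_assoc subset_iff)
      ultimately show "?g \<sqdot> v \<sqdot> [a] \<in> ?M" by blast
    qed
    then have "{a. fst a < N \<and> ?g \<sqdot> v \<sqdot> [a] \<in> ?M} = {a. fst a < N \<and> v \<sqdot> [a] \<in> M}" by blast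
    then show ?thesis by (simp only: dg_def)
  qed
  have "real (frank N ?J) - 1 = sum f' (rc ?J ` ?M)"
  proof (rule frank_based[OF J' cM' one JM' fin'])
    fix v assume "v \<in> ?M"
    then obtain u where u: "u \<in> M" "v = ?g \<sqdot> u" by blast
    then show "f' (rc ?J v) = real (dg ?M v) / 2 - 1" using f'v dg' f by simp
  qed
  also have "\<dots> = sum f (rc J ` M)"
  proof -
    have e: "rc ?J ` ?M = (\<lambda>c. (\<lambda>x. ?g \<sqdot> x) ` c) ` rc J ` M"
      unfolding image_image using rc_conjg[OF JG gG] MG by (intro image_cong) auto
    have inj: "inj_on (\<lambda>c. (\<lambda>x. ?g \<sqdot> x) ` c) (rc J ` M)"
      by (rule inj_on_inverseI[where g = "\<lambda>c. (\<lambda>x. m \<sqdot> x) ` c"]) (use bk rcG in auto)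
    show ?thesis unfolding e sum.reindex[OF inj] f'_def
      using bk rcG by (intro sum.cong) auto
  qed
  finally show "real (frank N J) - 1 = sum f (rc J ` M)" using frank_conjg[OF JG gG] by simp
qed

end

section \<open>The reduced rank functional\<close>

lemma emeasure_cadd:
  assumes s: "sets M2 = sets M1" and A: "A \<in> sets M1"
  shows "emeasure (cadd M1 M2) A = emeasure M1 A + emeasure M2 A"
proof (rule emeasure_measure_of[OF cadd_def])
  show "sets M1 \<subseteq> Pow (space M1)" using sets.sets_into_space by blast
  have e: "sets (cadd M1 M2) = sets M1" by (simp add: cadd_def)
  show "A \<in> sets (cadd M1 M2)" using A e by simp
  show "positive (sets (cadd M1 M2)) (\<lambda>A. emeasure M1 A + emeasure M2 A)" by (simp add: positive_def)
  show "countably_additive (sets (cadd M1 M2)) (\<lambda>A. emeasure M1 A + emeasure M2 A)"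
  proof (rule countably_additiveI)
    fix F :: "nat \<Rightarrow> 'a set" assume F: "range F \<subseteq> sets (cadd M1 M2)" "disjoint_family F"
    have "(\<Sum>i. emeasure M1 (F i) + emeasure M2 (F i)) = (\<Sum>i. emeasure M1 (F i)) + (\<Sum>i. emeasure M2 (F i))"
      by (rule suminf_add[symmetric]) auto
    also have "\<dots> = emeasure M1 (\<Union>i. F i) + emeasure M2 (\<Union>i. F i)"
      using F e s by (simp add: suminf_emeasure)
    finally show "(\<Sum>i. emeasure M1 (F i) + emeasure M2 (F i)) = emeasure M1 (\<Union>i. F i) + emeasure M2 (\<Union>i. F i)" .
  qed
qed

lemma sets_cadd [simp]: "sets (cadd M1 M2) = sets M1"
  by (simp add: cadd_def)

lemma space_cadd [simp]: "space (cadd M1 M2) = space M1"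
  by (simp add: cadd_def)

lemma sets_csmult [simp]: "sets (csmult a M) = sets M"
  by (simp add: csmult_def)

lemma space_csmult [simp]: "space (csmult a M) = space M"
  by (simp add: csmult_def space_scale_measure)

lemma emeasure_csmult: "emeasure (csmult a M) A = ennreal a * emeasure M A"
  by (simp add: csmult_def)

context free_group
begin

section \<open>Cylinders of local types\<close>

definition Z :: "nat \<Rightarrow> word set \<Rightarrow> bpt set set" where
  "Z n A = {S \<in> CN N. tp n S = A}"

text \<open>A finite index set for the types through the base vertex; members that do not occur as a
  type have an empty cylinder.\<close>

definition TT :: "nat \<Rightarrow> word set set" where
  "TT n = {A. A \<subseteq> B n \<and> [] \<in> A}"

lemma finite_TT: "finite (TT n)"
  by (rule finite_subset[of _ "Pow (B n)"]) (auto simp: TT_def finite_ball)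

lemma openin_Z: "openin (CN_top N) (Z n A)"
  unfolding openin_CN_tp Z_def by blast

lemma sets_Z: "Z n A \<in> sets (CN_meas N)"
  by (rule sets_open[OF openin_Z])

lemma Nil_tp: "[] \<in> tp n S \<longleftrightarrow> [] \<in> thull S"
  by (simp add: tp_def)

lemma Z_sub: "A \<in> TT n \<Longrightarrow> Z n A \<subseteq> Cv []"
  using Nil_tp by (auto simp: Z_def Cv_def TT_def)

lemma tp_TT: "[] \<in> thull S \<Longrightarrow> tp n S \<in> TT n"
  using tp_sub Nil_tp by (auto simp: TT_def)

lemma SCurr_cadd:
  assumes m: "\<mu> \<in> SCurr N" "\<nu> \<in> SCurr N" and ab: "0 \<le> a" "0 \<le> b"
  shows "cadd (csmult a \<mu>) (csmult b \<nu>) \<in> SCurr N"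
proof -
  have em: "emeasure (cadd (csmult a \<mu>) (csmult b \<nu>)) U = ennreal a * emeasure \<mu> U + ennreal b * emeasure \<nu> U"
    if "U \<in> sets (CN_meas N)" for U
    using that SCurr_sets[OF m(1)] SCurr_sets[OF m(2)] by (subst emeasure_cadd) (auto simp: emeasure_csmult)
  show ?thesis
  proof (rule SCurrI)
    fix g U assume g: "g \<in> G" and U: "U \<in> sets (CN_meas N)"
    show "emeasure (cadd (csmult a \<mu>) (csmult b \<nu>)) (act g ` U) = emeasure (cadd (csmult a \<mu>) (csmult b \<nu>)) U"
      unfolding em[OF U] em[OF sets_act[OF g U]] SCurr_inv[OF m(1) g U] SCurr_inv[OF m(2) g U] ..
  next
    show "emeasure (cadd (csmult a \<mu>) (csmult b \<nu>)) (Cv []) < \<infinity>"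
      unfolding em[OF sets_Cv] using SCurr_fin[OF m(1)] SCurr_fin[OF m(2)]
      by (simp add: ennreal_mult_less_top)
  qed (use SCurr_sets[OF m(1)] SCurr_space[OF m(1)] in auto)
qed

lemma SCurr_fin_sub:
  assumes "\<mu> \<in> SCurr N" "U \<subseteq> Cv []"
  shows "emeasure \<mu> U < \<infinity>"
proof -
  have "emeasure \<mu> U \<le> emeasure \<mu> (Cv [])"
    using assms sets_Cv SCurr_sets by (intro emeasure_mono) auto
  then show ?thesis using SCurr_fin[OF assms(1)] by (rule le_less_trans)
qed

lemma measure_cadd:
  assumes m: "\<mu> \<in> SCurr N" "\<nu> \<in> SCurr N" and ab: "0 \<le> a" "0 \<le> b" and U: "U \<in> sets (CN_meas N)" "U \<subseteq> Cv []"
  shows "measure (cadd (csmult a \<mu>) (csmult b \<nu>)) U = a * measure \<mu> U + b * measure \<nu> U"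
proof -
  have "emeasure (cadd (csmult a \<mu>) (csmult b \<nu>)) U = ennreal a * emeasure \<mu> U + ennreal b * emeasure \<nu> U"
    using U SCurr_sets[OF m(1)] SCurr_sets[OF m(2)] by (subst emeasure_cadd) (auto simp: emeasure_csmult)
  moreover have "emeasure \<mu> U < \<top>" "emeasure \<nu> U < \<top>"
    using SCurr_fin_sub m U(2) by auto
  ultimately show ?thesis unfolding measure_def using ab
    by (simp add: enn2real_plus enn2real_mult ennreal_mult_less_top)
qed

lemma measure_partition:
  assumes m: "\<mu> \<in> SCurr N"
  shows "measure \<mu> {S \<in> Cv []. P (tp n S)} = (\<Sum>A\<in>{A \<in> TT n. P A}. measure \<mu> (Z n A))"
proof -
  have e: "{S \<in> Cv []. P (tp n S)} = (\<Union>A\<in>{A \<in> TT n. P A}. Z n A)"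
  proof (intro equalityI subsetI)
    fix S assume S: "S \<in> {S \<in> Cv []. P (tp n S)}"
    then have "tp n S \<in> TT n" using tp_TT by (simp add: Cv_def)
    then show "S \<in> (\<Union>A\<in>{A \<in> TT n. P A}. Z n A)" using S by (auto simp: Z_def Cv_def)
  next
    fix S assume "S \<in> (\<Union>A\<in>{A \<in> TT n. P A}. Z n A)"
    then obtain A where A: "A \<in> TT n" "P A" "S \<in> Z n A" by blast
    then show "S \<in> {S \<in> Cv []. P (tp n S)}" using Z_sub[OF A(1)] by (auto simp: Z_def)
  qed
  show ?thesis unfolding e
  proof (rule measure_finite_Union)
    show "finite {A \<in> TT n. P A}" using finite_TT by simp
    show "Z n ` {A \<in> TT n. P A} \<subseteq> sets \<mu>" using sets_Z SCurr_sets[OF m] by auto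
    show "disjoint_family_on (Z n) {A \<in> TT n. P A}" by (auto simp: disjoint_family_on_def Z_def)
    fix A assume "A \<in> {A \<in> TT n. P A}"
    then show "emeasure \<mu> (Z n A) \<noteq> \<infinity>" using SCurr_fin_sub[OF m Z_sub[of A n]] by (auto simp: less_top)
  qed
qed

definition mass :: "bpt set measure \<Rightarrow> real" where
  "mass \<mu> = measure \<mu> (Cv [])"

lemma mass_eq: "\<mu> \<in> SCurr N \<Longrightarrow> mass \<mu> = (\<Sum>A\<in>TT n. measure \<mu> (Z n A))"
  using measure_partition[of \<mu> "\<lambda>_. True" n] by (simp add: mass_def)

lemma sum_refine:
  assumes m: "\<mu> \<in> SCurr N" and n: "k \<le> n"
  shows "(\<Sum>A\<in>TT k. F A * measure \<mu> (Z k A)) = (\<Sum>A\<in>TT n. F (A \<inter> B k) * measure \<mu> (Z n A))"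
proof -
  have r: "measure \<mu> (Z k A) = (\<Sum>A'\<in>{A' \<in> TT n. A' \<inter> B k = A}. measure \<mu> (Z n A'))" if A: "A \<in> TT k" for A
  proof -
    have "Z k A = {S \<in> Cv []. tp n S \<inter> B k = A}"
      using Z_sub[OF A] tp_Int[OF n] by (auto simp: Z_def Cv_def)
    then show ?thesis using measure_partition[OF m, of "\<lambda>X. X \<inter> B k = A" n] by simp
  qed
  have "(\<Sum>A\<in>TT k. F A * measure \<mu> (Z k A)) = (\<Sum>A\<in>TT k. \<Sum>A'\<in>{A' \<in> TT n. A' \<inter> B k = A}. F (A' \<inter> B k) * measure \<mu> (Z n A'))"
  proof (rule sum.cong)
    fix A assume A: "A \<in> TT k"
    have "F A * measure \<mu> (Z k A) = (\<Sum>A'\<in>{A' \<in> TT n. A' \<inter> B k = A}. F A * measure \<mu> (Z n A'))"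
      unfolding r[OF A] by (rule sum_distrib_left)
    also have "\<dots> = (\<Sum>A'\<in>{A' \<in> TT n. A' \<inter> B k = A}. F (A' \<inter> B k) * measure \<mu> (Z n A'))"
      by (rule sum.cong) auto
    finally show "F A * measure \<mu> (Z k A) = (\<Sum>A'\<in>{A' \<in> TT n. A' \<inter> B k = A}. F (A' \<inter> B k) * measure \<mu> (Z n A'))" .
  qed simp
  also have "\<dots> = (\<Sum>A\<in>TT n. F (A \<inter> B k) * measure \<mu> (Z n A))"
    by (rule sum.group[OF finite_TT finite_TT]) (auto simp: TT_def)
  finally show ?thesis .
qed

text \<open>The cosets in the second sum are the vertices of the finite quotient of the hull by
  \<open>H\<close>, and \<open>tp n (pt H c)\<close> is the ball around such a vertex. Integrals of
  local functions thus become sums over a finite graph.\<close>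

lemma eta_sum:
  assumes c: "cocpt H"
  shows "(\<Sum>A\<in>TT n. F A * measure (eta N H) (Z n A)) = (\<Sum>c\<in>rc H ` thull (L H). F (tp n (pt H c)))"
proof -
  have H: "subgroup H (FG N)" using c by (simp add: cocpt_def)
  have fin: "finite (rc H ` thull (L H))" using c by (simp add: cocpt_def cofin_def)
  have tt: "tp n (pt H c) \<in> TT n" and cn: "pt H c \<in> CN N" if cc: "c \<in> rc H ` thull (L H)" for c
  proof -
    obtain w where w: "w \<in> thull (L H)" "c = rc H w" using cc by blast
    have wG: "w \<in> G" using w hull_in_G by blast
    have h: "[] \<in> thull (pt H c)" using pt_hull[OF H wG, of "[]"] w wG by simp
    then show "tp n (pt H c) \<in> TT n" by (rule tp_TT)
    have "H \<noteq> {[]}" using w(1) limset_finite[of H] by (auto simp: thull_def)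
    then show "pt H c \<in> CN N" using pt_CN[OF H] w wG by blast
  qed
  have me: "measure (eta N H) (Z n A) = (\<Sum>c\<in>{c \<in> rc H ` thull (L H). tp n (pt H c) = A}. 1)" if A: "A \<in> TT n" for A
  proof -
    have "{c \<in> rc H ` thull (L H). pt H c \<in> Z n A} = {c \<in> rc H ` thull (L H). tp n (pt H c) = A}"
      using cn by (auto simp: Z_def)
    then show ?thesis using eta_emeasure_fin(1)[OF c sets_Z Z_sub[OF A]] by (simp add: measure_def)
  qed
  have "(\<Sum>A\<in>TT n. F A * measure (eta N H) (Z n A)) =
    (\<Sum>A\<in>TT n. \<Sum>c\<in>{c \<in> rc H ` thull (L H). tp n (pt H c) = A}. F (tp n (pt H c)))"
    using me by (intro sum.cong) auto
  also have "\<dots> = (\<Sum>c\<in>rc H ` thull (L H). F (tp n (pt H c)))"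
    using tt by (intro sum.group) (auto simp: finite_TT fin)
  finally show ?thesis .
qed

lemma tp_pt:
  assumes H: "subgroup H (FG N)" and w: "w \<in> G"
  shows "tp n (pt H (rc H w)) = {x \<in> B n. w \<sqdot> x \<in> thull (L H)}"
  unfolding tp_def using pt_hull[OF H w] by blast

lemma card_ball1:
  assumes "[] \<in> M"
  shows "card (M \<inter> B 1) = Suc (card {a. fst a < N \<and> [a] \<in> M})"
proof -
  have "M \<inter> B 1 = insert [] ((\<lambda>a. [a]) ` {a. fst a < N \<and> [a] \<in> M})"
  proof (intro equalityI subsetI)
    fix x assume x: "x \<in> M \<inter> B 1"
    then show "x \<in> insert [] ((\<lambda>a. [a]) ` {a. fst a < N \<and> [a] \<in> M})" by (cases x) auto
  qed (use assms in auto)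
  moreover have "card ((\<lambda>a. [a]) ` {a. fst a < N \<and> [a] \<in> M}) = card {a. fst a < N \<and> [a] \<in> M}"
    by (rule card_image) (auto simp: inj_on_def)
  moreover have "finite ((\<lambda>a. [a]) ` {a. fst a < N \<and> [a] \<in> M})" by (intro finite_imageI finite_letters)
  ultimately show ?thesis by (simp add: card_insert_if image_iff)
qed

text \<open>The contribution of the base vertex to minus the Euler characteristic.\<close>

definition cw :: "word set \<Rightarrow> real" where
  "cw A = (real (card (A \<inter> B 1)) - 1) / 2 - 1"

lemma cw_dg:
  assumes M: "M \<subseteq> G" "w \<in> M" and n: "1 \<le> n"
  shows "cw {x \<in> B n. w \<sqdot> x \<in> M} = real (dg M w) / 2 - 1"
proof -
  have "w \<in> G" using M by blast
  then have one: "[] \<in> {x \<in> B n. w \<sqdot> x \<in> M}" using M by simp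
  have "{a. fst a < N \<and> [a] \<in> {x \<in> B n. w \<sqdot> x \<in> M}} = {a. fst a < N \<and> w \<sqdot> [a] \<in> M}" using n by auto
  then show ?thesis unfolding cw_def card_ball1[OF one] by (simp add: dg_def)
qed

lemma hull_invariant:
  assumes H: "subgroup H (FG N)" and h: "h \<in> H" "v \<in> thull (L H)"
  shows "h \<sqdot> v \<in> thull (L H)"
  using hull_act[of h "L H" "h \<sqdot> v"] limset_sub[of H] limset_invariant[OF H h(1)] h(2) sub_G[OF H h(1)] hull_in_G[OF h(2)] by simp

lemma frank_trivial: "frank N {[]} = 0"
proof -
  have "\<exists>S. finite S \<and> S \<subseteq> G \<and> card S = 0 \<and> generate (FG N) S = {[]}"
    using generate_empty by (intro exI[of _ "{}"]) simp
  then show ?thesis unfolding frank_def by (rule Least_eq_0)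
qed

lemma rrank_trivial: "rrank N {[]} = 0"
  by (simp add: rrank_def frank_trivial)

lemma rrank_nontrivial:
  assumes "fgsub N H" "H \<noteq> {[]}"
  shows "rrank N H = real (frank N H) - 1"
proof -
  obtain S where S: "finite S" "S \<subseteq> G" "generate (FG N) S = H" using assms by (auto simp: fgsub_def)
  have "\<exists>S. finite S \<and> S \<subseteq> G \<and> card S = frank N H \<and> generate (FG N) S = H"
    unfolding frank_def by (rule LeastI[of _ "card S"]) (use S in blast)
  then obtain S' where S': "finite S'" "card S' = frank N H" "generate (FG N) S' = H" by blast
  have "frank N H \<noteq> 0"
  proof
    assume "frank N H = 0"
    then have "S' = {}" using S' by simp
    then show False using S' assms generate_empty by simp
  qed
  then show ?thesis by (simp add: rrank_def)
qed

lemma fgsub_trivial: "fgsub N {[]}"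
  using generate_empty generate_is_subgroup[of "{}"] unfolding fgsub_def by (intro conjI exI[of _ "{}"]) simp_all

lemma cocpt_fgsub:
  assumes c: "cocpt H"
  shows "fgsub N H"
proof (cases "H = {[]}")
  case False
  have H: "subgroup H (FG N)" using c by (simp add: cocpt_def)
  show ?thesis
    by (rule frank_formula(1)[OF H tconvex_hull[OF limset_sub[of H]]])
       (use CN_hull_ne[OF limset_in_CN[OF H False]] hull_invariant[OF H] c in \<open>auto simp: cocpt_def\<close>)
qed (simp add: fgsub_trivial)

lemma rank_sum_hull:
  assumes c: "cocpt H" and nt: "H \<noteq> {[]}"
  shows "(\<Sum>c\<in>rc H ` thull (L H). cw (tp 1 (pt H c))) = rrank N H"
proof -
  have H: "subgroup H (FG N)" using c by (simp add: cocpt_def)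
  have "real (frank N H) - 1 = (\<Sum>c\<in>rc H ` thull (L H). cw (tp 1 (pt H c)))"
  proof (rule frank_formula(2)[OF H tconvex_hull[OF limset_sub[of H]]])
    show "thull (L H) \<noteq> {}" using CN_hull_ne[OF limset_in_CN[OF H nt]] by blast
    show "cofin H (thull (L H))" using c by (simp add: cocpt_def)
    fix v assume v: "v \<in> thull (L H)"
    show "cw (tp 1 (pt H (rc H v))) = real (dg (thull (L H)) v) / 2 - 1"
      unfolding tp_pt[OF H hull_in_G[OF v]] by (rule cw_dg[OF hull_sub v]) simp
  qed (rule hull_invariant[OF H])
  then show ?thesis using rrank_nontrivial[OF cocpt_fgsub[OF c] nt] by simp
qed

section \<open>The reduced rank as an integral of local weights\<close>

definition rk :: "bpt set measure \<Rightarrow> real" where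
  "rk \<mu> = (if \<mu> \<in> SCurr N then \<Sum>A\<in>TT 1. cw A * measure \<mu> (Z 1 A) else 0)"

lemma rk_eta:
  assumes "fgsub N H"
  shows "rk (eta N H) = rrank N H"
proof (cases "H = {[]}")
  case True
  then show ?thesis using eta_SCurr[OF fgsub_cocpt[OF assms]]
    by (simp add: rk_def eta_def rrank_trivial measure_def)
next
  case False
  have c: "cocpt H" using fgsub_cocpt[OF assms] .
  show ?thesis using eta_sum[OF c, of cw 1] rank_sum_hull[OF c False] eta_SCurr[OF c] by (simp add: rk_def)
qed

lemma rk_linear: "nnlinear N rk"
  unfolding nnlinear_def
proof (intro ballI allI impI)
  fix \<mu> \<nu> and a b :: real
  assume m: "\<mu> \<in> SCurr N" "\<nu> \<in> SCurr N" and ab: "0 \<le> a" "0 \<le> b"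
  have "(\<Sum>A\<in>TT 1. cw A * measure (cadd (csmult a \<mu>) (csmult b \<nu>)) (Z 1 A)) =
    (\<Sum>A\<in>TT 1. a * (cw A * measure \<mu> (Z 1 A)) + b * (cw A * measure \<nu> (Z 1 A)))"
  proof (rule sum.cong)
    fix A assume "A \<in> TT 1"
    then show "cw A * measure (cadd (csmult a \<mu>) (csmult b \<nu>)) (Z 1 A) =
      a * (cw A * measure \<mu> (Z 1 A)) + b * (cw A * measure \<nu> (Z 1 A))"
      using measure_cadd[OF m ab sets_Z Z_sub] by (simp add: algebra_simps)
  qed simp
  then show "rk (cadd (csmult a \<mu>) (csmult b \<nu>)) = a * rk \<mu> + b * rk \<nu>"
    using m SCurr_cadd[OF m ab] by (simp add: rk_def sum.distrib sum_distrib_left)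
qed

section \<open>Continuity in the topology of currents\<close>

lemma zero_Cc: "(\<lambda>_. 0) \<in> Cc N"
  unfolding Cc_def by (auto intro: exI[of _ "{}"])

lemma topspace_curr [simp]: "topspace (curr_top N) = SCurr N"
proof -
  have "UNIV \<in> {{\<mu>. (\<integral>S. f S \<partial>\<mu>) \<in> V} | f V. f \<in> Cc N \<and> open V}"
    using zero_Cc by (intro CollectI exI[of _ "\<lambda>_. 0"] exI[of _ UNIV]) auto
  then have "\<Union>{{\<mu>. (\<integral>S. f S \<partial>\<mu>) \<in> V} | f V. f \<in> Cc N \<and> open V} = UNIV" by blast
  then show ?thesis unfolding curr_top_def by simp
qed

lemma continuous_curr_integral:
  assumes f: "f \<in> Cc N"
  shows "continuous_map (curr_top N) euclideanreal (\<lambda>\<mu>. \<integral>S. f S \<partial>\<mu>)"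
  unfolding continuous_map_def
proof (intro conjI allI impI)
  fix V :: "real set" assume "openin euclideanreal V"
  then have V: "open V" using open_openin[of V] by blast
  have "openin (topology_generated_by {{\<mu>. (\<integral>S. f S \<partial>\<mu>) \<in> V} | f V. f \<in> Cc N \<and> open V}) {\<mu>. (\<integral>S. f S \<partial>\<mu>) \<in> V}"
    using f V by (intro topology_generated_by_Basis) blast
  moreover have "{\<mu> \<in> topspace (curr_top N). (\<integral>S. f S \<partial>\<mu>) \<in> V} = {\<mu>. (\<integral>S. f S \<partial>\<mu>) \<in> V} \<inter> SCurr N" by auto
  ultimately show "openin (curr_top N) {\<mu> \<in> topspace (curr_top N). (\<integral>S. f S \<partial>\<mu>) \<in> V}"
    unfolding curr_top_def openin_subtopology topspace_curr[unfolded curr_top_def] by blast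
qed simp

lemma indicator_Cc:
  assumes U: "openin (CN_top N) U" "openin (CN_top N) (CN N - U)" "U \<subseteq> Cv []"
  shows "indicator U \<in> Cc N"
  unfolding Cc_def
proof (intro CollectI conjI exI[of _ "Cv []"] compactin_C0)
  show "continuous_map (CN_top N) euclideanreal (indicator U)"
    unfolding continuous_map_def
  proof (intro conjI allI impI)
    fix V :: "real set" assume "openin euclideanreal V"
    have UC: "U \<subseteq> CN N" using U(1) openin_subset by fastforce
    have e: "{x \<in> topspace (CN_top N). indicator U x \<in> V} =
      (if (1::real) \<in> V then U else {}) \<union> (if (0::real) \<in> V then CN N - U else {})"
      using UC by (auto simp: indicator_def split: if_splits)
    show "openin (CN_top N) {x \<in> topspace (CN_top N). indicator U x \<in> V}"
      unfolding e by (intro openin_Un) (simp_all add: U)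
  qed simp
  show "\<forall>S\<in>CN N - Cv []. indicator U S = (0::real)" using U(3) by (auto simp: indicator_def)
qed

lemma openin_not_Z: "openin (CN_top N) (CN N - Z n A)"
  unfolding openin_CN_tp Z_def by auto

lemma continuous_curr_measure:
  assumes "A \<in> TT n"
  shows "continuous_map (curr_top N) euclideanreal (\<lambda>\<mu>. measure \<mu> (Z n A))"
proof -
  have i: "indicator (Z n A) \<in> Cc N" using indicator_Cc[OF openin_Z openin_not_Z Z_sub[OF assms]] .
  show ?thesis
  proof (rule continuous_map_eq[OF continuous_curr_integral[OF i]])
    fix \<mu> assume "\<mu> \<in> topspace (curr_top N)"
    then have "space \<mu> = CN N" using SCurr_space by simp
    moreover have "Z n A \<inter> CN N = Z n A" by (auto simp: Z_def)
    ultimately show "(\<integral>S. indicator (Z n A) S \<partial>\<mu>) = measure \<mu> (Z n A)" by simp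
  qed
qed

lemma continuous_mass: "continuous_map (curr_top N) euclideanreal mass"
proof (rule continuous_map_eq)
  show "continuous_map (curr_top N) euclideanreal (\<lambda>\<mu>. \<Sum>A\<in>TT 0. measure \<mu> (Z 0 A))"
    using continuous_curr_measure by (intro continuous_map_sum) (auto simp: finite_TT)
qed (use mass_eq[of _ 0] in simp)

lemma rk_continuous: "continuous_map (curr_top N) euclideanreal rk"
proof (rule continuous_map_eq)
  show "continuous_map (curr_top N) euclideanreal (\<lambda>\<mu>. \<Sum>A\<in>TT 1. cw A * measure \<mu> (Z 1 A))"
    using continuous_curr_measure
    by (intro continuous_map_sum continuous_map_real_mult) (auto simp: finite_TT)
qed (simp add: rk_def)

end

section \<open>The intersection functional\<close>

context free_group
begin

text \<open>The second summand adds up to 1 over a finite tree with at most \<open>R\<close> vertices, which cancels its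
  Euler characteristic; finite trees are the components of the fibre product that belong to
  trivial intersections.\<close>

definition cR :: "nat \<Rightarrow> word set \<Rightarrow> real" where
  "cR R M = cw M + (if card M \<le> R then 1 / real (card M) else 0)"

definition NR :: "nat \<Rightarrow> bpt set measure \<Rightarrow> bpt set measure \<Rightarrow> real" where
  "NR R \<mu> \<nu> = (\<Sum>A\<in>TT R. (\<Sum>A'\<in>TT R. cR R (A \<inter> A') * measure \<nu> (Z R A')) * measure \<mu> (Z R A))"

lemma NR_refine:
  assumes m: "\<mu> \<in> SCurr N" "\<nu> \<in> SCurr N" and n: "R \<le> n"
  shows "NR R \<mu> \<nu> = (\<Sum>A\<in>TT n. (\<Sum>A'\<in>TT n. cR R (A \<inter> A' \<inter> B R) * measure \<nu> (Z n A')) * measure \<mu> (Z n A))"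
proof -
  have "NR R \<mu> \<nu> = (\<Sum>A\<in>TT n. (\<Sum>A'\<in>TT R. cR R (A \<inter> B R \<inter> A') * measure \<nu> (Z R A')) * measure \<mu> (Z n A))"
    unfolding NR_def by (rule sum_refine[OF m(1) n])
  also have "\<dots> = (\<Sum>A\<in>TT n. (\<Sum>A'\<in>TT n. cR R (A \<inter> B R \<inter> (A' \<inter> B R)) * measure \<nu> (Z n A')) * measure \<mu> (Z n A))"
    by (intro sum.cong refl arg_cong[where f = "\<lambda>x. x * _"] sum_refine[OF m(2) n])
  also have "\<dots> = (\<Sum>A\<in>TT n. (\<Sum>A'\<in>TT n. cR R (A \<inter> A' \<inter> B R) * measure \<nu> (Z n A')) * measure \<mu> (Z n A))"
  proof -
    have "A \<inter> B R \<inter> (A' \<inter> B R) = A \<inter> A' \<inter> B R" for A A' by blast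
    then show ?thesis by simp
  qed
  finally show ?thesis .
qed

text \<open>A vertex beyond radius \<open>R\<close> brings along its prefixes of the lengths 0 to
  \<open>R\<close>, which are \<open>R + 1\<close> vertices of \<open>M\<close> in the ball.\<close>

lemma tree_card:
  assumes M: "tconvex M" "[] \<in> M" and c: "card (M \<inter> B R) \<le> R"
  shows "M \<subseteq> B R"
proof (rule ccontr)
  assume "\<not> M \<subseteq> B R"
  then obtain w where w: "w \<in> M" "w \<notin> B R" by blast
  have wG: "w \<in> G" using M w by (auto simp: tconvex_def)
  then have l: "R < length w" using w by simp
  have "(\<lambda>i. take i w) ` {..R} \<subseteq> M \<inter> B R"
    using tconvex_prefix[OF M w(1) take_is_prefix] wG l by auto
  then have "card ((\<lambda>i. take i w) ` {..R}) \<le> card (M \<inter> B R)"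
    using finite_ball[of R] by (intro card_mono) auto
  moreover have "inj_on (\<lambda>i. take i w) {..R}"
  proof (rule inj_onI)
    fix i j assume "i \<in> {..R}" "j \<in> {..R}" "take i w = take j w"
    then have "length (take i w) = length (take j w)" "i \<le> R" "j \<le> R" by auto
    then show "i = j" using l by simp
  qed
  then have "card ((\<lambda>i. take i w) ` {..R}) = Suc R" by (simp add: card_image)
  ultimately show False using c by simp
qed

text \<open>If the ball of radius \<open>R\<close> sees at most \<open>R\<close> vertices, it
  contains all of \<open>M\<close> and nothing changes. Otherwise the weight at radius
  \<open>R\<close> is zero, and the one at radius \<open>n\<close> is zero or the inverse of a
  number exceeding \<open>R\<close>.\<close>

lemma cR_diff:
  assumes M: "tconvex M" "[] \<in> M" and R: "1 \<le> R" "R \<le> n"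
  shows "\<bar>cR R (M \<inter> B n \<inter> B R) - cR n (M \<inter> B n)\<bar> \<le> 1 / (real R + 1)"
proof -
  have e: "M \<inter> B n \<inter> B R = M \<inter> B R" using R by auto
  have c: "cw (M \<inter> B R) = cw (M \<inter> B n)"
  proof -
    have "M \<inter> B R \<inter> B 1 = M \<inter> B n \<inter> B 1" using R by auto
    then show ?thesis by (simp only: cw_def)
  qed
  show ?thesis
  proof (cases "card (M \<inter> B R) \<le> R")
    case True
    then have "M \<inter> B n = M \<inter> B R" using tree_card[OF M True] R by auto
    then show ?thesis unfolding e cR_def using True R by simp
  next
    case False
    have "card (M \<inter> B R) \<le> card (M \<inter> B n)" using R finite_ball[of n] by (intro card_mono) auto
    then have "real R + 1 \<le> real (card (M \<inter> B n))" using False by simp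
    then have "1 / real (card (M \<inter> B n)) \<le> 1 / (real R + 1)" by (intro divide_left_mono) auto
    then show ?thesis unfolding e cR_def c using False by simp
  qed
qed

text \<open>The pointwise estimate rests on convexity, so it is applied to pairs of types that
  occur; the other pairs carry no mass.\<close>

lemma NR_diff:
  assumes m: "\<mu> \<in> SCurr N" "\<nu> \<in> SCurr N" and R: "1 \<le> R" "R \<le> n"
  shows "\<bar>NR R \<mu> \<nu> - NR n \<mu> \<nu>\<bar> \<le> mass \<mu> * mass \<nu> / (real R + 1)"
proof -
  let ?d = "\<lambda>A A'. cR R (A \<inter> A' \<inter> B R) - cR n (A \<inter> A')"
  have b: "\<bar>?d A A' * measure \<nu> (Z n A') * measure \<mu> (Z n A)\<bar> \<le> 1 / (real R + 1) * measure \<nu> (Z n A') * measure \<mu> (Z n A)"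
    if A: "A \<in> TT n" "A' \<in> TT n" for A A'
  proof (cases "Z n A = {} \<or> Z n A' = {}")
    case False
    then obtain S S' where S: "S \<in> Z n A" "S' \<in> Z n A'" by blast
    have SC: "S \<in> CN N" "S' \<in> CN N" "A = thull S \<inter> B n" "A' = thull S' \<inter> B n"
      using S by (auto simp: Z_def tp_def)
    let ?M = "thull S \<inter> thull S'"
    have M: "tconvex ?M" using tconvex_Int tconvex_hull CN_sub SC by blast
    have one: "[] \<in> ?M" using A SC by (auto simp: TT_def)
    have "A \<inter> A' = ?M \<inter> B n" using SC by blast
    then have "\<bar>?d A A'\<bar> \<le> 1 / (real R + 1)" using cR_diff[OF M one R] by simp
    then have "\<bar>?d A A'\<bar> * (measure \<nu> (Z n A') * measure \<mu> (Z n A)) \<le> 1 / (real R + 1) * (measure \<nu> (Z n A') * measure \<mu> (Z n A))"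
      by (rule mult_right_mono) simp
    then show ?thesis by (simp add: abs_mult mult.assoc)
  qed auto
  have "NR R \<mu> \<nu> - NR n \<mu> \<nu> = (\<Sum>A\<in>TT n. \<Sum>A'\<in>TT n. ?d A A' * measure \<nu> (Z n A') * measure \<mu> (Z n A))"
    unfolding NR_refine[OF m R(2)] NR_def[of n] sum_distrib_right sum_subtractf[symmetric] left_diff_distrib ..
  then have "\<bar>NR R \<mu> \<nu> - NR n \<mu> \<nu>\<bar> \<le> (\<Sum>A\<in>TT n. \<Sum>A'\<in>TT n. \<bar>?d A A' * measure \<nu> (Z n A') * measure \<mu> (Z n A)\<bar>)"
    by (simp only:) (intro order_trans[OF sum_abs] sum_mono sum_abs)
  also have "\<dots> \<le> (\<Sum>A\<in>TT n. \<Sum>A'\<in>TT n. 1 / (real R + 1) * measure \<nu> (Z n A') * measure \<mu> (Z n A))"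
    by (intro sum_mono b)
  also have "\<dots> = (\<Sum>A\<in>TT n. measure \<mu> (Z n A)) * (\<Sum>A'\<in>TT n. measure \<nu> (Z n A')) / (real R + 1)"
    by (simp add: sum_product sum_divide_distrib mult.commute)
  finally show ?thesis unfolding mass_eq[OF m(1), of n] mass_eq[OF m(2), of n] .
qed

lemma mass_nonneg: "0 \<le> mass \<mu>"
  by (simp add: mass_def)

section \<open>The limit of the truncated functionals\<close>

definition NN :: "bpt set measure \<Rightarrow> bpt set measure \<Rightarrow> real" where
  "NN \<mu> \<nu> = (if \<mu> \<in> SCurr N \<and> \<nu> \<in> SCurr N then lim (\<lambda>R. NR R \<mu> \<nu>) else 0)"

lemma small_quotient:
  assumes "0 \<le> K" "0 < e"
  shows "\<exists>M\<ge>1. \<forall>m\<ge>M. K / (real m + 1) < e"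
proof -
  obtain M :: nat where M: "K / e < real M" using reals_Archimedean2 by blast
  have "K / (real m + 1) < e" if "m \<ge> max 1 M" for m
  proof -
    have "K / e < real m + 1" using M that by simp
    then show ?thesis using assms by (simp add: field_simps)
  qed
  then show ?thesis by (intro exI[of _ "max 1 M"]) auto
qed

lemma NR_tendsto:
  assumes m: "\<mu> \<in> SCurr N" "\<nu> \<in> SCurr N"
  shows "(\<lambda>R. NR R \<mu> \<nu>) \<longlonglongrightarrow> NN \<mu> \<nu>"
proof -
  have "Cauchy (\<lambda>R. NR R \<mu> \<nu>)"
  proof (rule CauchyI')
    fix e :: real assume e: "0 < e"
    obtain M where M: "M \<ge> 1" "\<And>k. k \<ge> M \<Longrightarrow> mass \<mu> * mass \<nu> / (real k + 1) < e"
      using small_quotient[of "mass \<mu> * mass \<nu>" e] e mass_nonneg by (metis mult_nonneg_nonneg)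
    have "dist (NR k \<mu> \<nu>) (NR n \<mu> \<nu>) < e" if "k \<ge> M" "n > k" for k n
      using NR_diff[OF m, of k n] M(2)[OF that(1)] M(1) that by (simp add: dist_real_def)
    then show "\<exists>M. \<forall>k\<ge>M. \<forall>n>k. dist (NR k \<mu> \<nu>) (NR n \<mu> \<nu>) < e" by blast
  qed
  then have "convergent (\<lambda>R. NR R \<mu> \<nu>)" by (simp add: Cauchy_convergent_iff)
  then show ?thesis using m by (simp add: NN_def convergent_LIMSEQ_iff)
qed

lemma NN_bound:
  assumes m: "\<mu> \<in> SCurr N" "\<nu> \<in> SCurr N" and R: "1 \<le> R"
  shows "\<bar>NR R \<mu> \<nu> - NN \<mu> \<nu>\<bar> \<le> mass \<mu> * mass \<nu> / (real R + 1)"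
proof (rule LIMSEQ_le_const2)
  show "(\<lambda>n. \<bar>NR R \<mu> \<nu> - NR n \<mu> \<nu>\<bar>) \<longlonglongrightarrow> \<bar>NR R \<mu> \<nu> - NN \<mu> \<nu>\<bar>"
    by (intro tendsto_intros NR_tendsto[OF m])
  show "\<exists>M. \<forall>n\<ge>M. \<bar>NR R \<mu> \<nu> - NR n \<mu> \<nu>\<bar> \<le> mass \<mu> * mass \<nu> / (real R + 1)"
    using NR_diff[OF m R] by blast
qed

lemma NR_sym: "NR R \<mu> \<nu> = NR R \<nu> \<mu>"
proof -
  have "NR R \<mu> \<nu> = (\<Sum>A\<in>TT R. \<Sum>A'\<in>TT R. cR R (A \<inter> A') * measure \<nu> (Z R A') * measure \<mu> (Z R A))"
    by (simp add: NR_def sum_distrib_right)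
  also have "\<dots> = (\<Sum>A'\<in>TT R. \<Sum>A\<in>TT R. cR R (A \<inter> A') * measure \<nu> (Z R A') * measure \<mu> (Z R A))"
    by (rule sum.swap)
  also have "\<dots> = NR R \<nu> \<mu>"
    unfolding NR_def sum_distrib_right by (intro sum.cong refl) (simp add: Int_commute mult_ac)
  finally show ?thesis .
qed

lemma NN_sym: "NN \<mu> \<nu> = NN \<nu> \<mu>"
  unfolding NN_def by (simp add: NR_sym[of _ \<mu> \<nu>])

lemma NR_linear:
  assumes m: "\<mu> \<in> SCurr N" "\<mu>' \<in> SCurr N" and ab: "0 \<le> a" "0 \<le> b"
  shows "NR R (cadd (csmult a \<mu>) (csmult b \<mu>')) \<nu> = a * NR R \<mu> \<nu> + b * NR R \<mu>' \<nu>"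
proof -
  let ?F = "\<lambda>A. \<Sum>A'\<in>TT R. cR R (A \<inter> A') * measure \<nu> (Z R A')"
  have "NR R (cadd (csmult a \<mu>) (csmult b \<mu>')) \<nu> = (\<Sum>A\<in>TT R. a * (?F A * measure \<mu> (Z R A)) + b * (?F A * measure \<mu>' (Z R A)))"
    unfolding NR_def
  proof (rule sum.cong)
    fix A assume "A \<in> TT R"
    then show "?F A * measure (cadd (csmult a \<mu>) (csmult b \<mu>')) (Z R A) =
      a * (?F A * measure \<mu> (Z R A)) + b * (?F A * measure \<mu>' (Z R A))"
      using measure_cadd[OF m ab sets_Z Z_sub] by (simp add: algebra_simps)
  qed simp
  then show ?thesis by (simp add: NR_def sum.distrib sum_distrib_left)
qed

lemma NN_linear:
  assumes n: "\<nu> \<in> SCurr N"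
  shows "nnlinear N (\<lambda>\<mu>. NN \<mu> \<nu>)"
  unfolding nnlinear_def
proof (intro ballI allI impI)
  fix \<mu> \<mu>' and a b :: real
  assume m: "\<mu> \<in> SCurr N" "\<mu>' \<in> SCurr N" and ab: "0 \<le> a" "0 \<le> b"
  have "(\<lambda>R. NR R (cadd (csmult a \<mu>) (csmult b \<mu>')) \<nu>) \<longlonglongrightarrow> NN (cadd (csmult a \<mu>) (csmult b \<mu>')) \<nu>"
    using NR_tendsto[OF SCurr_cadd[OF m ab] n] .
  moreover have "(\<lambda>R. NR R (cadd (csmult a \<mu>) (csmult b \<mu>')) \<nu>) \<longlonglongrightarrow> a * NN \<mu> \<nu> + b * NN \<mu>' \<nu>"
    unfolding NR_linear[OF m ab] by (intro tendsto_intros NR_tendsto m n)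
  ultimately show "NN (cadd (csmult a \<mu>) (csmult b \<mu>')) \<nu> = a * NN \<mu> \<nu> + b * NN \<mu>' \<nu>"
    by (rule LIMSEQ_unique)
qed

lemma continuous_NR: "continuous_map (prod_topology (curr_top N) (curr_top N)) euclideanreal (\<lambda>p. NR R (fst p) (snd p))"
proof -
  let ?X = "prod_topology (curr_top N) (curr_top N)"
  have f: "continuous_map ?X euclideanreal (\<lambda>p. measure (fst p) (Z R A))" if "A \<in> TT R" for A
    using continuous_map_compose[OF continuous_map_fst continuous_curr_measure[OF that]] by (simp add: o_def)
  have s: "continuous_map ?X euclideanreal (\<lambda>p. measure (snd p) (Z R A))" if "A \<in> TT R" for A
    using continuous_map_compose[OF continuous_map_snd continuous_curr_measure[OF that]] by (simp add: o_def)
  show ?thesis unfolding NR_def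
    by (intro continuous_map_sum continuous_map_real_mult f s finite_TT) auto
qed

lemma continuous_mass_prod:
  "continuous_map (prod_topology (curr_top N) (curr_top N)) euclideanreal (\<lambda>p. mass (fst p) * mass (snd p))"
  using continuous_map_compose[OF continuous_map_fst continuous_mass]
    continuous_map_compose[OF continuous_map_snd continuous_mass]
  by (intro continuous_map_real_mult) (simp_all add: o_def)

lemma NN_continuous: "continuous_map (prod_topology (curr_top N) (curr_top N)) euclideanreal (\<lambda>p. NN (fst p) (snd p))"
  unfolding continuous_map_def
proof (intro conjI allI impI)
  let ?X = "prod_topology (curr_top N) (curr_top N)"
  fix V :: "real set" assume "openin euclideanreal V"
  then have V: "open V" using open_openin[of V] by blast
  have "\<exists>T. openin ?X T \<and> p \<in> T \<and> T \<subseteq> {p \<in> topspace ?X. NN (fst p) (snd p) \<in> V}"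
    if p: "p \<in> {p \<in> topspace ?X. NN (fst p) (snd p) \<in> V}" for p
  proof -
    obtain e where e: "e > 0" "ball (NN (fst p) (snd p)) e \<subseteq> V" using V p open_contains_ball by blast
    \<comment> \<open>The added 1 leaves room for the product of the masses to stay below
      \<open>K\<close> on a whole neighbourhood of \<open>p\<close>; there the truncation error is
      uniformly small.\<close>
    define K where "K = mass (fst p) * mass (snd p) + 1"
    have K: "0 \<le> K" using mass_nonneg by (simp add: K_def)
    obtain R where R: "R \<ge> 1" "K / (real R + 1) < e / 3" using small_quotient[OF K, of "e / 3"] e(1) by auto
    define T where "T = {q \<in> topspace ?X. mass (fst q) * mass (snd q) \<in> {..<K}} \<inter>
      {q \<in> topspace ?X. NR R (fst q) (snd q) \<in> ball (NR R (fst p) (snd p)) (e / 3)}"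
    have "openin ?X T" unfolding T_def
      using open_openin[of "{..<K}", THEN iffD1, OF open_lessThan]
        open_openin[of "ball (NR R (fst p) (snd p)) (e / 3)", THEN iffD1, OF open_ball]
      by (intro openin_Int openin_continuous_map_preimage[OF continuous_mass_prod] openin_continuous_map_preimage[OF continuous_NR]) blast+
    moreover have "p \<in> T" using p e(1) by (simp add: T_def K_def)
    moreover have "NN (fst q) (snd q) \<in> V" if q: "q \<in> T" for q
    proof -
      have b: "\<bar>NR R (fst x) (snd x) - NN (fst x) (snd x)\<bar> \<le> K / (real R + 1)"
        if x: "x \<in> topspace ?X" "mass (fst x) * mass (snd x) \<le> K" for x
      proof -
        have "fst x \<in> SCurr N" "snd x \<in> SCurr N" using x by (auto simp: mem_Times_iff)
        from NN_bound[OF this R(1)] have "\<bar>NR R (fst x) (snd x) - NN (fst x) (snd x)\<bar> \<le> mass (fst x) * mass (snd x) / (real R + 1)" .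
        also have "\<dots> \<le> K / (real R + 1)" using x(2) by (intro divide_right_mono) auto
        finally show ?thesis .
      qed
      have "\<bar>NR R (fst q) (snd q) - NN (fst q) (snd q)\<bar> \<le> K / (real R + 1)"
        using b[of q] q unfolding T_def by force
      then have "\<bar>NR R (fst q) (snd q) - NN (fst q) (snd q)\<bar> < e / 3" using R(2) by linarith
      moreover have "\<bar>NR R (fst p) (snd p) - NN (fst p) (snd p)\<bar> \<le> K / (real R + 1)"
        using b[of p] p by (simp add: K_def)
      then have "\<bar>NR R (fst p) (snd p) - NN (fst p) (snd p)\<bar> < e / 3" using R(2) by linarith
      moreover have "\<bar>NR R (fst p) (snd p) - NR R (fst q) (snd q)\<bar> < e / 3" using q by (simp add: T_def dist_real_def)
      ultimately have "\<bar>NN (fst p) (snd p) - NN (fst q) (snd q)\<bar> < e" by linarith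
      then show ?thesis using e(2) by (auto simp: dist_real_def)
    qed
    ultimately show ?thesis unfolding T_def by blast
  qed
  then show "openin ?X {p \<in> topspace ?X. NN (fst p) (snd p) \<in> V}" by (subst openin_subopen) blast
qed simp

text \<open>A lift to the tree of the component of the fibre product that belongs to
  \<open>g\<close>. It contains the hull of the limit set of the intersection group, but it can be
  larger, and it can be a nonempty finite tree when that group is trivial.\<close>

definition MD :: "word set \<Rightarrow> word set \<Rightarrow> word \<Rightarrow> word set" where
  "MD H K g = thull (L H) \<inter> thull (L (conjg N g K))"

section \<open>Values on counting currents\<close>

context
  fixes H K :: "word set"
  assumes H: "cocpt H" "H \<noteq> {[]}" and K: "cocpt K" "K \<noteq> {[]}"
begin

lemma sH: "subgroup H (FG N)" and sK: "subgroup K (FG N)"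
  using H K by (auto simp: cocpt_def)

lemma KG: "K \<subseteq> G"
  using subgroup.subset[OF sK] .

lemma MD_iff: "g \<in> G \<Longrightarrow> v \<in> G \<Longrightarrow> v \<in> MD H K g \<longleftrightarrow> v \<in> thull (L H) \<and> iv g \<sqdot> v \<in> thull (L K)"
  unfolding MD_def limset_conjg[OF KG] using hull_act[OF _ limset_sub[of K]] by simp

lemma MD_sub: "MD H K g \<subseteq> G"
  using hull_sub by (auto simp: MD_def)

lemma MD_props:
  assumes g: "g \<in> G"
  defines "J \<equiv> H \<inter> conjg N g K"
  shows "subgroup J (FG N)" "tconvex (MD H K g)" "cofin J (MD H K g)" "cocpt J"
    "\<And>h v. h \<in> J \<Longrightarrow> v \<in> MD H K g \<Longrightarrow> h \<sqdot> v \<in> MD H K g" "thull (L J) \<subseteq> MD H K g"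
proof -
  have K': "cocpt (conjg N g K)" "conjg N g K \<noteq> {[]}" "subgroup (conjg N g K) (FG N)"
    using cocpt_conjg[OF K(1) g] conjg_nontriv[OF g KG K(2)] subgroup_conjg[OF sK g] .
  show "cofin J (MD H K g)" "cocpt J"
    using cocpt_Int[OF H(1) K'(1) H(2) K'(2)] by (simp_all add: J_def MD_def)
  then show "subgroup J (FG N)" by (simp add: cocpt_def)
  show "tconvex (MD H K g)" unfolding MD_def
    by (intro tconvex_Int tconvex_hull limset_sub)
  show "thull (L J) \<subseteq> MD H K g"
    unfolding MD_def J_def using hull_mono[OF limset_mono[of "H \<inter> conjg N g K" H]]
      hull_mono[OF limset_mono[of "H \<inter> conjg N g K" "conjg N g K"]] by auto
  fix h v assume h: "h \<in> J" "v \<in> MD H K g"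
  then show "h \<sqdot> v \<in> MD H K g"
    using hull_invariant[OF sH, of h v] hull_invariant[OF K'(3), of h v] by (simp add: MD_def J_def)
qed

lemma tp_psi:
  assumes g: "g \<in> G" and w: "w \<in> G"
  shows "tp n (pt H (fst (psi H K g w))) \<inter> tp n (pt K (snd (psi H K g w))) = {x \<in> B n. w \<sqdot> x \<in> MD H K g}"
proof -
  have "tp n (pt H (rc H w)) = {x \<in> B n. w \<sqdot> x \<in> thull (L H)}" using tp_pt[OF sH w] .
  moreover have "tp n (pt K (rc K (iv g \<sqdot> w))) = {x \<in> B n. iv g \<sqdot> w \<sqdot> x \<in> thull (L K)}"
    using tp_pt[OF sK, of "iv g \<sqdot> w"] g w by simp
  moreover have "w \<sqdot> x \<in> MD H K g \<longleftrightarrow> w \<sqdot> x \<in> thull (L H) \<and> iv g \<sqdot> w \<sqdot> x \<in> thull (L K)" if "x \<in> G" for x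
    using MD_iff[OF g, of "w \<sqdot> x"] g w that by (simp add: m_assoc)
  ultimately show ?thesis unfolding psi_def fst_conv snd_conv by blast
qed

lemma infinite_MD:
  assumes g: "g \<in> G" and m: "m \<in> MD H K g" and nt: "H \<inter> conjg N g K \<noteq> {[]}"
  shows "infinite (MD H K g)"
proof
  let ?J = "H \<inter> conjg N g K"
  assume f: "finite (MD H K g)"
  have J: "subgroup ?J (FG N)" using MD_props(1)[OF g] .
  have mG: "m \<in> G" using m MD_sub by blast
  have "(\<lambda>h. h \<sqdot> m) ` ?J \<subseteq> MD H K g" using MD_props(5)[OF g] m by blast
  then have "finite ((\<lambda>h. h \<sqdot> m) ` ?J)" using f finite_subset by blast
  moreover have "inj_on (\<lambda>h. h \<sqdot> m) ?J"
  proof (rule inj_on_inverseI[where g = "\<lambda>x. x \<sqdot> iv m"])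
    fix h assume "h \<in> ?J"
    then show "h \<sqdot> m \<sqdot> iv m = h" using sub_G[OF J] mG by simp
  qed
  ultimately have "finite ?J" by (rule finite_imageD)
  then have "L ?J = {}" by (rule limset_finite)
  then show False using limset_in_CN[OF J nt] by (simp add: CN_iff)
qed

text \<open>The weights split into the Euler term \<open>cw\<close> and a correction
  \<open>f2\<close> that is constant on the component. If the group is trivial, the component is a
  finite tree with at most \<open>R\<close> vertices, and its corrections add up to 1, cancelling
  the -1 of the rank formula. Otherwise the component is infinite, every ball of radius
  \<open>R\<close> in it has more than \<open>R\<close> vertices, and the correction is
  zero.\<close>

lemma component_sum:
  assumes g: "g \<in> G" and ne: "MD H K g \<noteq> {}" and R: "1 \<le> R"
    and triv: "H \<inter> conjg N g K = {[]} \<Longrightarrow> card (MD H K g) \<le> R"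
    and f: "\<And>w. w \<in> MD H K g \<Longrightarrow> f (rc (H \<inter> conjg N g K) w) = cR R {x \<in> B R. w \<sqdot> x \<in> MD H K g}"
  shows "sum f (rc (H \<inter> conjg N g K) ` MD H K g) = rrank N (H \<inter> conjg N g K)"
proof -
  let ?J = "H \<inter> conjg N g K" and ?M = "MD H K g"
  have J: "subgroup ?J (FG N)" "tconvex ?M" "cofin ?J ?M" "cocpt ?J" using MD_props[OF g] by blast+
  define f2 where "f2 = (if ?J = {[]} then 1 / real (card ?M) else 0)"
  define f1 where "f1 c = f c - f2" for c
  have injM: "inj_on (rc ?J) ?M" if t: "?J = {[]}"
  proof (rule inj_onI)
    fix u v assume u: "u \<in> ?M" "v \<in> ?M" "rc ?J u = rc ?J v"
    have G: "u \<in> G" "v \<in> G" using u MD_sub by blast+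
    have "u \<sqdot> iv v = []" using rc_eq_iff[OF J(1) G] u(3) t by blast
    then have "u \<sqdot> iv v \<sqdot> v = v" using G by simp
    then show "u = v" using G by simp
  qed
  have finM: "finite ?M" if "?J = {[]}"
    using J(3) finite_imageD[OF _ injM[OF that]] unfolding cofin_def by blast
  have h: "(if card {x \<in> B R. v \<sqdot> x \<in> ?M} \<le> R then 1 / real (card {x \<in> B R. v \<sqdot> x \<in> ?M}) else 0) = f2" if v: "v \<in> ?M" for v
  proof -
    have vG: "v \<in> G" using v MD_sub by blast
    let ?Mv = "(\<lambda>x. iv v \<sqdot> x) ` ?M"
    have Mv: "tconvex ?Mv" using tconvex_translate[OF J(2), of "iv v"] vG by simp
    have one: "[] \<in> ?Mv" using v vG by (intro image_eqI[of _ _ v]) auto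
    have mem: "x \<in> ?Mv \<longleftrightarrow> v \<sqdot> x \<in> ?M" if x: "x \<in> G" for x
    proof
      assume "x \<in> ?Mv"
      then obtain y where y: "y \<in> ?M" "x = iv v \<sqdot> y" by blast
      then show "v \<sqdot> x \<in> ?M" using MD_sub[of g] vG by (simp add: subset_iff)
    next
      assume "v \<sqdot> x \<in> ?M"
      then show "x \<in> ?Mv" using x vG by (intro image_eqI[of _ _ "v \<sqdot> x"]) auto
    qed
    have e: "{x \<in> B R. v \<sqdot> x \<in> ?M} = ?Mv \<inter> B R" using mem by blast
    have inj: "inj_on (\<lambda>x. iv v \<sqdot> x) ?M"
      by (rule inj_on_inverseI[where g = "\<lambda>x. v \<sqdot> x"]) (use MD_sub[of g] vG in \<open>auto simp: subset_iff\<close>)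
    show ?thesis
    proof (cases "?J = {[]}")
      case True
      have fM: "finite ?M" using finM[OF True] .
      have "card (?Mv \<inter> B R) \<le> card ?Mv" using fM by (intro card_mono) auto
      also have "card ?Mv = card ?M" using card_image[OF inj] .
      finally have le: "card (?Mv \<inter> B R) \<le> R" using triv[OF True] by simp
      then have "?Mv \<inter> B R = ?Mv" using tree_card[OF Mv one] by blast
      then have "card (?Mv \<inter> B R) = card ?M" using card_image[OF inj] by simp
      then show ?thesis unfolding e f2_def using True le by simp
    next
      case False
      have "infinite ?Mv" using infinite_MD[OF g v False] finite_imageD[OF _ inj] by blast
      then have "\<not> card (?Mv \<inter> B R) \<le> R" using tree_card[OF Mv one] finite_ball[of R] finite_subset by blast
      then show ?thesis unfolding e f2_def using False by simp
    qed
  qed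
  have "real (frank N ?J) - 1 = sum f1 (rc ?J ` ?M)"
  proof (rule frank_formula(2)[OF J(1,2) ne _ J(3)])
    fix h v assume "h \<in> ?J" "v \<in> ?M"
    then show "h \<sqdot> v \<in> ?M" by (rule MD_props(5)[OF g])
  next
    fix v assume v: "v \<in> ?M"
    show "f1 (rc ?J v) = real (dg ?M v) / 2 - 1"
      unfolding f1_def f[OF v] cR_def h[OF v] using cw_dg[OF MD_sub v R] by simp
  qed
  moreover have "sum f (rc ?J ` ?M) = sum f1 (rc ?J ` ?M) + real (card (rc ?J ` ?M)) * f2"
    by (simp add: f1_def sum_subtractf)
  moreover have "real (frank N ?J) - 1 + real (card (rc ?J ` ?M)) * f2 = rrank N ?J"
  proof (cases "?J = {[]}")
    case True
    have "card (rc ?J ` ?M) = card ?M" by (rule card_image[OF injM[OF True]])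
    moreover have "card ?M > 0" using finM[OF True] ne by (simp add: card_gt_0_iff)
    ultimately show ?thesis using True by (simp add: f2_def frank_trivial rrank_trivial)
  next
    case False
    then show ?thesis using rrank_nontrivial[OF cocpt_fgsub[OF J(4)] False] by (simp add: f2_def)
  qed
  ultimately show ?thesis by simp
qed

text \<open>The double cosets with a nonempty component. There are finitely many of them, and all
  others have a trivial intersection group, so sums over all double cosets reduce to finite sums
  over these.\<close>

definition dcs :: "word set set" where
  "dcs = {D \<in> dcosets N H K. MD H K (dcrep N H K D) \<noteq> {}}"

lemma dcs_out:
  assumes D: "D \<in> dcosets N H K" "D \<notin> dcs"
  shows "H \<inter> conjg N (dcrep N H K D) K = {[]}"
proof (rule ccontr)
  let ?g = "dcrep N H K D"
  assume nt: "H \<inter> conjg N ?g K \<noteq> {[]}"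
  have g: "?g \<in> G" using dcrep(1)[OF D(1)] .
  have "thull (L (H \<inter> conjg N ?g K)) \<noteq> {}" using CN_hull_ne[OF limset_in_CN[OF MD_props(1)[OF g] nt]] by blast
  then show False using MD_props(6)[OF g] D by (auto simp: dcs_def)
qed

definition phi :: "word set \<Rightarrow> word set \<Rightarrow> word set \<times> word set" where
  "phi D c = (let g = dcrep N H K D in psi H K g (inv_into (MD H K g) (rc (H \<inter> conjg N g K)) c))"

lemma phi_rc:
  assumes D: "D \<in> dcosets N H K" and w: "w \<in> MD H K (dcrep N H K D)"
  shows "phi D (rc (H \<inter> conjg N (dcrep N H K D) K) w) = psi H K (dcrep N H K D) w"
proof -
  let ?g = "dcrep N H K D"
  let ?J = "H \<inter> conjg N ?g K" and ?M = "MD H K ?g"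
  have g: "?g \<in> G" using dcrep(1)[OF D] .
  let ?u = "inv_into ?M (rc ?J) (rc ?J w)"
  have u: "?u \<in> ?M" "rc ?J ?u = rc ?J w"
    using inv_into_into[OF imageI[OF w], of "rc ?J"] f_inv_into_f[OF imageI[OF w], of "rc ?J"] by blast+
  have G: "?u \<in> G" "w \<in> G" using u w MD_sub by blast+
  have "psi H K ?g ?u = psi H K ?g w" using psi_eq_iff[OF sH sK g G] u(2) by simp
  then show ?thesis by (simp add: phi_def Let_def)
qed

lemma rc_thull: "subgroup A (FG N) \<Longrightarrow> w \<in> G \<Longrightarrow> rc A w \<in> rc A ` thull (L A) \<longleftrightarrow> w \<in> thull (L A)"
proof
  assume A: "subgroup A (FG N)" and w: "w \<in> G" and "rc A w \<in> rc A ` thull (L A)"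
  then obtain v where v: "v \<in> thull (L A)" "rc A w = rc A v" by blast
  have vG: "v \<in> G" using v hull_in_G by blast
  have "w \<sqdot> iv v \<in> A" using rc_eq_iff[OF A w vG] v by simp
  from hull_invariant[OF A this v(1)] show "w \<in> thull (L A)" using w vG by simp
qed blast

text \<open>The vertices of the fibre product of the two quotient graphs, sorted by
  components.\<close>

lemma bij_phi:
  "bij_betw (\<lambda>(D, c). phi D c) (SIGMA D:dcs. rc (H \<inter> conjg N (dcrep N H K D) K) ` MD H K (dcrep N H K D))
    (rc H ` thull (L H) \<times> rc K ` thull (L K))" (is "bij_betw ?f ?S ?P")
  unfolding bij_betw_def
proof
  let ?g = "dcrep N H K"
  have dc: "D \<in> dcosets N H K" "?g D \<in> G" if "D \<in> dcs" for D using that dcrep(1) by (auto simp: dcs_def)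
  show "inj_on ?f ?S"
  proof (rule inj_onI)
    fix x y assume x: "x \<in> ?S" and y: "y \<in> ?S" and e: "?f x = ?f y"
    obtain D w where D: "D \<in> dcs" "w \<in> MD H K (?g D)" "x = (D, rc (H \<inter> conjg N (?g D) K) w)" using x by blast
    obtain D' w' where D': "D' \<in> dcs" "w' \<in> MD H K (?g D')" "y = (D', rc (H \<inter> conjg N (?g D') K) w')" using y by blast
    have G: "w \<in> G" "w' \<in> G" using D D' MD_sub by blast+
    have ps: "psi H K (?g D) w = psi H K (?g D') w'" using e D D' phi_rc dc(1) by simp
    then have DD: "D = D'" using psi_disjoint[OF sH sK dc(1)[OF D(1)] dc(1)[OF D'(1)] G] by blast
    then show "x = y" using psi_eq_iff[OF sH sK dc(2)[OF D(1)] G] ps D D' by simp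
  qed
  show "?f ` ?S = ?P"
  proof (intro equalityI subsetI)
    fix p assume "p \<in> ?f ` ?S"
    then obtain D w where D: "D \<in> dcs" "w \<in> MD H K (?g D)" "p = phi D (rc (H \<inter> conjg N (?g D) K) w)" by auto
    have w: "w \<in> G" using D MD_sub by blast
    have "p = psi H K (?g D) w" using D phi_rc dc(1) by simp
    then show "p \<in> ?P" using MD_iff[OF dc(2)[OF D(1)] w] D(2) by (simp add: psi_def)
  next
    fix p assume "p \<in> ?P"
    then obtain x y where xy: "x \<in> thull (L H)" "y \<in> thull (L K)" "p = (rc H x, rc K y)" by auto
    have G: "x \<in> G" "y \<in> G" using xy hull_in_G by blast+
    obtain D w where D: "D \<in> dcosets N H K" "w \<in> G" "psi H K (?g D) w = p"
      using psi_cover[OF sH sK G] xy(3) by blast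
    have g: "?g D \<in> G" using dcrep(1)[OF D(1)] .
    have "rc H w \<in> rc H ` thull (L H)" "rc K (iv (?g D) \<sqdot> w) \<in> rc K ` thull (L K)"
      using D(3) xy by (auto simp: psi_def)
    then have m: "w \<in> MD H K (?g D)" using MD_iff[OF g D(2)] rc_thull[OF sH D(2)] rc_thull[OF sK, of "iv (?g D) \<sqdot> w"] g D(2) by simp
    then have "D \<in> dcs" using D by (auto simp: dcs_def)
    moreover have "p = phi D (rc (H \<inter> conjg N (?g D) K) w)" using phi_rc[OF D(1) m] D(3) by simp
    ultimately show "p \<in> ?f ` ?S" using m by (intro image_eqI[of _ _ "(D, rc (H \<inter> conjg N (?g D) K) w)"]) auto
  qed
qed

lemma finite_P: "finite (rc H ` thull (L H) \<times> rc K ` thull (L K))"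
  using H K by (simp add: cocpt_def cofin_def)

lemma finite_dcs: "finite dcs"
proof -
  let ?S = "SIGMA D:dcs. rc (H \<inter> conjg N (dcrep N H K D) K) ` MD H K (dcrep N H K D)"
  have "finite ?S" using bij_betw_finite[OF bij_phi] finite_P by blast
  then have "finite (fst ` ?S)" by blast
  moreover have "dcs \<subseteq> fst ` ?S"
  proof
    fix D assume D: "D \<in> dcs"
    then obtain w where "w \<in> MD H K (dcrep N H K D)" by (auto simp: dcs_def)
    then show "D \<in> fst ` ?S" using D by (intro image_eqI[of _ _ "(D, rc (H \<inter> conjg N (dcrep N H K D) K) w)"]) auto
  qed
  ultimately show ?thesis using finite_subset by blast
qed

lemma NR_eta:
  "NR R (eta N H) (eta N K) = (\<Sum>D\<in>dcs. \<Sum>c\<in>rc (H \<inter> conjg N (dcrep N H K D) K) ` MD H K (dcrep N H K D).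
     cR R (tp R (pt H (fst (phi D c))) \<inter> tp R (pt K (snd (phi D c)))))"
proof -
  let ?F = "\<lambda>p. cR R (tp R (pt H (fst p)) \<inter> tp R (pt K (snd p)))"
  let ?PH = "rc H ` thull (L H)" and ?PK = "rc K ` thull (L K)"
  let ?I = "\<lambda>D. rc (H \<inter> conjg N (dcrep N H K D) K) ` MD H K (dcrep N H K D)"
  have "NR R (eta N H) (eta N K) = (\<Sum>c\<in>?PH. \<Sum>A'\<in>TT R. cR R (tp R (pt H c) \<inter> A') * measure (eta N K) (Z R A'))"
    unfolding NR_def by (rule eta_sum[OF H(1)])
  also have "\<dots> = (\<Sum>c\<in>?PH. \<Sum>d\<in>?PK. ?F (c, d))"
    unfolding fst_conv snd_conv by (intro sum.cong refl eta_sum[OF K(1)])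
  also have "\<dots> = sum ?F (?PH \<times> ?PK)" unfolding sum.cartesian_product by (simp add: case_prod_beta)
  also have "\<dots> = (\<Sum>x\<in>(SIGMA D:dcs. ?I D). ?F (case x of (D, c) \<Rightarrow> phi D c))"
    using sum.reindex_bij_betw[OF bij_phi, of ?F] by simp
  also have "\<dots> = (\<Sum>D\<in>dcs. \<Sum>c\<in>?I D. ?F (phi D c))"
  proof -
    have "finite (?I D)" if "D \<in> dcs" for D
      using that MD_props(3)[OF dcrep(1)] by (simp add: dcs_def cofin_def)
    then show ?thesis using finite_dcs by (subst sum.Sigma) (auto simp: case_prod_beta)
  qed
  finally show ?thesis .
qed

lemma NN_eta: "NN (eta N H) (eta N K) = (\<Sum>D\<in>dcs. rrank N (H \<inter> conjg N (dcrep N H K D) K))"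
proof -
  let ?g = "dcrep N H K"
  \<comment> \<open>An infinite component enters the maximum with cardinality 0. The bound concerns
    the components of trivial intersection groups, which are finite; beyond \<open>R0\<close> the
    sequence is constant.\<close>
  define R0 where "R0 = Max (insert 1 ((\<lambda>D. card (MD H K (?g D))) ` dcs))"
  have R0: "1 \<le> R0" "card (MD H K (?g D)) \<le> R0" if "D \<in> dcs" for D
    unfolding R0_def using finite_dcs that by (auto intro: Max_ge)
  have R1: "1 \<le> R0" unfolding R0_def using finite_dcs by (intro Max_ge) auto
  have e: "NR R (eta N H) (eta N K) = (\<Sum>D\<in>dcs. rrank N (H \<inter> conjg N (?g D) K))" if R: "R \<ge> R0" for R
    unfolding NR_eta
  proof (rule sum.cong)
    fix D assume D: "D \<in> dcs"
    then have Dd: "D \<in> dcosets N H K" and ne: "MD H K (?g D) \<noteq> {}" by (auto simp: dcs_def)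
    have g: "?g D \<in> G" using dcrep(1)[OF Dd] .
    show "(\<Sum>c\<in>rc (H \<inter> conjg N (?g D) K) ` MD H K (?g D).
      cR R (tp R (pt H (fst (phi D c))) \<inter> tp R (pt K (snd (phi D c))))) = rrank N (H \<inter> conjg N (?g D) K)"
    proof (rule component_sum[OF g ne])
      show "1 \<le> R" using R1 R by simp
      show "card (MD H K (?g D)) \<le> R" using R0(2)[OF D] R by simp
      fix w assume w: "w \<in> MD H K (?g D)"
      then have "w \<in> G" using MD_sub by blast
      then show "cR R (tp R (pt H (fst (phi D (rc (H \<inter> conjg N (?g D) K) w)))) \<inter>
          tp R (pt K (snd (phi D (rc (H \<inter> conjg N (?g D) K) w))))) = cR R {x \<in> B R. w \<sqdot> x \<in> MD H K (?g D)}"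
        unfolding phi_rc[OF Dd w] using tp_psi[OF g] by simp
    qed
  qed simp
  have "(\<lambda>R. NR R (eta N H) (eta N K)) \<longlonglongrightarrow> (\<Sum>D\<in>dcs. rrank N (H \<inter> conjg N (?g D) K))"
    by (rule tendsto_eventually) (use e in \<open>auto simp: eventually_sequentially\<close>)
  then show ?thesis using NR_tendsto[OF eta_SCurr[OF H(1)] eta_SCurr[OF K(1)]] LIMSEQ_unique by blast
qed

lemma infsum_dcs:
  "(\<Sum>\<^sub>\<infinity>D\<in>dcosets N H K. rrank N (H \<inter> conjg N (dcrep N H K D) K)) = (\<Sum>D\<in>dcs. rrank N (H \<inter> conjg N (dcrep N H K D) K))"
proof -
  have "(\<Sum>\<^sub>\<infinity>D\<in>dcosets N H K. rrank N (H \<inter> conjg N (dcrep N H K D) K)) =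
    (\<Sum>\<^sub>\<infinity>D\<in>dcs. rrank N (H \<inter> conjg N (dcrep N H K D) K))"
    by (rule infsum_cong_neutral) (use dcs_out in \<open>auto simp: rrank_trivial dcs_def\<close>)
  then show ?thesis using finite_dcs by simp
qed

lemma rk_dsum: "rk (dsum_eta N H K) = (\<Sum>D\<in>dcs. rrank N (H \<inter> conjg N (dcrep N H K D) K))"
proof -
  let ?J = "\<lambda>D. H \<inter> conjg N (dcrep N H K D) K"
  have J: "cocpt (?J D)" if "D \<in> dcosets N H K" for D using MD_props(4)[OF dcrep(1)[OF that]] .
  have m: "measure (dsum_eta N H K) (Z 1 A) = (\<Sum>D\<in>dcs. measure (eta N (?J D)) (Z 1 A))" if A: "A \<in> TT 1" for A
  proof -
    have "emeasure (dsum_eta N H K) (Z 1 A) = (\<Sum>D\<in>dcs. emeasure (eta N (?J D)) (Z 1 A))"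
      unfolding emeasure_dsum[OF sets_Z]
    proof (rule nn_integral_count_space'[OF finite_dcs])
      fix D assume D: "D \<in> dcosets N H K" "D \<notin> dcs"
      show "emeasure (eta N (?J D)) (Z 1 A) = 0" unfolding dcs_out[OF D] by (simp add: eta_def)
    qed (auto simp: dcs_def)
    also have "\<dots> = (\<Sum>D\<in>dcs. ennreal (measure (eta N (?J D)) (Z 1 A)))"
    proof (rule sum.cong)
      fix D assume "D \<in> dcs"
      then have "emeasure (eta N (?J D)) (Z 1 A) < \<infinity>"
        using SCurr_fin_sub[OF eta_SCurr[OF J] Z_sub[OF A]] by (simp add: dcs_def)
      then show "emeasure (eta N (?J D)) (Z 1 A) = ennreal (measure (eta N (?J D)) (Z 1 A))"
        by (simp add: emeasure_eq_ennreal_measure less_top)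
    qed simp
    also have "\<dots> = ennreal (\<Sum>D\<in>dcs. measure (eta N (?J D)) (Z 1 A))" by simp
    finally show ?thesis by (simp add: measure_def sum_nonneg)
  qed
  have "rk (dsum_eta N H K) = (\<Sum>A\<in>TT 1. cw A * (\<Sum>D\<in>dcs. measure (eta N (?J D)) (Z 1 A)))"
    using dsum_SCurr[OF H K] m by (simp add: rk_def)
  also have "\<dots> = (\<Sum>A\<in>TT 1. \<Sum>D\<in>dcs. cw A * measure (eta N (?J D)) (Z 1 A))" by (simp add: sum_distrib_left)
  also have "\<dots> = (\<Sum>D\<in>dcs. \<Sum>A\<in>TT 1. cw A * measure (eta N (?J D)) (Z 1 A))" by (rule sum.swap)
  also have "\<dots> = (\<Sum>D\<in>dcs. rrank N (?J D))"
  proof (rule sum.cong)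
    fix D assume "D \<in> dcs"
    then have "cocpt (?J D)" using J by (simp add: dcs_def)
    then show "(\<Sum>A\<in>TT 1. cw A * measure (eta N (?J D)) (Z 1 A)) = rrank N (?J D)"
      using rk_eta[OF cocpt_fgsub] eta_SCurr by (simp add: rk_def)
  qed simp
  finally show ?thesis .
qed

end

lemma NN_eta_all:
  assumes "fgsub N H" "fgsub N K"
  shows "NN (eta N H) (eta N K) = (\<Sum>\<^sub>\<infinity>D\<in>dcosets N H K. rrank N (H \<inter> conjg N (dcrep N H K D) K))"
proof -
  have c: "cocpt H" "cocpt K" using assms fgsub_cocpt by blast+
  have z: "NN (eta N {[]}) \<nu> = 0" for \<nu>
  proof (cases "\<nu> \<in> SCurr N")
    case True
    have "eta N {[]} \<in> SCurr N" using eta_SCurr[OF fgsub_cocpt[OF fgsub_trivial]] .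
    moreover have "NR R (eta N {[]}) \<nu> = 0" for R by (simp add: NR_def eta_def measure_def)
    ultimately show ?thesis using True by (simp add: NN_def)
  qed (simp add: NN_def)
  show ?thesis
  proof (cases "H \<noteq> {[]} \<and> K \<noteq> {[]}")
    case True
    then show ?thesis using NN_eta[OF c(1) _ c(2)] infsum_dcs[OF c(1) _ c(2)] by simp
  next
    case False
    have "H \<inter> conjg N (dcrep N H K D) K = {[]}" if D: "D \<in> dcosets N H K" for D
    proof -
      have g: "dcrep N H K D \<in> G" using dcrep(1)[OF D] .
      have s: "[] \<in> H" "[] \<in> conjg N (dcrep N H K D) K"
        using c sub_Nil subgroup_conjg[OF _ g] by (auto simp: cocpt_def)
      show ?thesis
      proof (cases "H = {[]}")
        case False
        then have "K = {[]}" using \<open>\<not> (H \<noteq> {[]} \<and> K \<noteq> {[]})\<close> by blast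
        then have "conjg N (dcrep N H K D) K = {[]}" using g by (simp add: conjg_eq)
        then show ?thesis using s by auto
      qed (use s in auto)
    qed
    then have "(\<Sum>\<^sub>\<infinity>D\<in>dcosets N H K. rrank N (H \<inter> conjg N (dcrep N H K D) K)) = (\<Sum>\<^sub>\<infinity>D\<in>dcosets N H K. 0)"
      by (intro infsum_cong) (simp add: rrank_trivial)
    moreover have "NN (eta N H) (eta N K) = 0" using False z NN_sym by metis
    ultimately show ?thesis by simp
  qed
qed

end

section \<open>Neighbourhoods in the space of currents\<close>

context free_group
begin

definition close :: "nat \<Rightarrow> real \<Rightarrow> bpt set measure \<Rightarrow> bpt set measure \<Rightarrow> bool" where
  "close n d \<mu> \<nu> \<longleftrightarrow> (\<forall>A\<in>TT n. \<bar>measure \<nu> (Z n A) - measure \<mu> (Z n A)\<bar> < d)"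

lemma close_partition:
  assumes m: "\<mu> \<in> SCurr N" "\<nu> \<in> SCurr N" and c: "close n d \<mu> \<nu>" "0 < d"
  shows "\<bar>measure \<nu> {S \<in> Cv []. P (tp n S)} - measure \<mu> {S \<in> Cv []. P (tp n S)}\<bar> \<le> real (card (TT n)) * d"
proof -
  let ?I = "{A \<in> TT n. P A}"
  have "\<bar>measure \<nu> {S \<in> Cv []. P (tp n S)} - measure \<mu> {S \<in> Cv []. P (tp n S)}\<bar>
    = \<bar>\<Sum>A\<in>?I. measure \<nu> (Z n A) - measure \<mu> (Z n A)\<bar>"
    unfolding measure_partition[OF m(1)] measure_partition[OF m(2)] by (simp add: sum_subtractf)
  also have "\<dots> \<le> (\<Sum>A\<in>?I. \<bar>measure \<nu> (Z n A) - measure \<mu> (Z n A)\<bar>)" by (rule sum_abs)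
  also have "\<dots> \<le> (\<Sum>A\<in>?I. d)" using c(1) unfolding close_def by (intro sum_mono) (auto intro: less_imp_le)
  also have "\<dots> = real (card ?I) * d" by simp
  also have "\<dots> \<le> real (card (TT n)) * d"
    using c(2) card_mono[OF finite_TT, of ?I n] by (intro mult_right_mono) auto
  finally show ?thesis .
qed

lemma close_mono:
  assumes "k \<le> n" "0 < d"
  shows "\<exists>d'>0. \<forall>\<mu>\<in>SCurr N. \<forall>\<nu>\<in>SCurr N. close n d' \<mu> \<nu> \<longrightarrow> close k d \<mu> \<nu>"
proof -
  \<comment> \<open>A cylinder of radius \<open>k\<close> is a union of at most
    \<open>card (TT n)\<close> cylinders of radius \<open>n\<close>; the added 1 keeps the total
    error strictly below \<open>d\<close>.\<close>
  define d' where "d' = d / (real (card (TT n)) + 1)"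
  have d': "d' > 0" using assms(2) by (simp add: d'_def)
  have lt: "real (card (TT n)) * d' < d"
  proof -
    have "real (card (TT n)) * d' < (real (card (TT n)) + 1) * d'" using d' by (simp add: distrib_right)
    also have "\<dots> = d" unfolding d'_def by (simp add: add_nonneg_eq_0_iff)
    finally show ?thesis .
  qed
  have "close k d \<mu> \<nu>" if m: "\<mu> \<in> SCurr N" "\<nu> \<in> SCurr N" and c: "close n d' \<mu> \<nu>" for \<mu> \<nu>
    unfolding close_def
  proof
    fix A assume A: "A \<in> TT k"
    have e: "Z k A = {S \<in> Cv []. tp n S \<inter> B k = A}"
      using Z_sub[OF A] tp_Int[OF assms(1)] by (auto simp: Z_def Cv_def)
    show "\<bar>measure \<nu> (Z k A) - measure \<mu> (Z k A)\<bar> < d"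
      unfolding e using close_partition[OF m c d', of "\<lambda>X. X \<inter> B k = A"] lt by linarith
  qed
  then show ?thesis using d' by blast
qed

text \<open>Uniform continuity with respect to types. Compactness of the support provides one radius
  for all its points; two sets of equal type then either share a centre of the finite cover or both
  lie outside the support, where \<open>f\<close> vanishes.\<close>

lemma Cc_uniform:
  assumes f: "f \<in> Cc N" and e: "0 < e"
  shows "\<exists>n. \<forall>S\<in>CN N. \<forall>S'\<in>CN N. tp n S = tp n S' \<longrightarrow> \<bar>f S - f S'\<bar> < e"
proof -
  obtain C where C: "compactin (CN_top N) C" "\<forall>S\<in>CN N - C. f S = 0" and cont: "continuous_map (CN_top N) euclideanreal f"
    using f unfolding Cc_def by blast
  have "\<exists>n. \<forall>S'\<in>CN N. tp n S' = tp n S \<longrightarrow> \<bar>f S' - f S\<bar> < e / 2" if S: "S \<in> CN N" for S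
  proof -
    have "openin (CN_top N) {S' \<in> topspace (CN_top N). f S' \<in> ball (f S) (e / 2)}"
      by (rule openin_continuous_map_preimage[OF cont]) (use open_openin[THEN iffD1, OF open_ball] in blast)
    moreover have "S \<in> {S' \<in> topspace (CN_top N). f S' \<in> ball (f S) (e / 2)}" using S e by simp
    ultimately obtain n where "\<forall>S'\<in>CN N. tp n S' = tp n S \<longrightarrow> S' \<in> {S' \<in> topspace (CN_top N). f S' \<in> ball (f S) (e / 2)}"
      unfolding openin_CN_tp by blast
    then show ?thesis by (intro exI[of _ n]) (auto simp: dist_real_def abs_minus_commute)
  qed
  then obtain k where k: "\<And>S S'. S \<in> CN N \<Longrightarrow> S' \<in> CN N \<Longrightarrow> tp (k S) S' = tp (k S) S \<Longrightarrow> \<bar>f S' - f S\<bar> < e / 2"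
    by metis
  have CC: "C \<subseteq> CN N" using compactin_subset_topspace[OF C(1)] by simp
  let ?UU = "(\<lambda>S. Z (k S) (tp (k S) S)) ` C"
  have "C \<subseteq> \<Union>?UU" using CC by (auto simp: Z_def)
  moreover have "\<forall>U\<in>?UU. openin (CN_top N) U" using openin_Z by blast
  ultimately obtain \<F> where F: "finite \<F>" "\<F> \<subseteq> ?UU" "C \<subseteq> \<Union>\<F>" using compactinD[OF C(1), of ?UU] by blast
  obtain I where I: "I \<subseteq> C" "finite I" "\<F> = (\<lambda>S. Z (k S) (tp (k S) S)) ` I"
    using finite_subset_image[OF F(1,2)] by blast
  define n where "n = Max (insert 0 (k ` I))"
  have n: "k S \<le> n" if "S \<in> I" for S unfolding n_def using I that by (intro Max_ge) auto
  have near: "\<bar>f S - f S'\<bar> < e" if S: "S \<in> C" "S' \<in> CN N" "tp n S = tp n S'" for S S'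
  proof -
    obtain T where T: "T \<in> I" "S \<in> Z (k T) (tp (k T) T)" using S(1) F(3) I(3) by blast
    have TC: "T \<in> CN N" "S \<in> CN N" using T I CC S by auto
    have e1: "tp (k T) S = tp (k T) T" using T by (simp add: Z_def)
    have e2: "tp (k T) S' = tp (k T) T" using tp_le[OF S(3) n[OF T(1)]] e1 by simp
    show ?thesis using k[OF TC e1] k[OF TC(1) S(2) e2] by linarith
  qed
  have "\<bar>f S - f S'\<bar> < e" if S: "S \<in> CN N" "S' \<in> CN N" "tp n S = tp n S'" for S S'
  proof (cases "S \<in> C")
    case True
    then show ?thesis using near S by blast
  next
    case False
    show ?thesis
    proof (cases "S' \<in> C")
      case True
      then show ?thesis using near[of S' S] S by (simp add: abs_minus_commute)
    next
      case f: False
      then show ?thesis using False C(2) S e by simp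
    qed
  qed
  then show ?thesis by blast
qed

text \<open>The support of a test function may contain sets whose hull misses the base vertex.
  Moving a hull vertex \<open>v\<close> of length at most \<open>r\<close> to \<open>[]\<close>
  expresses the measure of such a cylinder by types of radius \<open>n + r\<close> at the base
  vertex.\<close>

lemma measure_translate:
  assumes m: "\<mu> \<in> SCurr N" and v: "v \<in> A" "v \<in> G" "length v \<le> r"
  shows "measure \<mu> (Z n A) = measure \<mu> {S \<in> Cv []. {x \<in> B n. iv v \<sqdot> x \<in> tp (n + r) S} = A}" (is "_ = measure \<mu> ?W")
proof -
  have ZC: "Z n A \<subseteq> CN N" by (auto simp: Z_def)
  have key: "S \<in> Cv [] \<and> {x \<in> B n. iv v \<sqdot> x \<in> tp (n + r) S} = A \<longleftrightarrow> S \<in> CN N \<and> tp n (act v S) = A" if S: "S \<in> CN N" for S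
  proof -
    have Sb: "S \<subseteq> bdry N" using CN_sub[OF S] .
    have "x \<in> thull (act v S) \<longleftrightarrow> iv v \<sqdot> x \<in> tp (n + r) S" if x: "x \<in> B n" for x
    proof -
      have "length (iv v \<sqdot> x) \<le> n + r" using length_mul[of x "iv v"] x v by simp
      then show ?thesis using hull_act[OF v(2) Sb, of x] x v by (simp add: tp_def)
    qed
    then have e: "{x \<in> B n. iv v \<sqdot> x \<in> tp (n + r) S} = tp n (act v S)" unfolding tp_def[of n] by blast
    have "[] \<in> thull S" if "tp n (act v S) = A"
    proof -
      have "v \<in> thull (act v S)" using that v(1) by (auto simp: tp_def)
      then show ?thesis using hull_act[OF v(2) Sb v(2)] v(2) by simp
    qed
    then show ?thesis unfolding e using S by (auto simp: Cv_def)
  qed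
  have "?W = {S \<in> CN N. tp n (act v S) = A}"
  proof (intro equalityI subsetI)
    fix S assume "S \<in> ?W"
    then show "S \<in> {S \<in> CN N. tp n (act v S) = A}" using key[of S] by (simp add: Cv_def)
  next
    fix S assume "S \<in> {S \<in> CN N. tp n (act v S) = A}"
    then show "S \<in> ?W" using key[of S] by simp
  qed
  also have "\<dots> = act (iv v) ` Z n A"
  proof (intro equalityI subsetI)
    fix S assume S: "S \<in> {S \<in> CN N. tp n (act v S) = A}"
    then have "act v S \<in> Z n A" using act_CN[OF v(2)] by (simp add: Z_def)
    then show "S \<in> act (iv v) ` Z n A" using act_image_mem[OF inv_closed[OF v(2)] ZC, of S] S v(2) by simp
  next
    fix S assume S: "S \<in> act (iv v) ` Z n A"
    then have SC: "S \<in> CN N" using act_image_CN[OF inv_closed[OF v(2)] ZC] by blast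
    then have "act v S \<in> Z n A" using act_image_mem[OF inv_closed[OF v(2)] ZC SC] S v(2) by simp
    then show "S \<in> {S \<in> CN N. tp n (act v S) = A}" using SC by (simp add: Z_def)
  qed
  finally have "emeasure \<mu> ?W = emeasure \<mu> (Z n A)" using SCurr_inv[OF m inv_closed[OF v(2)] sets_Z] by simp
  then show ?thesis by (simp add: measure_def)
qed

lemma Cc_measurable:
  assumes f: "f \<in> Cc N" and m: "\<mu> \<in> SCurr N"
  shows "f \<in> borel_measurable \<mu>"
proof (rule borel_measurableI)
  fix V :: "real set" assume V: "open V"
  have "continuous_map (CN_top N) euclideanreal f" using f by (simp add: Cc_def)
  then have "openin (CN_top N) {S \<in> topspace (CN_top N). f S \<in> V}"
    by (rule openin_continuous_map_preimage) (use open_openin[of V] V in blast)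
  then have "{S \<in> CN N. f S \<in> V} \<in> sets \<mu>" using sets_open SCurr_sets[OF m] by simp
  moreover have "f -` V \<inter> space \<mu> = {S \<in> CN N. f S \<in> V}" using SCurr_space[OF m] by auto
  ultimately show "f -` V \<inter> space \<mu> \<in> sets \<mu>" by simp
qed

text \<open>The types on which a test function can be nonzero when all hulls in its support meet the
  ball of radius \<open>r\<close>.\<close>

definition AA :: "nat \<Rightarrow> nat \<Rightarrow> word set set" where
  "AA r n = {A. A \<subseteq> B n \<and> A \<inter> B r \<noteq> {}}"

lemma finite_AA: "finite (AA r n)"
  by (rule finite_subset[of _ "Pow (B n)"]) (auto simp: AA_def finite_ball)

lemma AA_vertex:
  assumes "A \<in> AA r n"
  shows "\<exists>v. v \<in> A \<and> v \<in> G \<and> length v \<le> r \<and> Z n A \<subseteq> Cv v"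
proof -
  obtain v where v: "v \<in> A" "v \<in> B r" using assms by (auto simp: AA_def)
  have "Z n A \<subseteq> Cv v" using v by (auto simp: Z_def Cv_def tp_def)
  then show ?thesis using v by blast
qed

lemma Cv_fin:
  assumes m: "\<mu> \<in> SCurr N" and v: "v \<in> G"
  shows "emeasure \<mu> (Cv v) = emeasure \<mu> (Cv [])"
  using SCurr_inv[OF m v sets_Cv[of "[]"]] act_Cv[OF v, of "[]"] v by simp

lemma AA_fin:
  assumes m: "\<mu> \<in> SCurr N" and A: "A \<in> AA r n"
  shows "emeasure \<mu> (Z n A) < \<infinity>"
proof -
  obtain v where v: "v \<in> G" "Z n A \<subseteq> Cv v" using AA_vertex[OF A] by blast
  have "emeasure \<mu> (Z n A) \<le> emeasure \<mu> (Cv v)" using v sets_Cv SCurr_sets[OF m] by (intro emeasure_mono) auto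
  also have "\<dots> < \<infinity>" using Cv_fin[OF m v(1)] SCurr_fin[OF m] by simp
  finally show ?thesis .
qed

lemma AA_mass:
  assumes m: "\<mu> \<in> SCurr N"
  shows "(\<Sum>A\<in>AA r n. measure \<mu> (Z n A)) \<le> real (card (B r)) * mass \<mu>"
proof -
  have "(\<Sum>A\<in>AA r n. measure \<mu> (Z n A)) = measure \<mu> (\<Union>A\<in>AA r n. Z n A)"
  proof (rule measure_finite_Union[symmetric])
    show "disjoint_family_on (Z n) (AA r n)" by (auto simp: disjoint_family_on_def Z_def)
    show "Z n ` AA r n \<subseteq> sets \<mu>" using sets_Z SCurr_sets[OF m] by auto
    show "emeasure \<mu> (Z n A) \<noteq> \<infinity>" if "A \<in> AA r n" for A using AA_fin[OF m that] by simp
  qed (rule finite_AA)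
  also have "\<dots> \<le> measure \<mu> (\<Union>v\<in>B r. Cv v)"
  proof (rule measure_mono_fmeasurable)
    show "(\<Union>A\<in>AA r n. Z n A) \<subseteq> (\<Union>v\<in>B r. Cv v)" using AA_vertex by blast
    show "(\<Union>A\<in>AA r n. Z n A) \<in> sets \<mu>" using sets_Z SCurr_sets[OF m] finite_AA by (intro sets.finite_UN) auto
    have "Cv v \<in> fmeasurable \<mu>" if "v \<in> B r" for v
      using Cv_fin[OF m, of v] SCurr_fin[OF m] sets_Cv[of v] SCurr_sets[OF m] that by (intro fmeasurableI) auto
    then show "(\<Union>v\<in>B r. Cv v) \<in> fmeasurable \<mu>" using finite_ball by (intro fmeasurable.finite_UN) auto
  qed
  also have "\<dots> \<le> (\<Sum>v\<in>B r. measure \<mu> (Cv v))"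
  proof (rule measure_UNION_le)
    show "finite (B r)" by (rule finite_ball)
    show "\<And>v. v \<in> B r \<Longrightarrow> Cv v \<in> sets \<mu>" using sets_Cv SCurr_sets[OF m] by auto
  qed
  also have "\<dots> = (\<Sum>v\<in>B r. mass \<mu>)"
  proof (rule sum.cong)
    fix v assume "v \<in> B r"
    then have "emeasure \<mu> (Cv v) = emeasure \<mu> (Cv [])" using Cv_fin[OF m, of v] by simp
    then show "measure \<mu> (Cv v) = mass \<mu>" by (simp add: mass_def measure_def)
  qed simp
  finally show ?thesis by simp
qed

lemma Cc_step_approx:
  assumes f: "f \<in> Cc N" and m: "\<nu> \<in> SCurr N"
    and supp: "\<And>S. S \<in> CN N \<Longrightarrow> f S \<noteq> 0 \<Longrightarrow> tp n S \<in> AA r n"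
    and s: "\<And>A S. S \<in> Z n A \<Longrightarrow> \<bar>f S - s A\<bar> < e"
  shows "\<bar>(\<integral>S. f S \<partial>\<nu>) - (\<Sum>A\<in>AA r n. s A * measure \<nu> (Z n A))\<bar> \<le> e * (\<Sum>A\<in>AA r n. measure \<nu> (Z n A))"
proof -
  define g where "g S = (\<Sum>A\<in>AA r n. s A * indicator (Z n A) S)" for S
  define h where "h S = (\<Sum>A\<in>AA r n. e * indicator (Z n A) S)" for S :: "bpt set"
  have Zs: "Z n A \<in> sets \<nu>" for A using sets_Z SCurr_sets[OF m] by simp
  have ii: "integrable \<nu> (\<lambda>S. c * indicator (Z n A) S :: real)" if "A \<in> AA r n" for A c
    using AA_fin[OF m that] Zs by (intro integrable_mult_right integrable_real_indicator) auto
  have gi: "integrable \<nu> g" and hi: "integrable \<nu> h"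
    unfolding g_def h_def by (intro Bochner_Integration.integrable_sum ii; assumption)+
  have mi: "(\<integral>S. c * indicator (Z n A) S \<partial>\<nu>) = c * measure \<nu> (Z n A)" for c A
  proof -
    have "Z n A \<inter> space \<nu> = Z n A" using SCurr_space[OF m] by (auto simp: Z_def)
    then show ?thesis by simp
  qed
  have gI: "(\<integral>S. g S \<partial>\<nu>) = (\<Sum>A\<in>AA r n. s A * measure \<nu> (Z n A))"
    unfolding g_def by (subst Bochner_Integration.integral_sum[OF ii]) (simp_all only: mi)
  have hI: "(\<integral>S. h S \<partial>\<nu>) = e * (\<Sum>A\<in>AA r n. measure \<nu> (Z n A))"
    unfolding h_def by (subst Bochner_Integration.integral_sum[OF ii]) (simp_all only: mi sum_distrib_left)
  have b: "\<bar>f S - g S\<bar> \<le> h S" if S: "S \<in> space \<nu>" for S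
  proof -
    have SC: "S \<in> CN N" using S SCurr_space[OF m] by simp
    have val: "(\<Sum>A\<in>AA r n. c A * indicator (Z n A) S) = (if tp n S \<in> AA r n then c (tp n S) else 0)" for c :: "word set \<Rightarrow> real"
    proof -
      have "(\<Sum>A\<in>AA r n. c A * indicator (Z n A) S) = (\<Sum>A\<in>AA r n. if tp n S = A then c A else 0)"
        using SC by (intro sum.cong) (auto simp: indicator_def Z_def)
      then show ?thesis using finite_AA by simp
    qed
    show ?thesis
    proof (cases "tp n S \<in> AA r n")
      case True
      have "S \<in> Z n (tp n S)" using SC by (simp add: Z_def)
      then show ?thesis using s[of S "tp n S"] True unfolding g_def h_def val by simp
    next
      case False
      then show ?thesis using supp[OF SC] unfolding g_def h_def val by auto
    qed
  qed
  have fm: "f \<in> borel_measurable \<nu>" using Cc_measurable[OF f m] .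
  have gm: "g \<in> borel_measurable \<nu>" using gi by (rule borel_measurable_integrable)
  have di: "integrable \<nu> (\<lambda>S. f S - g S)"
    by (rule Bochner_Integration.integrable_bound[OF hi]) (use fm gm b in \<open>auto intro!: AE_I2 order_trans[OF b]\<close>)
  have fi: "integrable \<nu> f" using Bochner_Integration.integrable_add[OF di gi] by simp
  have "(\<integral>S. f S \<partial>\<nu>) - (\<integral>S. g S \<partial>\<nu>) = (\<integral>S. f S - g S \<partial>\<nu>)" using fi gi by simp
  then have "\<bar>(\<integral>S. f S \<partial>\<nu>) - (\<integral>S. g S \<partial>\<nu>)\<bar> \<le> (\<integral>S. \<bar>f S - g S\<bar> \<partial>\<nu>)" using integral_abs_bound[of \<nu> "\<lambda>S. f S - g S"] by simp
  also have "\<dots> \<le> (\<integral>S. h S \<partial>\<nu>)" using di hi b by (intro integral_mono) auto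
  finally show ?thesis unfolding gI hI .
qed

lemma integral_close:
  assumes f: "f \<in> Cc N" and m: "\<mu> \<in> SCurr N" and e: "0 < e"
  shows "\<exists>n d. 0 < d \<and> (\<forall>\<nu>\<in>SCurr N. close n d \<mu> \<nu> \<longrightarrow> \<bar>(\<integral>S. f S \<partial>\<nu>) - (\<integral>S. f S \<partial>\<mu>)\<bar> < e)"
proof -
  obtain C where C: "compactin (CN_top N) C" "\<forall>S\<in>CN N - C. f S = 0" using f unfolding Cc_def by blast
  obtain F where F: "finite F" "F \<subseteq> G" "C \<subseteq> (\<Union>v\<in>F. Cv v)" using compactin_sub_Cv[OF C(1)] by auto
  define r where "r = Max (insert 0 (length ` F))"
  have r: "length v \<le> r" if "v \<in> F" for v unfolding r_def using F that by (intro Max_ge) auto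
  define m1 where "m1 = real (card (B r)) * mass \<mu>"
  have m1: "0 \<le> m1" using mass_nonneg by (simp add: m1_def)
  \<comment> \<open>Replacing \<open>f\<close> by a step function costs \<open>e1\<close> times the
    relevant mass, which is at most \<open>m1\<close> for \<mu> and \<open>m1 + 1\<close> for a
    nearby current; both costs together stay below \<open>e / 2\<close>.\<close>
  define e1 where "e1 = e / (2 * (2 * m1 + 1) + 1)"
  have e1: "0 < e1" using e m1 by (simp add: e1_def)
  obtain n0 where n0: "\<forall>S\<in>CN N. \<forall>S'\<in>CN N. tp n0 S = tp n0 S' \<longrightarrow> \<bar>f S - f S'\<bar> < e1" using Cc_uniform[OF f e1] by blast
  define n where "n = max n0 r"
  have un: "\<bar>f S - f S'\<bar> < e1" if "S \<in> CN N" "S' \<in> CN N" "tp n S = tp n S'" for S S'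
    using n0 that tp_le[OF that(3), of n0] by (simp add: n_def)
  have supp: "tp n S \<in> AA r n" if S: "S \<in> CN N" "f S \<noteq> 0" for S
  proof -
    have "S \<in> C" using C(2) S by blast
    then obtain v where v: "v \<in> F" "v \<in> thull S" using F(3) by (auto simp: Cv_def)
    then have "v \<in> tp n S \<inter> B r" using r[OF v(1)] F(2) by (auto simp: tp_def n_def)
    then show ?thesis using tp_sub[of n S] by (auto simp: AA_def)
  qed
  define s where "s A = f (SOME S. S \<in> Z n A)" for A
  have s: "\<bar>f S - s A\<bar> < e1" if S: "S \<in> Z n A" for S A
  proof -
    have "(SOME S. S \<in> Z n A) \<in> Z n A" using S by (rule someI)
    then show ?thesis unfolding s_def using un[of S "SOME S. S \<in> Z n A"] S by (simp add: Z_def)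
  qed
  define T where "T = real (card (TT (n + r)))"
  define q where "q = real (card (AA r n)) * T + (\<Sum>A\<in>AA r n. \<bar>s A\<bar>) * T + 1"
  have T0: "0 \<le> T" by (simp add: T_def)
  have q: "0 < q" "real (card (AA r n)) * T \<le> q" "(\<Sum>A\<in>AA r n. \<bar>s A\<bar>) * T \<le> q"
    using T0 by (auto simp: q_def sum_nonneg add_nonneg_pos)
  \<comment> \<open>The two bounds in the minimum limit the growth of the relevant mass to 1 and the
    difference of the step function integrals to \<open>e / 2\<close>.\<close>
  define d where "d = min 1 (e / 2) / q"
  have d: "0 < d" using e q by (simp add: d_def)
  have dq: "q * d \<le> 1" "q * d \<le> e / 2" using q by (simp_all add: d_def)
  have "\<bar>(\<integral>S. f S \<partial>\<nu>) - (\<integral>S. f S \<partial>\<mu>)\<bar> < e" if n: "\<nu> \<in> SCurr N" "close (n + r) d \<mu> \<nu>" for \<nu>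
  proof -
    have dz: "\<bar>measure \<nu> (Z n A) - measure \<mu> (Z n A)\<bar> \<le> T * d" if A: "A \<in> AA r n" for A
    proof -
      obtain v where v: "v \<in> A" "v \<in> G" "length v \<le> r" using AA_vertex[OF A] by blast
      show ?thesis unfolding measure_translate[OF m v] measure_translate[OF n(1) v] T_def
        by (rule close_partition[OF m n d])
    qed
    let ?Sm = "\<Sum>A\<in>AA r n. measure \<mu> (Z n A)" and ?Sn = "\<Sum>A\<in>AA r n. measure \<nu> (Z n A)"
    have a1: "\<bar>(\<integral>S. f S \<partial>\<nu>) - (\<Sum>A\<in>AA r n. s A * measure \<nu> (Z n A))\<bar> \<le> e1 * ?Sn"
      using Cc_step_approx[OF f n(1) supp s] .
    have a2: "\<bar>(\<integral>S. f S \<partial>\<mu>) - (\<Sum>A\<in>AA r n. s A * measure \<mu> (Z n A))\<bar> \<le> e1 * ?Sm"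
      using Cc_step_approx[OF f m supp s] .
    have Sm: "?Sm \<le> m1" using AA_mass[OF m] by (simp add: m1_def)
    have "?Sn - ?Sm = (\<Sum>A\<in>AA r n. measure \<nu> (Z n A) - measure \<mu> (Z n A))" by (simp add: sum_subtractf)
    also have "\<dots> \<le> (\<Sum>A\<in>AA r n. T * d)" using dz by (intro sum_mono) (meson abs_le_D1)
    also have "\<dots> = real (card (AA r n)) * T * d" by simp
    also have "\<dots> \<le> q * d" using q(2) d by (intro mult_right_mono) auto
    finally have Sn: "?Sn \<le> m1 + 1" using Sm dq(1) by linarith
    have "\<bar>(\<Sum>A\<in>AA r n. s A * measure \<nu> (Z n A)) - (\<Sum>A\<in>AA r n. s A * measure \<mu> (Z n A))\<bar>
      = \<bar>\<Sum>A\<in>AA r n. s A * (measure \<nu> (Z n A) - measure \<mu> (Z n A))\<bar>"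
      by (simp add: sum_subtractf right_diff_distrib)
    also have "\<dots> \<le> (\<Sum>A\<in>AA r n. \<bar>s A * (measure \<nu> (Z n A) - measure \<mu> (Z n A))\<bar>)" by (rule sum_abs)
    also have "\<dots> \<le> (\<Sum>A\<in>AA r n. \<bar>s A\<bar> * (T * d))"
      unfolding abs_mult using dz by (intro sum_mono mult_left_mono) auto
    also have "\<dots> = (\<Sum>A\<in>AA r n. \<bar>s A\<bar>) * T * d" by (simp add: sum_distrib_right mult.assoc)
    also have "\<dots> \<le> q * d" using q(3) d by (intro mult_right_mono) auto
    finally have a3: "\<bar>(\<Sum>A\<in>AA r n. s A * measure \<nu> (Z n A)) - (\<Sum>A\<in>AA r n. s A * measure \<mu> (Z n A))\<bar> \<le> e / 2"
      using dq(2) by linarith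
    have "e1 * ?Sn + e1 * ?Sm \<le> e1 * (m1 + 1) + e1 * m1"
      using Sn Sm e1 by (intro add_mono mult_left_mono) auto
    also have "\<dots> = e1 * (2 * m1 + 1)" by (simp add: algebra_simps)
    also have "\<dots> < e / 2"
    proof -
      have "e1 * (2 * (2 * m1 + 1) + 1) = e" using m1 by (simp add: e1_def)
      then have "2 * (e1 * (2 * m1 + 1)) + e1 = e" by (simp add: algebra_simps)
      then show ?thesis using e1 by linarith
    qed
    finally show ?thesis using a1 a2 a3 by linarith
  qed
  then show ?thesis using d by blast
qed

lemma curr_nbhd_generated:
  assumes "generate_topology_on {{\<mu>. (\<integral>S. f S \<partial>\<mu>) \<in> V} | f V. f \<in> Cc N \<and> open V} W"
  shows "\<mu> \<in> W \<Longrightarrow> \<mu> \<in> SCurr N \<Longrightarrow> \<exists>n d. 0 < d \<and> (\<forall>\<nu>\<in>SCurr N. close n d \<mu> \<nu> \<longrightarrow> \<nu> \<in> W)"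
  using assms
proof (induction arbitrary: \<mu> rule: generate_topology_on.induct)
  case (Int a b)
  obtain n1 d1 where 1: "0 < d1" "\<forall>\<nu>\<in>SCurr N. close n1 d1 \<mu> \<nu> \<longrightarrow> \<nu> \<in> a" using Int by blast
  obtain n2 d2 where 2: "0 < d2" "\<forall>\<nu>\<in>SCurr N. close n2 d2 \<mu> \<nu> \<longrightarrow> \<nu> \<in> b" using Int by blast
  let ?n = "max n1 n2"
  obtain d1' where 3: "0 < d1'" "\<forall>\<mu>\<in>SCurr N. \<forall>\<nu>\<in>SCurr N. close ?n d1' \<mu> \<nu> \<longrightarrow> close n1 d1 \<mu> \<nu>"
    using close_mono[of n1 ?n d1] 1 by auto
  obtain d2' where 4: "0 < d2'" "\<forall>\<mu>\<in>SCurr N. \<forall>\<nu>\<in>SCurr N. close ?n d2' \<mu> \<nu> \<longrightarrow> close n2 d2 \<mu> \<nu>"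
    using close_mono[of n2 ?n d2] 2 by auto
  have "close ?n (min d1' d2') \<mu> \<nu> \<longrightarrow> \<nu> \<in> a \<inter> b" if v: "\<nu> \<in> SCurr N" for \<nu>
  proof
    assume "close ?n (min d1' d2') \<mu> \<nu>"
    then have "close ?n d1' \<mu> \<nu>" "close ?n d2' \<mu> \<nu>" by (auto simp: close_def)
    then show "\<nu> \<in> a \<inter> b" using 1(2) 2(2) 3(2) 4(2) v Int.prems(2) by blast
  qed
  then show ?case using 3(1) 4(1) by (intro exI[of _ ?n] exI[of _ "min d1' d2'"]) simp
next
  case (UN k)
  then obtain A where A: "A \<in> k" "\<mu> \<in> A" by blast
  then obtain n d where "0 < d" "\<forall>\<nu>\<in>SCurr N. close n d \<mu> \<nu> \<longrightarrow> \<nu> \<in> A" using UN by blast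
  then show ?case using A by blast
next
  case (Basis s)
  then obtain f V where fV: "s = {\<mu>. (\<integral>S. f S \<partial>\<mu>) \<in> V}" "f \<in> Cc N" "open V" by blast
  then have "(\<integral>S. f S \<partial>\<mu>) \<in> V" using Basis by simp
  then obtain e where e: "e > 0" "ball (\<integral>S. f S \<partial>\<mu>) e \<subseteq> V" using fV(3) open_contains_ball by blast
  obtain n d where nd: "0 < d" "\<forall>\<nu>\<in>SCurr N. close n d \<mu> \<nu> \<longrightarrow> \<bar>(\<integral>S. f S \<partial>\<nu>) - (\<integral>S. f S \<partial>\<mu>)\<bar> < e"
    using integral_close[OF fV(2) Basis.prems(2) e(1)] by blast
  have "\<nu> \<in> s" if "\<nu> \<in> SCurr N" "close n d \<mu> \<nu>" for \<nu>
  proof -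
    have "(\<integral>S. f S \<partial>\<nu>) \<in> ball (\<integral>S. f S \<partial>\<mu>) e" using bspec[OF nd(2) that(1)] that(2) by (simp add: dist_real_def abs_minus_commute)
    then show ?thesis using e(2) fV(1) by blast
  qed
  then show ?case using nd(1) by blast
qed auto

lemma curr_nbhd:
  assumes W: "openin (curr_top N) W" and m: "\<mu> \<in> W"
  shows "\<exists>n d. 1 \<le> n \<and> 0 < d \<and> (\<forall>\<nu>\<in>SCurr N. close n d \<mu> \<nu> \<longrightarrow> \<nu> \<in> W)"
proof -
  obtain T where T: "generate_topology_on {{\<mu>. (\<integral>S. f S \<partial>\<mu>) \<in> V} | f V. f \<in> Cc N \<and> open V} T" "W = T \<inter> SCurr N"
    using W unfolding curr_top_def openin_subtopology openin_topology_generated_by_iff by blast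
  have mS: "\<mu> \<in> SCurr N" "\<mu> \<in> T" using m T by auto
  obtain n d where nd: "0 < d" "\<forall>\<nu>\<in>SCurr N. close n d \<mu> \<nu> \<longrightarrow> \<nu> \<in> T"
    using curr_nbhd_generated[OF T(1) mS(2,1)] by blast
  \<comment> \<open>The radius is raised by one so that the ball contains the neighbours of the base
    vertex, as the edge equations require.\<close>
  obtain d' where d': "0 < d'" "\<forall>\<mu>\<in>SCurr N. \<forall>\<nu>\<in>SCurr N. close (Suc n) d' \<mu> \<nu> \<longrightarrow> close n d \<mu> \<nu>"
    using close_mono[of n "Suc n" d] nd by auto
  have "\<forall>\<nu>\<in>SCurr N. close (Suc n) d' \<mu> \<nu> \<longrightarrow> \<nu> \<in> W" using d'(2) nd(2) mS(1) T(2) by blast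
  then show ?thesis using d'(1) by (intro exI[of _ "Suc n"] exI[of _ d']) simp
qed

end

section \<open>Currents of finite labelled graphs\<close>

context free_group
begin

context
  fixes V :: "'v set" and Lv :: "'v \<Rightarrow> letter set" and st :: "'v \<Rightarrow> letter \<Rightarrow> 'v"
  assumes finV: "finite V"
    and LvN: "\<And>v a. v \<in> V \<Longrightarrow> a \<in> Lv v \<Longrightarrow> fst a < N"
    and stV: "\<And>v a. v \<in> V \<Longrightarrow> a \<in> Lv v \<Longrightarrow> st v a \<in> V"
    and stL: "\<And>v a. v \<in> V \<Longrightarrow> a \<in> Lv v \<Longrightarrow> linv a \<in> Lv (st v a)"
    and stst: "\<And>v a. v \<in> V \<Longrightarrow> a \<in> Lv v \<Longrightarrow> st (st v a) (linv a) = v"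
    and two: "\<And>v. v \<in> V \<Longrightarrow> \<exists>a\<in>Lv v. \<exists>b\<in>Lv v. a \<noteq> b"
begin

primrec pth :: "'v \<Rightarrow> word \<Rightarrow> 'v option" where
  "pth v [] = Some v"
| "pth v (a # w) = (if a \<in> Lv v then pth (st v a) w else None)"

lemma pth_V: "v \<in> V \<Longrightarrow> pth v w = Some x \<Longrightarrow> x \<in> V"
  by (induction w arbitrary: v) (auto split: if_splits intro: stV)

lemma pth_append: "pth v (u @ w) = (case pth v u of None \<Rightarrow> None | Some x \<Rightarrow> pth x w)"
  by (induction u arbitrary: v) auto

lemma pth_push: "v \<in> V \<Longrightarrow> pth v (a # w) = Some x \<Longrightarrow> pth v (push a w) = Some x"
  by (cases w) (auto split: if_splits simp: stst)

text \<open>Free reduction only removes backtracking, which does not change the end of a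
  path.\<close>

lemma pth_foldr: "v \<in> V \<Longrightarrow> pth v (u @ w) = Some x \<Longrightarrow> pth v (foldr push u w) = Some x"
proof (induction u arbitrary: v)
  case (Cons a u)
  then have a: "a \<in> Lv v" "pth (st v a) (u @ w) = Some x" by (auto split: if_splits)
  then have "pth (st v a) (foldr push u w) = Some x" using Cons stV by blast
  then have "pth v (a # foldr push u w) = Some x" using a by simp
  then show ?case using pth_push[OF Cons.prems(1)] by simp
qed simp

lemma pth_mul:
  assumes "v \<in> V" "w \<in> G" "pth v u = Some x" "pth x w = Some y"
  shows "pth v (u \<sqdot> w) = Some y"
  using pth_foldr[OF assms(1), of u w y] assms by (simp add: mul_eq pth_append)

lemma pth_winv: "v \<in> V \<Longrightarrow> pth v u = Some x \<Longrightarrow> pth x (winv u) = Some v"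
proof (induction u arbitrary: v)
  case (Cons a u)
  then have a: "a \<in> Lv v" "pth (st v a) u = Some x" by (auto split: if_splits)
  then have "pth x (winv u) = Some (st v a)" using Cons stV by blast
  then show ?case using a Cons.prems stL stst by (simp add: winv_Cons pth_append)
qed simp

lemma pth_iv: "v \<in> V \<Longrightarrow> u \<in> G \<Longrightarrow> pth v u = Some x \<Longrightarrow> pth x (iv u) = Some v"
  using pth_winv by (simp add: iv_eq)

lemma pth_mul_eq:
  assumes v: "v \<in> V" and u: "u \<in> G" "pth v u = Some x" and y: "y \<in> G"
  shows "pth v (u \<sqdot> y) = pth x y"
proof (cases "pth x y")
  case (Some z)
  then show ?thesis using pth_mul[OF v y u(2)] by simp
next
  case None
  show ?thesis
  proof (cases "pth v (u \<sqdot> y)")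
    case (Some z)
    have "pth x (iv u \<sqdot> (u \<sqdot> y)) = Some z"
      using pth_mul[OF pth_V[OF v u(2)] _ pth_iv[OF v u] Some] u y by simp
    then show ?thesis using None u y by simp
  qed (simp add: None)
qed

text \<open>The universal cover of the component of \<open>v\<close>, realised as a subtree of the
  Cayley tree; \<open>Hg v\<close> is the fundamental group at \<open>v\<close>.\<close>

definition Yg :: "'v \<Rightarrow> word set" where
  "Yg v = {w \<in> G. pth v w \<noteq> None}"

definition Hg :: "'v \<Rightarrow> word set" where
  "Hg v = {w \<in> G. pth v w = Some v}"

lemma Yg_mul: "v \<in> V \<Longrightarrow> u \<in> G \<Longrightarrow> pth v u = Some x \<Longrightarrow> y \<in> G \<Longrightarrow> u \<sqdot> y \<in> Yg v \<longleftrightarrow> y \<in> Yg x"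
  using pth_mul_eq by (simp add: Yg_def)

lemma Yg_take: "w \<in> Yg v \<Longrightarrow> take n w \<in> Yg v"
  using pth_append[of v "take n w" "drop n w"] by (auto simp: Yg_def split: option.splits)

lemma Hg_sub: "Hg v \<subseteq> Yg v"
  by (auto simp: Hg_def Yg_def)

lemma subgroup_Hg:
  assumes v: "v \<in> V"
  shows "subgroup (Hg v) (FG N)"
proof (rule subgroupI)
  show "Hg v \<subseteq> G" by (auto simp: Hg_def)
  have "[] \<in> Hg v" by (simp add: Hg_def)
  then show "Hg v \<noteq> {}" by blast
next
  fix a assume "a \<in> Hg v"
  then show "iv a \<in> Hg v" using pth_iv[OF v] by (simp add: Hg_def)
next
  fix a b assume "a \<in> Hg v" "b \<in> Hg v"
  then show "a \<sqdot> b \<in> Hg v" using pth_mul[OF v] by (simp add: Hg_def)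
qed

lemma rc_Hg:
  assumes v: "v \<in> V" and w: "w \<in> Yg v" "w' \<in> Yg v"
  shows "rc (Hg v) w = rc (Hg v) w' \<longleftrightarrow> pth v w = pth v w'"
proof -
  have G: "w \<in> G" "w' \<in> G" using w by (auto simp: Yg_def)
  obtain x' where x': "pth v w' = Some x'" using w by (auto simp: Yg_def)
  have "w \<sqdot> iv w' \<in> Hg v \<longleftrightarrow> pth v w = pth v w'"
  proof
    assume "w \<sqdot> iv w' \<in> Hg v"
    then have "pth v (w \<sqdot> iv w' \<sqdot> w') = pth v w'"
      using pth_mul_eq[OF v, of "w \<sqdot> iv w'" v w'] G by (simp add: Hg_def)
    then show "pth v w = pth v w'" using G by simp
  next
    assume "pth v w = pth v w'"
    then have "pth v (w \<sqdot> iv w') = Some v" using pth_mul[OF v _ _ pth_iv[OF v G(2) x']] x' G by simp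
    then show "w \<sqdot> iv w' \<in> Hg v" using G by (simp add: Hg_def)
  qed
  then show ?thesis using rc_eq_iff[OF subgroup_Hg[OF v] G] by simp
qed

lemma cofin_Hg:
  assumes v: "v \<in> V"
  shows "cofin (Hg v) (Yg v)"
  unfolding cofin_def
proof (rule finite_image_factor[of "pth v"])
  have "pth v ` Yg v \<subseteq> Some ` V" using pth_V[OF v] by (auto simp: Yg_def)
  then show "finite (pth v ` Yg v)" using finV finite_subset by blast
  fix x y assume "x \<in> Yg v" "y \<in> Yg v" "pth v x = pth v y"
  then show "rc (Hg v) x = rc (Hg v) y" using rc_Hg[OF v] by blast
qed

lemma limset_Hg:
  assumes v: "v \<in> V"
  shows "L (Hg v) = {\<xi> \<in> bdry N. \<forall>n. pre n \<xi> \<in> Yg v}"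
proof (intro equalityI subsetI)
  fix \<xi> assume x: "\<xi> \<in> L (Hg v)"
  have "pre n \<xi> \<in> Yg v" for n
  proof -
    obtain h where h: "h \<in> Hg v" "take n h = pre n \<xi>" using x by (auto simp: limset_iff)
    then show ?thesis using Yg_take[of h v n] Hg_sub by auto
  qed
  then show "\<xi> \<in> {\<xi> \<in> bdry N. \<forall>n. pre n \<xi> \<in> Yg v}" using x by (simp add: limset_iff)
next
  fix \<xi> assume x: "\<xi> \<in> {\<xi> \<in> bdry N. \<forall>n. pre n \<xi> \<in> Yg v}"
  show "\<xi> \<in> L (Hg v)"
  proof (rule cofin_limset[OF subgroup_Hg[OF v] _ cofin_Hg[OF v]])
    show "Yg v \<subseteq> G" by (auto simp: Yg_def)
  qed (use x in auto)
qed

text \<open>Every vertex has two outgoing edges, so a path can always be continued without turning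
  back.\<close>

lemma ray_Yg:
  assumes x: "x \<in> V" and a: "a \<in> Lv x"
  shows "\<exists>\<xi>\<in>bdry N. \<xi> 0 = a \<and> (\<forall>n. pre n \<xi> \<in> Yg x)"
proof -
  \<comment> \<open>A state consists of the current vertex and the edge to be taken next.\<close>
  define P where "P n p \<longleftrightarrow> fst p \<in> V \<and> snd p \<in> Lv (fst p) \<and> (n = 0 \<longrightarrow> p = (x, a))" for n :: nat and p :: "'v \<times> letter"
  define Q where "Q n p p' \<longleftrightarrow> fst p' = st (fst p) (snd p) \<and> snd p' \<noteq> linv (snd p)" for n :: nat and p p' :: "'v \<times> letter"
  have "\<exists>f. \<forall>n. P n (f n) \<and> Q n (f n) (f (Suc n))"
  proof (rule dependent_nat_choice)
    show "\<exists>p. P 0 p" using x a by (intro exI[of _ "(x, a)"]) (simp add: P_def)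
    fix p n assume p: "P n p"
    let ?y = "st (fst p) (snd p)"
    have y: "?y \<in> V" using p stV by (simp add: P_def)
    obtain b c where bc: "b \<in> Lv ?y" "c \<in> Lv ?y" "b \<noteq> c" using two[OF y] by blast
    then obtain b' where "b' \<in> Lv ?y" "b' \<noteq> linv (snd p)" by metis
    then show "\<exists>p'. P (Suc n) p' \<and> Q n p p'" using y by (intro exI[of _ "(?y, b')"]) (simp add: P_def Q_def)
  qed
  then obtain f where f: "\<And>n. P n (f n)" "\<And>n. Q n (f n) (f (Suc n))" by blast
  define \<xi> where "\<xi> i = snd (f i)" for i
  have f0: "f 0 = (x, a)" using f(1)[of 0] by (simp add: P_def)
  have pth: "pth x (pre n \<xi>) = Some (fst (f n))" for n
  proof (induction n)
    case 0
    then show ?case using f0 by simp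
  next
    case (Suc n)
    have "\<xi> n \<in> Lv (fst (f n))" using f(1)[of n] by (simp add: P_def \<xi>_def)
    then show ?case using Suc f(2)[of n] by (simp add: pre_Suc pth_append Q_def \<xi>_def)
  qed
  have "fst (\<xi> i) < N" for i using f(1)[of i] LvN[of "fst (f i)" "snd (f i)"] by (simp add: P_def \<xi>_def)
  moreover have "\<xi> (Suc i) \<noteq> linv (\<xi> i)" for i using f(2)[of i] by (simp add: Q_def \<xi>_def)
  ultimately have b: "\<xi> \<in> bdry N" by (simp add: bdry_def)
  then have "pre n \<xi> \<in> Yg x" for n using pth[of n] by (simp add: Yg_def)
  moreover have "\<xi> 0 = a" using f0 by (simp add: \<xi>_def)
  ultimately show ?thesis using b by blast
qed

text \<open>Limit rays never leave the universal cover. Conversely, each of its vertices has two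
  outgoing edges and hence sees limit points in two directions.\<close>

lemma hull_Hg:
  assumes v: "v \<in> V"
  shows "thull (L (Hg v)) = Yg v"
proof (intro equalityI subsetI)
  fix w assume w: "w \<in> thull (L (Hg v))"
  obtain \<xi> where x: "\<xi> \<in> L (Hg v)" "pre (length w) \<xi> = w" using hull_prefix[OF w limset_sub] by blast
  have "pre (length w) \<xi> \<in> Yg v" using x(1) unfolding limset_Hg[OF v] by blast
  then show "w \<in> Yg v" using x(2) by simp
next
  fix w assume w: "w \<in> Yg v"
  then obtain x where x: "pth v w = Some x" "w \<in> G" by (auto simp: Yg_def)
  have xV: "x \<in> V" using pth_V[OF v x(1)] .
  have *: "\<exists>\<zeta>\<in>L (Hg v). dir w \<zeta> = a" if a: "a \<in> Lv x" for a
  proof -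
    obtain \<xi> where xi: "\<xi> \<in> bdry N" "\<xi> 0 = a" "\<And>n. pre n \<xi> \<in> Yg x" using ray_Yg[OF xV a] by blast
    have "pre m (bact w \<xi>) \<in> Yg v" for m
    proof -
      let ?y = "pre (m + length w) \<xi>"
      have "w \<sqdot> ?y \<in> Yg v" using Yg_mul[OF v x(2,1), of ?y] xi by simp
      then have "take m (w \<sqdot> ?y) \<in> Yg v" by (rule Yg_take)
      moreover have "take m (w \<sqdot> ?y) = pre m (bact w \<xi>)" using take_mul_bact[OF x(2), of ?y m \<xi>] xi(1) by simp
      ultimately show ?thesis by simp
    qed
    then have "bact w \<xi> \<in> L (Hg v)" unfolding limset_Hg[OF v] using xi(1) x(2) by simp
    moreover have "dir w (bact w \<xi>) = a" using xi x(2) by (simp add: dir_def)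
    ultimately show ?thesis by blast
  qed
  obtain a b where ab: "a \<in> Lv x" "b \<in> Lv x" "a \<noteq> b" using two[OF xV] by blast
  obtain \<zeta> where z: "\<zeta> \<in> L (Hg v)" "dir w \<zeta> = a" using *[OF ab(1)] by blast
  obtain \<zeta>' where z': "\<zeta>' \<in> L (Hg v)" "dir w \<zeta>' = b" using *[OF ab(2)] by blast
  have "dir w \<zeta> \<noteq> dir w \<zeta>'" using z z' ab by simp
  then show "w \<in> thull (L (Hg v))" using z(1) z'(1) x(2) unfolding thull_def by blast
qed

lemma cocpt_Hg: "v \<in> V \<Longrightarrow> cocpt (Hg v)"
  using subgroup_Hg cofin_Hg hull_Hg by (simp add: cocpt_def)

section \<open>Connected components and their counting currents\<close>

definition Comp :: "'v \<Rightarrow> 'v set" where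
  "Comp v = {x. \<exists>w\<in>G. pth v w = Some x}"

lemma Comp_self: "v \<in> Comp v"
  by (auto simp: Comp_def intro!: bexI[of _ "[]"])

lemma Comp_V: "v \<in> V \<Longrightarrow> Comp v \<subseteq> V"
  using pth_V by (auto simp: Comp_def)

lemma Comp_eq:
  assumes v: "v \<in> V" and x: "x \<in> Comp v"
  shows "Comp x = Comp v"
proof -
  obtain w where w: "w \<in> G" "pth v w = Some x" using x by (auto simp: Comp_def)
  have xV: "x \<in> V" using pth_V[OF v w(2)] .
  have "pth x (iv w) = Some v" using pth_iv[OF v w] .
  note iw = this
  show ?thesis
  proof (intro equalityI subsetI)
    fix y assume "y \<in> Comp x"
    then obtain u where "u \<in> G" "pth x u = Some y" by (auto simp: Comp_def)
    then have "w \<sqdot> u \<in> G" "pth v (w \<sqdot> u) = Some y" using pth_mul[OF v _ w(2)] w(1) by auto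
    then show "y \<in> Comp v" unfolding Comp_def by blast
  next
    fix y assume "y \<in> Comp v"
    then obtain u where "u \<in> G" "pth v u = Some y" by (auto simp: Comp_def)
    then have "iv w \<sqdot> u \<in> G" "pth x (iv w \<sqdot> u) = Some y" using pth_mul[OF xV _ iw] w(1) by auto
    then show "y \<in> Comp x" unfolding Comp_def by blast
  qed
qed

text \<open>The cosets of \<open>Hg v\<close> in its hull are the vertices of the component, and the
  type at a coset is the ball of the universal cover at that vertex.\<close>

lemma eta_Hg:
  assumes v: "v \<in> V" and A: "A \<in> TT n"
  shows "measure (eta N (Hg v)) (Z n A) = (\<Sum>x\<in>Comp v. of_bool (Yg x \<inter> B n = A))"
proof -
  let ?H = "Hg v"
  have sH: "subgroup ?H (FG N)" using subgroup_Hg[OF v] .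
  define wx where "wx x = (SOME w. w \<in> G \<and> pth v w = Some x)" for x
  have wx: "wx x \<in> G" "pth v (wx x) = Some x" if "x \<in> Comp v" for x
  proof -
    have "\<exists>w. w \<in> G \<and> pth v w = Some x" using that by (auto simp: Comp_def)
    from someI_ex[OF this] show "wx x \<in> G" "pth v (wx x) = Some x" unfolding wx_def by auto
  qed
  have wY: "wx x \<in> Yg v" if "x \<in> Comp v" for x using wx[OF that] by (simp add: Yg_def)
  have inj: "inj_on (\<lambda>x. rc ?H (wx x)) (Comp v)"
  proof (rule inj_onI)
    fix x y assume x: "x \<in> Comp v" "y \<in> Comp v" "rc ?H (wx x) = rc ?H (wx y)"
    then have "pth v (wx x) = pth v (wx y)" using rc_Hg[OF v wY[OF x(1)] wY[OF x(2)]] by simp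
    then show "x = y" using wx x by simp
  qed
  have im: "(\<lambda>x. rc ?H (wx x)) ` Comp v = rc ?H ` Yg v"
  proof (intro equalityI subsetI)
    fix c assume "c \<in> rc ?H ` Yg v"
    then obtain w where w: "w \<in> Yg v" "c = rc ?H w" by blast
    then obtain x where x: "pth v w = Some x" "w \<in> G" by (auto simp: Yg_def)
    then have xC: "x \<in> Comp v" by (auto simp: Comp_def)
    have "c = rc ?H (wx x)" using rc_Hg[OF v w(1) wY[OF xC]] wx[OF xC] x w by simp
    then show "c \<in> (\<lambda>x. rc ?H (wx x)) ` Comp v" using xC by blast
  qed (use wY in blast)
  have t: "tp n (pt ?H (rc ?H (wx x))) = Yg x \<inter> B n" if x: "x \<in> Comp v" for x
  proof -
    have "tp n (pt ?H (rc ?H (wx x))) = {y \<in> B n. wx x \<sqdot> y \<in> Yg v}"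
      using tp_pt[OF sH wx(1)[OF x]] hull_Hg[OF v] by simp
    then show ?thesis using Yg_mul[OF v wx[OF x]] by blast
  qed
  have "(\<Sum>A'\<in>TT n. of_bool (A' = A) * measure (eta N ?H) (Z n A')) = measure (eta N ?H) (Z n A)"
  proof -
    have "(\<Sum>A'\<in>TT n. of_bool (A' = A) * measure (eta N ?H) (Z n A')) = (\<Sum>A'\<in>TT n. if A = A' then measure (eta N ?H) (Z n A') else 0)"
      by (intro sum.cong) auto
    then show ?thesis using finite_TT A by simp
  qed
  then have "measure (eta N ?H) (Z n A) = (\<Sum>c\<in>rc ?H ` Yg v. of_bool (tp n (pt ?H c) = A))"
    using eta_sum[OF cocpt_Hg[OF v], of "\<lambda>X. of_bool (X = A)" n] hull_Hg[OF v] by simp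
  also have "\<dots> = (\<Sum>x\<in>Comp v. of_bool (tp n (pt ?H (rc ?H (wx x))) = A))"
    unfolding im[symmetric] by (simp add: sum.reindex[OF inj])
  also have "\<dots> = (\<Sum>x\<in>Comp v. of_bool (Yg x \<inter> B n = A))" using t by (intro sum.cong) auto
  finally show ?thesis .
qed

text \<open>One subgroup is taken for every component, at a chosen base vertex; together they count
  every vertex of the graph once.\<close>

lemma graph_current:
  "\<exists>I h. finite (I :: 'v set set) \<and> (\<forall>i\<in>I. fgsub N (h i)) \<and>
     (\<forall>A\<in>TT n. (\<Sum>i\<in>I. measure (eta N (h i)) (Z n A)) = real (card {x \<in> V. Yg x \<inter> B n = A}))"
proof -
  define rp where "rp C = (SOME v. v \<in> V \<and> Comp v = C)" for C
  have rp: "rp C \<in> V" "Comp (rp C) = C" if "C \<in> Comp ` V" for C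
  proof -
    have "\<exists>v. v \<in> V \<and> Comp v = C" using that by blast
    from someI_ex[OF this] show "rp C \<in> V" "Comp (rp C) = C" unfolding rp_def by auto
  qed
  have fib: "{x \<in> V. Comp x = C} = C" if C: "C \<in> Comp ` V" for C
  proof (intro equalityI subsetI)
    fix x assume "x \<in> {x \<in> V. Comp x = C}"
    then show "x \<in> C" using Comp_self[of x] by simp
  next
    fix x assume "x \<in> C"
    then show "x \<in> {x \<in> V. Comp x = C}"
      using Comp_eq[OF rp(1)[OF C], of x] Comp_V[OF rp(1)[OF C]] rp(2)[OF C] by auto
  qed
  have "(\<Sum>C\<in>Comp ` V. measure (eta N (Hg (rp C))) (Z n A)) = real (card {x \<in> V. Yg x \<inter> B n = A})" if A: "A \<in> TT n" for A
  proof -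
    have "(\<Sum>C\<in>Comp ` V. measure (eta N (Hg (rp C))) (Z n A)) = (\<Sum>C\<in>Comp ` V. \<Sum>x\<in>{x \<in> V. Comp x = C}. of_bool (Yg x \<inter> B n = A))"
      using eta_Hg[OF rp(1) A] rp(2) fib by (intro sum.cong) auto
    also have "\<dots> = (\<Sum>x\<in>V. of_bool (Yg x \<inter> B n = A))" by (rule sum.image_gen[OF finV, symmetric])
    also have "\<dots> = real (card {x \<in> V. Yg x \<inter> B n = A})" using finV by (simp add: of_bool_def sum.If_cases Int_def)
    finally show ?thesis .
  qed
  moreover have "\<forall>C\<in>Comp ` V. fgsub N (Hg (rp C))" using cocpt_fgsub[OF cocpt_Hg] rp(1) by blast
  ultimately show ?thesis using finV by (intro exI[of _ "Comp ` V"] exI[of _ "\<lambda>C. Hg (rp C)"]) simp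
qed

end

section \<open>Density of rational currents and uniqueness\<close>

text \<open>This captures the cone spanned by the counting currents.\<close>

definition tested :: "bpt set measure \<Rightarrow> bool" where
  "tested \<nu> \<longleftrightarrow> \<nu> \<in> SCurr N \<and> (\<forall>r. nnlinear N r \<longrightarrow> (\<forall>H. fgsub N H \<longrightarrow> r (eta N H) = 0) \<longrightarrow> r \<nu> = 0)"

lemma tested_sum:
  assumes "finite I" "\<And>i. i \<in> I \<Longrightarrow> fgsub N (h i)" "0 \<le> c"
  shows "\<exists>\<nu>. tested \<nu> \<and> (\<forall>U\<in>sets (CN_meas N). U \<subseteq> Cv [] \<longrightarrow> measure \<nu> U = c * (\<Sum>i\<in>I. measure (eta N (h i)) U))"
  using assms(1,2)
proof (induction rule: finite_induct)
  case empty
  have "tested (eta N {[]})" using eta_SCurr[OF fgsub_cocpt[OF fgsub_trivial]] fgsub_trivial by (auto simp: tested_def)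
  moreover have "measure (eta N {[]}) U = 0" for U by (simp add: eta_def measure_def)
  ultimately show ?case by (intro exI[of _ "eta N {[]}"]) simp
next
  case (insert i I)
  then obtain \<nu> where n: "tested \<nu>" "\<forall>U\<in>sets (CN_meas N). U \<subseteq> Cv [] \<longrightarrow> measure \<nu> U = c * (\<Sum>i\<in>I. measure (eta N (h i)) U)" by auto
  have nS: "\<nu> \<in> SCurr N" using n(1) by (simp add: tested_def)
  have fg: "fgsub N (h i)" using insert.prems by simp
  have eS: "eta N (h i) \<in> SCurr N" using eta_SCurr[OF fgsub_cocpt[OF fg]] .
  let ?n = "cadd (csmult c (eta N (h i))) (csmult 1 \<nu>)"
  have "tested ?n" unfolding tested_def
  proof (intro conjI allI impI)
    show "?n \<in> SCurr N" using SCurr_cadd[OF eS nS assms(3)] by simp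
    fix r assume r: "nnlinear N r" "\<forall>H. fgsub N H \<longrightarrow> r (eta N H) = 0"
    have "r ?n = c * r (eta N (h i)) + 1 * r \<nu>"
      using r(1) eS nS assms(3) unfolding nnlinear_def by (metis zero_le_one)
    then show "r ?n = 0" using r fg n(1) by (simp add: tested_def)
  qed
  moreover have "measure ?n U = c * (\<Sum>i\<in>insert i I. measure (eta N (h i)) U)" if "U \<in> sets (CN_meas N)" "U \<subseteq> Cv []" for U
    using measure_cadd[OF eS nS assms(3) _ that, of 1] n(2) that insert.hyps by (simp add: distrib_left)
  ultimately show ?case by blast
qed

text \<open>Used to glue half-edges: those with equal overlap are matched with each other, and the
  edge equations say that each class has as many partners as members.\<close>

lemma fiber_bijection:
  assumes fin: "finite P" "finite Q" and c: "\<And>E. card {v \<in> P. k1 v = E} = card {v \<in> Q. k2 v = E}"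
  shows "\<exists>\<sigma>. bij_betw \<sigma> P Q \<and> (\<forall>v\<in>P. k2 (\<sigma> v) = k1 v)"
proof -
  have "\<exists>\<beta>. bij_betw \<beta> {v \<in> P. k1 v = E} {v \<in> Q. k2 v = E}" for E
    using fin c[of E] by (intro finite_same_card_bij) auto
  then obtain \<beta> where b: "\<And>E. bij_betw (\<beta> E) {v \<in> P. k1 v = E} {v \<in> Q. k2 v = E}" by metis
  define \<sigma> where "\<sigma> v = \<beta> (k1 v) v" for v
  have s: "\<sigma> v \<in> Q" "k2 (\<sigma> v) = k1 v" if "v \<in> P" for v
    using bij_betwE[OF b[of "k1 v"]] that by (auto simp: \<sigma>_def)
  have "inj_on \<sigma> P"
  proof (rule inj_onI)
    fix u v assume u: "u \<in> P" "v \<in> P" "\<sigma> u = \<sigma> v"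
    then have k: "k1 u = k1 v" using s by metis
    then have "\<beta> (k1 v) u = \<beta> (k1 v) v" using u(3) by (simp add: \<sigma>_def)
    then show "u = v" using bij_betw_imp_inj_on[OF b[of "k1 v"]] u k by (auto dest: inj_onD)
  qed
  moreover have "\<sigma> ` P = Q"
  proof (intro equalityI subsetI)
    fix u assume u: "u \<in> Q"
    then have "u \<in> \<beta> (k2 u) ` {v \<in> P. k1 v = k2 u}" using bij_betw_imp_surj_on[OF b[of "k2 u"]] by blast
    then obtain v where "v \<in> P" "k1 v = k2 u" "u = \<beta> (k2 u) v" by blast
    then show "u \<in> \<sigma> ` P" by (intro image_eqI[of _ _ v]) (simp_all add: \<sigma>_def)
  qed (use s in blast)
  ultimately show ?thesis using s(2) unfolding bij_betw_def by blast
qed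

text \<open>The part of the type \<open>A\<close> of one end of an edge labelled \<open>a\<close> that lies in the overlap of the two
  balls around its ends, for the initial and for the terminal vertex, both seen from the former.\<close>

definition Eo :: "nat \<Rightarrow> letter \<Rightarrow> word set \<Rightarrow> word set" where
  "Eo n a A = {y \<in> A. [linv a] \<sqdot> y \<in> B n}"

definition Ei :: "nat \<Rightarrow> letter \<Rightarrow> word set \<Rightarrow> word set" where
  "Ei n a A = {y \<in> B n. [linv a] \<sqdot> y \<in> A}"

section \<open>Edge equations and their integral solutions\<close>

lemma linv_mul [simp]:
  "fst a < N \<Longrightarrow> y \<in> G \<Longrightarrow> [a] \<sqdot> ([linv a] \<sqdot> y) = y"
  "fst a < N \<Longrightarrow> y \<in> G \<Longrightarrow> [linv a] \<sqdot> ([a] \<sqdot> y) = y"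
  using mul_iv_cancel(1)[of "[a]" y] mul_iv_cancel(2)[of "[a]" y] iv_letter[of a] by simp_all

text \<open>Both sides measure the closed sets whose hull contains an edge labelled \<open>a\<close>
  with prescribed surroundings, once with the base vertex at its beginning and once at its end.
  Translation along the edge exchanges the two views.\<close>

lemma edge_equation:
  assumes m: "\<mu> \<in> SCurr N" and a: "fst a < N" and n: "1 \<le> n"
  shows "(\<Sum>A\<in>{A \<in> TT n. [a] \<in> A \<and> Eo n a A = E}. measure \<mu> (Z n A)) =
    (\<Sum>A\<in>{A \<in> TT n. [linv a] \<in> A \<and> Ei n a A = E}. measure \<mu> (Z n A))"
proof -
  let ?W1 = "{S \<in> Cv []. [a] \<in> tp n S \<and> Eo n a (tp n S) = E}"
  let ?W2 = "{S \<in> Cv []. [linv a] \<in> tp n S \<and> Ei n a (tp n S) = E}"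
  have aG: "[a] \<in> G" "[linv a] \<in> G" "iv [a] = [linv a]" using a iv_letter by simp_all
  have key: "S \<in> ?W1 \<longleftrightarrow> act [linv a] S \<in> ?W2" if S: "S \<in> CN N" for S
  proof -
    let ?S = "act [linv a] S"
    have Sb: "S \<subseteq> bdry N" using CN_sub[OF S] .
    have SC: "?S \<in> CN N" using act_CN[OF aG(2) S] .
    have h: "y \<in> thull ?S \<longleftrightarrow> [a] \<sqdot> y \<in> thull S" if "y \<in> G" for y
      using hull_act[OF aG(2) Sb that] iv_letter[of "linv a"] a by simp
    have 1: "?S \<in> Cv [] \<longleftrightarrow> [a] \<in> tp n S"
      using h[of "[]"] aG n S SC by (simp add: Cv_def tp_def)
    have 2: "[linv a] \<in> tp n ?S \<longleftrightarrow> S \<in> Cv []"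
      using h[of "[linv a]"] linv_mul(1)[OF a, of "[]"] aG n S by (simp add: Cv_def tp_def)
    have 3: "Ei n a (tp n ?S) = Eo n a (tp n S)"
    proof -
      have "y \<in> Ei n a (tp n ?S) \<longleftrightarrow> y \<in> Eo n a (tp n S)" if y: "y \<in> G" for y
        using h[of "[linv a] \<sqdot> y"] y a aG by (auto simp: Ei_def Eo_def tp_def)
      moreover have "Ei n a (tp n ?S) \<subseteq> G" "Eo n a (tp n S) \<subseteq> G" by (auto simp: Ei_def Eo_def tp_def)
      ultimately show ?thesis by blast
    qed
    show ?thesis using 1 2 3 by blast
  qed
  have W1: "?W1 \<subseteq> CN N" and W2: "?W2 \<subseteq> CN N" by (auto simp: Cv_def)
  have "act [a] ` ?W2 = ?W1"
  proof (intro equalityI subsetI)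
    fix S assume S: "S \<in> act [a] ` ?W2"
    then have SC: "S \<in> CN N" using act_image_CN[OF aG(1) W2] by blast
    then have "act [linv a] S \<in> ?W2" using act_image_mem[OF aG(1) W2 SC] S aG(3) by simp
    then show "S \<in> ?W1" using key[OF SC] by blast
  next
    fix S assume S: "S \<in> ?W1"
    then have SC: "S \<in> CN N" using W1 by blast
    then have "act [linv a] S \<in> ?W2" using key[OF SC] S by blast
    then show "S \<in> act [a] ` ?W2" using act_image_mem[OF aG(1) W2 SC] aG(3) by simp
  qed
  moreover have "?W2 \<in> sets (CN_meas N)"
  proof -
    have "?W2 = (\<Union>A\<in>{A \<in> TT n. [linv a] \<in> A \<and> Ei n a A = E}. Z n A)"
      using Z_sub tp_TT by (fastforce simp: Z_def Cv_def)
    then show ?thesis using sets_Z finite_TT by (simp add: sets.finite_UN)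
  qed
  ultimately have "emeasure \<mu> ?W1 = emeasure \<mu> ?W2" using SCurr_inv[OF m aG(1), of ?W2] by simp
  then have "measure \<mu> ?W1 = measure \<mu> ?W2" by (simp add: measure_def)
  then show ?thesis
    using measure_partition[OF m, of "\<lambda>X. [a] \<in> X \<and> Eo n a X = E" n]
      measure_partition[OF m, of "\<lambda>X. [linv a] \<in> X \<and> Ei n a X = E" n] by simp
qed

text \<open>Compatibility along an edge is a condition on its two ends together, so it can be read
  from either end. This transfers the gluing condition to reversed edges.\<close>

lemma Eo_flip:
  assumes a: "fst a < N" and X: "X \<subseteq> B n" "X' \<subseteq> B n" and e: "Eo n a X' = Ei n a X"
  shows "Eo n (linv a) X = Ei n (linv a) X'"
proof -
  have "y \<in> Eo n (linv a) X \<longleftrightarrow> y \<in> Ei n (linv a) X'" if y: "y \<in> G" for y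
  proof -
    have ay: "[a] \<sqdot> y \<in> G" using a y by simp
    have "y \<in> Eo n (linv a) X \<longleftrightarrow> [a] \<sqdot> y \<in> Ei n a X" using y a X by (auto simp: Eo_def Ei_def)
    also have "\<dots> \<longleftrightarrow> [a] \<sqdot> y \<in> Eo n a X'" using e by simp
    also have "\<dots> \<longleftrightarrow> y \<in> Ei n (linv a) X'" using y a X by (auto simp: Eo_def Ei_def)
    finally show ?thesis .
  qed
  moreover have "Eo n (linv a) X \<subseteq> G" "Ei n (linv a) X' \<subseteq> G" using X by (auto simp: Eo_def Ei_def)
  ultimately show ?thesis by blast
qed

text \<open>By simultaneous Dirichlet approximation the weights of the finitely many local types are
  approximated by integers over a common denominator so closely that the integers satisfy the
  edge equations exactly.\<close>

lemma integer_weights: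
  assumes m: "\<mu> \<in> SCurr N" and n: "1 \<le> n" and d: "0 < d"
  shows "\<exists>(q::real) (p :: word set \<Rightarrow> nat). 1 \<le> q \<and>
    (\<forall>A\<in>TT n. \<bar>real (p A) / q - measure \<mu> (Z n A)\<bar> < d) \<and>
    (\<forall>A\<in>TT n. 0 < p A \<longrightarrow> Z n A \<noteq> {}) \<and>
    (\<forall>a E. fst a < N \<longrightarrow> (\<Sum>A\<in>{A \<in> TT n. [a] \<in> A \<and> Eo n a A = E}. p A) =
       (\<Sum>A\<in>{A \<in> TT n. [linv a] \<in> A \<and> Ei n a A = E}. p A))"
proof -
  let ?x = "\<lambda>A. measure \<mu> (Z n A)"
  define k where "k = card (TT n)"
  obtain en where en: "bij_betw en {0..<k} (TT n)" using ex_bij_betw_nat_finite[OF finite_TT] k_def by blast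
  obtain M0 :: nat where M0: "1 / d < real M0" using reals_Archimedean2 by blast
  \<comment> \<open>The summand \<open>M0\<close> makes the error \<open>1 / M\<close> smaller than
    \<open>d\<close>. The summand \<open>2 * k + 1\<close> keeps the total error of two sums with at
    most \<open>k\<close> terms each below 1, which forces the two integers of an edge equation to
    be equal.\<close>
  define M where "M = M0 + 2 * k + 1"
  have M: "M > 0" by (simp add: M_def)
  obtain q p where q: "0 < q" and "q \<le> int (M ^ k)"
    and p: "\<And>i. i < k \<Longrightarrow> \<bar>of_int q * ?x (en i) - of_int (p i)\<bar> < 1 / M"
  proof (rule Dirichlet_approx_simult[OF M, where n = k and \<theta> = "\<lambda>i. ?x (en i)"])
    fix q p assume a: "0 < q" "q \<le> int (M ^ k)"
      "\<And>i. i < k \<Longrightarrow> \<bar>of_int q * ?x (en i) - of_int (p i)\<bar> < 1 / M"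
    show ?thesis by (rule that[OF a])
  qed
  define P where "P A = p (inv_into {0..<k} en A)" for A
  have P: "\<bar>of_int q * ?x A - of_int (P A)\<bar> < 1 / M" if A: "A \<in> TT n" for A
  proof -
    have "inv_into {0..<k} en A \<in> {0..<k}" "en (inv_into {0..<k} en A) = A"
      using bij_betw_inv_into_right[OF en A] bij_betwE[OF bij_betw_inv_into[OF en]] A by auto
    then show ?thesis using p[of "inv_into {0..<k} en A"] by (simp add: P_def)
  qed
  \<comment> \<open>Errors below 1 suffice to make the numerators of nonnegative weights
    nonnegative, and to make them vanish for types that do not occur.\<close>
  have M1: "1 / real M \<le> 1" using M by simp
  have P0: "0 \<le> P A" if A: "A \<in> TT n" for A
  proof -
    have "0 \<le> of_int q * ?x A" using q by simp
    then have "real_of_int (P A) > -1" using P[OF A] M1 by linarith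
    then show ?thesis by linarith
  qed
  define pn where "pn A = nat (P A)" for A
  have pn: "\<bar>of_int q * ?x A - real (pn A)\<bar> < 1 / M" if A: "A \<in> TT n" for A
    using P[OF A] P0[OF A] by (simp add: pn_def)
  have q1: "1 \<le> real_of_int q" using q by simp
  show ?thesis
  proof (intro exI[of _ "real_of_int q"] exI[of _ pn] conjI ballI impI allI)
    show "1 \<le> real_of_int q" by (rule q1)
  next
    fix A assume A: "A \<in> TT n"
    have "real (pn A) / q - ?x A = - (of_int q * ?x A - real (pn A)) / q" using q1 by (simp add: field_simps)
    then have "\<bar>real (pn A) / q - ?x A\<bar> = \<bar>of_int q * ?x A - real (pn A)\<bar> / \<bar>real_of_int q\<bar>"
      by (simp only: abs_divide abs_minus_cancel)
    also have "\<dots> \<le> \<bar>of_int q * ?x A - real (pn A)\<bar> / 1" using q1 by (intro divide_left_mono) auto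
    also have "\<dots> = \<bar>of_int q * ?x A - real (pn A)\<bar>" by simp
    also have "\<dots> < 1 / M" using pn[OF A] .
    also have "\<dots> < d"
    proof -
      have "1 / d < real M" using M0 by (simp add: M_def)
      then show ?thesis using d M by (simp add: field_simps)
    qed
    finally show "\<bar>real (pn A) / q - ?x A\<bar> < d" .
  next
    fix A assume A: "A \<in> TT n" and pos: "0 < pn A"
    show "Z n A \<noteq> {}"
    proof
      assume "Z n A = {}"
      then have "real (pn A) < 1 / M" using pn[OF A] by simp
      then show False using pos M1 by linarith
    qed
  next
    fix a :: letter and E assume a: "fst a < N"
    let ?I = "{A \<in> TT n. [a] \<in> A \<and> Eo n a A = E}" and ?J = "{A \<in> TT n. [linv a] \<in> A \<and> Ei n a A = E}"
    have b: "\<bar>real_of_int q * (\<Sum>A\<in>I. ?x A) - (\<Sum>A\<in>I. real (pn A))\<bar> \<le> real k / M" if I: "I \<subseteq> TT n" for I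
    proof -
      have "\<bar>real_of_int q * (\<Sum>A\<in>I. ?x A) - (\<Sum>A\<in>I. real (pn A))\<bar> = \<bar>\<Sum>A\<in>I. of_int q * ?x A - real (pn A)\<bar>"
        by (simp add: sum_distrib_left sum_subtractf)
      also have "\<dots> \<le> (\<Sum>A\<in>I. \<bar>of_int q * ?x A - real (pn A)\<bar>)" by (rule sum_abs)
      also have "\<dots> \<le> (\<Sum>A\<in>I. 1 / M)" using pn I by (intro sum_mono) (auto intro: less_imp_le)
      also have "\<dots> = real (card I) / M" by simp
      also have "\<dots> \<le> real k / M" using card_mono[OF finite_TT I] by (intro divide_right_mono) (auto simp: k_def)
      finally show ?thesis .
    qed
    have "real k / M + real k / M < 1"
    proof -
      have "real k + real k < real M" by (simp add: M_def)
      then show ?thesis using M by (simp add: field_simps)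
    qed
    then have "\<bar>(\<Sum>A\<in>?I. real (pn A)) - (\<Sum>A\<in>?J. real (pn A))\<bar> < 1"
      using b[of ?I] b[of ?J] edge_equation[OF m a n, of E] by auto
    then have "\<bar>real (\<Sum>A\<in>?I. pn A) - real (\<Sum>A\<in>?J. pn A)\<bar> < 1" by simp
    then show "(\<Sum>A\<in>?I. pn A) = (\<Sum>A\<in>?J. pn A)" by linarith
  qed
qed

lemma density:
  assumes m: "\<mu> \<in> SCurr N" and n: "1 \<le> n" and d: "0 < d"
  shows "\<exists>\<nu>. tested \<nu> \<and> close n d \<mu> \<nu>"
proof -
  obtain q :: real and p :: "word set \<Rightarrow> nat" where q: "1 \<le> q"
    and px: "\<forall>A\<in>TT n. \<bar>real (p A) / q - measure \<mu> (Z n A)\<bar> < d"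
    and pZ: "\<forall>A\<in>TT n. 0 < p A \<longrightarrow> Z n A \<noteq> {}"
    and ee: "\<forall>a E. fst a < N \<longrightarrow> (\<Sum>A\<in>{A \<in> TT n. [a] \<in> A \<and> Eo n a A = E}. p A) =
       (\<Sum>A\<in>{A \<in> TT n. [linv a] \<in> A \<and> Ei n a A = E}. p A)"
    using integer_weights[OF m n d] by auto
  \<comment> \<open>The vertices are \<open>p A\<close> numbered copies of each type
    \<open>A\<close>.\<close>
  define V where "V = (SIGMA A:TT n. {..<p A})"
  have fV: "finite V" unfolding V_def using finite_TT by auto
  have VS: "\<exists>S. S \<in> CN N \<and> fst v = tp n S \<and> [] \<in> thull S" if v: "v \<in> V" for v
  proof -
    have A: "fst v \<in> TT n" "0 < p (fst v)" using v by (auto simp: V_def)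
    then obtain S where S: "S \<in> Z n (fst v)" using pZ by blast
    then have "S \<in> Cv []" using Z_sub[OF A(1)] by blast
    then show ?thesis using S by (intro exI[of _ S]) (simp add: Z_def Cv_def)
  qed
  have VB: "fst v \<subseteq> B n" if "v \<in> V" for v using that by (auto simp: V_def TT_def)
  \<comment> \<open>The types in use are balls in convex sets, so a longer word brings its first
    letter along; a word that starts with a missing edge is thus outside the type.\<close>
  have Vpre: "[a] \<in> fst v" if v: "v \<in> V" "a # w \<in> fst v" for v a w
  proof -
    obtain S where S: "S \<in> CN N" "fst v = tp n S" "[] \<in> thull S" using VS[OF v(1)] by blast
    have "a # w \<in> thull S" using v(2) S by (simp add: tp_def)
    then have "[a] \<in> thull S" using tconvex_prefix[OF tconvex_hull[OF CN_sub[OF S(1)]] S(3), of "a # w" "[a]"] by simp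
    then show ?thesis using S n hull_in_G[of "[a]" S] by (simp add: tp_def)
  qed
  define P where "P a = {v \<in> V. [a] \<in> fst v}" for a
  have "\<exists>\<sigma>. bij_betw \<sigma> (P a) (P (linv a)) \<and> (\<forall>v\<in>P a. Ei n a (fst (\<sigma> v)) = Eo n a (fst v))" if a: "fst a < N" for a
  proof (rule fiber_bijection[where ?k1.0 = "\<lambda>v. Eo n a (fst v)" and ?k2.0 = "\<lambda>v. Ei n a (fst v)"])
    show "finite (P a)" "finite (P (linv a))" using fV by (auto simp: P_def)
    fix E
    have "{v \<in> P a. Eo n a (fst v) = E} = (SIGMA A:{A \<in> TT n. [a] \<in> A \<and> Eo n a A = E}. {..<p A})"
      by (auto simp: P_def V_def)
    moreover have "{v \<in> P (linv a). Ei n a (fst v) = E} = (SIGMA A:{A \<in> TT n. [linv a] \<in> A \<and> Ei n a A = E}. {..<p A})"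
      by (auto simp: P_def V_def)
    ultimately show "card {v \<in> P a. Eo n a (fst v) = E} = card {v \<in> P (linv a). Ei n a (fst v) = E}"
      using finite_TT ee[rule_format, OF a, of E] by (simp add: card_SigmaI)
  qed
  then obtain \<sigma> where s: "\<And>a. fst a < N \<Longrightarrow> bij_betw (\<sigma> a) (P a) (P (linv a))"
    "\<And>a v. fst a < N \<Longrightarrow> v \<in> P a \<Longrightarrow> Ei n a (fst (\<sigma> a v)) = Eo n a (fst v)" by metis
  define Lv where "Lv v = {a. fst a < N \<and> [a] \<in> fst v}" for v :: "word set \<times> nat"
  \<comment> \<open>The matchings are used for positive labels, and their inverses for negative
    ones. This makes the gluing symmetric, even though the matchings for inverse letters were chosen
    independently.\<close>
  define st where "st v a = (if snd a then inv_into (P (linv a)) (\<sigma> (linv a)) v else \<sigma> a v)" for v a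
  have stp: "st v a \<in> P (linv a) \<and> st (st v a) (linv a) = v \<and> Eo n a (fst v) = Ei n a (fst (st v a))"
    if v: "v \<in> V" and a: "a \<in> Lv v" for v a
  proof -
    have aN: "fst a < N" and vP: "v \<in> P a" using a v by (auto simp: Lv_def P_def)
    show ?thesis
    proof (cases "snd a")
      case False
      have "st v a = \<sigma> a v" using False by (simp add: st_def)
      moreover have "\<sigma> a v \<in> P (linv a)" using bij_betwE[OF s(1)[OF aN]] vP by blast
      moreover have "snd (linv a)" using False by (simp add: linv_def)
      then have "st (\<sigma> a v) (linv a) = inv_into (P a) (\<sigma> a) (\<sigma> a v)" by (simp add: st_def)
      moreover have "inv_into (P a) (\<sigma> a) (\<sigma> a v) = v" using bij_betw_inv_into_left[OF s(1)[OF aN] vP] .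
      ultimately show ?thesis using s(2)[OF aN vP] by simp
    next
      case True
      let ?b = "linv a"
      have bN: "fst ?b < N" using aN by simp
      have bij: "bij_betw (\<sigma> ?b) (P ?b) (P a)" using s(1)[OF bN] by simp
      let ?u = "inv_into (P ?b) (\<sigma> ?b) v"
      have u: "?u \<in> P ?b" "\<sigma> ?b ?u = v"
        using bij_betwE[OF bij_betw_inv_into[OF bij]] bij_betw_inv_into_right[OF bij vP] vP by auto
      have e1: "st v a = ?u" using True by (simp add: st_def)
      have "\<not> snd ?b" using True by (simp add: linv_def)
      then have e2: "st ?u ?b = v" using u by (simp add: st_def)
      have "Eo n ?b (fst ?u) = Ei n ?b (fst v)" using s(2)[OF bN u(1)] u(2) by simp
      moreover have "fst v \<subseteq> B n" "fst ?u \<subseteq> B n" using VB v u by (auto simp: P_def)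
      ultimately have "Eo n (linv ?b) (fst v) = Ei n (linv ?b) (fst ?u)" using Eo_flip[OF bN] by blast
      then show ?thesis using e1 e2 u by simp
    qed
  qed
  have two: "\<exists>a\<in>Lv v. \<exists>b\<in>Lv v. a \<noteq> b" if v: "v \<in> V" for v
  proof -
    obtain S where S: "S \<in> CN N" "fst v = tp n S" "[] \<in> thull S" using VS[OF v] by blast
    have Sb: "S \<subseteq> bdry N" using CN_sub[OF S(1)] .
    obtain \<xi> \<zeta> where x: "\<xi> \<in> S" "\<zeta> \<in> S" "\<xi> 0 \<noteq> \<zeta> 0" using S(3) by (auto simp: thull_def)
    have "a0 \<in> Lv v" if "\<exists>\<xi>\<in>S. \<xi> 0 = a0" for a0
    proof -
      have h: "[a0] \<in> thull S" using hull_letter[OF S(3) Sb] that by blast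
      then show ?thesis using S(2) n hull_in_G[OF h] by (simp add: Lv_def tp_def)
    qed
    then show ?thesis using x by blast
  qed
  have ctx: "finite V" "\<And>v a. v \<in> V \<Longrightarrow> a \<in> Lv v \<Longrightarrow> fst a < N" "\<And>v a. v \<in> V \<Longrightarrow> a \<in> Lv v \<Longrightarrow> st v a \<in> V"
    "\<And>v a. v \<in> V \<Longrightarrow> a \<in> Lv v \<Longrightarrow> linv a \<in> Lv (st v a)" "\<And>v a. v \<in> V \<Longrightarrow> a \<in> Lv v \<Longrightarrow> st (st v a) (linv a) = v"
    "\<And>v. v \<in> V \<Longrightarrow> \<exists>a\<in>Lv v. \<exists>b\<in>Lv v. a \<noteq> b"
  proof -
    fix v a assume va: "v \<in> V" "a \<in> Lv v"
    show aN: "fst a < N" using va by (simp add: Lv_def)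
    show "st v a \<in> V" using stp[OF va] by (simp add: P_def)
    show "linv a \<in> Lv (st v a)" using stp[OF va] aN by (simp add: P_def Lv_def)
    show "st (st v a) (linv a) = v" using stp[OF va] by simp
  qed (use fV two in auto)
  note Yg_simps = Yg_def[of V Lv st, OF ctx] pth.simps[of V Lv st, OF ctx]
  \<comment> \<open>The ball of the universal cover at a vertex is the type that this vertex was a
    copy of. The induction passes along the first edge: the overlaps agree there, and both the word
    and its remainder lie in the ball of radius \<open>n\<close>.\<close>
  have Y: "w \<in> Yg Lv st v \<longleftrightarrow> w \<in> fst v" if "v \<in> V" "w \<in> B n" for v w
    using that
  proof (induction w arbitrary: v)
    case Nil
    have "[] \<in> Yg Lv st v" by (simp add: Yg_simps)
    moreover have "[] \<in> fst v" using Nil by (auto simp: V_def TT_def)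
    ultimately show ?case by blast
  next
    case (Cons a w)
    have G: "fst a < N" "w \<in> G" "a # w \<in> G" "w \<in> B n" using Cons.prems by (auto simp: G_Cons)
    have e: "[linv a] \<sqdot> (a # w) = w"
      using linv_mul(2)[OF G(1,2)] mul_append[of "[a]" w] G(3) by simp
    show ?case
    proof (cases "a \<in> Lv v")
      case True
      have "a # w \<in> Yg Lv st v \<longleftrightarrow> w \<in> Yg Lv st (st v a)" using True G by (simp add: Yg_simps)
      also have "\<dots> \<longleftrightarrow> w \<in> fst (st v a)" using Cons.IH[OF ctx(3)[OF Cons.prems(1) True] G(4)] .
      also have "\<dots> \<longleftrightarrow> a # w \<in> Ei n a (fst (st v a))" using Cons.prems(2) e by (simp add: Ei_def)
      also have "\<dots> \<longleftrightarrow> a # w \<in> Eo n a (fst v)" using stp[OF Cons.prems(1) True] by simp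
      also have "\<dots> \<longleftrightarrow> a # w \<in> fst v" using e G by (simp add: Eo_def)
      finally show ?thesis .
    next
      case False
      then have "a # w \<notin> Yg Lv st v" by (simp add: Yg_simps)
      moreover have "a # w \<notin> fst v" using False Vpre[OF Cons.prems(1), of a w] G(1) by (auto simp: Lv_def)
      ultimately show ?thesis by blast
    qed
  qed
  obtain I :: "(word set \<times> nat) set set" and h where Ih: "finite I \<and> (\<forall>i\<in>I. fgsub N (h i)) \<and>
    (\<forall>A\<in>TT n. (\<Sum>i\<in>I. measure (eta N (h i)) (Z n A)) = real (card {x \<in> V. Yg Lv st x \<inter> B n = A}))"
  proof -
    have "\<exists>I h. finite (I :: (word set \<times> nat) set set) \<and> (\<forall>i\<in>I. fgsub N (h i)) \<and>
      (\<forall>A\<in>TT n. (\<Sum>i\<in>I. measure (eta N (h i)) (Z n A)) = real (card {x \<in> V. Yg Lv st x \<inter> B n = A}))"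
      by (rule graph_current[of V Lv st n]) (fact ctx)+
    then show ?thesis by (elim exE) (rule that)
  qed
  note I = conjunct1[OF Ih] conjunct1[OF conjunct2[OF Ih]] conjunct2[OF conjunct2[OF Ih]]
  have cardA: "card {x \<in> V. Yg Lv st x \<inter> B n = A} = p A" if A: "A \<in> TT n" for A
  proof -
    have "Yg Lv st x \<inter> B n = fst x" if "x \<in> V" for x using Y[OF that] VB[OF that] by blast
    then have "{x \<in> V. Yg Lv st x \<inter> B n = A} = {x \<in> V. fst x = A}" by auto
    also have "\<dots> = {A} \<times> {..<p A}" using A by (auto simp: V_def)
    finally show ?thesis by (simp add: card_cartesian_product)
  qed
  obtain \<nu> where v: "tested \<nu>" "\<forall>U\<in>sets (CN_meas N). U \<subseteq> Cv [] \<longrightarrow> measure \<nu> U = 1 / q * (\<Sum>i\<in>I. measure (eta N (h i)) U)"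
    using tested_sum[OF I(1), of h "1 / q"] I(2) q by auto
  have "close n d \<mu> \<nu>" unfolding close_def
  proof
    fix A assume A: "A \<in> TT n"
    have "measure \<nu> (Z n A) = 1 / q * real (p A)" using v(2) sets_Z Z_sub[OF A] I(3) A cardA by simp
    then show "\<bar>measure \<nu> (Z n A) - measure \<mu> (Z n A)\<bar> < d" using px A by simp
  qed
  then show ?thesis using v(1) by blast
qed

section \<open>Uniqueness of the two functionals\<close>

lemma functional_unique:
  assumes c: "continuous_map (curr_top N) euclideanreal r1" "continuous_map (curr_top N) euclideanreal r2"
    and l: "nnlinear N r1" "nnlinear N r2" and e: "\<And>H. fgsub N H \<Longrightarrow> r1 (eta N H) = r2 (eta N H)"
    and m: "\<mu> \<in> SCurr N"
  shows "r1 \<mu> = r2 \<mu>"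
proof (rule ccontr)
  assume ne: "r1 \<mu> \<noteq> r2 \<mu>"
  define D where "D \<nu> = r1 \<nu> - r2 \<nu>" for \<nu>
  have cD: "continuous_map (curr_top N) euclideanreal D"
    unfolding D_def using c by (rule continuous_map_diff)
  have lD: "nnlinear N D" using l unfolding nnlinear_def D_def by (simp add: algebra_simps)
  have zD: "\<forall>H. fgsub N H \<longrightarrow> D (eta N H) = 0" using e by (simp add: D_def)
  let ?W = "{\<nu> \<in> topspace (curr_top N). D \<nu> \<in> - {0}}"
  have "open (- {0 :: real})" by (rule open_Compl) simp
  then have "openin (curr_top N) ?W" using openin_continuous_map_preimage[OF cD] open_openin[of "- {0 :: real}"] by blast
  moreover have "\<mu> \<in> ?W" using m ne by (simp add: D_def)
  ultimately obtain n d where nd: "1 \<le> n" "0 < d" "\<forall>\<nu>\<in>SCurr N. close n d \<mu> \<nu> \<longrightarrow> \<nu> \<in> ?W" using curr_nbhd by blast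
  obtain \<nu> where v: "tested \<nu>" "close n d \<mu> \<nu>" using density[OF m nd(1,2)] by blast
  then have "D \<nu> \<noteq> 0" using nd(3) by (auto simp: tested_def)
  moreover have "D \<nu> = 0" using v(1) lD zD by (simp add: tested_def)
  ultimately show False by simp
qed

lemma rkbar_eq: "rkbar N = rk"
  unfolding rkbar_def
proof (rule the_equality)
  show "continuous_map (curr_top N) euclideanreal rk \<and> nnlinear N rk \<and> (\<forall>\<mu>. \<mu> \<notin> SCurr N \<longrightarrow> rk \<mu> = 0) \<and>
    (\<forall>H. fgsub N H \<longrightarrow> rk (eta N H) = rrank N H)"
    using rk_continuous rk_linear rk_eta by (auto simp: rk_def)
  fix r assume r: "continuous_map (curr_top N) euclideanreal r \<and> nnlinear N r \<and> (\<forall>\<mu>. \<mu> \<notin> SCurr N \<longrightarrow> r \<mu> = 0) \<and>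
    (\<forall>H. fgsub N H \<longrightarrow> r (eta N H) = rrank N H)"
  show "r = rk"
  proof
    fix \<mu>
    show "r \<mu> = rk \<mu>"
    proof (cases "\<mu> \<in> SCurr N")
      case True
      show ?thesis
        by (rule functional_unique[OF _ rk_continuous _ rk_linear _ True]) (use r rk_eta in auto)
    qed (use r in \<open>simp add: rk_def\<close>)
  qed
qed

lemma continuous_map_first:
  assumes c: "continuous_map (prod_topology (curr_top N) (curr_top N)) euclideanreal (\<lambda>p. f (fst p) (snd p))"
    and n: "\<nu> \<in> SCurr N"
  shows "continuous_map (curr_top N) euclideanreal (\<lambda>\<mu>. f \<mu> \<nu>)"
proof -
  have "continuous_map (curr_top N) (prod_topology (curr_top N) (curr_top N)) (\<lambda>\<mu>. (\<mu>, \<nu>))"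
    using n by (intro continuous_map_pairedI) auto
  from continuous_map_compose[OF this c] show ?thesis by (simp add: o_def)
qed

lemma Nform_eq: "Nform N = NN"
  unfolding Nform_def
proof (rule the_equality)
  show "continuous_map (prod_topology (curr_top N) (curr_top N)) euclideanreal (\<lambda>p. NN (fst p) (snd p)) \<and>
    (\<forall>\<mu> \<nu>. NN \<mu> \<nu> = NN \<nu> \<mu>) \<and> (\<forall>\<nu>\<in>SCurr N. nnlinear N (\<lambda>\<mu>. NN \<mu> \<nu>)) \<and>
    (\<forall>\<mu> \<nu>. \<mu> \<notin> SCurr N \<or> \<nu> \<notin> SCurr N \<longrightarrow> NN \<mu> \<nu> = 0) \<and>
    (\<forall>H K. fgsub N H \<and> fgsub N K \<longrightarrow> NN (eta N H) (eta N K) =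
       (\<Sum>\<^sub>\<infinity>D\<in>dcosets N H K. rrank N (H \<inter> conjg N (dcrep N H K D) K)))"
    by (intro conjI allI ballI impI NN_continuous NN_sym NN_linear NN_eta_all) (auto simp: NN_def)
  fix f assume f: "continuous_map (prod_topology (curr_top N) (curr_top N)) euclideanreal (\<lambda>p. f (fst p) (snd p)) \<and>
    (\<forall>\<mu> \<nu>. f \<mu> \<nu> = f \<nu> \<mu>) \<and> (\<forall>\<nu>\<in>SCurr N. nnlinear N (\<lambda>\<mu>. f \<mu> \<nu>)) \<and>
    (\<forall>\<mu> \<nu>. \<mu> \<notin> SCurr N \<or> \<nu> \<notin> SCurr N \<longrightarrow> f \<mu> \<nu> = 0) \<and>
    (\<forall>H K. fgsub N H \<and> fgsub N K \<longrightarrow> f (eta N H) (eta N K) =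
       (\<Sum>\<^sub>\<infinity>D\<in>dcosets N H K. rrank N (H \<inter> conjg N (dcrep N H K D) K)))"
  have fc: "continuous_map (curr_top N) euclideanreal (\<lambda>\<mu>. f \<mu> \<nu>)" "nnlinear N (\<lambda>\<mu>. f \<mu> \<nu>)" if "\<nu> \<in> SCurr N" for \<nu>
    using f continuous_map_first[OF _ that, of f] that by auto
  have gc: "continuous_map (curr_top N) euclideanreal (\<lambda>\<mu>. NN \<mu> \<nu>)" "nnlinear N (\<lambda>\<mu>. NN \<mu> \<nu>)" if "\<nu> \<in> SCurr N" for \<nu>
    using continuous_map_first[OF NN_continuous that] NN_linear[OF that] by auto
  \<comment> \<open>The second argument is first restricted to counting currents, where the values
    on counting currents are prescribed. The next step fixes an arbitrary second argument and, by
    symmetry, uses this one for the values on counting currents.\<close>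
  have 1: "f \<mu> (eta N K) = NN \<mu> (eta N K)" if m: "\<mu> \<in> SCurr N" and K: "fgsub N K" for \<mu> K
  proof -
    have eK: "eta N K \<in> SCurr N" using eta_SCurr[OF fgsub_cocpt[OF K]] .
    show ?thesis
      by (rule functional_unique[OF fc(1)[OF eK] gc(1)[OF eK] fc(2)[OF eK] gc(2)[OF eK] _ m])
         (use f K NN_eta_all in auto)
  qed
  have 2: "f \<mu> \<nu> = NN \<mu> \<nu>" if m: "\<mu> \<in> SCurr N" and n: "\<nu> \<in> SCurr N" for \<mu> \<nu>
  proof (rule functional_unique[OF fc(1)[OF n] gc(1)[OF n] fc(2)[OF n] gc(2)[OF n] _ m])
    fix H assume H: "fgsub N H"
    have "f (eta N H) \<nu> = f \<nu> (eta N H)" using f by blast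
    also have "\<dots> = NN \<nu> (eta N H)" using 1[OF n H] .
    also have "\<dots> = NN (eta N H) \<nu>" by (rule NN_sym)
    finally show "f (eta N H) \<nu> = NN (eta N H) \<nu>" .
  qed
  show "f = NN"
  proof (intro ext)
    fix \<mu> \<nu>
    show "f \<mu> \<nu> = NN \<mu> \<nu>"
    proof (cases "\<mu> \<in> SCurr N \<and> \<nu> \<in> SCurr N")
      case True
      then show ?thesis using 2 by blast
    next
      case False
      then have "f \<mu> \<nu> = 0" using f by blast
      then show ?thesis using False by (auto simp: NN_def)
    qed
  qed
qed

end

theorem mainTheorem4:
  fixes N :: nat and H K :: "word set"
  assumes "N \<ge> 2"
    and "fgsub N H" and "fgsub N K"
    and "H \<noteq> {[]}" and "K \<noteq> {[]}"
  shows "Ihat N (eta N H) (eta N K) = dsum_eta N H K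
       \<and> rkbar N (Ihat N (eta N H) (eta N K)) = Nform N (eta N H) (eta N K)"
proof -
  interpret free_group N .
  have c: "cocpt H" "cocpt K" using assms(2,3) fgsub_cocpt by blast+
  have I: "Ihat N (eta N H) (eta N K) = dsum_eta N H K"
    using Ihat_eq_dsum[OF c(1) assms(4) c(2) assms(5)] .
  have "rkbar N (Ihat N (eta N H) (eta N K)) = NN (eta N H) (eta N K)"
    unfolding I rkbar_eq rk_dsum[OF c(1) assms(4) c(2) assms(5)] NN_eta[OF c(1) assms(4) c(2) assms(5)] ..
  then show ?thesis using I Nform_eq by simp
qed

end
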